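(* Let $\sigma:\tilde M\to M$ be the blowing-up of $C$, with the set-up and notation of the context. For $Q\subsetneq K$, the map $$H_{\tilde Q}^{\mathrm{log}}:\mathbb S^\star(\tilde N_{\tilde Q|\tilde D^\circ_{\tilde Q}})\to\mathbb S(\pi^{-1}(N^\star_{K\setminus Q|C}))\times_C\mathbb S^\star(N_{Q|C}),\qquad H_{\tilde Q}^{\mathrm{log}}(\tilde x,\tilde\theta;\tilde\theta_q,q\in Q)=(\theta(\tilde x,\tilde\theta);\ \tilde\theta\tilde\theta_q,\ q\in Q),$$ is a bijection and, with $$h_{\tilde Q}^{\mathrm{log}}:\mathbb S(\pi^{-1}(N^\star_{K\setminus Q|C}))\times_C\mathbb S^\star(N_{Q|C})\to\mathbb S^\star(N_{K|C}),\qquad h_{\tilde Q}^{\mathrm{log}}(\theta(v);\theta_q,q\in Q)=(\theta(\pi_k(v)),k\in K\setminus Q;\ \theta_q,q\in Q),$$ the following diagram commutes: one has $\sigma_N^{\mathrm{log}}=h_{\tilde Q}^{\mathrm{log}}\circ H_{\tilde Q}^{\mathrm{log}}$, where $\sigma_N^{\mathrm{log}}:\mathbb S^\star(\tilde N_{\tilde Q|\tilde D^\circ_{\tilde Q}})\to\mathbb S^\star(N_{K|C})$ corresponds to $\sigma^{\mathrm{log}}:(\tilde M,\tilde D)^{\mathrm{log}}_{|\tilde D^\circ_{\tilde Q}}\to(M,D)^{\mathrm{log}}_{|C}$ under the identifications $(\tilde M,\tilde D)^{\mathrm{log}}_{|\tilde D^\circ_{\tilde Q}}\simeq\mathbb S^\star(\tilde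 N_{\tilde Q|\tilde D^\circ_{\tilde Q}})$ and $(M,D)^{\mathrm{log}}_{|C}\simeq\mathbb S^\star(N_{K|C})$.
   Context: **Set-up.** $M$ is a nonsingular complex algebraic variety, $D=\bigcup_{k\in K}D_k$ ($K$ finite, nonempty) a divisor with simple normal crossings, $D_K=\bigcap_{k\in K}D_k$, and $C\subset D_K$ a nonsingular subvariety in normal crossings with $D$ (so all components contain $C$). $\sigma:\tilde M\to M$ is the blowing-up of $C$, $E$ the exceptional divisor, $\tilde D_k$ the strict transform of $D_k$, $\tilde D=\sigma^{-1}(D)=E\cup\bigcup_k\tilde D_k$. For $Q\subset K$, $\tilde Q=Q\cup\{0\}$ and $\tilde D^\circ_{\tilde Q}=(E\cap\bigcap_{q\in Q}\tilde D_q)\setminus\bigcup_{k\in K\setminus Q}\tilde D_k$. **Log-spaces.** $\mathcal M(U)=\{g\in\mathcal O_M(U):g_{|U\setminus D}\text{ invertible}\}$ and $(M,D)^{\mathrm{log}}=\{(x,\varphi):x\in M,\ \varphi\in\mathrm{Hom}_{\mathrm{mon}}(\mathcal M_x,S^1),\ \varphi(g)=g(x)/|g(x)|\ \forall g\in\mathcal O_x^*\}$; similarly for $(\tilde M,\tilde D)$. $\sigma^{\mathrm{log}}(\tilde x,\tilde\varphi)=(\sigma(\tilde x),\ g\mapsto\tilde\varphi(g\circ\sigma))$. **Normal bundles.** $N=N_{M,C}$ is the normal bundle of $C$ in $M$, $N_k$ that of $D_k$ in $M$, $N_{D_K,C}$ that of $C$ in $D_K$, $\tilde N$ that of $E$ in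 $\tilde M$, $\tilde N_k$ that of $\tilde D_k$ in $\tilde M$. A superscript $*$ removes the zero section; $\mathbb S(A)=A/\mathbb R_{>0}$ for a conic set $A$ of nonzero vectors, $\mathbb S(F)=F^*/\mathbb R_{>0}$ for a vector bundle $F$, and $\theta(v)=v\bmod\mathbb R_{>0}$. There is an exact sequence $0\to N_{D_K,C}\to N\xrightarrow{\pi}\bigoplus_{k\in K}N_{k|C}\to0$, with components $\pi_k:N\to N_{k|C}$. $\mathbb S^\star(N_{Q|C})$ is the fibre product over $C$ of the $\mathbb S(N_{q|C})$, $q\in Q$; $\mathbb S^\star(\tilde N_{\tilde Q|\tilde D^\circ_{\tilde Q}})$ is the fibre product over $\tilde D^\circ_{\tilde Q}$ of $\mathbb S(\tilde N)$ and the $\mathbb S(\tilde N_q)$, $q\in Q$; its points are written $(\tilde x,\tilde\theta;\tilde\theta_q,q\in Q)$. $\pi^{-1}(N^\star_{K\setminus Q|C})$ is the set of $v\in N$ with $\pi_k(v)\ne0$ for $k\in K\setminus Q$ and $\pi_q(v)=0$ for $q\in Q$. **Canonical identifications.** (a) $(M,D)^{\mathrm{log}}_{|C}\simeq\mathbb S^\star(N_{K|C})$: $(x,\varphi)\leftrightarrow(\theta(v_k))_{k\in K}$ with $\varphi(g)=\partial_{v_k}g(x)/|\partial_{v_k}g(x)|$ for any generator $g\in\mathcal O_x$ of the ideal of $D_k$; likewise for $(\tilde M,\tilde D)$ over $\tilde D^\circ_{\tilde Q}$. (b) There is a canonical bijection $N^*\to\tilde N^*$, $v\mapsto([v],\tilde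 v)$: if $\gamma$ is a complex arc with $\gamma(0)=x\in C$ and $\gamma'(0)$ of class $v\neq0$ in $N_x$, and $\tilde\gamma$ is its lift to $\tilde M$, then $[v]=\tilde\gamma(0)\in E=\mathbb P(N)$ and $\tilde v$ is the class of $\tilde\gamma'(0)$ in $\tilde N$. It induces a bijection $\mathbb S(\tilde N)\ni([v],\theta(\tilde v))\leftrightarrow\theta(v)\in\mathbb S(N)$; $\theta(\tilde x,\tilde\theta)$ denotes the element of $\mathbb S(N)$ corresponding to $(\tilde x,\tilde\theta)$. (c) Over $E\cap\tilde D_k$ there is a canonical isomorphism $\tilde N\otimes\tilde N_k\simeq\sigma^*N_k$: $\tilde v\tilde v_k$ is the vector $v_k\in N_{k,\sigma(\tilde x)}$ with $\partial_{v_k}g_k(x)=\partial_{\tilde v}\tilde g(\tilde x)\cdot\partial_{\tilde v_k}\tilde g_k(\tilde x)$, where $g_k,\tilde g,\tilde g_k$ are local equations of $D_k,E,\tilde D_k$ with $g_k\circ\sigma=\tilde g\tilde g_k$; $\tilde\theta\tilde\theta_k$ is the induced product on directions. *)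

theory Defs
  imports "HOL-Analysis.Analysis"
begin

section \<open>Complex algebraic varieties as spaces with functions\<close>

text \<open>Varieties are taken in the sense of Serre: a Zariski topology together with a sheaf of
  complex-valued regular functions, locally isomorphic to closed algebraic subsets of
  \<open>\<complex>\<^sup>n\<close>. The space \<open>\<complex>\<^sup>n\<close> consists of the sequences supported on the indices below \<open>n\<close>.
  Sections over \<open>W\<close> are represented by total functions, of which only the values on \<open>W\<close> matter.\<close>

definition Vec :: "nat \<Rightarrow> (nat \<Rightarrow> complex) set" where
  "Vec n = {z. \<forall>i\<ge>n. z i = 0}"

definition join :: "nat \<Rightarrow> (nat \<Rightarrow> complex) \<Rightarrow> (nat \<Rightarrow> complex) \<Rightarrow> nat \<Rightarrow> complex" where
  "join n z w = (\<lambda>i. if i < n then z i else w (i - n))"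

inductive_set polyfun :: "nat \<Rightarrow> ((nat \<Rightarrow> complex) \<Rightarrow> complex) set" for n :: nat where
  const: "(\<lambda>z. c) \<in> polyfun n"
| coord: "i < n \<Longrightarrow> (\<lambda>z. z i) \<in> polyfun n"
| add: "p \<in> polyfun n \<Longrightarrow> q \<in> polyfun n \<Longrightarrow> (\<lambda>z. p z + q z) \<in> polyfun n"
| mult: "p \<in> polyfun n \<Longrightarrow> q \<in> polyfun n \<Longrightarrow> (\<lambda>z. p z * q z) \<in> polyfun n"

definition partial_deriv :: "nat \<Rightarrow> ((nat \<Rightarrow> complex) \<Rightarrow> complex) \<Rightarrow> (nat \<Rightarrow> complex) \<Rightarrow> complex" where
  "partial_deriv j p z = deriv (\<lambda>t. p (z(j := t))) (z j)"

definition alg_set :: "nat \<Rightarrow> (nat \<Rightarrow> complex) set \<Rightarrow> bool" where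
  "alg_set n Z \<longleftrightarrow> (\<exists>S \<subseteq> polyfun n. Z = {z \<in> Vec n. \<forall>p\<in>S. p z = 0})"

definition zariski_open :: "nat \<Rightarrow> (nat \<Rightarrow> complex) set \<Rightarrow> (nat \<Rightarrow> complex) set \<Rightarrow> bool" where
  "zariski_open n Z W \<longleftrightarrow> (\<exists>A. alg_set n A \<and> W = Z - A)"

definition regular_on ::
    "nat \<Rightarrow> (nat \<Rightarrow> complex) set \<Rightarrow> (nat \<Rightarrow> complex) set \<Rightarrow> ((nat \<Rightarrow> complex) \<Rightarrow> complex) \<Rightarrow> bool" where
  "regular_on n Z W f \<longleftrightarrow>
     (\<forall>z\<in>W. \<exists>V. \<exists>p\<in>polyfun n. \<exists>q\<in>polyfun n.
        zariski_open n Z V \<and> z \<in> V \<and> V \<subseteq> W \<and> (\<forall>y\<in>V. q y \<noteq> 0 \<and> f y = p y / q y))"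

record 'a fspace =
  zar :: "'a topology"
  reg :: "'a set \<Rightarrow> ('a \<Rightarrow> complex) set"

abbreviation pts :: "'a fspace \<Rightarrow> 'a set" where
  "pts X \<equiv> topspace (zar X)"

text \<open>An affine chart is an isomorphism of spaces with functions from an open subset onto
  a closed algebraic subset of \<open>\<complex>\<^sup>n\<close>.\<close>

definition affine_chart :: "'a fspace \<Rightarrow> 'a set \<Rightarrow> nat \<Rightarrow> ('a \<Rightarrow> nat \<Rightarrow> complex) \<Rightarrow> bool" where
  "affine_chart X U n a \<longleftrightarrow>
     openin (zar X) U \<and> inj_on a U \<and> alg_set n (a ` U) \<and>
     (\<forall>W\<subseteq>U. openin (zar X) W \<longleftrightarrow> zariski_open n (a ` U) (a ` W)) \<and>
     (\<forall>W\<subseteq>U. \<forall>f. openin (zar X) W \<longrightarrow>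
        (f \<in> reg X W \<longleftrightarrow> regular_on n (a ` U) (a ` W) (f \<circ> inv_into U a)))"

definition function_sheaf :: "'a fspace \<Rightarrow> bool" where
  "function_sheaf X \<longleftrightarrow>
     (\<forall>W V f. openin (zar X) W \<longrightarrow> openin (zar X) V \<longrightarrow> V \<subseteq> W \<longrightarrow> f \<in> reg X W \<longrightarrow> f \<in> reg X V) \<and>
     (\<forall>W f. openin (zar X) W \<longrightarrow>
        (\<forall>x\<in>W. \<exists>V. openin (zar X) V \<and> x \<in> V \<and> V \<subseteq> W \<and> f \<in> reg X V) \<longrightarrow> f \<in> reg X W)"

text \<open>The last clause is separatedness: the diagonal is closed in the products of affine charts.\<close>

definition variety :: "'a fspace \<Rightarrow> bool" where
  "variety X \<longleftrightarrow>
     function_sheaf X \<and>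
     (\<exists>\<U>. finite \<U> \<and> \<Union>\<U> = pts X \<and> (\<forall>U\<in>\<U>. \<exists>n a. affine_chart X U n a)) \<and>
     (\<forall>U n a V m b. affine_chart X U n a \<longrightarrow> affine_chart X V m b \<longrightarrow>
        alg_set (n + m) ((\<lambda>x. join n (a x) (b x)) ` (U \<inter> V)))"

text \<open>Nonsingularity in Jacobian form: near each point the variety is the zero locus in some
  \<open>\<complex>\<^sup>n\<close> of \<open>m\<close> polynomials whose Jacobian matrix has rank \<open>m\<close> at that point.\<close>

definition nonsingular_variety :: "'a fspace \<Rightarrow> bool" where
  "nonsingular_variety X \<longleftrightarrow> variety X \<and>
     (\<forall>x\<in>pts X. \<exists>U n a m f. affine_chart X U n a \<and> x \<in> U \<and>
        (\<forall>i<m. f i \<in> polyfun n) \<and> a ` U = {z \<in> Vec n. \<forall>i<m. f i z = 0} \<and>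
        (\<forall>c :: nat \<Rightarrow> complex.
           (\<forall>j<n. (\<Sum>i<m. c i * partial_deriv j (f i) (a x)) = 0) \<longrightarrow> (\<forall>i<m. c i = 0)))"

definition morphism :: "'b fspace \<Rightarrow> 'a fspace \<Rightarrow> ('b \<Rightarrow> 'a) \<Rightarrow> bool" where
  "morphism Y X s \<longleftrightarrow> continuous_map (zar Y) (zar X) s \<and>
     (\<forall>U f. openin (zar X) U \<longrightarrow> f \<in> reg X U \<longrightarrow> f \<circ> s \<in> reg Y (pts Y \<inter> s -` U))"

definition subspace_of :: "'a fspace \<Rightarrow> 'a set \<Rightarrow> 'a fspace" where
  "subspace_of X A =
     \<lparr>zar = subtopology (zar X) A,
      reg = (\<lambda>W. {f. \<forall>x\<in>W. \<exists>U g. openin (zar X) U \<and> x \<in> U \<and> g \<in> reg X U \<and> (\<forall>y\<in>U \<inter> W. f y = g y)})\<rparr>"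

definition nonsingular_subvariety :: "'a fspace \<Rightarrow> 'a set \<Rightarrow> bool" where
  "nonsingular_subvariety X A \<longleftrightarrow> closedin (zar X) A \<and> nonsingular_variety (subspace_of X A)"


section \<open>Germs, ideals, tangent and normal vectors\<close>

definition germ_eq :: "'a fspace \<Rightarrow> 'a \<Rightarrow> ('a \<Rightarrow> complex) \<Rightarrow> ('a \<Rightarrow> complex) \<Rightarrow> bool" where
  "germ_eq X x f g \<longleftrightarrow> (\<exists>U. openin (zar X) U \<and> x \<in> U \<and> (\<forall>y\<in>U. f y = g y))"

text \<open>The local ring at \<open>x\<close> is the following set modulo \<open>germ_eq\<close>. Maps on germs are
  maps on representatives that respect \<open>germ_eq\<close>.\<close>

definition stalk :: "'a fspace \<Rightarrow> 'a \<Rightarrow> ('a \<Rightarrow> complex) set" where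
  "stalk X x = {f. \<exists>U. openin (zar X) U \<and> x \<in> U \<and> f \<in> reg X U}"

definition stalk_units :: "'a fspace \<Rightarrow> 'a \<Rightarrow> ('a \<Rightarrow> complex) set" where
  "stalk_units X x = {f \<in> stalk X x. \<exists>h\<in>stalk X x. germ_eq X x (\<lambda>y. f y * h y) (\<lambda>y. 1)}"

definition ideal_at :: "'a fspace \<Rightarrow> 'a set \<Rightarrow> 'a \<Rightarrow> ('a \<Rightarrow> complex) set" where
  "ideal_at X A x =
     {f \<in> stalk X x. \<exists>U. openin (zar X) U \<and> x \<in> U \<and> (\<forall>y\<in>U \<inter> A. f y = 0)}"

definition generates_ideal ::
    "'a fspace \<Rightarrow> 'a set \<Rightarrow> 'a \<Rightarrow> 'i set \<Rightarrow> ('i \<Rightarrow> 'a \<Rightarrow> complex) \<Rightarrow> bool" where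
  "generates_ideal X A x J g \<longleftrightarrow>
     (\<forall>j\<in>J. g j \<in> ideal_at X A x) \<and>
     (\<forall>f\<in>ideal_at X A x. \<exists>h. (\<forall>j\<in>J. h j \<in> stalk X x) \<and> germ_eq X x f (\<lambda>y. \<Sum>j\<in>J. h j y * g j y))"

definition local_eq :: "'a fspace \<Rightarrow> 'a set \<Rightarrow> 'a \<Rightarrow> ('a \<Rightarrow> complex) \<Rightarrow> bool" where
  "local_eq X A x g \<longleftrightarrow> generates_ideal X A x {()} (\<lambda>_. g)"

type_synonym 'a tvec = "('a \<Rightarrow> complex) \<Rightarrow> complex"

text \<open>Tangent vectors are the derivations of the local ring (extended by \<open>0\<close> outside the stalk).\<close>

definition tangent :: "'a fspace \<Rightarrow> 'a \<Rightarrow> 'a tvec set" where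
  "tangent X x = {v.
     (\<forall>f. f \<notin> stalk X x \<longrightarrow> v f = 0) \<and>
     (\<forall>f\<in>stalk X x. \<forall>g\<in>stalk X x. germ_eq X x f g \<longrightarrow> v f = v g) \<and>
     (\<forall>f\<in>stalk X x. \<forall>c. v (\<lambda>y. c * f y) = c * v f) \<and>
     (\<forall>f\<in>stalk X x. \<forall>g\<in>stalk X x. v (\<lambda>y. f y + g y) = v f + v g) \<and>
     (\<forall>f\<in>stalk X x. \<forall>g\<in>stalk X x. v (\<lambda>y. f y * g y) = f x * v g + g x * v f)}"

definition tangent_sub :: "'a fspace \<Rightarrow> 'a set \<Rightarrow> 'a \<Rightarrow> 'a tvec set" where
  "tangent_sub X A x = {v \<in> tangent X x. \<forall>f\<in>ideal_at X A x. v f = 0}"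

text \<open>The fibre at \<open>x\<close> of the normal bundle of \<open>A\<close> is the quotient of the tangent space of \<open>X\<close>
  by that of \<open>A\<close>. Its zero vector is the coset \<open>tangent_sub X A x\<close>.\<close>

definition normal_class :: "'a fspace \<Rightarrow> 'a set \<Rightarrow> 'a \<Rightarrow> 'a tvec \<Rightarrow> 'a tvec set" where
  "normal_class X A x v = {w \<in> tangent X x. (\<lambda>f. w f - v f) \<in> tangent_sub X A x}"

definition normal :: "'a fspace \<Rightarrow> 'a set \<Rightarrow> 'a \<Rightarrow> 'a tvec set set" where
  "normal X A x = normal_class X A x ` tangent X x"

definition normal_nz :: "'a fspace \<Rightarrow> 'a set \<Rightarrow> 'a \<Rightarrow> 'a tvec set set" where
  "normal_nz X A x = normal X A x - {tangent_sub X A x}"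

text \<open>Derivative of \<open>g\<close> along a normal vector; meaningful for \<open>g\<close> in the ideal of \<open>A\<close>.\<close>

definition nderiv :: "'a tvec set \<Rightarrow> ('a \<Rightarrow> complex) \<Rightarrow> complex" where
  "nderiv m g = (THE c. \<forall>v\<in>m. v g = c)"

definition ray :: "'a tvec set \<Rightarrow> 'a tvec set set" where
  "ray m = {(\<lambda>v f. of_real c * v f) ` m | c :: real. c > 0}"

definition dirs :: "'a fspace \<Rightarrow> 'a set \<Rightarrow> 'a \<Rightarrow> 'a tvec set set set" where
  "dirs X A x = ray ` normal_nz X A x"

text \<open>Fibre product over \<open>A\<close> of the direction bundles of the normal bundles of \<open>D q\<close>, \<open>q \<in> Q\<close>.\<close>

definition dir_bundle ::
    "'a fspace \<Rightarrow> ('k \<Rightarrow> 'a set) \<Rightarrow> 'k set \<Rightarrow> 'a set \<Rightarrow> ('a \<times> ('k \<Rightarrow> 'a tvec set set)) set" where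
  "dir_bundle X D Q A = {(x, r). x \<in> A \<and> r \<in> (\<Pi>\<^sub>E q\<in>Q. dirs X (D q) x)}"


section \<open>Normal crossings\<close>

text \<open>Local coordinates (regular parameters) at \<open>x\<close>: functions vanishing at \<open>x\<close> whose
  differentials form a basis of the cotangent space.\<close>

definition local_coords :: "'a fspace \<Rightarrow> 'a \<Rightarrow> nat \<Rightarrow> (nat \<Rightarrow> 'a \<Rightarrow> complex) \<Rightarrow> bool" where
  "local_coords X x n u \<longleftrightarrow>
     (\<forall>i<n. u i \<in> stalk X x \<and> u i x = 0) \<and>
     bij_betw (\<lambda>v i. if i < n then v (u i) else 0) (tangent X x) (Vec n)"

definition adapted_coords ::
    "'a fspace \<Rightarrow> 'k set \<Rightarrow> ('k \<Rightarrow> 'a set) \<Rightarrow> 'a \<Rightarrow> nat \<Rightarrow> (nat \<Rightarrow> 'a \<Rightarrow> complex) \<Rightarrow> bool" where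
  "adapted_coords X K D x n u \<longleftrightarrow> local_coords X x n u \<and>
     (\<exists>\<iota>. inj_on \<iota> {k\<in>K. x \<in> D k} \<and>
        (\<forall>k\<in>K. x \<in> D k \<longrightarrow> \<iota> k < n \<and> local_eq X (D k) x (u (\<iota> k))))"

definition snc_divisor :: "'a fspace \<Rightarrow> 'k set \<Rightarrow> ('k \<Rightarrow> 'a set) \<Rightarrow> bool" where
  "snc_divisor X K D \<longleftrightarrow> (\<forall>k\<in>K. closedin (zar X) (D k)) \<and>
     (\<forall>x\<in>pts X. \<exists>n u. adapted_coords X K D x n u)"

definition normal_crossings_with :: "'a fspace \<Rightarrow> 'k set \<Rightarrow> ('k \<Rightarrow> 'a set) \<Rightarrow> 'a set \<Rightarrow> bool" where
  "normal_crossings_with X K D C \<longleftrightarrow>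
     (\<forall>x\<in>C. \<exists>n u J. adapted_coords X K D x n u \<and> J \<subseteq> {..<n} \<and> generates_ideal X C x J u)"


section \<open>Blowing-up of a nonsingular centre\<close>

text \<open>Over a neighbourhood \<open>U\<close> on which the ideal of \<open>C\<close> is generated by part of a system of
  parameters \<open>g 0, \<dots>, g (r - 1)\<close>, the blowing-up is
  \<open>{(x, [z]) \<in> U \<times> \<P>\<^sup>r\<^sup>-\<^sup>1. g j x * z l = g l x * z j}\<close>. The map \<open>\<omega>\<close> gives homogeneous
  coordinates of the projective component, and the isomorphism is expressed on the standard
  affine charts \<open>z i \<noteq> 0\<close>. Away from \<open>C\<close> one may take \<open>r = 1\<close>, \<open>g 0 = 1\<close>, so that
  the blowing-up is an isomorphism there.\<close>

definition blowing_up :: "'b fspace \<Rightarrow> 'a fspace \<Rightarrow> 'a set \<Rightarrow> ('b \<Rightarrow> 'a) \<Rightarrow> bool" where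
  "blowing_up Y X C \<sigma> \<longleftrightarrow> variety Y \<and> morphism Y X \<sigma> \<and>
     (\<forall>x\<in>pts X. \<exists>U n a r g \<omega>.
        affine_chart X U n a \<and> x \<in> U \<and>
        (\<forall>i<r. g i \<in> reg X U) \<and>
        (\<forall>y\<in>U. generates_ideal X C y {..<r} g) \<and>
        (\<forall>y\<in>U \<inter> C. \<forall>c :: nat \<Rightarrow> complex.
           (\<forall>v\<in>tangent X y. (\<Sum>i<r. c i * v (g i)) = 0) \<longrightarrow> (\<forall>i<r. c i = 0)) \<and>
        (\<forall>y\<in>pts Y \<inter> \<sigma> -` U. \<omega> y \<in> Vec r \<and> (\<exists>i<r. \<omega> y i \<noteq> 0)) \<and>
        (\<forall>i<r. let V = {y \<in> pts Y \<inter> \<sigma> -` U. \<omega> y i \<noteq> 0};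
                   b = (\<lambda>y. join n (a (\<sigma> y)) (\<lambda>j. \<omega> y j / \<omega> y i))
               in affine_chart Y V (n + r) b \<and>
                  b ` V = {join n (a y) z | y z. y \<in> U \<and> z \<in> Vec r \<and> z i = 1 \<and>
                             (\<forall>j<r. \<forall>l<r. g j y * z l = g l y * z j)}))"

definition exc_divisor :: "'b fspace \<Rightarrow> 'a set \<Rightarrow> ('b \<Rightarrow> 'a) \<Rightarrow> 'b set" where
  "exc_divisor Y C \<sigma> = pts Y \<inter> \<sigma> -` C"

definition strict_transform :: "'b fspace \<Rightarrow> 'a set \<Rightarrow> ('b \<Rightarrow> 'a) \<Rightarrow> 'a set \<Rightarrow> 'b set" where
  "strict_transform Y C \<sigma> A = zar Y closure_of (pts Y \<inter> \<sigma> -` (A - C))"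

text \<open>Components of the inverse image of the divisor. The index \<open>None\<close> plays the role of \<open>0\<close>.\<close>

definition up_div :: "'b fspace \<Rightarrow> 'a set \<Rightarrow> ('b \<Rightarrow> 'a) \<Rightarrow> ('k \<Rightarrow> 'a set) \<Rightarrow> 'k option \<Rightarrow> 'b set" where
  "up_div Y C \<sigma> D q =
     (case q of None \<Rightarrow> exc_divisor Y C \<sigma> | Some k \<Rightarrow> strict_transform Y C \<sigma> (D k))"

definition with_zero :: "'k set \<Rightarrow> 'k option set" where
  "with_zero Q = insert None (Some ` Q)"

definition stratum ::
    "'b fspace \<Rightarrow> 'a set \<Rightarrow> ('b \<Rightarrow> 'a) \<Rightarrow> ('k \<Rightarrow> 'a set) \<Rightarrow> 'k set \<Rightarrow> 'k set \<Rightarrow> 'b set" where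
  "stratum Y C \<sigma> D K Q =
     (exc_divisor Y C \<sigma> \<inter> (\<Inter>q\<in>Q. strict_transform Y C \<sigma> (D q)))
     - (\<Union>k\<in>K - Q. strict_transform Y C \<sigma> (D k))"


section \<open>Log-spaces\<close>

text \<open>\<open>log_monoid X B x\<close> represents the stalk at \<open>x\<close> of the sheaf of functions that are
  invertible outside \<open>B\<close>.\<close>

definition log_monoid :: "'a fspace \<Rightarrow> 'a set \<Rightarrow> 'a \<Rightarrow> ('a \<Rightarrow> complex) set" where
  "log_monoid X B x = {g. \<exists>U. openin (zar X) U \<and> x \<in> U \<and> g \<in> reg X U \<and>
     (\<exists>h\<in>reg X (U - B). \<forall>y\<in>U - B. g y * h y = 1)}"

definition log_space :: "'a fspace \<Rightarrow> 'a set \<Rightarrow> ('a \<times> (('a \<Rightarrow> complex) \<Rightarrow> complex)) set" where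
  "log_space X B = {(x, \<phi>). x \<in> pts X \<and> \<phi> \<in> extensional (log_monoid X B x) \<and>
     (\<forall>g\<in>log_monoid X B x. \<forall>h\<in>log_monoid X B x. germ_eq X x g h \<longrightarrow> \<phi> g = \<phi> h) \<and>
     (\<forall>g\<in>log_monoid X B x. cmod (\<phi> g) = 1) \<and>
     \<phi> (\<lambda>y. 1) = 1 \<and>
     (\<forall>g\<in>log_monoid X B x. \<forall>h\<in>log_monoid X B x. \<phi> (\<lambda>y. g y * h y) = \<phi> g * \<phi> h) \<and>
     (\<forall>g\<in>stalk_units X x. \<phi> g = g x / of_real (cmod (g x)))}"

definition log_over :: "'a fspace \<Rightarrow> 'a set \<Rightarrow> 'a set \<Rightarrow> ('a \<times> (('a \<Rightarrow> complex) \<Rightarrow> complex)) set" where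
  "log_over X B A = {p \<in> log_space X B. fst p \<in> A}"

definition sigma_log ::
    "'a fspace \<Rightarrow> 'a set \<Rightarrow> ('b \<Rightarrow> 'a) \<Rightarrow> 'b \<times> (('b \<Rightarrow> complex) \<Rightarrow> complex)
      \<Rightarrow> 'a \<times> (('a \<Rightarrow> complex) \<Rightarrow> complex)" where
  "sigma_log X B \<sigma> = (\<lambda>(y, \<phi>). (\<sigma> y, \<lambda>g\<in>log_monoid X B (\<sigma> y). \<phi> (g \<circ> \<sigma>)))"

text \<open>The canonical identification of the log-space, over points whose components are the
  \<open>D q\<close>, \<open>q \<in> Q\<close>, with the direction bundle: the direction of \<open>v\<close> normal to \<open>D q\<close> is
  determined by \<open>\<phi> g = \<partial>\<^sub>v g / |\<partial>\<^sub>v g|\<close> for all local equations \<open>g\<close> of \<open>D q\<close>.\<close>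

definition log_ident ::
    "'a fspace \<Rightarrow> ('k \<Rightarrow> 'a set) \<Rightarrow> 'k set \<Rightarrow> 'a \<times> (('a \<Rightarrow> complex) \<Rightarrow> complex)
      \<Rightarrow> 'a \<times> ('k \<Rightarrow> 'a tvec set set)" where
  "log_ident X D Q = (\<lambda>(x, \<phi>). (x, \<lambda>q\<in>Q. THE \<rho>. \<exists>m\<in>normal_nz X (D q) x. \<rho> = ray m \<and>
     (\<forall>g. local_eq X (D q) x g \<longrightarrow> \<phi> g = nderiv m g / of_real (cmod (nderiv m g)))))"

text \<open>The map between direction bundles that corresponds to \<open>sigma_log\<close>; \<open>inv_into\<close> is the inverse
  of the canonical identification over the stratum, which is a bijection.\<close>

definition sigma_N_log ::
    "'b fspace \<Rightarrow> 'a fspace \<Rightarrow> 'k set \<Rightarrow> ('k \<Rightarrow> 'a set) \<Rightarrow> 'a set \<Rightarrow> ('b \<Rightarrow> 'a) \<Rightarrow> 'k set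
      \<Rightarrow> 'b \<times> ('k option \<Rightarrow> 'b tvec set set) \<Rightarrow> 'a \<times> ('k \<Rightarrow> 'a tvec set set)" where
  "sigma_N_log Y X K D C \<sigma> Q p =
     log_ident X D K
       (sigma_log X (\<Union>k\<in>K. D k) \<sigma>
         (inv_into (log_over Y (pts Y \<inter> \<sigma> -` (\<Union>k\<in>K. D k)) (stratum Y C \<sigma> D K Q))
            (log_ident Y (up_div Y C \<sigma> D) (with_zero Q)) p))"


section \<open>Canonical maps between normal bundles\<close>

text \<open>Complex arcs at parameter \<open>0\<close>: morphisms of spaces with functions from a disc, equipped
  with its holomorphic functions.\<close>

definition complex_arc :: "'a fspace \<Rightarrow> (complex \<Rightarrow> 'a) \<Rightarrow> bool" where
  "complex_arc X \<gamma> \<longleftrightarrow> (\<exists>e>0. \<gamma> ` ball 0 e \<subseteq> pts X \<and>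
     (\<forall>U. openin (zar X) U \<longrightarrow> open (ball 0 e \<inter> \<gamma> -` U) \<and>
        (\<forall>f\<in>reg X U. (f \<circ> \<gamma>) holomorphic_on (ball 0 e \<inter> \<gamma> -` U))))"

definition velocity :: "'a fspace \<Rightarrow> (complex \<Rightarrow> 'a) \<Rightarrow> 'a tvec" where
  "velocity X \<gamma> = (\<lambda>f. if f \<in> stalk X (\<gamma> 0) then deriv (f \<circ> \<gamma>) 0 else 0)"

text \<open>The bijection \<open>v \<mapsto> ([v], \<tilde>v)\<close> from nonzero normal vectors of \<open>C\<close> to nonzero normal
  vectors of the exceptional divisor, obtained by lifting arcs.\<close>

definition normal_lift ::
    "'b fspace \<Rightarrow> 'a fspace \<Rightarrow> 'a set \<Rightarrow> ('b \<Rightarrow> 'a) \<Rightarrow> 'a \<times> 'a tvec set \<Rightarrow> 'b \<times> 'b tvec set" where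
  "normal_lift Y X C \<sigma> = (\<lambda>(x, m). THE p. \<exists>\<gamma> \<gamma>'.
     complex_arc X \<gamma> \<and> \<gamma> 0 = x \<and> normal_class X C x (velocity X \<gamma>) = m \<and>
     complex_arc Y \<gamma>' \<and> (\<forall>\<^sub>F t in nhds 0. \<sigma> (\<gamma>' t) = \<gamma> t) \<and>
     p = (\<gamma>' 0, normal_class Y (exc_divisor Y C \<sigma>) (\<gamma>' 0) (velocity Y \<gamma>')))"

definition theta_down ::
    "'b fspace \<Rightarrow> 'a fspace \<Rightarrow> 'a set \<Rightarrow> ('b \<Rightarrow> 'a) \<Rightarrow> 'b \<times> 'b tvec set set \<Rightarrow> 'a \<times> 'a tvec set set" where
  "theta_down Y X C \<sigma> = (\<lambda>(y, \<tau>). THE p. \<exists>x\<in>C. \<exists>m\<in>normal_nz X C x. p = (x, ray m) \<and>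
     (\<exists>m'. normal_lift Y X C \<sigma> (x, m) = (y, m') \<and> \<tau> = ray m'))"

text \<open>Component at \<open>x\<close> of the projection from the normal bundle of \<open>C\<close> to that of \<open>A \<supseteq> C\<close>.\<close>

definition normal_proj :: "'a fspace \<Rightarrow> 'a set \<Rightarrow> 'a \<Rightarrow> 'a tvec set \<Rightarrow> 'a tvec set" where
  "normal_proj X A x m = (\<Union>v\<in>m. normal_class X A x v)"

text \<open>The product of a normal vector of the exceptional divisor and a normal vector of the strict
  transform of \<open>A\<close>, and the induced product of directions.\<close>

definition normal_mult ::
    "'b fspace \<Rightarrow> 'a fspace \<Rightarrow> 'a set \<Rightarrow> ('b \<Rightarrow> 'a) \<Rightarrow> 'a set \<Rightarrow> 'b
      \<Rightarrow> 'b tvec set \<Rightarrow> 'b tvec set \<Rightarrow> 'a tvec set" where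
  "normal_mult Y X C \<sigma> A y m m' = (THE n. n \<in> normal X A (\<sigma> y) \<and>
     (\<forall>g ge ga. local_eq X A (\<sigma> y) g \<longrightarrow> local_eq Y (exc_divisor Y C \<sigma>) y ge \<longrightarrow>
        local_eq Y (strict_transform Y C \<sigma> A) y ga \<longrightarrow> germ_eq Y y (g \<circ> \<sigma>) (\<lambda>z. ge z * ga z) \<longrightarrow>
        nderiv n g = nderiv m ge * nderiv m' ga))"

definition dir_mult ::
    "'b fspace \<Rightarrow> 'a fspace \<Rightarrow> 'a set \<Rightarrow> ('b \<Rightarrow> 'a) \<Rightarrow> 'a set \<Rightarrow> 'b
      \<Rightarrow> 'b tvec set set \<Rightarrow> 'b tvec set set \<Rightarrow> 'a tvec set set" where
  "dir_mult Y X C \<sigma> A y \<tau> \<tau>' = {normal_mult Y X C \<sigma> A y m m' | m m'. m \<in> \<tau> \<and> m' \<in> \<tau>'}"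


section \<open>The maps of the theorem\<close>

text \<open>Points \<open>(x, \<theta>(v), (\<theta>\<^sub>q)\<^sub>q)\<close> of the fibre product over \<open>C\<close> of the directions of those \<open>v\<close>
  normal to \<open>C\<close> with \<open>\<pi>\<^sub>k v \<noteq> 0\<close> exactly for \<open>k \<in> K - Q\<close>, and of the direction bundle for \<open>Q\<close>.\<close>

definition middle_space ::
    "'a fspace \<Rightarrow> 'k set \<Rightarrow> ('k \<Rightarrow> 'a set) \<Rightarrow> 'a set \<Rightarrow> 'k set
      \<Rightarrow> ('a \<times> 'a tvec set set \<times> ('k \<Rightarrow> 'a tvec set set)) set" where
  "middle_space X K D C Q = {(x, \<rho>, r). (x, r) \<in> dir_bundle X D Q C \<and>
     (\<exists>m\<in>normal X C x. \<rho> = ray m \<and>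
        (\<forall>k\<in>K - Q. normal_proj X (D k) x m \<noteq> tangent_sub X (D k) x) \<and>
        (\<forall>q\<in>Q. normal_proj X (D q) x m = tangent_sub X (D q) x))}"

definition H_log ::
    "'b fspace \<Rightarrow> 'a fspace \<Rightarrow> ('k \<Rightarrow> 'a set) \<Rightarrow> 'a set \<Rightarrow> ('b \<Rightarrow> 'a) \<Rightarrow> 'k set
      \<Rightarrow> 'b \<times> ('k option \<Rightarrow> 'b tvec set set)
      \<Rightarrow> 'a \<times> 'a tvec set set \<times> ('k \<Rightarrow> 'a tvec set set)" where
  "H_log Y X D C \<sigma> Q = (\<lambda>(y, r).
     let (x, \<rho>) = theta_down Y X C \<sigma> (y, r None)
     in (x, \<rho>, \<lambda>q\<in>Q. dir_mult Y X C \<sigma> (D q) y (r None) (r (Some q))))"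

definition h_log ::
    "'a fspace \<Rightarrow> 'k set \<Rightarrow> ('k \<Rightarrow> 'a set) \<Rightarrow> 'k set
      \<Rightarrow> 'a \<times> 'a tvec set set \<times> ('k \<Rightarrow> 'a tvec set set)
      \<Rightarrow> 'a \<times> ('k \<Rightarrow> 'a tvec set set)" where
  "h_log X K D Q = (\<lambda>(x, \<rho>, r).
     (x, \<lambda>k\<in>K. if k \<in> Q then r k else normal_proj X (D k) x ` \<rho>))"

end

theory Submission
  imports Defs "HOL-Complex_Analysis.Complex_Analysis"
begin

text \<open>Near a point \<open>x\<close> of \<open>C\<close> let \<open>g\<^sub>j\<close> be generators of the ideal of \<open>C\<close> and \<open>d\<^sub>k = \<Sum>\<^sub>j h\<^sub>k\<^sub>j g\<^sub>j\<close> an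
  equation of \<open>D\<^sub>k\<close>. In the chart \<open>z\<^sub>i = 1\<close> of the blowing-up, \<open>g\<^sub>j = z\<^sub>j g\<^sub>i\<close>, so \<open>g\<^sub>i\<close> is an
  equation of the exceptional divisor and \<open>\<Sum>\<^sub>j h\<^sub>k\<^sub>j z\<^sub>j\<close> one of the strict transform of \<open>D\<^sub>k\<close>. Normal
  vectors are then given by their values on these equations: lifting arcs sends
  \<open>(z, c)\<close> to the normal vector with \<open>\<partial>g\<^sub>j = c z\<^sub>j\<close>, and the product of normal vectors multiplies
  the values. Hence \<open>H\<close> maps \<open>(z; c; c\<^sub>q)\<close> to \<open>(c z; c c\<^sub>q)\<close>, with inverse read off directly,
  and \<open>\<phi>(d\<^sub>k \<circ> \<sigma>) = \<phi>(g\<^sub>i) \<phi>(\<Sum>\<^sub>j h\<^sub>k\<^sub>j z\<^sub>j)\<close> gives the commutativity; for \<open>k \<notin> Q\<close> the second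
  factor is the direction of a unit. Points of the log-space with prescribed directions come from
  limits along arcs leaving the divisor.\<close>

section \<open>Polynomial functions\<close>

text \<open>Enough holomorphic arcs are needed: normal lifts are defined by them and log points are
  produced from them. The blowing-up is given only by charts that are closed algebraic sets, with no
  smoothness of the total space known in advance, so the arcs come from an implicit function
  argument on the product of the centre's ambient variety with an affine space. The same arcs then
  replace commutative algebra upstairs: a factor \<open>g i\<close> is cancelled by continuity along
  an arc leaving its zero set, and units are compared by applying a derivation that is nonzero on
  the equation at hand. Two points are not of this kind. That a generator of the ideal of a
  component vanishes only on that component near the point is where Hilbert's basis theorem enters.
  And the unique choice in \<open>theta_down\<close> ranges over all of the centre, while a chart
  covers only a part of it, so lifts are first shown to lie over their base points everywhere; after
  that everything happens over one point of the centre.\<close>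

lemma polyfun_cong:
  assumes "p \<in> polyfun n" "\<And>i. i < n \<Longrightarrow> z i = w i"
  shows "p z = p w"
  using assms by (induction rule: polyfun.induct) auto

lemma polyfun_subst:
  assumes "p \<in> polyfun n" "\<And>i. i < n \<Longrightarrow> (\<lambda>z. s z i) \<in> polyfun m"
  shows "(\<lambda>z. p (s z)) \<in> polyfun m"
  using assms(1)
proof (induction rule: polyfun.induct)
  case (coord i)
  then show ?case using assms(2) by simp
qed (intro polyfun.intros; assumption)+

lemma polyfun_mono:
  assumes "p \<in> polyfun n" "n \<le> m"
  shows "p \<in> polyfun m"
  using assms by (induction rule: polyfun.induct) (auto intro: polyfun.intros)

lemma polyfun_sum:
  assumes "\<And>i. i \<in> I \<Longrightarrow> p i \<in> polyfun n"
  shows "(\<lambda>z. \<Sum>i\<in>I. p i z) \<in> polyfun n"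
  using assms by (induction I rule: infinite_finite_induct) (auto intro: polyfun.intros)

lemma polyfun_power: "p \<in> polyfun n \<Longrightarrow> (\<lambda>z. p z ^ k) \<in> polyfun n"
  by (induction k) (auto intro: polyfun.intros)

lemma polyfun_cmult: "p \<in> polyfun n \<Longrightarrow> (\<lambda>z. c * p z) \<in> polyfun n"
  by (auto intro: polyfun.intros)

lemma polyfun_diff: "p \<in> polyfun n \<Longrightarrow> q \<in> polyfun n \<Longrightarrow> (\<lambda>z. p z - q z) \<in> polyfun n"
  using polyfun.add[of p n "\<lambda>z. (- 1) * q z"] polyfun_cmult[of q n "- 1"] by simp

lemma holomorphic_polyfun:
  assumes "p \<in> polyfun n" "\<And>i. i < n \<Longrightarrow> (\<lambda>t. z t i) holomorphic_on S"
  shows "(\<lambda>t. p (z t)) holomorphic_on S"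
  using assms by (induction rule: polyfun.induct) (auto intro!: holomorphic_intros)

text \<open>The bound and the Lipschitz constant on the polydisc of radius \<open>B\<close> are
  proved together, since the Lipschitz estimate for a product uses bounds of its factors. The
  estimate later makes the fixed point map for curves a contraction.\<close>

lemma polyfun_lipschitz:
  assumes "p \<in> polyfun n"
  shows "\<exists>L\<ge>0. \<forall>z w \<delta>. (\<forall>i<n. cmod (z i) \<le> B \<and> cmod (w i) \<le> B \<and> cmod (z i - w i) \<le> \<delta>) \<longrightarrow> \<delta> \<ge> 0 \<longrightarrow>
           cmod (p z) \<le> L \<and> cmod (p z - p w) \<le> L * \<delta>"
  using assms
proof (induction rule: polyfun.induct)
  case (const c)
  show ?case by (rule exI[of _ "cmod c"]) auto
next
  case (coord i)
  show ?case
  \<comment> \<open>A coordinate is bounded by \<open>B\<close> and has Lipschitz constant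
    1.\<close>
  proof (intro exI[of _ "max 1 B"] conjI allI impI)
    fix z w :: "nat \<Rightarrow> complex" and \<delta> :: real
    assume *: "\<forall>i<n. cmod (z i) \<le> B \<and> cmod (w i) \<le> B \<and> cmod (z i - w i) \<le> \<delta>" "0 \<le> \<delta>"
    show "cmod (z i) \<le> max 1 B" using * coord by (simp add: le_max_iff_disj)
    have "cmod (z i - w i) \<le> 1 * \<delta>" using * coord by simp
    also have "\<dots> \<le> max 1 B * \<delta>" using *(2) by (intro mult_right_mono) auto
    finally show "cmod (z i - w i) \<le> max 1 B * \<delta>" .
  qed auto
next
  case (add p q)
  obtain L1 where L1: "L1 \<ge> 0" "\<And>z w \<delta>. (\<forall>i<n. cmod (z i) \<le> B \<and> cmod (w i) \<le> B \<and> cmod (z i - w i) \<le> \<delta>) \<Longrightarrow> \<delta> \<ge> 0 \<Longrightarrow>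
           cmod (p z) \<le> L1 \<and> cmod (p z - p w) \<le> L1 * \<delta>"
    using add.IH(1) by blast
  obtain L2 where L2: "L2 \<ge> 0" "\<And>z w \<delta>. (\<forall>i<n. cmod (z i) \<le> B \<and> cmod (w i) \<le> B \<and> cmod (z i - w i) \<le> \<delta>) \<Longrightarrow> \<delta> \<ge> 0 \<Longrightarrow>
           cmod (q z) \<le> L2 \<and> cmod (q z - q w) \<le> L2 * \<delta>"
    using add.IH(2) by blast
  show ?case
  proof (intro exI[of _ "L1 + L2"] conjI allI impI)
    fix z w :: "nat \<Rightarrow> complex" and \<delta> :: real
    assume *: "\<forall>i<n. cmod (z i) \<le> B \<and> cmod (w i) \<le> B \<and> cmod (z i - w i) \<le> \<delta>" "0 \<le> \<delta>"
    note b = L1(2)[OF *] L2(2)[OF *]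
    show "cmod (p z + q z) \<le> L1 + L2"
      using b norm_triangle_ineq[of "p z" "q z"] by linarith
    show "cmod (p z + q z - (p w + q w)) \<le> (L1 + L2) * \<delta>"
      using b norm_triangle_ineq[of "p z - p w" "q z - q w"] by (simp add: algebra_simps)
  qed (use L1 L2 in auto)
next
  case (mult p q)
  obtain L1 where L1: "L1 \<ge> 0" "\<And>z w \<delta>. (\<forall>i<n. cmod (z i) \<le> B \<and> cmod (w i) \<le> B \<and> cmod (z i - w i) \<le> \<delta>) \<Longrightarrow> \<delta> \<ge> 0 \<Longrightarrow>
           cmod (p z) \<le> L1 \<and> cmod (p z - p w) \<le> L1 * \<delta>"
    using mult.IH(1) by blast
  obtain L2 where L2: "L2 \<ge> 0" "\<And>z w \<delta>. (\<forall>i<n. cmod (z i) \<le> B \<and> cmod (w i) \<le> B \<and> cmod (z i - w i) \<le> \<delta>) \<Longrightarrow> \<delta> \<ge> 0 \<Longrightarrow>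
           cmod (q z) \<le> L2 \<and> cmod (q z - q w) \<le> L2 * \<delta>"
    using mult.IH(2) by blast
  show ?case
  \<comment> \<open>The factor 2 pays for the two summands of the telescoped difference of products
    below.\<close>
  proof (intro exI[of _ "2 * (L1 * L2)"] conjI allI impI)
    fix z w :: "nat \<Rightarrow> complex" and \<delta> :: real
    assume *: "\<forall>i<n. cmod (z i) \<le> B \<and> cmod (w i) \<le> B \<and> cmod (z i - w i) \<le> \<delta>" "0 \<le> \<delta>"
    note b = L1(2)[OF *] L2(2)[OF *]
    \<comment> \<open>The inductive bound concerns only the first argument, so the pair
      \<open>w\<close>, \<open>w\<close> is used to bound \<open>q w\<close>.\<close>
    have w: "\<forall>i<n. cmod (w i) \<le> B \<and> cmod (w i) \<le> B \<and> cmod (w i - w i) \<le> \<delta>" using * by auto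
    note b' = L2(2)[OF w *(2)]
    have "cmod (p z * q z) \<le> L1 * L2"
      using b by (simp add: norm_mult mult_mono L1(1))
    then show "cmod (p z * q z) \<le> 2 * (L1 * L2)"
      using mult_nonneg_nonneg[OF L1(1) L2(1)] by linarith
    have "p z * q z - p w * q w = p z * (q z - q w) + (p z - p w) * q w" by (simp add: algebra_simps)
    then have "cmod (p z * q z - p w * q w) \<le> cmod (p z) * cmod (q z - q w) + cmod (p z - p w) * cmod (q w)"
      by (metis norm_mult norm_triangle_ineq)
    also have "\<dots> \<le> L1 * (L2 * \<delta>) + (L1 * \<delta>) * L2"
      using b b' L1(1) L2(1) *(2) by (intro add_mono mult_mono) auto
    finally show "cmod (p z * q z - p w * q w) \<le> 2 * (L1 * L2) * \<delta>" by (simp add: algebra_simps)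
  qed (use L1 L2 in auto)
qed

lemma polyfun_differentiable: "p \<in> polyfun n \<Longrightarrow> (\<lambda>t. p (z(j := t))) field_differentiable at s"
proof -
  assume "p \<in> polyfun n"
  then have "(\<lambda>t. p (z(j := t))) holomorphic_on UNIV"
  proof (rule holomorphic_polyfun)
    fix i show "(\<lambda>t. (z(j := t)) i) holomorphic_on UNIV"
      by (cases "i = j") (auto intro: holomorphic_intros)
  qed
  then show ?thesis by (simp add: holomorphic_on_def)
qed

lemma partial_deriv_const [simp]: "partial_deriv j (\<lambda>z. c) a = 0"
  by (simp add: partial_deriv_def)

lemma partial_deriv_coord [simp]: "partial_deriv j (\<lambda>z. z i) a = (if i = j then 1 else 0)"
  by (auto simp: partial_deriv_def)

lemma partial_deriv_add:
  "p \<in> polyfun n \<Longrightarrow> q \<in> polyfun n \<Longrightarrow>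
    partial_deriv j (\<lambda>z. p z + q z) a = partial_deriv j p a + partial_deriv j q a"
  by (simp add: partial_deriv_def deriv_add polyfun_differentiable)

lemma partial_deriv_mult:
  "p \<in> polyfun n \<Longrightarrow> q \<in> polyfun n \<Longrightarrow>
    partial_deriv j (\<lambda>z. p z * q z) a = partial_deriv j p a * q a + p a * partial_deriv j q a"
  by (simp add: partial_deriv_def deriv_mult polyfun_differentiable)

text \<open>The second-order remainder is kept as a polynomial in the direction \<open>b\<close> and
  the parameter \<open>t\<close>, which sits in the extra variable of index \<open>n\<close>. In
  this form \<open>polyfun_lipschitz\<close> and holomorphic substitution apply to it.\<close>

lemma polyfun_taylor:
  assumes "p \<in> polyfun n"
  shows "\<exists>R \<in> polyfun (Suc n). \<forall>t b. p (\<lambda>i. a i + t * b i)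
           = p a + t * (\<Sum>j<n. partial_deriv j p a * b j) + t\<^sup>2 * R (b(n := t))"
  using assms
proof (induction rule: polyfun.induct)
  case (const c)
  show ?case by (rule bexI[of _ "\<lambda>_. 0"]) (auto intro: polyfun.intros)
next
  case (coord i)
  then have "(\<Sum>j<n. partial_deriv j (\<lambda>z. z i) a * b j) = b i" for b
  proof -
    have "(\<Sum>j<n. partial_deriv j (\<lambda>z. z i) a * b j) = (\<Sum>j<n. if j = i then b j else 0)"
      by (intro sum.cong) auto
    then show ?thesis using coord by simp
  qed
  then show ?case
    by (intro bexI[of _ "\<lambda>_. 0"]) (auto intro: polyfun.intros)
next
  case (add p q)
  obtain R S where *: "R \<in> polyfun (Suc n)" "S \<in> polyfun (Suc n)"
    "\<forall>t b. p (\<lambda>i. a i + t * b i) = p a + t * (\<Sum>j<n. partial_deriv j p a * b j) + t\<^sup>2 * R (b(n := t))"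
    "\<forall>t b. q (\<lambda>i. a i + t * b i) = q a + t * (\<Sum>j<n. partial_deriv j q a * b j) + t\<^sup>2 * S (b(n := t))"
    using add.IH by blast
  show ?case
    by (rule bexI[of _ "\<lambda>z. R z + S z"])
      (use * add.hyps in \<open>auto intro: polyfun.intros simp: partial_deriv_add sum.distrib algebra_simps simp del: fun_upd_apply\<close>)
next
  case (mult p q)
  obtain R S where *: "R \<in> polyfun (Suc n)" "S \<in> polyfun (Suc n)"
    "\<And>t b. p (\<lambda>i. a i + t * b i) = p a + t * (\<Sum>j<n. partial_deriv j p a * b j) + t\<^sup>2 * R (b(n := t))"
    "\<And>t b. q (\<lambda>i. a i + t * b i) = q a + t * (\<Sum>j<n. partial_deriv j q a * b j) + t\<^sup>2 * S (b(n := t))"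
    using mult.IH by blast
  define P Q where "P = (\<lambda>z. \<Sum>j<n. partial_deriv j p a * z j)" and "Q = (\<lambda>z. \<Sum>j<n. partial_deriv j q a * z j)"
  have PQ: "P \<in> polyfun (Suc n)" "Q \<in> polyfun (Suc n)"
    unfolding P_def Q_def by (auto intro!: polyfun_sum polyfun.intros)
  have upd: "P (b(n := t)) = P b" "Q (b(n := t)) = Q b" for b t by (auto simp: P_def Q_def)
  \<comment> \<open>Coefficient of \<open>t\<^sup>2\<close> in the product of the two expansions; in
    the mixed terms \<open>z n\<close> stands for \<open>t\<close>.\<close>
  define T where "T = (\<lambda>z. p a * S z + q a * R z + (P z + z n * R z) * (Q z + z n * S z))"
  have "T \<in> polyfun (Suc n)" unfolding T_def using * PQ by (intro polyfun.intros) auto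
  moreover have "(\<Sum>j<n. partial_deriv j (\<lambda>z. p z * q z) a * b j) = q a * P b + p a * Q b" for b
    using mult.hyps by (simp add: P_def Q_def partial_deriv_mult sum.distrib algebra_simps sum_distrib_left)
  moreover have "p (\<lambda>i. a i + t * b i) * q (\<lambda>i. a i + t * b i) =
        p a * q a + t * (q a * P b + p a * Q b) + t\<^sup>2 * T (b(n := t))" for t b
  proof -
    have "p (\<lambda>i. a i + t * b i) = p a + t * P b + t\<^sup>2 * R (b(n := t))"
      "q (\<lambda>i. a i + t * b i) = q a + t * Q b + t\<^sup>2 * S (b(n := t))"
      by (simp_all add: *(3,4) P_def Q_def)
    then show ?thesis by (simp only: T_def upd) (simp add: algebra_simps power2_eq_square)
  qed
  ultimately show ?case by (intro bexI[of _ T]) (auto simp del: fun_upd_apply)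
qed

text \<open>Singles out the last variable for inductions on the number of variables, both in
  Hilbert's basis theorem and along the fibre coordinates of the blowing-up.\<close>

lemma polyfun_Suc_expand:
  assumes "p \<in> polyfun (Suc n)"
  shows "\<exists>d c. (\<forall>k. c k \<in> polyfun n) \<and> p = (\<lambda>z. \<Sum>k<d. c k z * z n ^ k)"
  using assms
proof (induction rule: polyfun.induct)
  case (const c)
  show ?case
    by (rule exI[of _ 1], rule exI[of _ "\<lambda>_ _. c"]) (auto intro: polyfun.intros)
next
  case (coord i)
  show ?case
  proof (cases "i = n")
    case True
    show ?thesis
      by (rule exI[of _ 2], rule exI[of _ "\<lambda>k _. if k = 1 then 1 else 0"])
        (auto intro: polyfun.intros simp: True numeral_2_eq_2)
  next
    case False
    then show ?thesis using coord
      by (intro exI[of _ 1] exI[of _ "\<lambda>_ z. z i"]) (auto intro: polyfun.intros)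
  qed
next
  case (add p q)
  obtain d c e b where *: "\<forall>k. c k \<in> polyfun n" "p = (\<lambda>z. \<Sum>k<d. c k z * z n ^ k)"
     "\<forall>k. b k \<in> polyfun n" "q = (\<lambda>z. \<Sum>k<e. b k z * z n ^ k)"
    using add.IH by blast
  define c' where "c' k = (if k < d then c k else (\<lambda>_. 0))" for k
  define b' where "b' k = (if k < e then b k else (\<lambda>_. 0))" for k
  have "p z = (\<Sum>k<max d e. c' k z * z n ^ k)" for z
    unfolding *(2) by (rule sum.mono_neutral_cong_left) (auto simp: c'_def)
  moreover have "q z = (\<Sum>k<max d e. b' k z * z n ^ k)" for z
    unfolding *(4) by (rule sum.mono_neutral_cong_left) (auto simp: b'_def)
  moreover have "(\<lambda>z. c' k z + b' k z) \<in> polyfun n" for k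
    using * by (auto simp: c'_def b'_def intro: polyfun.intros)
  ultimately show ?case
    by (intro exI[of _ "max d e"] exI[of _ "\<lambda>k z. c' k z + b' k z"]) (auto simp: algebra_simps sum.distrib)
next
  case (mult p q)
  obtain d c e b where *: "\<forall>k. c k \<in> polyfun n" "p = (\<lambda>z. \<Sum>k<d. c k z * z n ^ k)"
     "\<forall>k. b k \<in> polyfun n" "q = (\<lambda>z. \<Sum>k<e. b k z * z n ^ k)"
    using mult.IH by blast
  define f where "f m = (\<lambda>z. \<Sum>(k,l)\<in>{(k,l)\<in>{..<d}\<times>{..<e}. k + l = m}. c k z * b l z)" for m
  have "f m \<in> polyfun n" for m
    unfolding f_def using * by (intro polyfun_sum) (auto intro: polyfun.intros)
  moreover have "p z * q z = (\<Sum>m<d + e. f m z * z n ^ m)" for z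
  proof -
    have "p z * q z = (\<Sum>(k,l)\<in>{..<d}\<times>{..<e}. c k z * b l z * z n ^ (k + l))"
      unfolding *(2,4) sum_product sum.cartesian_product
      by (intro sum.cong refl) (auto simp: power_add algebra_simps)
    also have "\<dots> = (\<Sum>m<d + e. \<Sum>(k,l)\<in>{(k,l)\<in>{..<d}\<times>{..<e}. k + l = m}. c k z * b l z * z n ^ (k + l))"
      by (subst sum.group[symmetric, where g = "\<lambda>(k,l). k + l" and T = "{..<d + e}"])
        (auto intro!: sum.cong)
    also have "\<dots> = (\<Sum>m<d + e. f m z * z n ^ m)"
      unfolding f_def sum_distrib_right by (intro sum.cong refl) auto
    finally show ?thesis .
  qed
  ultimately show ?case by (intro exI[of _ "d + e"] exI[of _ f]) auto
qed

section \<open>Ideals of polynomial functions and Hilbert's basis theorem\<close>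

inductive_set poly_ideal :: "nat \<Rightarrow> ((nat \<Rightarrow> complex) \<Rightarrow> complex) set \<Rightarrow> ((nat \<Rightarrow> complex) \<Rightarrow> complex) set"
  for n S where
  zero: "(\<lambda>z. 0) \<in> poly_ideal n S"
| base: "p \<in> S \<Longrightarrow> p \<in> poly_ideal n S"
| add: "p \<in> poly_ideal n S \<Longrightarrow> q \<in> poly_ideal n S \<Longrightarrow> (\<lambda>z. p z + q z) \<in> poly_ideal n S"
| mult: "r \<in> polyfun n \<Longrightarrow> p \<in> poly_ideal n S \<Longrightarrow> (\<lambda>z. r z * p z) \<in> poly_ideal n S"

lemma poly_ideal_least: "p \<in> poly_ideal n S \<Longrightarrow> S \<subseteq> poly_ideal n T \<Longrightarrow> p \<in> poly_ideal n T"
  by (induction rule: poly_ideal.induct) (auto intro: poly_ideal.intros)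

lemma poly_ideal_mono: "p \<in> poly_ideal n S \<Longrightarrow> S \<subseteq> T \<Longrightarrow> p \<in> poly_ideal n T"
  by (erule poly_ideal_least) (auto intro: poly_ideal.intros)

lemma poly_ideal_diff:
  "p \<in> poly_ideal n S \<Longrightarrow> q \<in> poly_ideal n S \<Longrightarrow> (\<lambda>z. p z - q z) \<in> poly_ideal n S"
  using poly_ideal.add[OF _ poly_ideal.mult[OF polyfun.const[of "- 1"]], of p n S q] by simp

text \<open>Turns a finite set of generators found anywhere in the ideal into one contained in
  \<open>S\<close>.\<close>

lemma poly_ideal_finite_support:
  "p \<in> poly_ideal n S \<Longrightarrow> \<exists>F\<subseteq>S. finite F \<and> p \<in> poly_ideal n F"
proof (induction rule: poly_ideal.induct)
  case (base p)
  then show ?case by (intro exI[of _ "{p}"]) (auto intro: poly_ideal.intros)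
next
  case (add p q)
  then obtain F G where "F \<subseteq> S" "finite F" "p \<in> poly_ideal n F" "G \<subseteq> S" "finite G" "q \<in> poly_ideal n G"
    by blast
  then show ?case
    by (intro exI[of _ "F \<union> G"]) (auto intro: poly_ideal.add poly_ideal_mono)
qed (auto intro: poly_ideal.intros)

lemma poly_ideal_zero: "p \<in> poly_ideal n S \<Longrightarrow> (\<And>q. q \<in> S \<Longrightarrow> q z = 0) \<Longrightarrow> p z = 0"
  by (induction rule: poly_ideal.induct) auto

text \<open>The coefficient \<open>c\<close> may be zero, so \<open>d\<close> only bounds the degree
  in the last variable. With this convention the coefficients occurring for a fixed \<open>d\<close>
  are closed under addition.\<close>

definition leading :: "nat \<Rightarrow> nat \<Rightarrow> ((nat \<Rightarrow> complex) \<Rightarrow> complex) \<Rightarrow> ((nat \<Rightarrow> complex) \<Rightarrow> complex) \<Rightarrow> bool" where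
  "leading n d c p \<longleftrightarrow>
     (\<exists>b. (\<forall>k. b k \<in> polyfun n) \<and> p = (\<lambda>z. c z * z n ^ d + (\<Sum>k<d. b k z * z n ^ k)))"

lemma leading_add:
  assumes "leading n d c p" "leading n d c' p'"
  shows "leading n d (\<lambda>z. c z + c' z) (\<lambda>z. p z + p' z)"
proof -
  obtain b b' where "\<forall>k. b k \<in> polyfun n" "p = (\<lambda>z. c z * z n ^ d + (\<Sum>k<d. b k z * z n ^ k))"
     "\<forall>k. b' k \<in> polyfun n" "p' = (\<lambda>z. c' z * z n ^ d + (\<Sum>k<d. b' k z * z n ^ k))"
    using assms unfolding leading_def by blast
  then show ?thesis unfolding leading_def
    by (intro exI[of _ "\<lambda>k z. b k z + b' k z"]) (auto intro: polyfun.add simp: algebra_simps sum.distrib)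
qed

lemma leading_mult:
  assumes "leading n d c p" "r \<in> polyfun n"
  shows "leading n d (\<lambda>z. r z * c z) (\<lambda>z. r z * p z)"
proof -
  obtain b where "\<forall>k. b k \<in> polyfun n" "p = (\<lambda>z. c z * z n ^ d + (\<Sum>k<d. b k z * z n ^ k))"
    using assms unfolding leading_def by blast
  then show ?thesis unfolding leading_def using assms(2)
    by (intro exI[of _ "\<lambda>k z. r z * b k z"]) (auto intro: polyfun.mult simp: algebra_simps sum_distrib_left)
qed

lemma leading_shift:
  assumes "leading n d c p"
  shows "leading n (d + e) c (\<lambda>z. z n ^ e * p z)"
proof -
  obtain b where b: "\<forall>k. b k \<in> polyfun n" "p = (\<lambda>z. c z * z n ^ d + (\<Sum>k<d. b k z * z n ^ k))"
    using assms unfolding leading_def by blast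
  define b' where "b' k = (if e \<le> k then b (k - e) else (\<lambda>_. 0))" for k
  have "(\<Sum>k<d + e. b' k z * z n ^ k) = z n ^ e * (\<Sum>k<d. b k z * z n ^ k)" for z
  proof -
    have "(\<Sum>k<d + e. b' k z * z n ^ k) = (\<Sum>k\<in>{e..<d + e}. b' k z * z n ^ k)"
      by (rule sum.mono_neutral_right) (auto simp: b'_def)
    also have "\<dots> = (\<Sum>k<d. b' (k + e) z * z n ^ (k + e))"
      using sum.shift_bounds_nat_ivl[of "\<lambda>k. b' k z * z n ^ k" 0 e d] by (simp add: atLeast0LessThan)
    finally show ?thesis by (simp add: b'_def power_add sum_distrib_left algebra_simps)
  qed
  moreover have "b' k \<in> polyfun n" for k using b(1) by (auto simp: b'_def intro: polyfun.const)
  ultimately show ?thesis unfolding leading_def b(2)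
    by (intro exI[of _ b']) (auto simp: algebra_simps power_add)
qed

lemma leading_zero: "leading n d (\<lambda>z. 0) (\<lambda>z. 0)"
  unfolding leading_def by (rule exI[of _ "\<lambda>_ _. 0"]) (auto intro: polyfun.const)

text \<open>Hilbert's basis theorem: the leading coefficients of the ideal in each degree form an
  ascending chain of ideals in one variable less.\<close>

lemma poly_ideal_finitely_generated:
  assumes "S \<subseteq> polyfun n"
  shows "\<exists>F\<subseteq>S. finite F \<and> S \<subseteq> poly_ideal n F"
  using assms
proof (induction n arbitrary: S)
  case 0
  have const: "p = (\<lambda>z. p (\<lambda>_. 0))" if "p \<in> polyfun 0" for p
    by (rule ext, rule polyfun_cong[OF that]) simp
  show ?case
  proof (cases "\<exists>p\<in>S. p (\<lambda>_. 0) \<noteq> 0")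
    case True
    then obtain p where p: "p \<in> S" "p (\<lambda>_. 0) \<noteq> 0" by blast
    define c where "c = p (\<lambda>_. 0)"
    have pc: "p = (\<lambda>_. c)" unfolding c_def by (rule const) (rule subsetD[OF 0 p(1)])
    have "q \<in> poly_ideal 0 {p}" if "q \<in> S" for q
    proof -
      define d where "d = q (\<lambda>_. 0)"
      have qc: "q = (\<lambda>_. d)" unfolding d_def by (rule const) (rule subsetD[OF 0 that])
      have "(\<lambda>z. d / c * p z) \<in> poly_ideal 0 {p}"
        by (intro poly_ideal.mult polyfun.const poly_ideal.base) simp
      moreover have "(\<lambda>z. d / c * p z) = q"
        using p(2) by (simp add: pc qc)
      ultimately show ?thesis by simp
    qed
    then show ?thesis using p by (intro exI[of _ "{p}"]) auto
  next
    case False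
    have "p = (\<lambda>z. 0)" if "p \<in> S" for p
    proof -
      have "p = (\<lambda>z. p (\<lambda>_. 0))" by (rule const) (rule subsetD[OF 0 that])
      also have "\<dots> = (\<lambda>z. 0)" using False that by auto
      finally show ?thesis .
    qed
    then have "S \<subseteq> poly_ideal 0 {}" using poly_ideal.zero by blast
    then show ?thesis by (intro exI[of _ "{}"]) auto
  qed
next
  case (Suc n)
  define I where "I = poly_ideal (Suc n) S"
  have up: "r \<in> polyfun (Suc n)" if "r \<in> polyfun n" for r using polyfun_mono[OF that, of "Suc n"] by simp
  have zpow: "(\<lambda>z. z n ^ e) \<in> polyfun (Suc n)" for e by (intro polyfun_power polyfun.coord) simp
  define L where "L d = {c \<in> polyfun n. \<exists>p\<in>I. leading n d c p}" for d
  have L_mono: "L d \<subseteq> L (d + e)" for d e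
  proof
    fix c assume "c \<in> L d"
    then obtain p where "c \<in> polyfun n" "p \<in> I" "leading n d c p" by (auto simp: L_def)
    then have "(\<lambda>z. z n ^ e * p z) \<in> I" "leading n (d + e) c (\<lambda>z. z n ^ e * p z)"
      unfolding I_def by (auto intro: leading_shift poly_ideal.mult zpow)
    with \<open>c \<in> polyfun n\<close> show "c \<in> L (d + e)" by (auto simp: L_def)
  qed
  have "\<exists>F\<subseteq>L d. finite F \<and> L d \<subseteq> poly_ideal n F" for d
    by (rule Suc.IH) (auto simp: L_def)
  then obtain F where F: "\<And>d. F d \<subseteq> L d" "\<And>d. finite (F d)" "\<And>d. L d \<subseteq> poly_ideal n (F d)"
    by metis
  \<comment> \<open>The union of the ascending chain \<open>L\<close> is finitely generated; its
    generators all lie in one \<open>L D\<close>, so the generators of \<open>L D\<close> serve for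
    every higher degree.\<close>
  have "\<exists>F\<subseteq>(\<Union>d. L d). finite F \<and> (\<Union>d. L d) \<subseteq> poly_ideal n F"
    by (rule Suc.IH) (auto simp: L_def)
  then obtain F' where F': "F' \<subseteq> (\<Union>d. L d)" "finite F'" "(\<Union>d. L d) \<subseteq> poly_ideal n F'"
    by blast
  have "\<exists>d. \<forall>e\<ge>d. F' \<subseteq> L e"
    using F'(2,1)
  proof (induction F' rule: finite_induct)
    case (insert f F')
    then obtain d d' where "\<forall>e\<ge>d. F' \<subseteq> L e" "f \<in> L d'" by auto
    then show ?case using L_mono[of d'] by (intro exI[of _ "max d d'"]) (metis insert_subset le_add_diff_inverse max.bounded_iff subsetD)
  qed auto
  then obtain D where D: "F' \<subseteq> L D" by blast
  have F_all: "L d \<subseteq> poly_ideal n (F (min d D))" for d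
  proof (cases "d \<le> D")
    case True
    then show ?thesis using F(3) by (simp add: min_absorb1)
  next
    case False
    have "p \<in> poly_ideal n (F D)" if "p \<in> L d" for p
    proof (rule poly_ideal_least)
      show "p \<in> poly_ideal n F'" using that F'(3) by blast
      show "F' \<subseteq> poly_ideal n (F D)" using D F(3) by (rule order_trans)
    qed
    then show ?thesis using False by (auto simp: min_absorb2)
  qed
  define W where "W d c = (SOME p. p \<in> I \<and> leading n d c p)" for d c
  have W: "W d c \<in> I \<and> leading n d c (W d c)" if "c \<in> F d" for c d
  proof -
    have "c \<in> L d" using that F(1) by blast
    then have "\<exists>p. p \<in> I \<and> leading n d c p" by (auto simp: L_def)
    then show ?thesis unfolding W_def by (rule someI_ex)
  qed
  define G where "G = (\<Union>d\<le>D. W d ` F d)"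
  have G: "finite G" "G \<subseteq> I" unfolding G_def using F(2) W by auto
  \<comment> \<open>In degrees above \<open>D\<close> a witness from degree \<open>D\<close> is
    multiplied by a power of the last variable, so the finite set \<open>G\<close> realises every
    leading coefficient.\<close>
  have lift: "\<exists>q \<in> poly_ideal (Suc n) G. leading n d c q" if "c \<in> poly_ideal n (F (min d D))" for d c
    using that
  proof (induction rule: poly_ideal.induct)
    case zero
    show ?case by (intro bexI[of _ "\<lambda>z. 0"] leading_zero poly_ideal.zero)
  next
    case (base c)
    have "W (min d D) c \<in> G" using base by (auto simp: G_def)
    then have "(\<lambda>z. z n ^ (d - min d D) * W (min d D) c z) \<in> poly_ideal (Suc n) G"
      by (intro poly_ideal.mult zpow poly_ideal.base)
    moreover have "leading n (min d D + (d - min d D)) c (\<lambda>z. z n ^ (d - min d D) * W (min d D) c z)"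
      by (rule leading_shift) (use W base in blast)
    moreover have "min d D + (d - min d D) = d" by simp
    ultimately show ?case by metis
  next
    case (add p q)
    then obtain p' q' where "p' \<in> poly_ideal (Suc n) G" "leading n d p p'"
      "q' \<in> poly_ideal (Suc n) G" "leading n d q q'" by blast
    then show ?case by (intro bexI[of _ "\<lambda>z. p' z + q' z"] leading_add poly_ideal.add)
  next
    case (mult r p)
    then obtain p' where "p' \<in> poly_ideal (Suc n) G" "leading n d p p'" by blast
    then show ?case using mult.hyps(1)
      by (intro bexI[of _ "\<lambda>z. r z * p' z"] leading_mult poly_ideal.mult up)
  qed
  \<comment> \<open>Division: subtracting an element of the ideal of \<open>G\<close> with the same
    top coefficient lowers the degree bound by one.\<close>
  have red: "p \<in> poly_ideal (Suc n) G"
    if "p \<in> I" "\<forall>k. b k \<in> polyfun n" "p = (\<lambda>z. \<Sum>k<d. b k z * z n ^ k)" for d b p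
    using that
  proof (induction d arbitrary: b p)
    case 0
    then show ?case by (simp add: poly_ideal.zero)
  next
    case (Suc d)
    have "leading n d (b d) p" unfolding leading_def using Suc.prems by (intro exI[of _ b]) (auto simp: algebra_simps)
    then have "b d \<in> L d" using Suc.prems by (auto simp: L_def)
    then obtain q where q: "q \<in> poly_ideal (Suc n) G" "leading n d (b d) q" using lift F_all by blast
    then obtain b' where b': "\<forall>k. b' k \<in> polyfun n" "q = (\<lambda>z. b d z * z n ^ d + (\<Sum>k<d. b' k z * z n ^ k))"
      unfolding leading_def by blast
    have "q \<in> I" using poly_ideal_least[OF q(1), of S] G(2) by (auto simp: I_def)
    then have "(\<lambda>z. p z - q z) \<in> I" using Suc.prems(1) unfolding I_def by (intro poly_ideal_diff)
    moreover have "\<forall>k. (\<lambda>z. b k z - b' k z) \<in> polyfun n" using Suc.prems(2) b'(1) by (auto intro: polyfun_diff)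
    moreover have "(\<lambda>z. p z - q z) = (\<lambda>z. \<Sum>k<d. (b k z - b' k z) * z n ^ k)"
      unfolding Suc.prems(3) b'(2) by (simp add: algebra_simps sum_subtractf)
    ultimately have "(\<lambda>z. p z - q z) \<in> poly_ideal (Suc n) G" by (rule Suc.IH)
    from poly_ideal.add[OF this q(1)] show ?case by simp
  qed
  have SI: "S \<subseteq> poly_ideal (Suc n) G"
  proof
    fix p assume p: "p \<in> S"
    then obtain d c where "\<forall>k. c k \<in> polyfun n" "p = (\<lambda>z. \<Sum>k<d. c k z * z n ^ k)"
      using polyfun_Suc_expand[of p n] Suc.prems by blast
    then show "p \<in> poly_ideal (Suc n) G" using p by (intro red) (auto simp: I_def intro: poly_ideal.base)
  qed
  \<comment> \<open>\<open>G\<close> lies in the ideal but not necessarily in \<open>S\<close>; its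
    members are replaced by the finitely many elements of \<open>S\<close> that they come
    from.\<close>
  have "\<forall>g\<in>G. \<exists>F\<subseteq>S. finite F \<and> g \<in> poly_ideal (Suc n) F"
    using G(2) poly_ideal_finite_support unfolding I_def by blast
  then obtain T where T: "\<And>g. g \<in> G \<Longrightarrow> T g \<subseteq> S \<and> finite (T g) \<and> g \<in> poly_ideal (Suc n) (T g)"
    by metis
  have "G \<subseteq> poly_ideal (Suc n) (\<Union>g\<in>G. T g)"
    using T by (blast intro: poly_ideal_mono)
  then have "S \<subseteq> poly_ideal (Suc n) (\<Union>g\<in>G. T g)" using SI poly_ideal_least by blast
  then show ?case using T G(1) by (intro exI[of _ "\<Union>g\<in>G. T g"]) auto
qed

section \<open>Linear algebra\<close>

text \<open>Duality for a subspace \<open>W\<close> without dimension counts. Given vectors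
  \<open>e j\<close> dual to the coordinates in \<open>I\<close>, each \<open>u\<close> can be
  corrected to vanish on \<open>I\<close>. If all corrected vectors also vanished at
  \<open>k\<close>, the coordinate \<open>k\<close> would be a linear combination of the others on
  \<open>W\<close>, against independence.\<close>

lemma independent_surj:
  fixes W :: "('i \<Rightarrow> complex) set"
  assumes "finite I" "w0 \<in> W"
    and lin: "\<And>c d u v. u \<in> W \<Longrightarrow> v \<in> W \<Longrightarrow> (\<lambda>i. c * u i + d * v i) \<in> W"
    and indep: "\<And>c. (\<And>w. w \<in> W \<Longrightarrow> (\<Sum>i\<in>I. c i * w i) = 0) \<Longrightarrow> \<forall>i\<in>I. c i = 0"
  shows "\<exists>w\<in>W. \<forall>i\<in>I. w i = y i"
  using assms(1) indep
proof (induction I arbitrary: y rule: finite_induct)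
  case empty
  then show ?case using assms(2) by auto
next
  case (insert k I)
  have I: "\<exists>w\<in>W. \<forall>i\<in>I. w i = y i" for y
  proof (rule insert.IH)
    fix c :: "'i \<Rightarrow> complex" assume c: "\<And>w. w \<in> W \<Longrightarrow> (\<Sum>i\<in>I. c i * w i) = 0"
    define c' where "c' = c(k := 0)"
    have "(\<Sum>i\<in>insert k I. c' i * w i) = (\<Sum>i\<in>I. c i * w i)" for w
      using insert.hyps by (auto simp: c'_def intro!: sum.cong)
    then have "\<forall>i\<in>insert k I. c' i = 0" using c insert.prems by auto
    then show "\<forall>i\<in>I. c i = 0" using insert.hyps by (auto simp: c'_def split: if_splits)
  qed
  have lins: "(\<lambda>i. \<Sum>j\<in>J. c j * e j i) \<in> W" if "finite J" "\<And>j. j \<in> J \<Longrightarrow> e j \<in> W" for J c and e :: "'i \<Rightarrow> 'i \<Rightarrow> complex"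
    using that
  proof (induction J rule: finite_induct)
    case empty
    show ?case using lin[OF assms(2) assms(2), of 0 0] by simp
  next
    case (insert j J)
    then show ?case using lin[of "e j" "\<lambda>i. \<Sum>j\<in>J. c j * e j i" "c j" 1] by simp
  qed
  have "\<forall>j. \<exists>w\<in>W. \<forall>i\<in>I. w i = (if i = j then 1 else 0)" by (intro allI I)
  then obtain e where e: "\<And>j. e j \<in> W" "\<And>i j. i \<in> I \<Longrightarrow> e j i = (if i = j then 1 else 0)"
    by metis
  have "\<exists>u\<in>W. u k \<noteq> (\<Sum>i\<in>I. u i * e i k)"
  proof (rule ccontr)
    assume "\<not> ?thesis"
    then have *: "u k = (\<Sum>i\<in>I. u i * e i k)" if "u \<in> W" for u using that by blast
    define c where "c i = (if i = k then - 1 else e i k)" for i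
    have "(\<Sum>i\<in>insert k I. c i * w i) = 0" if "w \<in> W" for w
    proof -
      have "(\<Sum>i\<in>insert k I. c i * w i) = - w k + (\<Sum>i\<in>I. w i * e i k)"
        using insert.hyps by (auto simp: c_def algebra_simps intro!: sum.cong)
      then show ?thesis using *[OF that] by simp
    qed
    then have "\<forall>i\<in>insert k I. c i = 0" using insert.prems by blast
    then show False by (auto simp: c_def)
  qed
  then obtain u where u: "u \<in> W" "u k \<noteq> (\<Sum>i\<in>I. u i * e i k)" by blast
  define u' where "u' = (\<lambda>i. 1 * u i + (- 1) * (\<Sum>j\<in>I. u j * e j i))"
  have u': "u' \<in> W" unfolding u'_def by (intro lin u lins insert.hyps e)
  have u'0: "u' i = 0" if "i \<in> I" for i
  proof -
    have "(\<Sum>j\<in>I. u j * e j i) = (\<Sum>j\<in>I. if i = j then u j else 0)"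
      using that by (intro sum.cong) (auto simp: e)
    then show ?thesis using that insert.hyps by (simp add: u'_def)
  qed
  have u'k: "u' k \<noteq> 0" using u(2) by (simp add: u'_def)
  obtain w where w: "w \<in> W" "\<forall>i\<in>I. w i = y i" using I by blast
  have "(\<lambda>i. 1 * w i + (y k - w k) / u' k * u' i) \<in> W" by (intro lin w u')
  moreover have "\<forall>i\<in>insert k I. 1 * w i + (y k - w k) / u' k * u' i = y i"
    using u'0 u'k w(2) by auto
  ultimately show ?case by (intro bexI[of _ "\<lambda>i. 1 * w i + (y k - w k) / u' k * u' i"])
qed

lemma tendsto_polyfun:
  assumes "p \<in> polyfun n" "\<And>i. i < n \<Longrightarrow> ((\<lambda>t. z t i) \<longlongrightarrow> w i) F"
  shows "((\<lambda>t. p (z t)) \<longlongrightarrow> p w) F"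
  using assms by (induction rule: polyfun.induct) (auto intro!: tendsto_intros)

section \<open>Holomorphic curves in smooth zero sets\<close>

text \<open>Writing the curve as \<open>a + t (v + A u(t))\<close> with a right inverse \<open>A\<close> of the Jacobian matrix
  turns the equations into the fixed point problem \<open>u = - t R(t, v + A u)\<close> with polynomial \<open>R\<close>,
  which is a contraction for small \<open>t\<close>.\<close>

lemma polynomial_curve_exists:
  fixes f :: "nat \<Rightarrow> (nat \<Rightarrow> complex) \<Rightarrow> complex"
  assumes f: "\<And>i. i < m \<Longrightarrow> f i \<in> polyfun N" "\<And>i. i < m \<Longrightarrow> f i a = 0"
    and av: "a \<in> Vec N" "v \<in> Vec N"
    and tang: "\<And>i. i < m \<Longrightarrow> (\<Sum>j<N. partial_deriv j (f i) a * v j) = 0"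
    and indep: "\<And>c. (\<And>j. j < N \<Longrightarrow> (\<Sum>i<m. c i * partial_deriv j (f i) a) = 0) \<Longrightarrow> \<forall>i<m. c i = 0"
  shows "\<exists>e>0. \<exists>\<gamma>. \<gamma> 0 = a \<and> (\<forall>t\<in>ball 0 e. \<gamma> t \<in> Vec N \<and> (\<forall>i<m. f i (\<gamma> t) = 0)) \<and>
     (\<forall>j. (\<lambda>t. \<gamma> t j) holomorphic_on ball 0 e \<and> ((\<lambda>t. \<gamma> t j) has_field_derivative v j) (at 0))"
proof -
  define d where "d i j = partial_deriv j (f i) a" for i j
  \<comment> \<open>Image of the Jacobian matrix. Independence of the rows makes it everything,
    which yields the right inverse \<open>A\<close>.\<close>
  define W where "W = {w. \<exists>b. w = (\<lambda>i. \<Sum>j<N. d i j * b j)}"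
  have inv: "\<exists>b. \<forall>i<m. (\<Sum>j<N. d i j * b j) = (if i = k then 1 else 0)" for k
  proof -
    have "\<exists>w\<in>W. \<forall>i\<in>{..<m}. w i = (if i = k then 1 else 0)"
    proof (rule independent_surj)
      show "(\<lambda>i. \<Sum>j<N. d i j * 0) \<in> W"
        unfolding W_def by (intro CollectI exI[of _ "\<lambda>_. 0"]) simp
      fix c1 c2 :: complex and u1 u2 assume "u1 \<in> W" "u2 \<in> W"
      then obtain b1 b2 where b: "u1 = (\<lambda>i. \<Sum>j<N. d i j * b1 j)" "u2 = (\<lambda>i. \<Sum>j<N. d i j * b2 j)"
        unfolding W_def by blast
      show "(\<lambda>i. c1 * u1 i + c2 * u2 i) \<in> W"
        unfolding W_def b
        by (intro CollectI exI[of _ "\<lambda>j. c1 * b1 j + c2 * b2 j"])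
           (simp add: sum_distrib_left sum.distrib algebra_simps)
    next
      fix c :: "nat \<Rightarrow> complex" assume c: "\<And>w. w \<in> W \<Longrightarrow> (\<Sum>i<m. c i * w i) = 0"
      have "(\<Sum>i<m. c i * d i j) = 0" if "j < N" for j
      proof -
        have "(\<Sum>l<N. d i l * (if l = j then 1 else 0)) = d i j" for i
        proof -
          have "(\<Sum>l<N. d i l * (if l = j then 1 else 0)) = (\<Sum>l<N. if l = j then d i l else 0)"
            by (intro sum.cong) auto
          then show ?thesis using that by simp
        qed
        then have "(\<lambda>i. d i j) \<in> W" unfolding W_def
          by (intro CollectI exI[of _ "\<lambda>l. if l = j then 1 else 0"]) auto
        then show ?thesis by (rule c)
      qed
      then show "\<forall>i\<in>{..<m}. c i = 0" using indep unfolding d_def by auto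
    qed auto
    then obtain w where "w \<in> W" and w: "\<forall>i\<in>{..<m}. w i = (if i = k then 1 else 0)" by blast
    then obtain b where "w = (\<lambda>i. \<Sum>j<N. d i j * b j)" unfolding W_def by blast
    then show ?thesis using w by (intro exI[of _ b]) blast
  qed
  then obtain A where A: "\<And>i k. i < m \<Longrightarrow> (\<Sum>j<N. d i j * A k j) = (if i = k then 1 else 0)"
    by metis
  have "\<forall>i\<in>{..<m}. \<exists>R. R \<in> polyfun (Suc N) \<and> (\<forall>t b. f i (\<lambda>j. a j + t * b j)
           = t * (\<Sum>j<N. d i j * b j) + t\<^sup>2 * R (b(N := t)))"
  proof
    fix i assume "i \<in> {..<m}"
    then obtain R where "R \<in> polyfun (Suc N)" "\<forall>t b. f i (\<lambda>j. a j + t * b j)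
           = f i a + t * (\<Sum>j<N. d i j * b j) + t\<^sup>2 * R (b(N := t))"
      unfolding d_def using polyfun_taylor[OF f(1)] by blast
    then show "\<exists>R. R \<in> polyfun (Suc N) \<and> (\<forall>t b. f i (\<lambda>j. a j + t * b j)
           = t * (\<Sum>j<N. d i j * b j) + t\<^sup>2 * R (b(N := t)))"
      using f(2) \<open>i \<in> {..<m}\<close> by (intro exI[of _ R]) (simp del: fun_upd_apply)
  qed
  from bchoice[OF this] obtain R where R: "\<And>i. i < m \<Longrightarrow> R i \<in> polyfun (Suc N)"
    "\<And>i t b. i < m \<Longrightarrow> f i (\<lambda>j. a j + t * b j) = t * (\<Sum>j<N. d i j * b j) + t\<^sup>2 * R i (b(N := t))"
    unfolding Ball_def lessThan_iff by blast
  \<comment> \<open>The velocity corrected by \<open>A\<close>, set to zero from index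
    \<open>N\<close> on so that the curve stays in \<open>Vec N\<close>. By \<open>db\<close> below,
    the linear part of \<open>f i\<close> along it is exactly \<open>u i\<close>.\<close>
  define b where "b u j = (if j < N then v j + (\<Sum>k<m. A k j * u k) else 0)" for u j
  have db: "(\<Sum>j<N. d i j * b u j) = u i" if "i < m" for i u
  proof -
    have "(\<Sum>j<N. d i j * b u j) = (\<Sum>j<N. d i j * v j) + (\<Sum>j<N. \<Sum>k<m. d i j * A k j * u k)"
      by (simp add: b_def algebra_simps sum.distrib sum_distrib_left)
    also have "(\<Sum>j<N. \<Sum>k<m. d i j * A k j * u k) = (\<Sum>k<m. (\<Sum>j<N. d i j * A k j) * u k)"
      by (subst sum.swap) (simp add: sum_distrib_right)
    also have "\<dots> = (\<Sum>k<m. if i = k then u k else 0)"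
      using A that by (intro sum.cong) auto
    also have "\<dots> = u i" using that by simp
    finally show ?thesis using tang[OF that] by (simp add: d_def)
  qed
  \<comment> \<open>\<open>B\<close> dominates the coordinates of \<open>b u\<close> for
    \<open>u\<close> in the unit polydisc, the Lipschitz constant of \<open>b\<close>, and the
    parameter \<open>t\<close>, whose modulus is at most 1.\<close>
  define B where "B = 1 + (\<Sum>j<N. cmod (v j) + (\<Sum>k<m. cmod (A k j)))"
  have "\<exists>l\<ge>0. \<forall>z w \<delta>. (\<forall>j<Suc N. cmod (z j) \<le> B \<and> cmod (w j) \<le> B \<and> cmod (z j - w j) \<le> \<delta>) \<longrightarrow> \<delta> \<ge> 0 \<longrightarrow>
           cmod (R i z) \<le> l \<and> cmod (R i z - R i w) \<le> l * \<delta>" if "i < m" for i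
    by (rule polyfun_lipschitz[OF R(1)[OF that]])
  then obtain l where l: "\<And>i. i < m \<Longrightarrow> l i \<ge> 0"
    "\<And>i z w \<delta>. i < m \<Longrightarrow> (\<forall>j<Suc N. cmod (z j) \<le> B \<and> cmod (w j) \<le> B \<and> cmod (z j - w j) \<le> \<delta>) \<Longrightarrow> \<delta> \<ge> 0 \<Longrightarrow>
           cmod (R i z) \<le> l i \<and> cmod (R i z - R i w) \<le> l i * \<delta>"
    by metis
  define L where "L = (\<Sum>i<m. l i)"
  have lL: "l i \<le> L" if "i < m" for i
    unfolding L_def by (rule member_le_sum) (use that l(1) in auto)
  have L0: "L \<ge> 0" unfolding L_def using l(1) by (intro sum_nonneg) auto
  have B1: "cmod (v j) + (\<Sum>k<m. cmod (A k j)) \<le> B" if "j < N" for j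
  proof -
    have "cmod (v j) + (\<Sum>k<m. cmod (A k j)) \<le> (\<Sum>j<N. cmod (v j) + (\<Sum>k<m. cmod (A k j)))"
      by (rule member_le_sum) (use that in \<open>auto intro!: add_nonneg_nonneg sum_nonneg\<close>)
    then show ?thesis by (simp add: B_def)
  qed
  have B2: "B \<ge> 1" unfolding B_def by (auto intro!: sum_nonneg add_nonneg_nonneg)
  have bB: "cmod (b u j) \<le> B" if "\<forall>k<m. cmod (u k) \<le> 1" for u j
  proof (cases "j < N")
    case True
    have "cmod (\<Sum>k<m. A k j * u k) \<le> (\<Sum>k<m. cmod (A k j))"
      using that by (intro sum_norm_le) (auto simp: norm_mult intro!: mult_left_le)
    then show ?thesis using B1[OF True] True norm_triangle_ineq[of "v j" "\<Sum>k<m. A k j * u k"]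
      by (simp add: b_def)
  qed (use B2 in \<open>auto simp: b_def\<close>)
  have bd: "cmod (b u j - b u' j) \<le> B * \<delta>" if "\<forall>k<m. cmod (u k - u' k) \<le> \<delta>" "\<delta> \<ge> 0" for u u' j \<delta>
  proof (cases "j < N")
    case True
    have "b u j - b u' j = (\<Sum>k<m. A k j * (u k - u' k))"
      using True by (simp add: b_def sum_subtractf algebra_simps)
    also have "cmod \<dots> \<le> (\<Sum>k<m. cmod (A k j) * \<delta>)"
      using that by (intro sum_norm_le) (auto simp: norm_mult intro!: mult_left_mono)
    also have "\<dots> = (\<Sum>k<m. cmod (A k j)) * \<delta>" by (simp add: sum_distrib_right)
    also have "\<dots> \<le> B * \<delta>"
      using B1[OF True] that(2) norm_ge_zero[of "v j"] by (intro mult_right_mono) linarith+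
    finally show ?thesis .
  qed (use B2 that in \<open>auto simp: b_def\<close>)
  \<comment> \<open>The radius makes \<open>e * L\<close> and \<open>e * (L * B)\<close> at most
    1/2: the first keeps the iterates in the unit polydisc, the second halves distances.\<close>
  define e where "e = 1 / (2 * (L * B + L + 1))"
  have LB: "L * B \<ge> 0" using L0 B2 by simp
  have e: "e > 0" "e \<le> 1" "e * L \<le> 1 / 2" "e * (L * B) \<le> 1 / 2"
    unfolding e_def using L0 LB by (auto simp: field_simps)
  define \<Phi> where "\<Phi> t u i = - t * R i ((b u)(N := t))" for t u i
  have \<Phi>1: "cmod (\<Phi> t u i) \<le> 1" if "i < m" "t \<in> ball 0 e" "\<forall>k<m. cmod (u k) \<le> 1" for t u i
  proof -
    have "cmod (R i ((b u)(N := t))) \<le> l i"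
      using l(2)[OF that(1), of "(b u)(N := t)" "(b u)(N := t)" 0] bB[OF that(3)] that(2) e B2 by auto
    also have "\<dots> \<le> L" by (rule lL[OF that(1)])
    finally have "cmod (\<Phi> t u i) \<le> e * L"
      unfolding \<Phi>_def using that(2) e by (simp add: norm_mult mult_mono)
    then show ?thesis using e by linarith
  qed
  have \<Phi>2: "cmod (\<Phi> t u i - \<Phi> t u' i) \<le> \<delta> / 2"
    if "i < m" "t \<in> ball 0 e" "\<forall>k<m. cmod (u k) \<le> 1" "\<forall>k<m. cmod (u' k) \<le> 1"
      "\<forall>k<m. cmod (u k - u' k) \<le> \<delta>" "\<delta> \<ge> 0" for t u u' i \<delta>
  proof -
    have "cmod (R i ((b u)(N := t)) - R i ((b u')(N := t))) \<le> l i * (B * \<delta>)"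
      using l(2)[OF that(1), of "(b u)(N := t)" "(b u')(N := t)" "B * \<delta>"] bB[OF that(3)] bB[OF that(4)]
        bd[OF that(5,6)] that(2,6) e B2 by auto
    also have "\<dots> \<le> L * (B * \<delta>)" using lL[OF that(1)] B2 that(6) by (intro mult_right_mono) auto
    finally have "cmod (R i ((b u)(N := t)) - R i ((b u')(N := t))) \<le> L * (B * \<delta>)" .
    moreover have "\<Phi> t u i - \<Phi> t u' i = - t * (R i ((b u)(N := t)) - R i ((b u')(N := t)))"
      by (simp add: \<Phi>_def algebra_simps)
    ultimately have "cmod (\<Phi> t u i - \<Phi> t u' i) \<le> e * (L * (B * \<delta>))"
      using that(2) e by (simp only: norm_mult norm_minus_cancel) (intro mult_mono, auto)
    also have "\<dots> \<le> 1 / 2 * \<delta>" using mult_right_mono[OF e(4) that(6)] by (simp add: algebra_simps)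
    finally show ?thesis by simp
  qed
  define U where "U s t = ((\<Phi> t) ^^ s) (\<lambda>_. 0)" for s t
  have U0: "U 0 t = (\<lambda>_. 0)" and USuc: "U (Suc s) t = \<Phi> t (U s t)" for s t by (auto simp: U_def)
  have U1: "\<forall>k<m. cmod (U s t k) \<le> 1" if "t \<in> ball 0 e" for s t
    by (induction s) (use \<Phi>1 that in \<open>auto simp: U0 USuc\<close>)
  have Ud: "\<forall>k<m. cmod (U (Suc s) t k - U s t k) \<le> (1 / 2) ^ s" if "t \<in> ball 0 e" for s t
  proof (induction s)
    case 0
    then show ?case using U1[OF that, of 1] by (simp add: U0)
  next
    case (Suc s)
    then show ?case
      using \<Phi>2[OF _ that U1[OF that, of "Suc s"] U1[OF that, of s], of _ "(1 / 2) ^ s"] by (simp add: USuc)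
  qed
  \<comment> \<open>The limit of the iterates, written as a telescoping series. The Weierstrass test
    gives uniform convergence, so the limit is holomorphic in \<open>t\<close>.\<close>
  define w where "w t k = (\<Sum>s. U (Suc s) t k - U s t k)" for t k
  have ulim: "uniform_limit (ball 0 e) (\<lambda>s t. U s t k) (\<lambda>t. w t k) sequentially" if "k < m" for k
  proof -
    have "uniform_limit (ball 0 e) (\<lambda>n t. \<Sum>s<n. U (Suc s) t k - U s t k) (\<lambda>t. \<Sum>s. U (Suc s) t k - U s t k) sequentially"
      by (rule Weierstrass_m_test[of _ _ "\<lambda>s. (1 / 2) ^ s"]) (use Ud that in \<open>auto intro: summable_geometric\<close>)
    moreover have "(\<Sum>s<n. U (Suc s) t k - U s t k) = U n t k" for n t
      by (simp add: sum_lessThan_telescope[of "\<lambda>s. U s t k"] U0)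
    ultimately show ?thesis by (simp add: w_def)
  qed
  have Uhol: "(\<lambda>t. U s t k) holomorphic_on ball 0 e" if "k < m" for s k
    using that
  proof (induction s arbitrary: k)
    case 0
    then show ?case by (simp add: U0)
  next
    case (Suc s)
    have "(\<lambda>t. ((b (U s t))(N := t)) j) holomorphic_on ball 0 e" for j
      using Suc.IH by (cases "j < N"; cases "j = N") (auto simp: b_def intro!: holomorphic_intros)
    then have "(\<lambda>t. - t * R k ((b (U s t))(N := t))) holomorphic_on ball 0 e"
      by (intro holomorphic_intros holomorphic_polyfun[OF R(1)[OF Suc.prems]])
    then show ?case by (simp add: USuc \<Phi>_def)
  qed
  have whol: "(\<lambda>t. w t k) holomorphic_on ball 0 e" if "k < m" for k
  proof (rule holomorphic_uniform_sequence[OF open_ball Uhol[OF that]])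
    fix x :: complex assume "x \<in> ball 0 e"
    then obtain r where "r > 0" "cball x r \<subseteq> ball 0 e" using open_contains_cball[of "ball (0::complex) e"] open_ball by blast
    then show "\<exists>d>0. cball x d \<subseteq> ball 0 e \<and> uniform_limit (cball x d) (\<lambda>s t. U s t k) (\<lambda>t. w t k) sequentially"
      using uniform_limit_on_subset[OF ulim[OF that]] by blast
  qed
  have wfix: "w t k = - t * R k ((b (w t))(N := t))" if "k < m" "t \<in> ball 0 e" for t k
  proof (rule LIMSEQ_unique)
    have lim: "(\<lambda>s. U s t k) \<longlonglongrightarrow> w t k" if "k < m" for k
      using tendsto_uniform_limitI[OF ulim[OF that] \<open>t \<in> ball 0 e\<close>] .
    show "(\<lambda>s. U (Suc s) t k) \<longlonglongrightarrow> w t k" using lim[OF that(1)] by (rule LIMSEQ_Suc)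
    have "(\<lambda>s. ((b (U s t))(N := t)) j) \<longlonglongrightarrow> ((b (w t))(N := t)) j" for j
      using lim by (cases "j < N"; cases "j = N") (auto simp: b_def intro!: tendsto_intros)
    then have "(\<lambda>s. - t * R k ((b (U s t))(N := t))) \<longlonglongrightarrow> - t * R k ((b (w t))(N := t))"
      by (intro tendsto_intros tendsto_polyfun[OF R(1)[OF that(1)]])
    then show "(\<lambda>s. U (Suc s) t k) \<longlonglongrightarrow> - t * R k ((b (w t))(N := t))" by (simp add: USuc \<Phi>_def)
  qed
  define \<gamma> where "\<gamma> t = (\<lambda>j. a j + t * b (w t) j)" for t
  have bhol: "(\<lambda>t. b (w t) j) holomorphic_on ball 0 e" for j
    using whol by (cases "j < N") (auto simp: b_def intro!: holomorphic_intros)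
  have "f i (\<gamma> t) = 0" if "i < m" "t \<in> ball 0 e" for i t
  proof -
    have "f i (\<gamma> t) = t * (w t i + t * R i ((b (w t))(N := t)))"
      unfolding \<gamma>_def R(2)[OF that(1)] db[OF that(1)] by (simp add: algebra_simps power2_eq_square)
    also have "w t i + t * R i ((b (w t))(N := t)) = 0" by (subst wfix[OF that]) simp
    finally show ?thesis by simp
  qed
  moreover have "\<gamma> t \<in> Vec N" for t using av by (auto simp: Vec_def \<gamma>_def b_def)
  moreover have "(\<lambda>t. \<gamma> t j) holomorphic_on ball 0 e" for j
    unfolding \<gamma>_def by (intro holomorphic_intros bhol)
  moreover have "((\<lambda>t. \<gamma> t j) has_field_derivative v j) (at 0)" for j
  proof -
    obtain b' where b': "((\<lambda>t. b (w t) j) has_field_derivative b') (at 0)"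
      using bhol[of j] e(1) by (meson centre_in_ball field_differentiable_def holomorphic_on_imp_differentiable_at open_ball)
    \<comment> \<open>At \<open>t = 0\<close> the fixed point equation forces
      \<open>w 0 k = 0\<close>, so the initial velocity is exactly \<open>v\<close>.\<close>
    have "w 0 k = 0" if "k < m" for k using wfix[OF that, of 0] e(1) by simp
    then have "b (w 0) j = v j" using av(2) by (auto simp: b_def Vec_def)
    then show ?thesis unfolding \<gamma>_def
      using b' by (auto intro!: derivative_eq_intros)
  qed
  ultimately show ?thesis
    using e(1) by (intro exI[of _ e] conjI exI[of _ \<gamma>]) (auto simp: \<gamma>_def)
qed

section \<open>Local rings, derivations and arcs\<close>

text \<open>With Zariski neighbourhoods as a filter, identities of germs become
  \<open>eventually\<close> statements, and the repeated shrinking of neighbourhoods is left to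
  \<open>eventually_elim\<close>.\<close>

abbreviation znhds :: "'a fspace \<Rightarrow> 'a \<Rightarrow> 'a filter" where
  "znhds X x \<equiv> nhdsin (zar X) x"

lemma eventually_znhds:
  "x \<in> pts X \<Longrightarrow> eventually P (znhds X x) \<longleftrightarrow> (\<exists>U. openin (zar X) U \<and> x \<in> U \<and> (\<forall>y\<in>U. P y))"
  by (simp add: eventually_nhdsin)

lemma eventually_znhds_self: "x \<in> pts X \<Longrightarrow> eventually P (znhds X x) \<Longrightarrow> P x"
  by (auto simp: eventually_znhds)

lemma eventually_znhds_open: "openin (zar X) U \<Longrightarrow> x \<in> U \<Longrightarrow> eventually (\<lambda>y. y \<in> U) (znhds X x)"
  using openin_subset[of "zar X" U] by (auto simp: eventually_nhdsin)

lemma eventually_znhds_pts: "eventually (\<lambda>y. y \<in> pts X) (znhds X x)"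
  by (cases "x \<in> pts X") (auto intro: eventually_znhds_open)

text \<open>Moves a germ identity from \<open>x\<close> to all nearby points. Cancellation arguments
  need this because they test functions along arcs starting at such points.\<close>

lemma eventually_znhds_znhds:
  assumes "x \<in> pts X" "eventually P (znhds X x)"
  shows "eventually (\<lambda>y. y \<in> pts X \<and> eventually P (znhds X y)) (znhds X x)"
proof -
  obtain U where U: "openin (zar X) U" "x \<in> U" "\<forall>y\<in>U. P y"
    using assms by (auto simp: eventually_znhds)
  have "eventually (\<lambda>y. y \<in> U) (znhds X x)" using U by (intro eventually_znhds_open)
  then show ?thesis
  proof eventually_elim
    case (elim y)
    have "eventually (\<lambda>z. z \<in> U) (znhds X y)" using U elim by (intro eventually_znhds_open)
    then have "eventually P (znhds X y)" by eventually_elim (use U in blast)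
    then show ?case using openin_subset[OF U(1)] elim by blast
  qed
qed

lemma germ_eq_iff: "x \<in> pts X \<Longrightarrow> germ_eq X x f g \<longleftrightarrow> eventually (\<lambda>y. f y = g y) (znhds X x)"
  by (simp add: germ_eq_def eventually_znhds)

lemma stalk_pts: "f \<in> stalk X x \<Longrightarrow> x \<in> pts X"
  using openin_subset[of "zar X"] by (auto simp: stalk_def)

lemma ideal_at_iff:
  "x \<in> pts X \<Longrightarrow> f \<in> ideal_at X A x \<longleftrightarrow> f \<in> stalk X x \<and> eventually (\<lambda>y. y \<in> A \<longrightarrow> f y = 0) (znhds X x)"
  by (auto simp: ideal_at_def eventually_znhds)

lemma affine_chart_subset: "affine_chart X U n a \<Longrightarrow> U \<subseteq> pts X"
  unfolding affine_chart_def using openin_subset by blast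

lemma affine_chart_Vec: "affine_chart X U n a \<Longrightarrow> y \<in> U \<Longrightarrow> a y \<in> Vec n"
  unfolding affine_chart_def alg_set_def by blast

lemma affine_chart_inj: "affine_chart X U n a \<Longrightarrow> inj_on a U"
  unfolding affine_chart_def by blast

lemma affine_chart_open: "affine_chart X U n a \<Longrightarrow> openin (zar X) U"
  unfolding affine_chart_def by blast

lemma affine_chart_openin_iff:
  "affine_chart X U n a \<Longrightarrow> W \<subseteq> U \<Longrightarrow> openin (zar X) W \<longleftrightarrow> zariski_open n (a ` U) (a ` W)"
  unfolding affine_chart_def by blast

lemma affine_chart_reg_iff:
  "affine_chart X U n a \<Longrightarrow> W \<subseteq> U \<Longrightarrow> openin (zar X) W \<Longrightarrow>
     f \<in> reg X W \<longleftrightarrow> regular_on n (a ` U) (a ` W) (f \<circ> inv_into U a)"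
  unfolding affine_chart_def by blast

lemma openin_basic:
  assumes "affine_chart X U n a" "p \<in> polyfun n"
  shows "openin (zar X) {y \<in> U. p (a y) \<noteq> 0}"
proof -
  have "alg_set n {z \<in> Vec n. p z = 0}"
    unfolding alg_set_def using assms(2) by (intro exI[of _ "{p}"]) auto
  moreover have "a ` {y \<in> U. p (a y) \<noteq> 0} = a ` U - {z \<in> Vec n. p z = 0}"
    using affine_chart_Vec[OF assms(1)] by auto
  ultimately have "zariski_open n (a ` U) (a ` {y \<in> U. p (a y) \<noteq> 0})"
    unfolding zariski_open_def by blast
  then show ?thesis by (subst affine_chart_openin_iff[OF assms(1)]) auto
qed

text \<open>A point outside a closed algebraic set violates one of its equations, and the
  nonvanishing locus of that single polynomial is already a neighbourhood.\<close>

lemma basic_neighbourhood: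
  assumes "affine_chart X U n a" "x \<in> U" "eventually P (znhds X x)"
  obtains p where "p \<in> polyfun n" "p (a x) \<noteq> 0" "\<And>y. y \<in> U \<Longrightarrow> p (a y) \<noteq> 0 \<Longrightarrow> P y"
proof -
  have xp: "x \<in> pts X" using affine_chart_subset assms(1,2) by blast
  then obtain W where W: "openin (zar X) W" "x \<in> W" "\<forall>y\<in>W. P y"
    using assms(3) by (auto simp: eventually_znhds)
  have "openin (zar X) (W \<inter> U)" using W(1) affine_chart_open[OF assms(1)] by blast
  then obtain A S where A: "a ` (W \<inter> U) = a ` U - A" "S \<subseteq> polyfun n" "A = {z \<in> Vec n. \<forall>p\<in>S. p z = 0}"
    using affine_chart_openin_iff[OF assms(1), of "W \<inter> U"] unfolding zariski_open_def alg_set_def by auto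
  have "a x \<notin> A" using A(1) assms(2) W(2) by blast
  then obtain p where p: "p \<in> S" "p (a x) \<noteq> 0"
    using affine_chart_Vec[OF assms(1,2)] unfolding A(3) by blast
  show thesis
  proof (rule that[of p])
    fix y assume y: "y \<in> U" "p (a y) \<noteq> 0"
    then have "a y \<in> a ` (W \<inter> U)" using p(1) unfolding A(1) A(3) by blast
    then have "y \<in> W" using affine_chart_inj[OF assms(1)] y(1) by (auto simp: inj_on_def)
    then show "P y" using W(3) by blast
  qed (use p A in auto)
qed

locale variety_space =
  fixes X :: "'a fspace"
  assumes variety: "variety X"
begin

lemma chart_at:
  assumes "x \<in> pts X"
  obtains U n a where "affine_chart X U n a" "x \<in> U"
proof -
  from variety obtain \<U> where \<U>: "\<Union>\<U> = pts X" "\<forall>U\<in>\<U>. \<exists>n a. affine_chart X U n a"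
    unfolding variety_def by (elim conjE exE)
  then obtain U where "U \<in> \<U>" "x \<in> U" using assms by blast
  then show thesis using \<U>(2) that by blast
qed

lemma reg_restrict: "f \<in> reg X W \<Longrightarrow> openin (zar X) W \<Longrightarrow> openin (zar X) V \<Longrightarrow> V \<subseteq> W \<Longrightarrow> f \<in> reg X V"
proof -
  have "function_sheaf X" using variety unfolding variety_def by (elim conjE)
  then have "\<forall>W V f. openin (zar X) W \<longrightarrow> openin (zar X) V \<longrightarrow> V \<subseteq> W \<longrightarrow> f \<in> reg X W \<longrightarrow> f \<in> reg X V"
    unfolding function_sheaf_def by (elim conjE)
  then show "f \<in> reg X W \<Longrightarrow> openin (zar X) W \<Longrightarrow> openin (zar X) V \<Longrightarrow> V \<subseteq> W \<Longrightarrow> f \<in> reg X V"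
    by simp
qed

lemma reg_iff_stalk:
  assumes "openin (zar X) W"
  shows "f \<in> reg X W \<longleftrightarrow> (\<forall>x\<in>W. f \<in> stalk X x)"
proof
  assume "f \<in> reg X W" then show "\<forall>x\<in>W. f \<in> stalk X x" using assms by (auto simp: stalk_def)
next
  assume *: "\<forall>x\<in>W. f \<in> stalk X x"
  have "\<exists>V. openin (zar X) V \<and> x \<in> V \<and> V \<subseteq> W \<and> f \<in> reg X V" if "x \<in> W" for x
  proof -
    have "f \<in> stalk X x" using * that by blast
    then obtain U where "openin (zar X) U" "x \<in> U" "f \<in> reg X U" unfolding stalk_def by blast
    moreover from this have "openin (zar X) (U \<inter> W)" using assms by (intro openin_Int)
    moreover from calculation have "f \<in> reg X (U \<inter> W)" by (elim reg_restrict) simp_all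
    ultimately show ?thesis using that by (intro exI[of _ "U \<inter> W"]) simp
  qed
  moreover have "function_sheaf X" using variety unfolding variety_def by (elim conjE)
  then have "\<forall>W f. openin (zar X) W \<longrightarrow>
        (\<forall>x\<in>W. \<exists>V. openin (zar X) V \<and> x \<in> V \<and> V \<subseteq> W \<and> f \<in> reg X V) \<longrightarrow> f \<in> reg X W"
    unfolding function_sheaf_def by (elim conjE)
  ultimately show "f \<in> reg X W" using assms by simp
qed

text \<open>Working description of the local ring: its closure properties become arithmetic of
  fractions of polynomials in the chart coordinates.\<close>

lemma stalk_iff:
  assumes "affine_chart X U n a" "x \<in> U"
  shows "f \<in> stalk X x \<longleftrightarrow> (\<exists>p\<in>polyfun n. \<exists>q\<in>polyfun n. q (a x) \<noteq> 0 \<and>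
           eventually (\<lambda>y. f y = p (a y) / q (a y)) (znhds X x))"
proof
  have xp: "x \<in> pts X" using affine_chart_subset assms by blast
  assume "f \<in> stalk X x"
  then obtain W where W: "openin (zar X) W" "x \<in> W" "f \<in> reg X W" by (auto simp: stalk_def)
  have WU: "openin (zar X) (W \<inter> U)" using W(1) affine_chart_open[OF assms(1)] by blast
  then have "f \<in> reg X (W \<inter> U)" using W reg_restrict by blast
  then have "regular_on n (a ` U) (a ` (W \<inter> U)) (f \<circ> inv_into U a)"
    using affine_chart_reg_iff[OF assms(1) _ WU] by blast
  moreover have "a x \<in> a ` (W \<inter> U)" using assms W by blast
  ultimately obtain V p q where V: "p \<in> polyfun n" "q \<in> polyfun n" "zariski_open n (a ` U) V"
    "a x \<in> V" "V \<subseteq> a ` (W \<inter> U)" "\<forall>y\<in>V. q y \<noteq> 0 \<and> (f \<circ> inv_into U a) y = p y / q y"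
    unfolding regular_on_def by blast
  have "a ` {y \<in> U. a y \<in> V} = V" using V(5) by blast
  then have "openin (zar X) {y \<in> U. a y \<in> V}"
    using V(3) by (subst affine_chart_openin_iff[OF assms(1)]) auto
  then have "eventually (\<lambda>y. y \<in> {y \<in> U. a y \<in> V}) (znhds X x)"
    using assms V(4) by (intro eventually_znhds_open) auto
  then have "eventually (\<lambda>y. f y = p (a y) / q (a y)) (znhds X x)"
    by eventually_elim (use V(6) affine_chart_inj[OF assms(1)] in force)
  then show "\<exists>p\<in>polyfun n. \<exists>q\<in>polyfun n. q (a x) \<noteq> 0 \<and>
           eventually (\<lambda>y. f y = p (a y) / q (a y)) (znhds X x)"
    using V by blast
next
  have xp: "x \<in> pts X" using affine_chart_subset assms by blast
  assume "\<exists>p\<in>polyfun n. \<exists>q\<in>polyfun n. q (a x) \<noteq> 0 \<and>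
           eventually (\<lambda>y. f y = p (a y) / q (a y)) (znhds X x)"
  then obtain p q V where V: "p \<in> polyfun n" "q \<in> polyfun n" "q (a x) \<noteq> 0" "openin (zar X) V"
    "x \<in> V" "\<forall>y\<in>V. f y = p (a y) / q (a y)"
    using xp by (auto simp: eventually_znhds)
  define V' where "V' = V \<inter> {y \<in> U. q (a y) \<noteq> 0}"
  have V': "V' \<subseteq> U" "x \<in> V'" unfolding V'_def using V assms by auto
  have oV: "openin (zar X) V'" unfolding V'_def by (rule openin_Int[OF V(4) openin_basic[OF assms(1) V(2)]])
  have "zariski_open n (a ` U) (a ` V')"
    by (rule iffD1[OF affine_chart_openin_iff[OF assms(1) V'(1)] oV])
  moreover have "(f \<circ> inv_into U a) (a y) = p (a y) / q (a y) \<and> q (a y) \<noteq> 0" if "y \<in> V'" for y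
    using that V(6) affine_chart_inj[OF assms(1)] unfolding V'_def by auto
  ultimately have "regular_on n (a ` U) (a ` V') (f \<circ> inv_into U a)"
    unfolding regular_on_def using V by (intro ballI exI[of _ "a ` V'"] bexI[of _ p] bexI[of _ q]) auto
  then have "f \<in> reg X V'" using affine_chart_reg_iff[OF assms(1) V'(1) oV] by blast
  then show "f \<in> stalk X x" using V' oV by (auto simp: stalk_def)
qed

lemma stalk_cong:
  assumes "f \<in> stalk X x" "eventually (\<lambda>y. f y = g y) (znhds X x)"
  shows "g \<in> stalk X x"
proof -
  obtain U n a where U: "affine_chart X U n a" "x \<in> U" using chart_at stalk_pts[OF assms(1)] by blast
  obtain p q where pq: "p \<in> polyfun n" "q \<in> polyfun n" "q (a x) \<noteq> 0" "eventually (\<lambda>y. f y = p (a y) / q (a y)) (znhds X x)"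
    using assms(1) stalk_iff[OF U] by blast
  have "eventually (\<lambda>y. g y = p (a y) / q (a y)) (znhds X x)"
    using pq(4) assms(2) by eventually_elim simp
  then show ?thesis using stalk_iff[OF U] pq by blast
qed

lemma stalk_polyfun:
  assumes "affine_chart X U n a" "x \<in> U" "p \<in> polyfun n"
  shows "(\<lambda>y. p (a y)) \<in> stalk X x"
  unfolding stalk_iff[OF assms(1,2)]
  by (rule bexI[OF _ assms(3)], rule bexI[of _ "\<lambda>_. 1"]) (simp_all add: polyfun.const)

lemma stalk_coord: "affine_chart X U n a \<Longrightarrow> x \<in> U \<Longrightarrow> j < n \<Longrightarrow> (\<lambda>y. a y j) \<in> stalk X x"
  using stalk_polyfun[of U n a x "\<lambda>z. z j"] by (simp add: polyfun.coord)

lemma stalk_const: "x \<in> pts X \<Longrightarrow> (\<lambda>y. c) \<in> stalk X x"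
  using chart_at[of x] stalk_polyfun[of _ _ _ x "\<lambda>_. c"] by (metis polyfun.const)

lemma stalk_nonzero:
  assumes "f \<in> stalk X x" "f x \<noteq> 0"
  shows "eventually (\<lambda>y. f y \<noteq> 0) (znhds X x)"
proof -
  have xp: "x \<in> pts X" using stalk_pts[OF assms(1)] .
  obtain U n a where U: "affine_chart X U n a" "x \<in> U" using chart_at xp by blast
  obtain p q where pq: "p \<in> polyfun n" "q \<in> polyfun n" "q (a x) \<noteq> 0" "eventually (\<lambda>y. f y = p (a y) / q (a y)) (znhds X x)"
    using assms(1) stalk_iff[OF U] by blast
  have "p (a x) \<noteq> 0" using eventually_znhds_self[OF xp pq(4)] assms(2) by auto
  then have "eventually (\<lambda>y. y \<in> {y \<in> U. p (a y) \<noteq> 0}) (znhds X x)"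
    using U(2) by (intro eventually_znhds_open openin_basic[OF U(1) pq(1)]) simp
  moreover have "eventually (\<lambda>y. y \<in> {y \<in> U. q (a y) \<noteq> 0}) (znhds X x)"
    using U(2) pq(3) by (intro eventually_znhds_open openin_basic[OF U(1) pq(2)]) simp
  ultimately show ?thesis using pq(4) by eventually_elim auto
qed

lemma
  assumes "f \<in> stalk X x" "g \<in> stalk X x"
  shows stalk_add: "(\<lambda>y. f y + g y) \<in> stalk X x" and stalk_mult: "(\<lambda>y. f y * g y) \<in> stalk X x"
proof -
  have xp: "x \<in> pts X" using stalk_pts[OF assms(1)] .
  obtain U n a where U: "affine_chart X U n a" "x \<in> U" using chart_at xp by blast
  obtain p q where pq: "p \<in> polyfun n" "q \<in> polyfun n" "q (a x) \<noteq> 0" "eventually (\<lambda>y. f y = p (a y) / q (a y)) (znhds X x)"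
    using assms(1) stalk_iff[OF U] by blast
  obtain r s where rs: "r \<in> polyfun n" "s \<in> polyfun n" "s (a x) \<noteq> 0" "eventually (\<lambda>y. g y = r (a y) / s (a y)) (znhds X x)"
    using assms(2) stalk_iff[OF U] by blast
  note nz = stalk_nonzero[OF stalk_polyfun[OF U pq(2)] pq(3)] stalk_nonzero[OF stalk_polyfun[OF U rs(2)] rs(3)]
  have "eventually (\<lambda>y. f y + g y = (p (a y) * s (a y) + q (a y) * r (a y)) / (q (a y) * s (a y))) (znhds X x)"
    using nz pq(4) rs(4) by eventually_elim (simp add: field_simps)
  moreover have "(\<lambda>z. p z * s z + q z * r z) \<in> polyfun n" "(\<lambda>z. q z * s z) \<in> polyfun n"
    using pq rs by (auto intro: polyfun.intros)
  ultimately show "(\<lambda>y. f y + g y) \<in> stalk X x"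
    unfolding stalk_iff[OF U] using pq(3) rs(3)
    by (intro bexI[of _ "\<lambda>z. p z * s z + q z * r z"] bexI[of _ "\<lambda>z. q z * s z"]) simp_all
  have "eventually (\<lambda>y. f y * g y = (p (a y) * r (a y)) / (q (a y) * s (a y))) (znhds X x)"
    using nz pq(4) rs(4) by eventually_elim (simp add: field_simps)
  moreover have "(\<lambda>z. p z * r z) \<in> polyfun n" "(\<lambda>z. q z * s z) \<in> polyfun n"
    using pq rs by (auto intro: polyfun.intros)
  ultimately show "(\<lambda>y. f y * g y) \<in> stalk X x"
    unfolding stalk_iff[OF U] using pq(3) rs(3)
    by (intro bexI[of _ "\<lambda>z. p z * r z"] bexI[of _ "\<lambda>z. q z * s z"]) simp_all
qed

lemma stalk_inverse:
  assumes "f \<in> stalk X x" "f x \<noteq> 0"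
  shows "(\<lambda>y. 1 / f y) \<in> stalk X x"
proof -
  have xp: "x \<in> pts X" using stalk_pts[OF assms(1)] .
  obtain U n a where U: "affine_chart X U n a" "x \<in> U" using chart_at xp by blast
  obtain p q where pq: "p \<in> polyfun n" "q \<in> polyfun n" "q (a x) \<noteq> 0" "eventually (\<lambda>y. f y = p (a y) / q (a y)) (znhds X x)"
    using assms(1) stalk_iff[OF U] by blast
  have "p (a x) \<noteq> 0" using eventually_znhds_self[OF xp pq(4)] assms(2) by auto
  moreover have "eventually (\<lambda>y. 1 / f y = q (a y) / p (a y)) (znhds X x)"
    using pq(4) by eventually_elim simp
  ultimately show ?thesis using pq stalk_iff[OF U] by blast
qed

lemma stalk_cmult: "f \<in> stalk X x \<Longrightarrow> (\<lambda>y. c * f y) \<in> stalk X x"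
  by (rule stalk_mult[OF stalk_const[OF stalk_pts]])

lemma stalk_diff: "f \<in> stalk X x \<Longrightarrow> g \<in> stalk X x \<Longrightarrow> (\<lambda>y. f y - g y) \<in> stalk X x"
  using stalk_add[OF _ stalk_cmult[of g x "- 1"], of f] by simp

lemma stalk_divide: "f \<in> stalk X x \<Longrightarrow> g \<in> stalk X x \<Longrightarrow> g x \<noteq> 0 \<Longrightarrow> (\<lambda>y. f y / g y) \<in> stalk X x"
  using stalk_mult[OF _ stalk_inverse[of g x], of f] by simp

lemma stalk_sum:
  "x \<in> pts X \<Longrightarrow> (\<And>i. i \<in> I \<Longrightarrow> f i \<in> stalk X x) \<Longrightarrow> (\<lambda>y. \<Sum>i\<in>I. f i y) \<in> stalk X x"
  by (induction I rule: infinite_finite_induct) (simp_all add: stalk_const stalk_add)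

lemma stalk_power: "f \<in> stalk X x \<Longrightarrow> (\<lambda>y. f y ^ n) \<in> stalk X x"
proof (induction n)
  case 0
  then show ?case using stalk_const[OF stalk_pts[of f X x]] by simp
next
  case (Suc n)
  then show ?case using stalk_mult[of f x "\<lambda>y. f y ^ n"] by simp
qed

lemma stalk_eventually:
  assumes "f \<in> stalk X x" shows "eventually (\<lambda>y. f \<in> stalk X y) (znhds X x)"
proof -
  obtain U where U: "openin (zar X) U" "x \<in> U" "f \<in> reg X U" using assms unfolding stalk_def by blast
  then have "eventually (\<lambda>y. y \<in> U) (znhds X x)" by (intro eventually_znhds_open)
  then show ?thesis by eventually_elim (use U in \<open>unfold stalk_def, blast\<close>)
qed

lemma stalk_units_iff: "f \<in> stalk_units X x \<longleftrightarrow> f \<in> stalk X x \<and> f x \<noteq> 0"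
proof
  assume *: "f \<in> stalk_units X x"
  then have f: "f \<in> stalk X x" by (simp add: stalk_units_def)
  note xp = stalk_pts[OF f]
  from * obtain h where "eventually (\<lambda>y. f y * h y = 1) (znhds X x)"
    unfolding stalk_units_def germ_eq_iff[OF xp] by blast
  from eventually_znhds_self[OF xp this] f show "f \<in> stalk X x \<and> f x \<noteq> 0" by auto
next
  assume *: "f \<in> stalk X x \<and> f x \<noteq> 0"
  then have f: "f \<in> stalk X x" "f x \<noteq> 0" by simp_all
  note xp = stalk_pts[OF f(1)]
  have "eventually (\<lambda>y. f y \<noteq> 0) (znhds X x)" by (rule stalk_nonzero[OF f])
  then have "germ_eq X x (\<lambda>y. f y * (1 / f y)) (\<lambda>y. 1)"
    unfolding germ_eq_iff[OF xp] by eventually_elim simp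
  moreover have "(\<lambda>y. 1 / f y) \<in> stalk X x" using * by (intro stalk_inverse) auto
  ultimately show "f \<in> stalk_units X x"
    using * unfolding stalk_units_def by (intro CollectI conjI bexI[of _ "\<lambda>y. 1 / f y"]) auto
qed

end

section \<open>Ideals of germs and log monoids\<close>

context variety_space
begin

lemma generates_idealD:
  assumes "generates_ideal X A x J g" "f \<in> stalk X x" "eventually (\<lambda>y. y \<in> A \<longrightarrow> f y = 0) (znhds X x)"
  obtains h where "\<forall>j\<in>J. h j \<in> stalk X x" "eventually (\<lambda>y. f y = (\<Sum>j\<in>J. h j y * g j y)) (znhds X x)"
proof -
  note xp = stalk_pts[OF assms(2)]
  have "f \<in> ideal_at X A x" using assms(2,3) by (simp add: ideal_at_iff[OF xp])
  then have "\<exists>h. (\<forall>j\<in>J. h j \<in> stalk X x) \<and> germ_eq X x f (\<lambda>y. \<Sum>j\<in>J. h j y * g j y)"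
    using assms(1) by (simp add: generates_ideal_def)
  then obtain h where "\<forall>j\<in>J. h j \<in> stalk X x" "germ_eq X x f (\<lambda>y. \<Sum>j\<in>J. h j y * g j y)"
    by blast
  then show thesis using that by (simp add: germ_eq_iff[OF xp])
qed

lemma generates_ideal_mem:
  assumes "generates_ideal X A x J g" "j \<in> J"
  shows "g j \<in> stalk X x" "eventually (\<lambda>y. y \<in> A \<longrightarrow> g j y = 0) (znhds X x)"
proof -
  have *: "g j \<in> ideal_at X A x" using assms by (simp add: generates_ideal_def)
  then show "g j \<in> stalk X x" by (simp add: ideal_at_def)
  then have "x \<in> pts X" by (rule stalk_pts)
  then show "eventually (\<lambda>y. y \<in> A \<longrightarrow> g j y = 0) (znhds X x)" using * by (simp add: ideal_at_iff)
qed

lemma generates_ideal_zero: "generates_ideal X A x J g \<Longrightarrow> j \<in> J \<Longrightarrow> x \<in> A \<Longrightarrow> g j x = 0"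
proof -
  assume *: "generates_ideal X A x J g" "j \<in> J" "x \<in> A"
  note g = generates_ideal_mem[OF *(1,2)]
  show "g j x = 0" using eventually_znhds_self[OF stalk_pts[OF g(1)] g(2)] *(3) by simp
qed

lemma local_eqI:
  assumes "d \<in> stalk X x" "eventually (\<lambda>y. y \<in> A \<longrightarrow> d y = 0) (znhds X x)"
    "\<And>f. f \<in> stalk X x \<Longrightarrow> eventually (\<lambda>y. y \<in> A \<longrightarrow> f y = 0) (znhds X x) \<Longrightarrow>
       \<exists>h\<in>stalk X x. eventually (\<lambda>y. f y = h y * d y) (znhds X x)"
  shows "local_eq X A x d"
proof -
  note xp = stalk_pts[OF assms(1)]
  show ?thesis unfolding local_eq_def generates_ideal_def
  proof (intro conjI ballI)
    show "d \<in> ideal_at X A x" unfolding ideal_at_iff[OF xp] using assms(1,2) by simp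
    fix f assume "f \<in> ideal_at X A x"
    then have "f \<in> stalk X x" "eventually (\<lambda>y. y \<in> A \<longrightarrow> f y = 0) (znhds X x)"
      unfolding ideal_at_iff[OF xp] by simp_all
    from assms(3)[OF this] obtain h where "h \<in> stalk X x" "eventually (\<lambda>y. f y = h y * d y) (znhds X x)" ..
    then show "\<exists>h. (\<forall>j\<in>{()}. h j \<in> stalk X x) \<and> germ_eq X x f (\<lambda>y. \<Sum>j\<in>{()}. h j y * d y)"
      unfolding germ_eq_iff[OF xp] by (intro exI[of _ "\<lambda>_. h"]) simp
  qed
qed

lemma local_eqD:
  assumes "local_eq X A x d"
  shows "d \<in> stalk X x" "eventually (\<lambda>y. y \<in> A \<longrightarrow> d y = 0) (znhds X x)"
    "x \<in> A \<Longrightarrow> d x = 0"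
  using generates_ideal_mem[of A x "{()}" "\<lambda>_. d" "()"] generates_ideal_zero[of A x "{()}" "\<lambda>_. d" "()"] assms
  by (auto simp: local_eq_def)

lemma local_eq_multiple:
  assumes "local_eq X A x d" "f \<in> stalk X x" "eventually (\<lambda>y. y \<in> A \<longrightarrow> f y = 0) (znhds X x)"
  obtains h where "h \<in> stalk X x" "eventually (\<lambda>y. f y = h y * d y) (znhds X x)"
proof -
  obtain h where "\<forall>j\<in>{()}. h j \<in> stalk X x"
    "eventually (\<lambda>y. f y = (\<Sum>j\<in>{()}. h j y * d y)) (znhds X x)"
    by (rule generates_idealD[OF assms(1)[unfolded local_eq_def] assms(2,3)])
  then show thesis using that[of "h ()"] by simp
qed

text \<open>Noetherianity makes finitely many equations of \<open>A\<close>, each a multiple of \<open>d\<close> near \<open>x\<close>, suffice.\<close>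

lemma local_eq_zero_set:
  assumes "closedin (zar X) A" "local_eq X A x d"
  shows "eventually (\<lambda>y. d y = 0 \<longrightarrow> y \<in> A) (znhds X x)"
proof -
  note d = local_eqD[OF assms(2)]
  have xp: "x \<in> pts X" using stalk_pts[OF d(1)] .
  obtain U n a where U: "affine_chart X U n a" "x \<in> U" using chart_at xp by blast
  have "openin (zar X) (U - A)" using affine_chart_open[OF U(1)] assms(1) by (rule openin_diff)
  then obtain Z S where Z: "a ` (U - A) = a ` U - Z" "S \<subseteq> polyfun n" "Z = {z \<in> Vec n. \<forall>p\<in>S. p z = 0}"
    using affine_chart_openin_iff[OF U(1), of "U - A"] unfolding zariski_open_def alg_set_def by auto
  obtain F where F: "F \<subseteq> S" "finite F" "S \<subseteq> poly_ideal n F"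
    using poly_ideal_finitely_generated[OF Z(2)] by blast
  have "eventually (\<lambda>y. d y = 0 \<longrightarrow> p (a y) = 0) (znhds X x)" if "p \<in> F" for p
  proof -
    have "p \<in> polyfun n" using that F Z by blast
    then have st: "(\<lambda>y. p (a y)) \<in> stalk X x" by (rule stalk_polyfun[OF U])
    have pz: "p (a y) = 0" if "y \<in> U" "y \<in> A" for y
    proof -
      have "a y \<notin> a ` (U - A)" using that affine_chart_inj[OF U(1)] by (auto simp: inj_on_def)
      then have "a y \<in> Z" using that Z(1) by blast
      then show ?thesis using \<open>p \<in> F\<close> F Z by blast
    qed
    have "eventually (\<lambda>y. y \<in> A \<longrightarrow> p (a y) = 0) (znhds X x)"
      using eventually_znhds_open[OF affine_chart_open[OF U(1)] U(2)] by eventually_elim (use pz in blast)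
    from local_eq_multiple[OF assms(2) st this] obtain h
      where "eventually (\<lambda>y. p (a y) = h y * d y) (znhds X x)" .
    then show ?thesis by eventually_elim simp
  qed
  then have "eventually (\<lambda>y. \<forall>p\<in>F. d y = 0 \<longrightarrow> p (a y) = 0) (znhds X x)"
    using F(2) by (intro eventually_ball_finite) auto
  then show ?thesis
    using eventually_znhds_open[OF affine_chart_open[OF U(1)] U(2)]
  proof eventually_elim
    case (elim y)
    show ?case
    proof
      assume "d y = 0"
      then have z: "p (a y) = 0" if "p \<in> F" for p using elim that by simp
      have "p (a y) = 0" if "p \<in> S" for p
        by (rule poly_ideal_zero[of p n F]) (use that z F(3) in auto)
      then have "a y \<in> Z" using affine_chart_Vec[OF U(1) elim(2)] by (auto simp: Z(3))
      then show "y \<in> A" using Z(1) elim(2) by blast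
    qed
  qed
qed

text \<open>The inverse off \<open>B\<close> is \<open>1 / g\<close>, which is regular wherever
  \<open>g\<close> does not vanish, and by the sheaf property regularity can be checked in the
  stalks.\<close>

lemma log_monoid_iff:
  assumes "closedin (zar X) B"
  shows "g \<in> log_monoid X B x \<longleftrightarrow>
           g \<in> stalk X x \<and> eventually (\<lambda>y. y \<notin> B \<longrightarrow> g y \<noteq> 0) (znhds X x)"
proof
  assume "g \<in> log_monoid X B x"
  then obtain U h where U: "openin (zar X) U" "x \<in> U" "g \<in> reg X U" "\<forall>y\<in>U - B. g y * h y = 1"
    unfolding log_monoid_def by blast
  have "eventually (\<lambda>y. y \<in> U) (znhds X x)" using U by (intro eventually_znhds_open)
  then have "eventually (\<lambda>y. y \<notin> B \<longrightarrow> g y \<noteq> 0) (znhds X x)"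
    by eventually_elim (use U(4) in force)
  then show "g \<in> stalk X x \<and> eventually (\<lambda>y. y \<notin> B \<longrightarrow> g y \<noteq> 0) (znhds X x)"
    using U by (auto simp: stalk_def)
next
  assume *: "g \<in> stalk X x \<and> eventually (\<lambda>y. y \<notin> B \<longrightarrow> g y \<noteq> 0) (znhds X x)"
  then have xp: "x \<in> pts X" by (auto dest: stalk_pts)
  have "eventually (\<lambda>y. g \<in> stalk X y \<and> (y \<notin> B \<longrightarrow> g y \<noteq> 0)) (znhds X x)"
    using * stalk_eventually by (intro eventually_conj) auto
  then obtain U where U: "openin (zar X) U" "x \<in> U" "\<forall>y\<in>U. g \<in> stalk X y \<and> (y \<notin> B \<longrightarrow> g y \<noteq> 0)"
    by (auto simp: eventually_znhds[OF xp])
  have "openin (zar X) (U - B)" using U(1) assms by (rule openin_diff)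
  then have "(\<lambda>y. 1 / g y) \<in> reg X (U - B)"
    using U(3) by (auto simp: reg_iff_stalk intro!: stalk_inverse)
  moreover have "g \<in> reg X U" using U by (simp add: reg_iff_stalk)
  ultimately show "g \<in> log_monoid X B x" unfolding log_monoid_def
    using U by (intro CollectI exI[of _ U] conjI bexI[of _ "\<lambda>y. 1 / g y"]) auto
qed

section \<open>Derivations of the local ring\<close>

context
  fixes x v
  assumes v: "v \<in> tangent X x"
begin

lemma tangent_outside: "f \<notin> stalk X x \<Longrightarrow> v f = 0"
proof -
  have "\<forall>f. f \<notin> stalk X x \<longrightarrow> v f = 0"
    using v unfolding tangent_def mem_Collect_eq by (elim conjE)
  then show "f \<notin> stalk X x \<Longrightarrow> v f = 0" by simp
qed

lemma tangent_cong:
  assumes "f \<in> stalk X x" "eventually (\<lambda>y. f y = g y) (znhds X x)"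
  shows "v f = v g"
proof -
  have "\<forall>f\<in>stalk X x. \<forall>g\<in>stalk X x. germ_eq X x f g \<longrightarrow> v f = v g"
    using v unfolding tangent_def mem_Collect_eq by (elim conjE)
  from this[rule_format, OF assms(1) stalk_cong[OF assms]] show ?thesis
    using assms(2) by (simp add: germ_eq_iff[OF stalk_pts[OF assms(1)]])
qed

lemma tangent_add: "f \<in> stalk X x \<Longrightarrow> g \<in> stalk X x \<Longrightarrow> v (\<lambda>y. f y + g y) = v f + v g"
proof -
  have "\<forall>f\<in>stalk X x. \<forall>g\<in>stalk X x. v (\<lambda>y. f y + g y) = v f + v g"
    using v unfolding tangent_def mem_Collect_eq by (elim conjE)
  then show "f \<in> stalk X x \<Longrightarrow> g \<in> stalk X x \<Longrightarrow> v (\<lambda>y. f y + g y) = v f + v g" by simp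
qed

lemma tangent_cmult: "f \<in> stalk X x \<Longrightarrow> v (\<lambda>y. c * f y) = c * v f"
proof -
  have "\<forall>f\<in>stalk X x. \<forall>c. v (\<lambda>y. c * f y) = c * v f"
    using v unfolding tangent_def mem_Collect_eq by (elim conjE)
  then show "f \<in> stalk X x \<Longrightarrow> v (\<lambda>y. c * f y) = c * v f" by simp
qed

lemma tangent_mult: "f \<in> stalk X x \<Longrightarrow> g \<in> stalk X x \<Longrightarrow> v (\<lambda>y. f y * g y) = f x * v g + g x * v f"
proof -
  have "\<forall>f\<in>stalk X x. \<forall>g\<in>stalk X x. v (\<lambda>y. f y * g y) = f x * v g + g x * v f"
    using v unfolding tangent_def mem_Collect_eq by (elim conjE)
  then show "f \<in> stalk X x \<Longrightarrow> g \<in> stalk X x \<Longrightarrow> v (\<lambda>y. f y * g y) = f x * v g + g x * v f" by simp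
qed

lemma tangent_const: "x \<in> pts X \<Longrightarrow> v (\<lambda>y. c) = 0"
  using tangent_mult[OF stalk_const[of x 1] stalk_const[of x 1]] tangent_cmult[OF stalk_const[of x 1], of c]
  by simp

lemma tangent_sum:
  "x \<in> pts X \<Longrightarrow> (\<And>i. i \<in> I \<Longrightarrow> f i \<in> stalk X x) \<Longrightarrow> v (\<lambda>y. \<Sum>i\<in>I. f i y) = (\<Sum>i\<in>I. v (f i))"
proof (induction I rule: infinite_finite_induct)
  case (insert i I)
  then show ?case by (simp add: tangent_add[OF insert.prems(2) stalk_sum])
qed (simp_all add: tangent_const)

text \<open>Since the \<open>g i\<close> vanish at \<open>x\<close>, the Leibniz rule leaves only
  the values \<open>h i x\<close>. This is why a normal vector is determined by its values on
  generators of the ideal.\<close>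

lemma tangent_sum_zero:
  assumes "x \<in> pts X" "\<And>i. i \<in> I \<Longrightarrow> h i \<in> stalk X x" "\<And>i. i \<in> I \<Longrightarrow> g i \<in> stalk X x"
    "\<And>i. i \<in> I \<Longrightarrow> g i x = 0" "f \<in> stalk X x" "eventually (\<lambda>y. f y = (\<Sum>i\<in>I. h i y * g i y)) (znhds X x)"
  shows "v f = (\<Sum>i\<in>I. h i x * v (g i))"
proof -
  have "v f = v (\<lambda>y. \<Sum>i\<in>I. h i y * g i y)" using assms(5,6) by (rule tangent_cong)
  also have "\<dots> = (\<Sum>i\<in>I. v (\<lambda>y. h i y * g i y))"
    using assms(1-3) by (intro tangent_sum stalk_mult)
  also have "\<dots> = (\<Sum>i\<in>I. h i x * v (g i))" 
    by (intro sum.cong refl) (simp add: tangent_mult[OF assms(2,3)] assms(4))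
  finally show ?thesis .
qed

lemma tangent_multiple:
  assumes "h \<in> stalk X x" "g \<in> stalk X x" "g x = 0" "f \<in> stalk X x" "eventually (\<lambda>y. f y = h y * g y) (znhds X x)"
  shows "v f = h x * v g"
  using tangent_cong[OF assms(4,5)] tangent_mult[OF assms(1,2)] assms(3) by simp

lemma tangent_polyfun:
  assumes "affine_chart X U n a" "x \<in> U" "p \<in> polyfun n"
  shows "v (\<lambda>y. p (a y)) = (\<Sum>j<n. partial_deriv j p (a x) * v (\<lambda>y. a y j))"
  using assms(3)
proof (induction rule: polyfun.induct)
  case (const c)
  show ?case using affine_chart_subset[OF assms(1)] assms(2) by (auto simp: tangent_const)
next
  case (coord i)
  have "(\<Sum>j<n. partial_deriv j (\<lambda>z. z i) (a x) * v (\<lambda>y. a y j)) = (\<Sum>j<n. if j = i then v (\<lambda>y. a y j) else 0)"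
    by (intro sum.cong) auto
  then show ?case using coord by simp
next
  case (add p q)
  then show ?case using stalk_polyfun[OF assms(1,2)]
    by (simp add: tangent_add partial_deriv_add algebra_simps sum.distrib)
next
  case (mult p q)
  then show ?case using stalk_polyfun[OF assms(1,2)]
    by (simp add: tangent_mult partial_deriv_mult algebra_simps sum.distrib sum_distrib_left)
qed

end

lemma tangent_eqI:
  assumes u: "u \<in> tangent X x" and v: "v \<in> tangent X x" and U: "affine_chart X U n a" "x \<in> U"
    and eq: "\<And>j. j < n \<Longrightarrow> u (\<lambda>y. a y j) = v (\<lambda>y. a y j)"
  shows "u = v"
proof
  fix f
  show "u f = v f"
  proof (cases "f \<in> stalk X x")
    case True
    then obtain p q where pq: "p \<in> polyfun n" "q \<in> polyfun n" "q (a x) \<noteq> 0" "eventually (\<lambda>y. f y = p (a y) / q (a y)) (znhds X x)"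
      using stalk_iff[OF U] by blast
    note st = stalk_polyfun[OF U pq(1)] stalk_polyfun[OF U pq(2)]
    have "eventually (\<lambda>y. q (a y) \<noteq> 0) (znhds X x)" using stalk_nonzero[OF st(2)] pq(3) by simp
    then have ev: "eventually (\<lambda>y. p (a y) = f y * q (a y)) (znhds X x)" using pq(4) by eventually_elim simp
    \<comment> \<open>The Leibniz rule for the product of \<open>f\<close> and the denominator. As
      \<open>q (a x)\<close> is nonzero, this determines \<open>w f\<close> without a quotient
      rule.\<close>
    have *: "w (\<lambda>y. p (a y)) = f x * w (\<lambda>y. q (a y)) + q (a x) * w f" if "w \<in> tangent X x" for w
      using tangent_cong[OF that st(1) ev] tangent_mult[OF that True st(2)] by simp
    have "u (\<lambda>y. r (a y)) = v (\<lambda>y. r (a y))" if "r \<in> polyfun n" for r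
      using tangent_polyfun[OF u U that] tangent_polyfun[OF v U that] eq by simp
    then show ?thesis using *[OF u] *[OF v] pq by simp
  next
    case False
    then show ?thesis using tangent_outside[OF u] tangent_outside[OF v] by simp
  qed
qed

lemma tangentI:
  assumes "\<And>f. f \<notin> stalk X x \<Longrightarrow> v f = 0"
    and "\<And>f g. f \<in> stalk X x \<Longrightarrow> g \<in> stalk X x \<Longrightarrow> eventually (\<lambda>y. f y = g y) (znhds X x) \<Longrightarrow> v f = v g"
    and "\<And>f c. f \<in> stalk X x \<Longrightarrow> v (\<lambda>y. c * f y) = c * v f"
    and "\<And>f g. f \<in> stalk X x \<Longrightarrow> g \<in> stalk X x \<Longrightarrow> v (\<lambda>y. f y + g y) = v f + v g"
    and "\<And>f g. f \<in> stalk X x \<Longrightarrow> g \<in> stalk X x \<Longrightarrow> v (\<lambda>y. f y * g y) = f x * v g + g x * v f"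
  shows "v \<in> tangent X x"
  unfolding tangent_def
proof (intro CollectI conjI allI impI ballI)
  fix f g assume *: "f \<in> stalk X x" "g \<in> stalk X x" "germ_eq X x f g"
  then show "v f = v g" by (intro assms(2)) (simp_all add: germ_eq_iff[OF stalk_pts[OF *(1)]])
qed (fact assms)+

lemma tangent_lincomb:
  assumes u: "u \<in> tangent X x" and v: "v \<in> tangent X x"
  shows "(\<lambda>f. c * u f + d * v f) \<in> tangent X x"
proof (rule tangentI)
  fix f g assume f: "f \<in> stalk X x" and g: "g \<in> stalk X x" and e: "eventually (\<lambda>y. f y = g y) (znhds X x)"
  show "c * u f + d * v f = c * u g + d * v g"
    by (simp add: tangent_cong[OF u f e] tangent_cong[OF v f e])
next
  fix f assume f: "f \<notin> stalk X x"
  show "c * u f + d * v f = 0" by (simp add: tangent_outside[OF u f] tangent_outside[OF v f])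
next
  fix f b assume f: "f \<in> stalk X x"
  show "c * u (\<lambda>y. b * f y) + d * v (\<lambda>y. b * f y) = b * (c * u f + d * v f)"
    by (simp add: tangent_cmult[OF u f] tangent_cmult[OF v f] algebra_simps)
next
  fix f g assume f: "f \<in> stalk X x" and g: "g \<in> stalk X x"
  show "c * u (\<lambda>y. f y + g y) + d * v (\<lambda>y. f y + g y) = c * u f + d * v f + (c * u g + d * v g)"
    by (simp add: tangent_add[OF u f g] tangent_add[OF v f g] algebra_simps)
  show "c * u (\<lambda>y. f y * g y) + d * v (\<lambda>y. f y * g y) = f x * (c * u g + d * v g) + g x * (c * u f + d * v f)"
    by (simp add: tangent_mult[OF u f g] tangent_mult[OF v f g] algebra_simps)
qed

lemma tangent_zero: "x \<in> pts X \<Longrightarrow> (\<lambda>f. 0) \<in> tangent X x"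
  by (rule tangentI) simp_all

lemma tangent_diff: "u \<in> tangent X x \<Longrightarrow> v \<in> tangent X x \<Longrightarrow> (\<lambda>f. u f - v f) \<in> tangent X x"
  using tangent_lincomb[of u x v 1 "- 1"] by simp

text \<open>Each equation is a multiple of the other, with cofactors \<open>h\<close> and
  \<open>k\<close>. Applying \<open>v\<close> gives \<open>v d = k x * h x * v d\<close>, and
  \<open>v d\<close> being nonzero takes the place of cancelling \<open>d\<close> in an integral
  domain.\<close>

lemma local_eq_unit_multiple:
  assumes "local_eq X A x g" "local_eq X A x d" "x \<in> A" "v \<in> tangent X x" "v d \<noteq> 0"
  obtains h where "h \<in> stalk X x" "h x \<noteq> 0" "eventually (\<lambda>y. g y = h y * d y) (znhds X x)"
proof -
  note g = local_eqD[OF assms(1)] and d = local_eqD[OF assms(2)]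
  obtain h where h: "h \<in> stalk X x" "eventually (\<lambda>y. g y = h y * d y) (znhds X x)"
    by (rule local_eq_multiple[OF assms(2) g(1,2)])
  obtain k where k: "k \<in> stalk X x" "eventually (\<lambda>y. d y = k y * g y) (znhds X x)"
    by (rule local_eq_multiple[OF assms(1) d(1,2)])
  have "v d = k x * v g" by (rule tangent_multiple[OF assms(4) k(1) g(1) g(3)[OF assms(3)] d(1) k(2)])
  also have "v g = h x * v d" by (rule tangent_multiple[OF assms(4) h(1) d(1) d(3)[OF assms(3)] g(1) h(2)])
  finally have "h x \<noteq> 0" using assms(5) by auto
  then show thesis using that h by blast
qed

section \<open>Complex arcs and their velocities\<close>

lemma arc_pts: "complex_arc X \<gamma> \<Longrightarrow> \<gamma> 0 \<in> pts X"
  unfolding complex_arc_def by force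

lemma arc_eventually:
  assumes "complex_arc X \<gamma>" "eventually P (znhds X (\<gamma> 0))"
  shows "eventually (\<lambda>t. P (\<gamma> t)) (nhds 0)"
proof -
  obtain e where e: "e > 0" "\<gamma> ` ball 0 e \<subseteq> pts X" "\<forall>U. openin (zar X) U \<longrightarrow> open (ball 0 e \<inter> \<gamma> -` U)"
    using assms(1) unfolding complex_arc_def by blast
  obtain U where U: "openin (zar X) U" "\<gamma> 0 \<in> U" "\<forall>y\<in>U. P y"
    using assms(2) eventually_znhds[OF arc_pts[OF assms(1)]] by blast
  have "open (ball 0 e \<inter> \<gamma> -` U)" "0 \<in> ball 0 e \<inter> \<gamma> -` U" using e U by auto
  then have "eventually (\<lambda>t. t \<in> ball 0 e \<inter> \<gamma> -` U) (nhds 0)" by (rule eventually_nhds_in_open)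
  then show ?thesis by eventually_elim (use U in auto)
qed

lemma arc_holomorphic:
  assumes "complex_arc X \<gamma>" "f \<in> stalk X (\<gamma> 0)"
  obtains r where "r > 0" "(f \<circ> \<gamma>) holomorphic_on ball 0 r"
proof -
  obtain e where e: "e > 0" "\<forall>U. openin (zar X) U \<longrightarrow> open (ball 0 e \<inter> \<gamma> -` U) \<and>
        (\<forall>f\<in>reg X U. (f \<circ> \<gamma>) holomorphic_on (ball 0 e \<inter> \<gamma> -` U))"
    using assms(1) unfolding complex_arc_def by blast
  obtain U where U: "openin (zar X) U" "\<gamma> 0 \<in> U" "f \<in> reg X U" using assms(2) by (auto simp: stalk_def)
  have o: "open (ball 0 e \<inter> \<gamma> -` U)" and z: "0 \<in> ball 0 e \<inter> \<gamma> -` U" using e U by auto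
  obtain r where "r > 0" "ball 0 r \<subseteq> ball 0 e \<inter> \<gamma> -` U"
    using openE[OF o z] by blast
  moreover have "(f \<circ> \<gamma>) holomorphic_on (ball 0 e \<inter> \<gamma> -` U)" using e U by blast
  ultimately show thesis using that holomorphic_on_subset by blast
qed

lemma arc_differentiable:
  assumes "complex_arc X \<gamma>" "f \<in> stalk X (\<gamma> 0)"
  shows "(\<lambda>t. f (\<gamma> t)) field_differentiable at 0"
proof -
  obtain r where r: "r > 0" "(f \<circ> \<gamma>) holomorphic_on ball 0 r" by (rule arc_holomorphic[OF assms])
  have "(f \<circ> \<gamma>) field_differentiable at 0"
    by (rule holomorphic_on_imp_differentiable_at[OF r(2) open_ball]) (simp add: r(1))
  then show ?thesis by (simp add: comp_def)
qed

lemma arc_isCont: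
  assumes "complex_arc X \<gamma>" "f \<in> stalk X (\<gamma> 0)"
  shows "isCont (\<lambda>t. f (\<gamma> t)) 0"
  using arc_differentiable[OF assms] by (simp add: field_differentiable_imp_continuous_at)

lemma velocity_eq: "f \<in> stalk X (\<gamma> 0) \<Longrightarrow> velocity X \<gamma> f = deriv (\<lambda>t. f (\<gamma> t)) 0"
  by (simp add: velocity_def comp_def)

lemma velocity_tangent:
  assumes "complex_arc X \<gamma>"
  shows "velocity X \<gamma> \<in> tangent X (\<gamma> 0)"
proof -
  note xp = arc_pts[OF assms]
  note d = arc_differentiable[OF assms]
  show ?thesis
  proof (rule tangentI)
    fix f g assume f: "f \<in> stalk X (\<gamma> 0)" and g: "g \<in> stalk X (\<gamma> 0)" and e: "eventually (\<lambda>y. f y = g y) (znhds X (\<gamma> 0))"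
    show "velocity X \<gamma> f = velocity X \<gamma> g"
      unfolding velocity_eq[of f \<gamma>, OF f] velocity_eq[of g \<gamma>, OF g]
      by (rule deriv_cong_ev[OF arc_eventually[OF assms e] refl])
  next
    fix f assume "f \<notin> stalk X (\<gamma> 0)" then show "velocity X \<gamma> f = 0" by (simp add: velocity_def)
  next
    fix f c assume f: "f \<in> stalk X (\<gamma> 0)"
    show "velocity X \<gamma> (\<lambda>y. c * f y) = c * velocity X \<gamma> f"
      unfolding velocity_eq[of f \<gamma>, OF f] velocity_eq[of "\<lambda>y. c * f y" \<gamma>, OF stalk_cmult[OF f]]
      using d[OF f] by (simp add: deriv_cmult)
  next
    fix f g assume f: "f \<in> stalk X (\<gamma> 0)" and g: "g \<in> stalk X (\<gamma> 0)"
    show "velocity X \<gamma> (\<lambda>y. f y + g y) = velocity X \<gamma> f + velocity X \<gamma> g"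
      unfolding velocity_eq[of f \<gamma>, OF f] velocity_eq[of g \<gamma>, OF g] velocity_eq[of "\<lambda>y. f y + g y" \<gamma>, OF stalk_add[OF f g]]
      using d[OF f] d[OF g] by (simp add: deriv_add)
    show "velocity X \<gamma> (\<lambda>y. f y * g y) = f (\<gamma> 0) * velocity X \<gamma> g + g (\<gamma> 0) * velocity X \<gamma> f"
      unfolding velocity_eq[of f \<gamma>, OF f] velocity_eq[of g \<gamma>, OF g] velocity_eq[of "\<lambda>y. f y * g y" \<gamma>, OF stalk_mult[OF f g]]
      using d[OF f] d[OF g] by (simp add: deriv_mult)
  qed
qed

lemma arc_vanish:
  assumes "complex_arc X \<gamma>" "f \<in> stalk X (\<gamma> 0)" "eventually (\<lambda>t. f (\<gamma> t) = 0) (at 0)"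
  shows "f (\<gamma> 0) = 0"
proof -
  have "((\<lambda>t. f (\<gamma> t)) \<longlongrightarrow> f (\<gamma> 0)) (at 0)" using arc_isCont[OF assms(1,2)] by (simp add: isCont_def)
  moreover have "((\<lambda>t. f (\<gamma> t)) \<longlongrightarrow> 0) (at 0)" using assms(3) by (rule tendsto_eventually)
  ultimately show ?thesis by (intro tendsto_unique[of "at 0"]) auto
qed

lemma arc_nonzero:
  assumes "complex_arc X \<gamma>" "f \<in> stalk X (\<gamma> 0)" "velocity X \<gamma> f \<noteq> 0"
  shows "eventually (\<lambda>t. f (\<gamma> t) \<noteq> 0) (at 0)"
proof (cases "f (\<gamma> 0) = 0")
  case False
  then have "eventually (\<lambda>t. f (\<gamma> t) \<noteq> 0) (nhds 0)"
    by (intro arc_eventually[OF assms(1)] stalk_nonzero[OF assms(2)])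
  then show ?thesis by (auto simp: eventually_at_filter elim: eventually_mono)
next
  case True
  have "((\<lambda>t. f (\<gamma> t)) has_field_derivative velocity X \<gamma> f) (at 0)"
    using arc_differentiable[OF assms(1,2)] by (simp add: velocity_eq[of f \<gamma>, OF assms(2)] field_differentiable_derivI)
  then have "((\<lambda>t. (f (\<gamma> t) - f (\<gamma> 0)) / (t - 0)) \<longlongrightarrow> velocity X \<gamma> f) (at 0)"
    by (simp only: has_field_derivative_iff)
  then have "eventually (\<lambda>t. (f (\<gamma> t) - f (\<gamma> 0)) / (t - 0) \<noteq> 0) (at 0)"
    using assms(3) by (rule tendsto_imp_eventually_ne)
  then show ?thesis by eventually_elim (use True in auto)
qed

text \<open>Zariski neighbourhoods contain nonvanishing loci of polynomials, whose preimages under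
  holomorphic coordinates are open in the usual topology, and regular functions are locally
  quotients of polynomials in the coordinates.\<close>

lemma complex_arc_chart:
  assumes U: "affine_chart X U n a" and e: "e > 0" and \<gamma>: "\<And>t. t \<in> ball 0 e \<Longrightarrow> \<gamma> t \<in> U"
    and hol: "\<And>j. j < n \<Longrightarrow> (\<lambda>t. a (\<gamma> t) j) holomorphic_on ball 0 e"
  shows "complex_arc X \<gamma>"
proof -
  have phol: "(\<lambda>t. p (a (\<gamma> t))) holomorphic_on ball 0 e" if "p \<in> polyfun n" for p
    by (rule holomorphic_polyfun[OF that hol])
  have ev: "eventually (\<lambda>s. P (\<gamma> s)) (nhds t)" if t: "t \<in> ball 0 e" and P: "eventually P (znhds X (\<gamma> t))" for t P
  proof -
    obtain p where p: "p \<in> polyfun n" "p (a (\<gamma> t)) \<noteq> 0" "\<And>y. y \<in> U \<Longrightarrow> p (a y) \<noteq> 0 \<Longrightarrow> P y"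
      using basic_neighbourhood[OF U \<gamma>[OF t] P] by metis
    have "isCont (\<lambda>s. p (a (\<gamma> s))) t"
      using holomorphic_on_imp_continuous_on[OF phol[OF p(1)]] t by (simp add: continuous_on_eq_continuous_at)
    then have "((\<lambda>s. p (a (\<gamma> s))) \<longlongrightarrow> p (a (\<gamma> t))) (nhds t)" by (simp add: isCont_def tendsto_nhds_iff)
    then have "eventually (\<lambda>s. p (a (\<gamma> s)) \<noteq> 0) (nhds t)" using p(2) by (rule tendsto_imp_eventually_ne)
    moreover have "eventually (\<lambda>s. s \<in> ball 0 e) (nhds t)" using t by (intro eventually_nhds_in_open) auto
    ultimately show ?thesis by eventually_elim (use p \<gamma> in auto)
  qed
  show ?thesis unfolding complex_arc_def
  proof (intro exI[of _ e] conjI allI impI ballI)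
    show "e > 0" "\<gamma> ` ball 0 e \<subseteq> pts X" using e \<gamma> affine_chart_subset[OF U] by auto
    fix W assume W: "openin (zar X) W"
    show op: "open (ball 0 e \<inter> \<gamma> -` W)"
    proof -
      have "\<exists>T. open T \<and> t \<in> T \<and> T \<subseteq> ball 0 e \<inter> \<gamma> -` W" if "t \<in> ball 0 e \<inter> \<gamma> -` W" for t
      proof -
        have "eventually (\<lambda>s. \<gamma> s \<in> W) (nhds t)" using that W by (intro ev eventually_znhds_open) auto
        moreover have "eventually (\<lambda>s. s \<in> ball 0 e) (nhds t)" using that by (intro eventually_nhds_in_open) auto
        ultimately have "eventually (\<lambda>s. s \<in> ball 0 e \<inter> \<gamma> -` W) (nhds t)" by eventually_elim auto
        then show ?thesis by (auto simp: eventually_nhds)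
      qed
      then show ?thesis by (subst open_subopen) blast
    qed
    fix f assume f: "f \<in> reg X W"
    show "(f \<circ> \<gamma>) holomorphic_on ball 0 e \<inter> \<gamma> -` W"
      unfolding holomorphic_on_def
    proof
      fix t assume t: "t \<in> ball 0 e \<inter> \<gamma> -` W"
      then have "f \<in> stalk X (\<gamma> t)" using f W by (auto simp: stalk_def)
      then obtain p q where pq: "p \<in> polyfun n" "q \<in> polyfun n" "q (a (\<gamma> t)) \<noteq> 0"
        "eventually (\<lambda>y. f y = p (a y) / q (a y)) (znhds X (\<gamma> t))"
        using stalk_iff[OF U \<gamma>[of t]] t by blast
      have "eventually (\<lambda>s. (f \<circ> \<gamma>) s = p (a (\<gamma> s)) / q (a (\<gamma> s))) (nhds t)"
        using ev[OF _ pq(4)] t by simp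
      moreover have "(\<lambda>s. p (a (\<gamma> s)) / q (a (\<gamma> s))) field_differentiable at t"
        using phol[OF pq(1)] phol[OF pq(2)] t pq(3)
        by (intro field_differentiable_divide) (auto intro: holomorphic_on_imp_differentiable_at)
      ultimately have "(f \<circ> \<gamma>) field_differentiable at t"
        unfolding field_differentiable_def using DERIV_cong_ev[OF refl _ refl] by metis
      then show "(f \<circ> \<gamma>) field_differentiable at t within ball 0 e \<inter> \<gamma> -` W"
        by (rule field_differentiable_at_within)
    qed
  qed
qed

end

section \<open>Normal vectors\<close>

text \<open>When the \<open>g j\<close> generate the ideal of \<open>A\<close> at a point
  \<open>x\<close> of \<open>A\<close>, the nonempty sets of this form are the vectors normal to
  \<open>A\<close>, and \<open>w\<close> is a coordinate vector. Linear relations between the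
  differentials of the \<open>g j\<close> make some of the sets empty.\<close>

definition coset :: "'a fspace \<Rightarrow> 'a \<Rightarrow> 'i set \<Rightarrow> ('i \<Rightarrow> 'a \<Rightarrow> complex) \<Rightarrow> ('i \<Rightarrow> complex) \<Rightarrow> 'a tvec set" where
  "coset X x J g w = {v \<in> tangent X x. \<forall>j\<in>J. v (g j) = w j}"

lemma coset_eq_iff:
  assumes "coset X x J g w \<noteq> {}"
  shows "coset X x J g w = coset X x J g w' \<longleftrightarrow> (\<forall>j\<in>J. w j = w' j)"
proof
  assume eq: "coset X x J g w = coset X x J g w'"
  obtain v where v: "v \<in> coset X x J g w" using assms by blast
  then have "v \<in> coset X x J g w'" using eq by simp
  then show "\<forall>j\<in>J. w j = w' j" using v by (simp add: coset_def)
next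
  assume "\<forall>j\<in>J. w j = w' j"
  then show "coset X x J g w = coset X x J g w'" by (simp add: coset_def)
qed

lemma coset_cong: "(\<And>j. j \<in> J \<Longrightarrow> w j = w' j) \<Longrightarrow> coset X x J g w = coset X x J g w'"
  by (auto simp: coset_def)

lemma nderiv_eqI:
  assumes "m \<noteq> {}" "\<And>v. v \<in> m \<Longrightarrow> v g = c"
  shows "nderiv m g = c"
  unfolding nderiv_def
proof (rule the_equality)
  show "\<forall>v\<in>m. v g = c" using assms(2) by simp
  fix b assume b: "\<forall>v\<in>m. v g = b"
  obtain v where "v \<in> m" using assms(1) by blast
  then show "b = c" using b assms(2)[of v] by simp
qed

text \<open>The case of one equation: \<open>c\<close> is the coordinate on the normal line of a
  hypersurface.\<close>

definition hcoset :: "'a fspace \<Rightarrow> 'a \<Rightarrow> ('a \<Rightarrow> complex) \<Rightarrow> complex \<Rightarrow> 'a tvec set" where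
  "hcoset X x d c = {v \<in> tangent X x. v d = c}"

lemma hcoset_eq_coset: "hcoset X x d c = coset X x {()} (\<lambda>_. d) (\<lambda>_. c)"
  by (simp add: hcoset_def coset_def)

text \<open>The nonvanishing differential makes \<open>hcoset\<close> nonempty for every value, so
  normal vectors at \<open>x\<close> correspond bijectively to complex numbers. It also supplies the
  derivation used to compare units.\<close>

definition smooth_eq :: "'a fspace \<Rightarrow> 'a set \<Rightarrow> 'a \<Rightarrow> ('a \<Rightarrow> complex) \<Rightarrow> bool" where
  "smooth_eq X A x d \<longleftrightarrow> x \<in> A \<and> local_eq X A x d \<and> (\<exists>t\<in>tangent X x. t d \<noteq> 0)"

context variety_space
begin

lemma tangent_sub_eq:
  assumes "generates_ideal X A x J g" "x \<in> A" "x \<in> pts X"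
  shows "tangent_sub X A x = coset X x J g (\<lambda>_. 0)"
proof (intro equalityI subsetI)
  fix v assume "v \<in> tangent_sub X A x"
  then show "v \<in> coset X x J g (\<lambda>_. 0)"
    using assms(1) by (simp add: tangent_sub_def coset_def generates_ideal_def)
next
  fix v assume v: "v \<in> coset X x J g (\<lambda>_. 0)"
  then have vt: "v \<in> tangent X x" and v0: "\<And>j. j \<in> J \<Longrightarrow> v (g j) = 0" by (simp_all add: coset_def)
  have "v f = 0" if f: "f \<in> ideal_at X A x" for f
  proof -
    have f': "f \<in> stalk X x" "eventually (\<lambda>y. y \<in> A \<longrightarrow> f y = 0) (znhds X x)"
      using f by (simp_all add: ideal_at_iff[OF assms(3)])
    obtain h where h: "\<forall>j\<in>J. h j \<in> stalk X x" "eventually (\<lambda>y. f y = (\<Sum>j\<in>J. h j y * g j y)) (znhds X x)"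
      by (rule generates_idealD[OF assms(1) f'])
    have "v f = (\<Sum>j\<in>J. h j x * v (g j))"
      by (rule tangent_sum_zero[OF vt assms(3) _ _ _ f'(1) h(2)])
        (use h(1) generates_ideal_mem[OF assms(1)] generates_ideal_zero[OF assms(1) _ assms(2)] in simp_all)
    then show ?thesis using v0 by simp
  qed
  then show "v \<in> tangent_sub X A x" using vt by (simp add: tangent_sub_def)
qed

context
  fixes A x and J :: "'i set" and g
  assumes gen: "generates_ideal X A x J g" and xA: "x \<in> A" and xp: "x \<in> pts X"
begin

lemma normal_class_eq:
  assumes v: "v \<in> tangent X x"
  shows "normal_class X A x v = coset X x J g (\<lambda>j. v (g j))"
  unfolding normal_class_def tangent_sub_eq[OF gen xA xp] coset_def
  using tangent_diff[OF _ v] by auto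

lemma normal_eq: "normal X A x = {coset X x J g w | w. coset X x J g w \<noteq> {}}"
proof (intro equalityI subsetI)
  fix m assume "m \<in> normal X A x"
  then obtain v where v: "v \<in> tangent X x" "m = normal_class X A x v" unfolding normal_def by blast
  then have "m = coset X x J g (\<lambda>j. v (g j))" "v \<in> m" by (simp_all add: normal_class_eq coset_def)
  then show "m \<in> {coset X x J g w | w. coset X x J g w \<noteq> {}}" by blast
next
  fix m assume "m \<in> {coset X x J g w | w. coset X x J g w \<noteq> {}}"
  then obtain w v where w: "m = coset X x J g w" "v \<in> coset X x J g w" by blast
  then have v: "v \<in> tangent X x" "\<And>j. j \<in> J \<Longrightarrow> v (g j) = w j" by (simp_all add: coset_def)
  then have "m = normal_class X A x v" unfolding w(1) normal_class_eq[OF v(1)] by (intro coset_cong) simp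
  then show "m \<in> normal X A x" unfolding normal_def using v(1) by (rule image_eqI)
qed

lemma normal_nz_eq: "normal_nz X A x = {coset X x J g w | w. coset X x J g w \<noteq> {} \<and> (\<exists>j\<in>J. w j \<noteq> 0)}"
proof (intro equalityI subsetI)
  fix m assume "m \<in> normal_nz X A x"
  then obtain w where w: "m = coset X x J g w" "coset X x J g w \<noteq> {}" "m \<noteq> coset X x J g (\<lambda>_. 0)"
    unfolding normal_nz_def normal_eq tangent_sub_eq[OF gen xA xp] by auto
  then have "\<exists>j\<in>J. w j \<noteq> 0" using coset_eq_iff[OF w(2), of "\<lambda>_. 0"] by simp
  then show "m \<in> {coset X x J g w | w. coset X x J g w \<noteq> {} \<and> (\<exists>j\<in>J. w j \<noteq> 0)}"
    using w(1,2) by blast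
next
  fix m assume "m \<in> {coset X x J g w | w. coset X x J g w \<noteq> {} \<and> (\<exists>j\<in>J. w j \<noteq> 0)}"
  then obtain w where w: "m = coset X x J g w" "coset X x J g w \<noteq> {}" "\<exists>j\<in>J. w j \<noteq> 0" by auto
  then have "m \<noteq> coset X x J g (\<lambda>_. 0)" using coset_eq_iff[OF w(2), of "\<lambda>_. 0"] by simp
  then show "m \<in> normal_nz X A x"
    unfolding normal_nz_def normal_eq tangent_sub_eq[OF gen xA xp] using w(1,2)
    by (intro DiffI CollectI exI[of _ w]) simp_all
qed

end

lemma scale_coset:
  assumes "c \<noteq> 0"
  shows "(\<lambda>v f. c * v f) ` coset X x J g w = coset X x J g (\<lambda>j. c * w j)"
proof (intro equalityI subsetI)
  fix v assume "v \<in> (\<lambda>v f. c * v f) ` coset X x J g w"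
  then obtain u where u: "u \<in> coset X x J g w" "v = (\<lambda>f. c * u f)" by blast
  then have ut: "u \<in> tangent X x" by (simp add: coset_def)
  from tangent_lincomb[OF ut ut, of c 0] have "v \<in> tangent X x" by (simp add: u(2))
  then show "v \<in> coset X x J g (\<lambda>j. c * w j)" using u by (simp add: coset_def)
next
  fix v assume v: "v \<in> coset X x J g (\<lambda>j. c * w j)"
  then have vt: "v \<in> tangent X x" by (simp add: coset_def)
  from tangent_lincomb[OF vt vt, of "1 / c" 0] have "(\<lambda>f. v f / c) \<in> tangent X x" by simp
  then have "(\<lambda>f. v f / c) \<in> coset X x J g w" using v assms by (simp add: coset_def)
  moreover have "v = (\<lambda>f. c * (v f / c))" using assms by simp
  ultimately show "v \<in> (\<lambda>v f. c * v f) ` coset X x J g w" by (intro image_eqI[of _ _ "\<lambda>f. v f / c"])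
qed

lemma ray_coset: "ray (coset X x J g w) = {coset X x J g (\<lambda>j. of_real c * w j) | c :: real. c > 0}"
  unfolding ray_def
proof (intro Collect_cong ex_cong1 rev_conj_cong refl)
  fix m :: "'a tvec set" and c :: real
  assume "c > 0"
  then have "(\<lambda>v f. of_real c * v f) ` coset X x J g w = coset X x J g (\<lambda>j. of_real c * w j)"
    by (intro scale_coset) simp
  then show "m = (\<lambda>v f. of_real c * v f) ` coset X x J g w \<longleftrightarrow> m = coset X x J g (\<lambda>j. of_real c * w j)"
    by simp
qed

lemma coset_in_ray: "coset X x J g w \<in> ray (coset X x J g w)"
  unfolding ray_coset by (intro CollectI exI[of _ 1]) simp

lemma ray_coset_eq_iff:
  assumes "coset X x J g w \<noteq> {}"
  shows "ray (coset X x J g w) = ray (coset X x J g w') \<longleftrightarrow> (\<exists>c>0. \<forall>j\<in>J. w j = of_real c * w' j)"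
proof
  assume "ray (coset X x J g w) = ray (coset X x J g w')"
  then have "coset X x J g w \<in> ray (coset X x J g w')" using coset_in_ray[of x J g w] by simp
  then obtain c :: real where "c > 0" "coset X x J g w = coset X x J g (\<lambda>j. of_real c * w' j)"
    unfolding ray_coset by blast
  then show "\<exists>c>0. \<forall>j\<in>J. w j = of_real c * w' j" 
    using coset_eq_iff[OF assms, of "\<lambda>j. of_real c * w' j"] by auto
next
  assume "\<exists>c>0. \<forall>j\<in>J. w j = of_real c * w' j"
  then obtain c :: real where c: "c > 0" "\<forall>j\<in>J. w j = of_real c * w' j" by blast
  show "ray (coset X x J g w) = ray (coset X x J g w')"
    unfolding ray_coset
  proof (intro equalityI subsetI)
    fix m assume "m \<in> {coset X x J g (\<lambda>j. of_real c * w j) | c :: real. c > 0}"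
    then obtain b :: real where b: "b > 0" "m = coset X x J g (\<lambda>j. of_real b * w j)" unfolding mem_Collect_eq by (elim exE conjE)
    have "m = coset X x J g (\<lambda>j. of_real (b * c) * w' j)" unfolding b(2) by (intro coset_cong) (simp add: c(2))
    then show "m \<in> {coset X x J g (\<lambda>j. of_real c * w' j) | c :: real. c > 0}" using b c
      by (intro CollectI exI[of _ "b * c"]) simp
  next
    fix m assume "m \<in> {coset X x J g (\<lambda>j. of_real c * w' j) | c :: real. c > 0}"
    then obtain b :: real where b: "b > 0" "m = coset X x J g (\<lambda>j. of_real b * w' j)" unfolding mem_Collect_eq by (elim exE conjE)
    have "m = coset X x J g (\<lambda>j. of_real (b / c) * w j)" unfolding b(2) using c by (intro coset_cong) simp
    then show "m \<in> {coset X x J g (\<lambda>j. of_real c * w j) | c :: real. c > 0}" using b c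
      by (intro CollectI exI[of _ "b / c"]) simp
  qed
qed

lemma ray_hcoset: "ray (hcoset X x d c) = {hcoset X x d (of_real s * c) | s :: real. s > 0}"
  unfolding hcoset_eq_coset ray_coset ..

context
  fixes A x d
  assumes sm: "smooth_eq X A x d"
begin

lemma smooth_eqD: "x \<in> A" "local_eq X A x d" "d \<in> stalk X x" "x \<in> pts X" "d x = 0"
  using sm local_eqD[of A x d] stalk_pts[of d X x] by (simp_all add: smooth_eq_def)

lemma hcoset_nonempty: "hcoset X x d c \<noteq> {}"
proof -
  obtain t where t: "t \<in> tangent X x" "t d \<noteq> 0" using sm unfolding smooth_eq_def by blast
  from tangent_lincomb[OF t(1) t(1), of "c / t d" 0] have "(\<lambda>f. c / t d * t f) \<in> hcoset X x d c"
    using t(2) by (simp add: hcoset_def)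
  then show ?thesis by blast
qed

lemma hcoset_eq_iff: "hcoset X x d c = hcoset X x d c' \<longleftrightarrow> c = c'"
  using coset_eq_iff[OF hcoset_nonempty[of c, unfolded hcoset_eq_coset]] by (simp add: hcoset_eq_coset)

lemma ray_hcoset_eq_iff: "ray (hcoset X x d c) = ray (hcoset X x d c') \<longleftrightarrow> (\<exists>s>0. c = of_real s * c')"
  using ray_coset_eq_iff[OF hcoset_nonempty[of c, unfolded hcoset_eq_coset]] by (simp add: hcoset_eq_coset)

lemma normal_class_hcoset: "v \<in> tangent X x \<Longrightarrow> normal_class X A x v = hcoset X x d (v d)"
  using normal_class_eq[OF smooth_eqD(2)[unfolded local_eq_def] smooth_eqD(1,4)] by (simp add: hcoset_eq_coset)

lemma tangent_sub_hcoset: "tangent_sub X A x = hcoset X x d 0"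
  using tangent_sub_eq[OF smooth_eqD(2)[unfolded local_eq_def] smooth_eqD(1,4)] by (simp add: hcoset_eq_coset)

lemma normal_hcoset: "normal X A x = range (hcoset X x d)"
proof (intro equalityI subsetI)
  fix m assume "m \<in> normal X A x"
  then obtain v where "v \<in> tangent X x" "m = normal_class X A x v" unfolding normal_def by blast
  then show "m \<in> range (hcoset X x d)" by (simp add: normal_class_hcoset)
next
  fix m assume "m \<in> range (hcoset X x d)"
  then obtain c where c: "m = hcoset X x d c" by blast
  obtain v where v: "v \<in> hcoset X x d c" using hcoset_nonempty[of c] by blast
  then have "v \<in> tangent X x" "v d = c" by (simp_all add: hcoset_def)
  then show "m \<in> normal X A x" unfolding normal_def using c normal_class_hcoset by (intro image_eqI[of _ _ v]) simp_all
qed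

lemma normal_nz_hcoset: "normal_nz X A x = hcoset X x d ` (- {0})"
  unfolding normal_nz_def normal_hcoset tangent_sub_hcoset by (auto simp: hcoset_eq_iff)

lemma dirs_hcoset: "dirs X A x = {ray (hcoset X x d c) | c. c \<noteq> 0}"
  unfolding dirs_def normal_nz_hcoset by auto

lemma nderiv_hcoset:
  assumes "h \<in> stalk X x" "g \<in> stalk X x" "eventually (\<lambda>y. g y = h y * d y) (znhds X x)"
  shows "nderiv (hcoset X x d c) g = h x * c"
proof (rule nderiv_eqI[OF hcoset_nonempty])
  fix v assume "v \<in> hcoset X x d c"
  then have v: "v \<in> tangent X x" "v d = c" by (simp_all add: hcoset_def)
  show "v g = h x * c" using tangent_multiple[OF v(1) assms(1) smooth_eqD(3,5) assms(2,3)] v(2) by simp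
qed

lemma nderiv_hcoset_self: "nderiv (hcoset X x d c) d = c"
  by (rule nderiv_eqI[OF hcoset_nonempty]) (simp add: hcoset_def)

lemma local_eq_unit:
  assumes "local_eq X A x g"
  obtains h where "h \<in> stalk X x" "h x \<noteq> 0" "eventually (\<lambda>y. g y = h y * d y) (znhds X x)"
proof -
  obtain t where t: "t \<in> tangent X x" "t d \<noteq> 0" using sm unfolding smooth_eq_def by blast
  show thesis by (rule local_eq_unit_multiple[OF assms smooth_eqD(2,1) t that])
qed

text \<open>The number \<open>\<phi> d\<close> has modulus 1, so it is itself the coordinate of a
  normal vector of the required direction, and any other local equation differs from
  \<open>d\<close> by a unit. The hypotheses ask for just these two properties of \<phi>, so that
  the lemma applies directly to the image of a log point under \<open>sigma_log\<close>.\<close>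

lemma log_ident_component:
  assumes norm: "cmod (\<phi> d) = 1"
    and unit: "\<And>g h. g \<in> stalk X x \<Longrightarrow> h \<in> stalk X x \<Longrightarrow> h x \<noteq> 0 \<Longrightarrow>
      eventually (\<lambda>y. g y = h y * d y) (znhds X x) \<Longrightarrow> \<phi> g = sgn (h x) * \<phi> d"
  shows "(THE \<rho>. \<exists>m\<in>normal_nz X A x. \<rho> = ray m \<and>
     (\<forall>g. local_eq X A x g \<longrightarrow> \<phi> g = nderiv m g / of_real (cmod (nderiv m g)))) = ray (hcoset X x d (\<phi> d))"
    (is "(THE \<rho>. ?P \<rho>) = _")
proof (rule the_equality)
  have "\<phi> d \<noteq> 0" using norm by auto
  then have "hcoset X x d (\<phi> d) \<in> normal_nz X A x" unfolding normal_nz_hcoset by simp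
  moreover have "\<phi> g = nderiv (hcoset X x d (\<phi> d)) g / of_real (cmod (nderiv (hcoset X x d (\<phi> d)) g))"
    if g: "local_eq X A x g" for g
  proof -
    obtain h where h: "h \<in> stalk X x" "h x \<noteq> 0" "eventually (\<lambda>y. g y = h y * d y) (znhds X x)"
      by (rule local_eq_unit[OF g])
    note gs = local_eqD(1)[OF g]
    show ?thesis unfolding unit[OF gs h] nderiv_hcoset[OF h(1) gs h(3)]
      by (simp add: sgn_eq norm_mult norm)
  qed
  ultimately show "?P (ray (hcoset X x d (\<phi> d)))" by blast
next
  fix \<rho> assume "?P \<rho>"
  then obtain m where m: "m \<in> normal_nz X A x" "\<rho> = ray m"
    "\<forall>g. local_eq X A x g \<longrightarrow> \<phi> g = nderiv m g / of_real (cmod (nderiv m g))" by blast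
  then obtain c where c: "c \<noteq> 0" "m = hcoset X x d c" unfolding normal_nz_hcoset by blast
  have "\<phi> d = c / of_real (cmod c)"
    using m(3)[rule_format, OF smooth_eqD(2)] unfolding c(2) nderiv_hcoset_self .
  then have "c = of_real (cmod c) * \<phi> d" using c(1) by simp
  then show "\<rho> = ray (hcoset X x d (\<phi> d))"
    unfolding m(2) c(2) ray_hcoset_eq_iff using c(1) by (intro exI[of _ "cmod c"]) simp
qed

end

section \<open>Points of log-spaces and limits along arcs\<close>

lemma log_spaceD:
  assumes "(x, \<phi>) \<in> log_space X B"
  shows "x \<in> pts X" "\<phi> \<in> extensional (log_monoid X B x)"
    "g \<in> log_monoid X B x \<Longrightarrow> h \<in> log_monoid X B x \<Longrightarrow> eventually (\<lambda>y. g y = h y) (znhds X x) \<Longrightarrow> \<phi> g = \<phi> h"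
    "g \<in> log_monoid X B x \<Longrightarrow> cmod (\<phi> g) = 1"
    "g \<in> log_monoid X B x \<Longrightarrow> h \<in> log_monoid X B x \<Longrightarrow> \<phi> (\<lambda>y. g y * h y) = \<phi> g * \<phi> h"
    "g \<in> stalk X x \<Longrightarrow> g x \<noteq> 0 \<Longrightarrow> \<phi> g = sgn (g x)"
proof -
  note c = assms[unfolded log_space_def mem_Collect_eq prod.case]
  note c2 = c[THEN conjunct2, THEN conjunct2]
  note c4 = c2[THEN conjunct2, THEN conjunct2, THEN conjunct2]
  note * = c[THEN conjunct1] c[THEN conjunct2, THEN conjunct1] c2[THEN conjunct1] c2[THEN conjunct2, THEN conjunct1]
    c4[THEN conjunct1] c4[THEN conjunct2]
  show "x \<in> pts X" "\<phi> \<in> extensional (log_monoid X B x)" by (fact *)+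
  show "g \<in> log_monoid X B x \<Longrightarrow> h \<in> log_monoid X B x \<Longrightarrow> eventually (\<lambda>y. g y = h y) (znhds X x) \<Longrightarrow> \<phi> g = \<phi> h"
    by (rule *(3)[unfolded germ_eq_iff[OF *(1)], rule_format])
  show "g \<in> log_monoid X B x \<Longrightarrow> cmod (\<phi> g) = 1" by (rule *(4)[rule_format])
  show "g \<in> log_monoid X B x \<Longrightarrow> h \<in> log_monoid X B x \<Longrightarrow> \<phi> (\<lambda>y. g y * h y) = \<phi> g * \<phi> h" by (rule *(5)[rule_format])
  show "g \<in> stalk X x \<Longrightarrow> g x \<noteq> 0 \<Longrightarrow> \<phi> g = sgn (g x)"
    unfolding sgn_eq by (rule *(6)[rule_format]) (simp add: stalk_units_iff)
qed

context
  fixes B assumes closed: "closedin (zar X) B"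
begin

lemma unit_log_monoid:
  assumes "g \<in> stalk X x" "g x \<noteq> 0"
  shows "g \<in> log_monoid X B x"
  unfolding log_monoid_iff[OF closed] using stalk_nonzero[OF assms] assms(1) by (auto elim: eventually_mono)

lemma log_monoid_mult:
  assumes "g \<in> log_monoid X B x" "h \<in> log_monoid X B x"
  shows "(\<lambda>y. g y * h y) \<in> log_monoid X B x"
proof -
  have g: "g \<in> stalk X x" "eventually (\<lambda>y. y \<notin> B \<longrightarrow> g y \<noteq> 0) (znhds X x)"
    and h: "h \<in> stalk X x" "eventually (\<lambda>y. y \<notin> B \<longrightarrow> h y \<noteq> 0) (znhds X x)"
    using assms by (simp_all add: log_monoid_iff[OF closed])
  have "eventually (\<lambda>y. y \<notin> B \<longrightarrow> g y * h y \<noteq> 0) (znhds X x)"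
    using g(2) h(2) by eventually_elim simp
  then show ?thesis using stalk_mult[OF g(1) h(1)] by (simp add: log_monoid_iff[OF closed])
qed

text \<open>A product that is nonzero off \<open>B\<close> has factors nonzero off \<open>B\<close>.
  Applied to the pullback of an equation of a component, this puts the equations of the exceptional
  divisor and of the strict transform into the log monoid.\<close>

lemma log_monoid_factor:
  assumes "g \<in> stalk X x" "h \<in> stalk X x" "f \<in> log_monoid X B x" "eventually (\<lambda>y. f y = g y * h y) (znhds X x)"
  shows "g \<in> log_monoid X B x" "h \<in> log_monoid X B x"
proof -
  have f: "eventually (\<lambda>y. y \<notin> B \<longrightarrow> f y \<noteq> 0) (znhds X x)" using assms(3) by (simp add: log_monoid_iff[OF closed])
  have "eventually (\<lambda>y. y \<notin> B \<longrightarrow> g y \<noteq> 0) (znhds X x)" "eventually (\<lambda>y. y \<notin> B \<longrightarrow> h y \<noteq> 0) (znhds X x)"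
    using f assms(4) by (eventually_elim; auto)+
  then show "g \<in> log_monoid X B x" "h \<in> log_monoid X B x" using assms(1,2) by (simp_all add: log_monoid_iff[OF closed])
qed

lemma log_monoid_cong:
  assumes "g \<in> log_monoid X B x" "eventually (\<lambda>y. g y = h y) (znhds X x)"
  shows "h \<in> log_monoid X B x"
proof -
  have g: "g \<in> stalk X x" "eventually (\<lambda>y. y \<notin> B \<longrightarrow> g y \<noteq> 0) (znhds X x)"
    using assms by (simp_all add: log_monoid_iff[OF closed])
  have "eventually (\<lambda>y. y \<notin> B \<longrightarrow> h y \<noteq> 0) (znhds X x)" using g(2) assms(2) by eventually_elim simp
  then show ?thesis using stalk_cong[OF g(1) assms(2)] by (simp add: log_monoid_iff[OF closed])
qed

lemma log_char_mult:
  assumes "(x, \<phi>) \<in> log_space X B" "g \<in> log_monoid X B x" "h \<in> log_monoid X B x"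
    "eventually (\<lambda>y. f y = g y * h y) (znhds X x)"
  shows "\<phi> f = \<phi> g * \<phi> h"
proof -
  have gh: "(\<lambda>y. g y * h y) \<in> log_monoid X B x" by (rule log_monoid_mult[OF assms(2,3)])
  have ev: "eventually (\<lambda>y. g y * h y = f y) (znhds X x)" using assms(4) by eventually_elim simp
  have "\<phi> f = \<phi> (\<lambda>y. g y * h y)"
    by (rule log_spaceD(3)[OF assms(1) log_monoid_cong[OF gh ev] gh assms(4)])
  also have "\<dots> = \<phi> g * \<phi> h" by (rule log_spaceD(5)[OF assms(1-3)])
  finally show ?thesis .
qed

lemma log_char_unit_mult:
  assumes "(x, \<phi>) \<in> log_space X B" "d \<in> log_monoid X B x" "h \<in> stalk X x" "h x \<noteq> 0"
    "eventually (\<lambda>y. g y = h y * d y) (znhds X x)"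
  shows "\<phi> g = sgn (h x) * \<phi> d"
  using log_char_mult[OF assms(1) unit_log_monoid[OF assms(3,4)] assms(2,5)] log_spaceD(6)[OF assms(1,3,4)] by simp

text \<open>An arc leaving \<open>B\<close> defines a point of the log-space by the limit directions of functions along the
  positive real axis.\<close>

lemma arc_direction:
  assumes arc: "complex_arc X \<gamma>" and off: "eventually (\<lambda>t. \<gamma> t \<notin> B) (at 0)" and g: "g \<in> log_monoid X B (\<gamma> 0)"
  shows "\<exists>l. cmod l = 1 \<and> ((\<lambda>s. sgn (g (\<gamma> (of_real s)))) \<longlongrightarrow> l) (at_right (0::real))"
proof -
  have gs: "g \<in> stalk X (\<gamma> 0)" and gB: "eventually (\<lambda>y. y \<notin> B \<longrightarrow> g y \<noteq> 0) (znhds X (\<gamma> 0))"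
    using g by (simp_all add: log_monoid_iff[OF closed])
  obtain r where r: "r > 0" "(g \<circ> \<gamma>) holomorphic_on ball 0 r" by (rule arc_holomorphic[OF arc gs])
  have "eventually (\<lambda>t. \<gamma> t \<notin> B \<longrightarrow> g (\<gamma> t) \<noteq> 0) (at 0)"
    using arc_eventually[OF arc gB] by (simp add: eventually_at_filter) (auto elim: eventually_mono)
  then have nz: "eventually (\<lambda>t. g (\<gamma> t) \<noteq> 0) (at 0)" using off by eventually_elim simp
  have lim: "filterlim (\<lambda>s. complex_of_real s) (at 0) (at_right (0::real))"
    unfolding filterlim_at by (auto intro!: tendsto_eq_intros simp: eventually_at_filter)
  show ?thesis
  proof (cases "g (\<gamma> 0) = 0")
    case False
    have "((\<lambda>t. g (\<gamma> t)) \<longlongrightarrow> g (\<gamma> 0)) (at 0)" using arc_isCont[OF arc gs] by (simp add: isCont_def)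
    from filterlim_compose[OF this lim] have "((\<lambda>s. sgn (g (\<gamma> (of_real s)))) \<longlongrightarrow> sgn (g (\<gamma> 0))) (at_right (0::real))"
      using False by (intro tendsto_sgn)
    then show ?thesis using False by (intro exI[of _ "sgn (g (\<gamma> 0))"]) (simp add: norm_sgn)
  next
    case True
    \<comment> \<open>Off the centre the arc avoids \<open>B\<close>, so \<open>g\<close> is nonzero
      on it there. Hence the zero at 0 has finite order and a power of the parameter can be split
      off.\<close>
    have "\<not> (g \<circ> \<gamma>) constant_on ball 0 r"
    proof
      assume "(g \<circ> \<gamma>) constant_on ball 0 r"
      then have "\<And>t. t \<in> ball 0 r \<Longrightarrow> g (\<gamma> t) = 0" using r(1) True by (auto simp: constant_on_def)
      then have "eventually (\<lambda>t. g (\<gamma> t) = 0) (at 0)"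
        using eventually_at_ball[OF r(1), of 0 UNIV] by (auto elim: eventually_mono)
      with nz have "eventually (\<lambda>t::complex. False) (at 0)" by eventually_elim simp
      then show False by simp
    qed
    then obtain G \<delta> n where G: "0 < \<delta>" "G holomorphic_on ball 0 \<delta>"
        "\<And>w. w \<in> ball 0 \<delta> \<Longrightarrow> (g \<circ> \<gamma>) w = (w - 0) ^ n * G w" "\<And>w. w \<in> ball 0 \<delta> \<Longrightarrow> G w \<noteq> 0"
      using holomorphic_factor_zero_nonconstant[OF r(2) open_ball connected_ball, of 0 thesis] r(1) True
      by simp
    have "isCont G 0" using G(1,2) holomorphic_on_imp_continuous_on[OF G(2)] by (simp add: continuous_on_eq_continuous_at)
    then have "(G \<longlongrightarrow> G 0) (at 0)" by (simp add: isCont_def)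
    from filterlim_compose[OF this lim] have "((\<lambda>s. sgn (G (of_real s))) \<longlongrightarrow> sgn (G 0)) (at_right (0::real))"
      using G(1,4) by (intro tendsto_sgn) simp_all
    moreover have "eventually (\<lambda>s. sgn (G (of_real s)) = sgn (g (\<gamma> (of_real s)))) (at_right (0::real))"
      using eventually_at_right_real[OF G(1)]
    proof eventually_elim
      case (elim s)
      then have "g (\<gamma> (of_real s)) = of_real (s ^ n) * G (of_real s)" using G(3)[of "of_real s"] by simp
      \<comment> \<open>On the positive axis the power is a positive real and does not affect the
        direction.\<close>
      moreover have "sgn (complex_of_real (s ^ n)) = 1" using elim by (simp only: sgn_of_real) simp
      ultimately show ?case by (simp only: sgn_mult) simp
    qed
    ultimately have "((\<lambda>s. sgn (g (\<gamma> (of_real s)))) \<longlongrightarrow> sgn (G 0)) (at_right (0::real))"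
      by (rule Lim_transform_eventually)
    moreover have "cmod (sgn (G 0)) = 1" using G(1,4) by (simp add: norm_sgn)
    ultimately show ?thesis by blast
  qed
qed

lemma arc_direction_velocity:
  assumes arc: "complex_arc X \<gamma>" and gs: "g \<in> stalk X (\<gamma> 0)" and z: "g (\<gamma> 0) = 0" and v: "velocity X \<gamma> g \<noteq> 0"
  shows "((\<lambda>s. sgn (g (\<gamma> (of_real s)))) \<longlongrightarrow> sgn (velocity X \<gamma> g)) (at_right (0::real))"
proof -
  have lim: "filterlim (\<lambda>s. complex_of_real s) (at 0) (at_right (0::real))"
    unfolding filterlim_at by (auto intro!: tendsto_eq_intros simp: eventually_at_filter)
  have "((\<lambda>t. g (\<gamma> t)) has_field_derivative velocity X \<gamma> g) (at 0)"
    using arc_differentiable[OF arc gs] by (simp add: velocity_eq[of g \<gamma>, OF gs] field_differentiable_derivI)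
  then have "((\<lambda>t. g (\<gamma> t) / t) \<longlongrightarrow> velocity X \<gamma> g) (at 0)"
    unfolding has_field_derivative_iff by (simp add: z)
  from filterlim_compose[OF this lim]
  have "((\<lambda>s. sgn (g (\<gamma> (of_real s)) / of_real s)) \<longlongrightarrow> sgn (velocity X \<gamma> g)) (at_right (0::real))"
    using v by (intro tendsto_sgn)
  moreover have "eventually (\<lambda>s. sgn (g (\<gamma> (of_real s)) / of_real s) = sgn (g (\<gamma> (of_real s)))) (at_right (0::real))"
    using eventually_at_right_less
  proof eventually_elim
    case (elim s)
    have "sgn (g (\<gamma> (of_real s)) / of_real s) = sgn (g (\<gamma> (of_real s))) * sgn (complex_of_real (1 / s))"
      by (simp add: sgn_mult[symmetric])
    moreover have "sgn (complex_of_real (1 / s)) = 1" using elim by (simp only: sgn_of_real) simp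
    ultimately show ?case by simp
  qed
  ultimately show ?thesis by (rule Lim_transform_eventually)
qed

text \<open>The axioms of a log point hold because \<open>sgn\<close> is multiplicative and limits
  are unique. The second conclusion is the point of the construction: on functions with a simple
  zero along the arc the character is the direction of the velocity, so prescribing velocities
  prescribes directions.\<close>

lemma arc_log_point:
  assumes arc: "complex_arc X \<gamma>" and off: "eventually (\<lambda>t. \<gamma> t \<notin> B) (at 0)"
  obtains \<phi> where "(\<gamma> 0, \<phi>) \<in> log_space X B"
    "\<And>g. g \<in> log_monoid X B (\<gamma> 0) \<Longrightarrow> g (\<gamma> 0) = 0 \<Longrightarrow> velocity X \<gamma> g \<noteq> 0 \<Longrightarrow> \<phi> g = sgn (velocity X \<gamma> g)"
proof -
  define x where "x = \<gamma> 0"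
  note xp = arc_pts[OF arc, folded x_def]
  have ex: "\<forall>g\<in>log_monoid X B x. \<exists>l. cmod l = 1 \<and> ((\<lambda>s. sgn (g (\<gamma> (of_real s)))) \<longlongrightarrow> l) (at_right (0::real))"
    unfolding x_def by (intro ballI arc_direction[OF arc off])
  from bchoice[OF ex] obtain \<psi> where \<psi>: "\<And>g. g \<in> log_monoid X B x \<Longrightarrow> cmod (\<psi> g) = 1"
    "\<And>g. g \<in> log_monoid X B x \<Longrightarrow> ((\<lambda>s. sgn (g (\<gamma> (of_real s)))) \<longlongrightarrow> \<psi> g) (at_right (0::real))" by blast
  have uniq: "\<psi> g = l" if "g \<in> log_monoid X B x" "((\<lambda>s. sgn (g (\<gamma> (of_real s)))) \<longlongrightarrow> l) (at_right (0::real))" for g l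
    by (rule tendsto_unique[OF _ \<psi>(2)[OF that(1)] that(2)]) simp
  have lim: "filterlim (\<lambda>s. complex_of_real s) (at 0) (at_right (0::real))"
    unfolding filterlim_at by (auto intro!: tendsto_eq_intros simp: eventually_at_filter)
  have unit: "\<psi> g = sgn (g x)" if g: "g \<in> stalk X x" "g x \<noteq> 0" for g
  proof (rule uniq[OF unit_log_monoid[OF g]])
    have "((\<lambda>t. g (\<gamma> t)) \<longlongrightarrow> g x) (at 0)" using arc_isCont[OF arc, of g] g by (simp add: isCont_def x_def)
    from filterlim_compose[OF this lim] show "((\<lambda>s. sgn (g (\<gamma> (of_real s)))) \<longlongrightarrow> sgn (g x)) (at_right (0::real))"
      using g(2) by (intro tendsto_sgn)
  qed
  have one: "(\<lambda>y. 1) \<in> log_monoid X B x" by (rule unit_log_monoid[OF stalk_const[OF xp]]) simp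
  define \<phi> where "\<phi> = restrict \<psi> (log_monoid X B x)"
  have \<phi>: "\<phi> g = \<psi> g" if "g \<in> log_monoid X B x" for g using that by (simp add: \<phi>_def)
  have "(x, \<phi>) \<in> log_space X B"
    unfolding log_space_def mem_Collect_eq prod.case
  proof (intro conjI ballI impI)
    show "x \<in> pts X" by (rule xp)
    show "\<phi> \<in> extensional (log_monoid X B x)" by (simp add: \<phi>_def)
    show "\<phi> (\<lambda>y. 1) = 1" unfolding \<phi>[OF one] using unit[OF stalk_const[OF xp], of 1] by simp
  next
    fix g h assume g: "g \<in> log_monoid X B x" and h: "h \<in> log_monoid X B x" and e: "germ_eq X x g h"
    have "eventually (\<lambda>t. g (\<gamma> t) = h (\<gamma> t)) (nhds 0)"
      using e by (intro arc_eventually[OF arc]) (simp add: germ_eq_iff[OF xp] x_def[symmetric])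
    then have "eventually (\<lambda>t. g (\<gamma> t) = h (\<gamma> t)) (at 0)" by (simp add: eventually_at_filter) (auto elim: eventually_mono)
    then have "eventually (\<lambda>s. sgn (h (\<gamma> (of_real s))) = sgn (g (\<gamma> (of_real s)))) (at_right (0::real))"
      using eventually_compose_filterlim[OF _ lim] by (force elim: eventually_mono)
    then have "((\<lambda>s. sgn (g (\<gamma> (of_real s)))) \<longlongrightarrow> \<psi> h) (at_right (0::real))"
      by (rule Lim_transform_eventually[OF \<psi>(2)[OF h]])
    then show "\<phi> g = \<phi> h" unfolding \<phi>[OF g] \<phi>[OF h] by (rule uniq[OF g])
  next
    fix g assume g: "g \<in> log_monoid X B x"
    show "cmod (\<phi> g) = 1" unfolding \<phi>[OF g] by (rule \<psi>(1)[OF g])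
  next
    fix g h assume g: "g \<in> log_monoid X B x" and h: "h \<in> log_monoid X B x"
    note gh = log_monoid_mult[OF g h]
    show "\<phi> (\<lambda>y. g y * h y) = \<phi> g * \<phi> h"
      unfolding \<phi>[OF g] \<phi>[OF h] \<phi>[OF gh]
      by (rule uniq[OF gh]) (simp only: sgn_mult, intro tendsto_mult \<psi>(2) g h)
  next
    fix g assume "g \<in> stalk_units X x"
    then have g: "g \<in> stalk X x" "g x \<noteq> 0" by (simp_all add: stalk_units_iff)
    show "\<phi> g = g x / of_real (cmod (g x))" unfolding \<phi>[OF unit_log_monoid[OF g]] unit[OF g] by (rule sgn_eq)
  qed
  moreover have "\<phi> g = sgn (velocity X \<gamma> g)"
    if g: "g \<in> log_monoid X B x" and z: "g x = 0" "velocity X \<gamma> g \<noteq> 0" for g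
  proof -
    have gs: "g \<in> stalk X (\<gamma> 0)" using g by (simp add: log_monoid_iff[OF closed] x_def)
    show ?thesis unfolding \<phi>[OF g]
      by (rule uniq[OF g arc_direction_velocity[OF arc gs]]) (use z in \<open>simp_all add: x_def\<close>)
  qed
  ultimately show thesis unfolding x_def by (rule that)
qed

end

end

section \<open>The blowing-up in charts\<close>

lemma Vec_join: "z \<in> Vec r \<Longrightarrow> join n w z \<in> Vec (n + r)"
  by (auto simp: Vec_def join_def)

lemma join_less [simp]: "l < n \<Longrightarrow> join n w z l = w l"
  by (simp add: join_def)

lemma join_add [simp]: "join n w z (n + j) = z j"
  by (simp add: join_def)

lemma Vec_eqI: "w \<in> Vec n \<Longrightarrow> w' \<in> Vec n \<Longrightarrow> (\<And>l. l < n \<Longrightarrow> w l = w' l) \<Longrightarrow> w = w'"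
proof -
  assume *: "w \<in> Vec n" "w' \<in> Vec n" "\<And>l. l < n \<Longrightarrow> w l = w' l"
  show "w = w'"
  proof
    fix l show "w l = w' l" using * by (cases "l < n") (simp_all add: Vec_def)
  qed
qed

lemma polyfun_join: "p \<in> polyfun n \<Longrightarrow> p (join n w z) = p w"
  by (erule polyfun_cong) simp

definition trunc :: "nat \<Rightarrow> (nat \<Rightarrow> complex) \<Rightarrow> nat \<Rightarrow> complex" where
  "trunc n w = (\<lambda>l. if l < n then w l else 0)"

lemma trunc_Vec: "trunc n w \<in> Vec n" by (simp add: trunc_def Vec_def)

lemma polyfun_trunc: "p \<in> polyfun n \<Longrightarrow> p (trunc n w) = p w"
  by (erule polyfun_cong) (simp add: trunc_def)

lemma polyfun_join_trunc: "p \<in> polyfun (n + r) \<Longrightarrow> p (join n w (trunc r z)) = p (join n w z)"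
  by (erule polyfun_cong) (auto simp: trunc_def join_def)

text \<open>Differential of \<open>p\<close> at \<open>A\<close> in the direction \<open>u\<close>.
  Rows of a Jacobian matrix can thus be tested on vectors that come from derivations.\<close>

definition dpoly :: "nat \<Rightarrow> (nat \<Rightarrow> complex) \<Rightarrow> (nat \<Rightarrow> complex) \<Rightarrow> ((nat \<Rightarrow> complex) \<Rightarrow> complex) \<Rightarrow> complex" where
  "dpoly N A u p = (\<Sum>l<N. partial_deriv l p A * u l)"

lemma dpoly_add: "p \<in> polyfun n \<Longrightarrow> q \<in> polyfun n \<Longrightarrow> dpoly N A u (\<lambda>z. p z + q z) = dpoly N A u p + dpoly N A u q"
  by (simp add: dpoly_def partial_deriv_add algebra_simps sum.distrib)

lemma dpoly_mult: "p \<in> polyfun n \<Longrightarrow> q \<in> polyfun n \<Longrightarrow>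
    dpoly N A u (\<lambda>z. p z * q z) = dpoly N A u p * q A + p A * dpoly N A u q"
  by (simp add: dpoly_def partial_deriv_mult algebra_simps sum.distrib sum_distrib_left)

lemma dpoly_const: "dpoly N A u (\<lambda>z. c) = 0" by (simp add: dpoly_def)

lemma dpoly_coord: "i < N \<Longrightarrow> dpoly N A u (\<lambda>z. z i) = u i"
proof -
  assume "i < N"
  have "(\<Sum>l<N. partial_deriv l (\<lambda>z. z i) A * u l) = (\<Sum>l<N. if l = i then u l else 0)"
    by (intro sum.cong) auto
  then show ?thesis using \<open>i < N\<close> by (simp add: dpoly_def)
qed

lemma dpoly_diff: "p \<in> polyfun n \<Longrightarrow> q \<in> polyfun n \<Longrightarrow> dpoly N A u (\<lambda>z. p z - q z) = dpoly N A u p - dpoly N A u q"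
proof -
  assume p: "p \<in> polyfun n" and q: "q \<in> polyfun n"
  have "dpoly N A u (\<lambda>z. p z + (- 1) * q z) = dpoly N A u p + dpoly N A u (\<lambda>z. (- 1) * q z)"
    by (rule dpoly_add[OF p polyfun_cmult[OF q]])
  also have "dpoly N A u (\<lambda>z. (- 1) * q z) = - dpoly N A u q"
    using dpoly_mult[OF polyfun.const[of "- 1"] q, of N A u] by (simp add: dpoly_const)
  finally show ?thesis by simp
qed

lemma partial_deriv_polyfun_outside: "p \<in> polyfun n \<Longrightarrow> n \<le> l \<Longrightarrow> partial_deriv l p A = 0"
proof -
  assume *: "p \<in> polyfun n" "n \<le> l"
  have "(\<lambda>t. p (A(l := t))) = (\<lambda>t. p A)"
    by (rule ext, rule polyfun_cong[OF *(1)]) (use *(2) in auto)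
  then show ?thesis by (simp add: partial_deriv_def)
qed

lemma partial_deriv_cong:
  assumes "p \<in> polyfun n" "\<And>l. l < n \<Longrightarrow> A l = B l" "l < n"
  shows "partial_deriv l p A = partial_deriv l p B"
proof -
  have "(\<lambda>t. p (A(l := t))) = (\<lambda>t. p (B(l := t)))"
    by (rule ext, rule polyfun_cong[OF assms(1)]) (use assms(2) in auto)
  then show ?thesis using assms(2,3) by (simp add: partial_deriv_def)
qed

lemma dpoly_join: "p \<in> polyfun n \<Longrightarrow> dpoly (n + r) (join n w z) (join n u \<zeta>) p = dpoly n w u p"
proof -
  assume p: "p \<in> polyfun n"
  have "(\<Sum>l<n + r. partial_deriv l p (join n w z) * join n u \<zeta> l) = (\<Sum>l<n. partial_deriv l p (join n w z) * join n u \<zeta> l)"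
    by (rule sum.mono_neutral_right) (auto simp: partial_deriv_polyfun_outside[OF p])
  also have "\<dots> = (\<Sum>l<n. partial_deriv l p w * u l)"
    by (intro sum.cong refl) (simp add: partial_deriv_cong[OF p, of "join n w z" w])
  finally show ?thesis by (simp add: dpoly_def)
qed

section \<open>Pullback of germs and arcs along a morphism\<close>

locale variety_morphism = X: variety_space X + Y: variety_space Y
  for X :: "'a fspace" and Y :: "'b fspace" +
  fixes \<sigma> :: "'b \<Rightarrow> 'a"
  assumes morphism: "morphism Y X \<sigma>"
begin

lemma sigma_pts: "y \<in> pts Y \<Longrightarrow> \<sigma> y \<in> pts X"
proof -
  have "continuous_map (zar Y) (zar X) \<sigma>" using morphism unfolding morphism_def by (rule conjunct1)
  then show "y \<in> pts Y \<Longrightarrow> \<sigma> y \<in> pts X" using continuous_map_funspace by blast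
qed

lemma openin_sigma: "openin (zar X) W \<Longrightarrow> openin (zar Y) (pts Y \<inter> \<sigma> -` W)"
proof -
  assume W: "openin (zar X) W"
  have "continuous_map (zar Y) (zar X) \<sigma>" using morphism unfolding morphism_def by (rule conjunct1)
  from openin_continuous_map_preimage[OF this W] show ?thesis by (simp add: vimage_def Int_def)
qed

lemma closedin_sigma: "closedin (zar X) W \<Longrightarrow> closedin (zar Y) (pts Y \<inter> \<sigma> -` W)"
proof -
  assume W: "closedin (zar X) W"
  have "continuous_map (zar Y) (zar X) \<sigma>" using morphism unfolding morphism_def by (rule conjunct1)
  from closedin_continuous_map_preimage[OF this W] show ?thesis by (simp add: vimage_def Int_def)
qed

lemma eventually_sigma:
  assumes "y \<in> pts Y" "eventually P (znhds X (\<sigma> y))"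
  shows "eventually (\<lambda>y'. P (\<sigma> y')) (znhds Y y)"
proof -
  obtain W where W: "openin (zar X) W" "\<sigma> y \<in> W" "\<forall>x\<in>W. P x"
    using assms(2) unfolding eventually_znhds[OF sigma_pts[OF assms(1)]] by blast
  have "eventually (\<lambda>y'. y' \<in> pts Y \<inter> \<sigma> -` W) (znhds Y y)"
    using assms(1) W(2) by (intro eventually_znhds_open openin_sigma[OF W(1)]) simp
  then show ?thesis by eventually_elim (use W(3) in simp)
qed

lemma stalk_sigma:
  assumes "y \<in> pts Y" "f \<in> stalk X (\<sigma> y)"
  shows "(\<lambda>y'. f (\<sigma> y')) \<in> stalk Y y"
proof -
  obtain W where W: "openin (zar X) W" "\<sigma> y \<in> W" "f \<in> reg X W" using assms(2) unfolding stalk_def by blast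
  have "\<forall>U f. openin (zar X) U \<longrightarrow> f \<in> reg X U \<longrightarrow> f \<circ> \<sigma> \<in> reg Y (pts Y \<inter> \<sigma> -` U)"
    using morphism unfolding morphism_def by (rule conjunct2)
  then have "f \<circ> \<sigma> \<in> reg Y (pts Y \<inter> \<sigma> -` W)" using W(1,3) by simp
  moreover have "y \<in> pts Y \<inter> \<sigma> -` W" using assms(1) W(2) by simp
  ultimately show ?thesis using openin_sigma[OF W(1)] unfolding stalk_def comp_def by blast
qed

lemma arc_sigma_velocity:
  assumes "complex_arc Y \<gamma>" "\<gamma> 0 = y" "f \<in> stalk X (\<sigma> y)"
  shows "velocity Y \<gamma> (\<lambda>y'. f (\<sigma> y')) = deriv (\<lambda>t. f (\<sigma> (\<gamma> t))) 0"
proof -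
  have "y \<in> pts Y" using Y.arc_pts[OF assms(1)] assms(2) by simp
  then show ?thesis using Y.velocity_eq[of "\<lambda>y'. f (\<sigma> y')" \<gamma>] stalk_sigma[of y f] assms(2,3) by simp
qed

end

text \<open>The data that \<open>blowing_up\<close> provides near one point. Since
  \<open>z i\<close> normalises the homogeneous coordinates at the index \<open>i\<close>, the map
  \<open>b i\<close> is the standard affine chart with that index, and \<open>z i y i = 1\<close> on
  it.\<close>

locale blowup_chart = variety_morphism X Y \<sigma>
  for X :: "'a fspace" and Y :: "'b fspace" and \<sigma> +
  fixes C :: "'a set" and U :: "'a set" and n :: nat and a :: "'a \<Rightarrow> nat \<Rightarrow> complex"
    and r :: nat and g :: "nat \<Rightarrow> 'a \<Rightarrow> complex" and \<omega> :: "'b \<Rightarrow> nat \<Rightarrow> complex"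
    and z :: "nat \<Rightarrow> 'b \<Rightarrow> nat \<Rightarrow> complex" and V :: "nat \<Rightarrow> 'b set" and b :: "nat \<Rightarrow> 'b \<Rightarrow> nat \<Rightarrow> complex"
  defines "z i y j \<equiv> \<omega> y j / \<omega> y i"
    and "V i \<equiv> {y \<in> pts Y \<inter> \<sigma> -` U. \<omega> y i \<noteq> 0}"
    and "b i y \<equiv> join n (a (\<sigma> y)) (z i y)"
  assumes nonsing: "nonsingular_variety X"
    and closed: "closedin (zar X) C"
    and chart: "affine_chart X U n a"
    and g_reg: "\<And>i. i < r \<Longrightarrow> g i \<in> reg X U"
    and gen: "\<And>x. x \<in> U \<Longrightarrow> generates_ideal X C x {..<r} g"
    and indep: "\<And>x c. x \<in> U \<Longrightarrow> x \<in> C \<Longrightarrow> (\<And>v. v \<in> tangent X x \<Longrightarrow> (\<Sum>i<r. c i * v (g i)) = 0) \<Longrightarrow> \<forall>i<r. c i = 0"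
    and omega: "\<And>y. y \<in> pts Y \<Longrightarrow> \<sigma> y \<in> U \<Longrightarrow> \<omega> y \<in> Vec r \<and> (\<exists>i<r. \<omega> y i \<noteq> 0)"
    and charts: "\<And>i. i < r \<Longrightarrow> affine_chart Y (V i) (n + r) (b i)"
    and image: "\<And>i. i < r \<Longrightarrow> b i ` V i = {join n (a x) \<zeta> | x \<zeta>. x \<in> U \<and> \<zeta> \<in> Vec r \<and> \<zeta> i = 1 \<and>
                             (\<forall>j<r. \<forall>l<r. g j x * \<zeta> l = g l x * \<zeta> j)}"
begin

lemma V_D: "y \<in> V i \<Longrightarrow> y \<in> pts Y \<and> \<sigma> y \<in> U \<and> \<omega> y i \<noteq> 0"
  by (simp add: V_def)

lemma V_cover: "y \<in> pts Y \<Longrightarrow> \<sigma> y \<in> U \<Longrightarrow> \<exists>i<r. y \<in> V i"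
proof -
  assume y: "y \<in> pts Y" "\<sigma> y \<in> U"
  obtain i where "i < r" "\<omega> y i \<noteq> 0" using omega[OF y] by blast
  then show "\<exists>i<r. y \<in> V i" using y by (intro exI[of _ i]) (simp add: V_def)
qed

lemma U_pts: "x \<in> U \<Longrightarrow> x \<in> pts X"
  using affine_chart_subset[OF chart] by blast

lemma g_stalk: "j < r \<Longrightarrow> x \<in> U \<Longrightarrow> g j \<in> stalk X x"
  using iffD1[OF X.reg_iff_stalk[OF affine_chart_open[OF chart]] g_reg] by simp

lemma z_Vec: "y \<in> V i \<Longrightarrow> z i y \<in> Vec r"
proof -
  assume "y \<in> V i"
  then have "\<omega> y \<in> Vec r" using omega[of y] V_D[of y i] by simp
  then show "z i y \<in> Vec r" by (simp add: Vec_def z_def)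
qed

lemma z_self: "y \<in> V i \<Longrightarrow> z i y i = 1"
  using V_D[of y i] by (simp add: z_def)

text \<open>The homogeneous coordinates vanish from index \<open>r\<close> on, so a point of
  \<open>V i\<close> forces \<open>i < r\<close>. Later statements about points of
  \<open>V i\<close> obtain the bound this way.\<close>

lemma z_outside: "y \<in> V i \<Longrightarrow> i < r"
proof -
  assume y: "y \<in> V i"
  then have "\<omega> y \<in> Vec r" "\<omega> y i \<noteq> 0" using omega[of y] V_D[of y i] by simp_all
  then have "\<not> r \<le> i" by (auto simp: Vec_def)
  then show "i < r" by simp
qed

text \<open>Off the closed set \<open>C\<close> the constant 1 belongs to the ideal of
  \<open>C\<close>, hence is a combination of the generators, which therefore have no common zero
  there.\<close>

lemma g_zero_iff:
  assumes "x \<in> U"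
  shows "x \<in> C \<longleftrightarrow> (\<forall>j<r. g j x = 0)"
proof
  assume "x \<in> C"
  then show "\<forall>j<r. g j x = 0" using X.generates_ideal_zero[OF gen[OF assms]] by simp
next
  assume z: "\<forall>j<r. g j x = 0"
  note xp = U_pts[OF assms]
  show "x \<in> C"
  proof (rule ccontr)
    assume "x \<notin> C"
    then have "eventually (\<lambda>y. y \<in> pts X - C) (znhds X x)"
      using xp by (intro eventually_znhds_open openin_diff[OF openin_topspace closed]) simp
    then have "eventually (\<lambda>y. y \<in> C \<longrightarrow> (1::complex) = 0) (znhds X x)" by eventually_elim simp
    from X.generates_idealD[OF gen[OF assms] X.stalk_const[OF xp] this]
    obtain h where "eventually (\<lambda>y. (1::complex) = (\<Sum>j\<in>{..<r}. h j y * g j y)) (znhds X x)" .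
    from eventually_znhds_self[OF xp this] show False using z by simp
  qed
qed

lemma V_relation:
  assumes "y \<in> V i" "j < r"
  shows "g j (\<sigma> y) = z i y j * g i (\<sigma> y)"
proof -
  note i = z_outside[OF assms(1)] and yU = V_D[OF assms(1)]
  have "b i y \<in> b i ` V i" using assms(1) by blast
  then obtain x \<zeta> where x: "b i y = join n (a x) \<zeta>" "x \<in> U" "\<zeta> i = 1"
    "\<forall>j<r. \<forall>l<r. g j x * \<zeta> l = g l x * \<zeta> j" unfolding image[OF i] by blast
  have "a (\<sigma> y) l = a x l" if "l < n" for l using arg_cong[OF x(1), of "\<lambda>w. w l"] that by (simp add: b_def)
  then have "a (\<sigma> y) = a x"
    using affine_chart_Vec[OF chart, of "\<sigma> y"] affine_chart_Vec[OF chart, of x] yU x(2) by (intro Vec_eqI[of _ n]) simp_all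
  then have "\<sigma> y = x" using inj_onD[OF affine_chart_inj[OF chart]] yU x(2) by simp
  moreover have "\<zeta> l = z i y l" for l using arg_cong[OF x(1), of "\<lambda>w. w (n + l)"] by (simp add: b_def)
  ultimately show ?thesis using x(4)[rule_format, OF assms(2) i] x(3) by simp
qed

lemma V_point:
  assumes "i < r" "x \<in> U" "\<zeta> \<in> Vec r" "\<zeta> i = 1" "\<And>j. j < r \<Longrightarrow> g j x = \<zeta> j * g i x"
  shows "\<exists>y\<in>V i. \<sigma> y = x \<and> z i y = \<zeta>"
proof -
  have "\<forall>j<r. \<forall>l<r. g j x * \<zeta> l = g l x * \<zeta> j"
  proof (intro allI impI)
    fix j l assume "j < r" "l < r"
    then show "g j x * \<zeta> l = g l x * \<zeta> j" using assms(5)[of j] assms(5)[of l] by simp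
  qed
  then have "join n (a x) \<zeta> \<in> b i ` V i" unfolding image[OF assms(1)] using assms(2-4) by blast
  then obtain y where y: "y \<in> V i" "join n (a x) \<zeta> = b i y" by blast
  note yU = V_D[OF y(1)]
  have "a (\<sigma> y) l = a x l" if "l < n" for l using arg_cong[OF y(2), of "\<lambda>w. w l"] that by (simp add: b_def)
  then have "a (\<sigma> y) = a x"
    using affine_chart_Vec[OF chart, of "\<sigma> y"] affine_chart_Vec[OF chart, of x] yU assms(2) by (intro Vec_eqI[of _ n]) simp_all
  then have "\<sigma> y = x" using inj_onD[OF affine_chart_inj[OF chart]] yU assms(2) by simp
  moreover have "z i y = \<zeta>"
  proof
    fix l show "z i y l = \<zeta> l" using arg_cong[OF y(2), of "\<lambda>w. w (n + l)"] by (simp add: b_def)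
  qed
  ultimately show ?thesis using y(1) by blast
qed

lemma V_eqI:
  assumes "y \<in> V i" "y' \<in> V i" "\<sigma> y = \<sigma> y'" "\<And>j. j < r \<Longrightarrow> z i y j = z i y' j"
  shows "y = y'"
proof -
  have "z i y = z i y'" using assms(4) by (rule Vec_eqI[OF z_Vec[OF assms(1)] z_Vec[OF assms(2)]])
  then have "b i y = b i y'" using assms(3) by (simp add: b_def)
  then show ?thesis 
    using inj_onD[OF affine_chart_inj[OF charts[OF z_outside[OF assms(1)]]]] assms(1,2) by simp
qed

lemma z_stalk:
  assumes "y \<in> V i" "j < r"
  shows "(\<lambda>y'. z i y' j) \<in> stalk Y y"
  using Y.stalk_coord[OF charts[OF z_outside[OF assms(1)]] assms(1), of "n + j"] assms(2) by (simp add: b_def)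

lemma g_sigma_stalk:
  assumes "y \<in> V i" "j < r"
  shows "(\<lambda>y'. g j (\<sigma> y')) \<in> stalk Y y"
  using V_D[OF assms(1)] assms(2) by (intro stalk_sigma g_stalk) simp_all

lemma eventually_V: "y \<in> V i \<Longrightarrow> eventually (\<lambda>y'. y' \<in> V i) (znhds Y y)"
  by (rule eventually_znhds_open[OF affine_chart_open[OF charts[OF z_outside]]])

text \<open>Independence of the differentials along \<open>C\<close> is turned into surjectivity:
  every vector \<open>w\<close> is the coordinate vector of a vector normal to
  \<open>C\<close>.\<close>

lemma g_differentials_surj:
  assumes "x \<in> U" "x \<in> C"
  shows "\<exists>v\<in>tangent X x. \<forall>j<r. v (g j) = w j"
proof -
  define W where "W = {u. \<exists>v\<in>tangent X x. u = (\<lambda>j. v (g j))}"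
  have W: "(\<lambda>j. v (g j)) \<in> W" if "v \<in> tangent X x" for v
    unfolding W_def using that by (intro CollectI bexI[of _ v] refl)
  have "\<exists>u\<in>W. \<forall>j\<in>{..<r}. u j = w j"
  proof (rule independent_surj[OF finite_lessThan W[OF X.tangent_zero[OF U_pts[OF assms(1)]]]])
    fix c d :: complex and u1 u2
    assume "u1 \<in> W" "u2 \<in> W"
    then obtain v1 v2 where v: "v1 \<in> tangent X x" "v2 \<in> tangent X x" "u1 = (\<lambda>j. v1 (g j))" "u2 = (\<lambda>j. v2 (g j))"
      unfolding W_def by blast
    show "(\<lambda>i. c * u1 i + d * u2 i) \<in> W"
      using W[OF X.tangent_lincomb[OF v(1,2), of c d]] unfolding v(3,4) .
  next
    fix c :: "nat \<Rightarrow> complex"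
    assume c: "\<And>u. u \<in> W \<Longrightarrow> (\<Sum>i\<in>{..<r}. c i * u i) = 0"
    have "\<forall>i<r. c i = 0" by (rule indep[OF assms]) (rule c[OF W])
    then show "\<forall>i\<in>{..<r}. c i = 0" by simp
  qed
  then obtain u where u: "u \<in> W" "\<forall>j\<in>{..<r}. u j = w j" by blast
  then obtain v where "v \<in> tangent X x" "u = (\<lambda>j. v (g j))" unfolding W_def by blast
  then show ?thesis using u(2) by (intro bexI[of _ v]) simp_all
qed

end

lemma sum_lessThan_add: "(\<Sum>k<m + r. f k) = (\<Sum>k<m. f k) + (\<Sum>j<r. f (m + j))" for f :: "nat \<Rightarrow> complex"
  by (induction r) (simp_all add: algebra_simps)

context blowup_chart
begin

text \<open>The pairs \<open>(x, \<zeta>)\<close> with \<open>g j x = \<zeta> j * g i x\<close> and \<open>\<zeta> i = 1\<close> form a smooth zero set, in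
  coordinates in which \<open>X\<close> itself is a smooth zero set.\<close>

lemma curve_in_product:
  assumes xU: "x \<in> U" and xC: "x \<in> C" and i: "i < r" and z0: "z0 \<in> Vec r" "z0 i = 1"
    and v: "v \<in> tangent X x" and vg0: "\<forall>j<r. v (g j) = l0 * z0 j" and \<zeta>: "\<zeta> \<in> Vec r" "\<zeta> i = 0"
  shows "\<exists>\<xi> Z e. complex_arc X \<xi> \<and> \<xi> 0 = x \<and> velocity X \<xi> = v \<and> e > 0 \<and> Z 0 = z0 \<and>
    (\<forall>j. (\<lambda>t. Z t j) holomorphic_on ball 0 e \<and> ((\<lambda>t. Z t j) has_field_derivative \<zeta> j) (at 0)) \<and>
    (\<forall>t\<in>ball 0 e. \<xi> t \<in> U \<and> Z t \<in> Vec r \<and> Z t i = 1 \<and> (\<forall>j<r. g j (\<xi> t) = Z t j * g i (\<xi> t)))"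
proof -
  note xp = U_pts[OF xU] and vg = vg0[rule_format]
  have gx: "g j x = 0" if "j < r" for j using g_zero_iff[OF xU] xC that by simp
  \<comment> \<open>The chart that witnesses nonsingularity need not be the chart of the blowing-up.
    The generators \<open>g j\<close> are therefore rewritten as fractions in its
    coordinates.\<close>
  have "\<forall>x\<in>pts X. \<exists>U n a m f. affine_chart X U n a \<and> x \<in> U \<and>
        (\<forall>i<m. f i \<in> polyfun n) \<and> a ` U = {z \<in> Vec n. \<forall>i<m. f i z = 0} \<and>
        (\<forall>c :: nat \<Rightarrow> complex.
           (\<forall>j<n. (\<Sum>i<m. c i * partial_deriv j (f i) (a x)) = 0) \<longrightarrow> (\<forall>i<m. c i = 0))"
    using nonsing unfolding nonsingular_variety_def by (rule conjunct2)
  from bspec[OF this xp] obtain U1 n1 a1 f and m :: nat where ch1: "affine_chart X U1 n1 a1" "x \<in> U1"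
    and fp0: "\<forall>k<m. f k \<in> polyfun n1"
    and im: "a1 ` U1 = {z \<in> Vec n1. \<forall>i<m. f i z = 0}"
    and jac0: "\<forall>c. (\<forall>j<n1. (\<Sum>i<m. c i * partial_deriv j (f i) (a1 x)) = 0) \<longrightarrow> (\<forall>i<m. c i = 0)"
    by (elim exE conjE) (rule that, assumption+)
  note fp = fp0[rule_format] and jac = jac0[THEN spec, THEN mp]
  have "\<forall>j\<in>{..<r}. \<exists>p q. p \<in> polyfun n1 \<and> q \<in> polyfun n1 \<and> q (a1 x) \<noteq> 0 \<and>
     eventually (\<lambda>y. g j y = p (a1 y) / q (a1 y)) (znhds X x)"
  proof
    fix j assume "j \<in> {..<r}"
    then have "g j \<in> stalk X x" using g_stalk[of j, OF _ xU] by simp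
    then show "\<exists>p q. p \<in> polyfun n1 \<and> q \<in> polyfun n1 \<and> q (a1 x) \<noteq> 0 \<and>
     eventually (\<lambda>y. g j y = p (a1 y) / q (a1 y)) (znhds X x)"
      unfolding X.stalk_iff[OF ch1] by blast
  qed
  from bchoice[OF this] obtain p where "\<forall>j\<in>{..<r}. \<exists>q. p j \<in> polyfun n1 \<and> q \<in> polyfun n1 \<and> q (a1 x) \<noteq> 0 \<and>
     eventually (\<lambda>y. g j y = p j (a1 y) / q (a1 y)) (znhds X x)" ..
  from bchoice[OF this] obtain q where pq0: "\<forall>j\<in>{..<r}. p j \<in> polyfun n1 \<and> q j \<in> polyfun n1 \<and> q j (a1 x) \<noteq> 0 \<and>
     eventually (\<lambda>y. g j y = p j (a1 y) / q j (a1 y)) (znhds X x)" ..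
  have pq: "p j \<in> polyfun n1" "q j \<in> polyfun n1" "q j (a1 x) \<noteq> 0"
     "eventually (\<lambda>y. g j y = p j (a1 y) / q j (a1 y)) (znhds X x)" if "j < r" for j
    using bspec[OF pq0, of j] that by simp_all
  have p0: "p j (a1 x) = 0" if "j < r" for j
    using eventually_znhds_self[OF xp pq(4)[OF that]] gx[OF that] pq(3)[OF that] by simp
  have qnz: "eventually (\<lambda>y. q j (a1 y) \<noteq> 0) (znhds X x)" if "j < r" for j
    by (rule X.stalk_nonzero[OF X.stalk_polyfun[OF ch1 pq(2)[OF that]] pq(3)[OF that]])
  define col where "col u l = u (\<lambda>y. a1 y l)" for u :: "'a tvec" and l
  have dp: "dpoly n1 (a1 x) (col u) p' = u (\<lambda>y. p' (a1 y))" if "u \<in> tangent X x" "p' \<in> polyfun n1" for u p'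
    using X.tangent_polyfun[OF that(1) ch1 that(2)] by (simp add: dpoly_def col_def)
  have up: "u (\<lambda>y. p j (a1 y)) = q j (a1 x) * u (g j)" if "u \<in> tangent X x" "j < r" for u j
  proof -
    have "eventually (\<lambda>y. p j (a1 y) = q j (a1 y) * g j y) (znhds X x)"
      using pq(4)[OF that(2)] qnz[OF that(2)] by eventually_elim simp
    from X.tangent_multiple[OF that(1) X.stalk_polyfun[OF ch1 pq(2)[OF that(2)]] g_stalk[OF that(2) xU] gx[OF that(2)]
        X.stalk_polyfun[OF ch1 pq(1)[OF that(2)]] this]
    show ?thesis .
  qed
  define N A where "N = n1 + r" and "A = join n1 (a1 x) z0"
  \<comment> \<open>The equations \<open>\<zeta> i = 1\<close> and
    \<open>g j = \<zeta> j * g i\<close>, the latter with the denominators \<open>q\<close> cleared.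
    The coordinates from index \<open>n1\<close> on hold \<zeta>.\<close>
  define G where "G j = (if j = i then (\<lambda>w. w (n1 + i) - 1)
     else (\<lambda>w :: nat \<Rightarrow> complex. p j w * q i w - w (n1 + j) * (p i w * q j w)))" for j
  define F where "F k = (if k < m then f k else G (k - m))" for k
  have up1: "h \<in> polyfun N" if "h \<in> polyfun n1" for h using polyfun_mono[OF that] by (simp add: N_def)
  have Gp: "G j \<in> polyfun N" if "j < r" for j
  proof (cases "j = i")
    case True
    have "(\<lambda>w. w (n1 + i) - 1) \<in> polyfun N"
      by (intro polyfun_diff polyfun.const polyfun.coord) (simp add: N_def i)
    then show ?thesis by (simp add: G_def True)
  next
    case False
    have "(\<lambda>w. p j w * q i w - w (n1 + j) * (p i w * q j w)) \<in> polyfun N"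
      by (intro polyfun_diff polyfun.mult polyfun.coord up1 pq that i) (simp add: N_def that)
    then show ?thesis using False by (simp add: G_def)
  qed
  have Ap: "h A = h (a1 x)" if "h \<in> polyfun n1" for h unfolding A_def by (rule polyfun_join[OF that])
  have dA: "dpoly N A (join n1 u \<eta>) h = dpoly n1 (a1 x) u h" if "h \<in> polyfun n1" for h u \<eta>
    unfolding A_def N_def by (rule dpoly_join[OF that])
  have dF1: "dpoly N A (join n1 (col u) \<eta>) (f k) = 0" if "u \<in> tangent X x" "k < m" for u \<eta> k
  proof -
    have "eventually (\<lambda>y. y \<in> U1) (znhds X x)" by (rule eventually_znhds_open[OF affine_chart_open[OF ch1(1)] ch1(2)])
    then have "eventually (\<lambda>y. f k (a1 y) = 0) (znhds X x)"
    proof eventually_elim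
      case (elim y)
      then have "a1 y \<in> a1 ` U1" by blast
      then show ?case unfolding im using that(2) by simp
    qed
    from X.tangent_cong[OF that(1) X.stalk_polyfun[OF ch1 fp[OF that(2)]] this]
    show ?thesis unfolding dA[OF fp[OF that(2)]] dp[OF that(1) fp[OF that(2)]]
      using X.tangent_const[OF that(1) xp, of 0] by simp
  qed
  have dGi: "dpoly N A (join n1 u \<eta>) (G i) = \<eta> i" for u \<eta>
  proof -
    have "(\<lambda>w. w (n1 + i)) \<in> polyfun N" by (rule polyfun.coord) (simp add: N_def i)
    from dpoly_diff[OF this polyfun.const[of 1], of N A "join n1 u \<eta>"]
    show ?thesis using dpoly_coord[of "n1 + i" N A "join n1 u \<eta>"] by (simp add: G_def dpoly_const N_def i)
  qed
  \<comment> \<open>The term with \<open>\<eta> j\<close> drops out because \<open>p i\<close>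
    vanishes at \<open>a1 x\<close>. So these equations put no condition on the velocity of the
    fibre coordinates.\<close>
  have dGj: "dpoly N A (join n1 (col u) \<eta>) (G j) = q i (a1 x) * q j (a1 x) * (u (g j) - z0 j * u (g i))"
    if "u \<in> tangent X x" "j < r" "j \<noteq> i" for u \<eta> j
  proof -
    note pj = pq(1,2)[OF that(2)] and pi = pq(1,2)[OF i]
    have c: "(\<lambda>w. w (n1 + j)) \<in> polyfun N" by (rule polyfun.coord) (simp add: N_def that)
    note m1 = polyfun.mult[OF up1[OF pj(1)] up1[OF pi(2)]] and m2 = polyfun.mult[OF up1[OF pi(1)] up1[OF pj(2)]]
    have "dpoly N A (join n1 (col u) \<eta>) (G j) =
      dpoly N A (join n1 (col u) \<eta>) (\<lambda>w. p j w * q i w) - dpoly N A (join n1 (col u) \<eta>) (\<lambda>w. w (n1 + j) * (p i w * q j w))"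
      using that(3) dpoly_diff[OF m1 polyfun.mult[OF c m2]] by (simp add: G_def)
    also have "\<dots> = u (\<lambda>y. p j (a1 y)) * q i (a1 x) - z0 j * (u (\<lambda>y. p i (a1 y)) * q j (a1 x))"
      unfolding dpoly_mult[OF up1[OF pj(1)] up1[OF pi(2)]] dpoly_mult[OF c m2] dpoly_mult[OF up1[OF pi(1)] up1[OF pj(2)]]
        dA[OF pj(1)] dA[OF pj(2)] dA[OF pi(1)] dA[OF pi(2)] dp[OF that(1) pj(1)] dp[OF that(1) pi(1)]
        Ap[OF pj(1)] Ap[OF pj(2)] Ap[OF pi(1)] Ap[OF pi(2)] p0[OF that(2)] p0[OF i]
      by (simp add: A_def)
    also have "\<dots> = q i (a1 x) * q j (a1 x) * (u (g j) - z0 j * u (g i))"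
      unfolding up[OF that(1,2)] up[OF that(1) i] by (simp add: algebra_simps)
    finally show ?thesis .
  qed
  have "\<exists>e>0. \<exists>\<gamma>. \<gamma> 0 = A \<and> (\<forall>t\<in>ball 0 e. \<gamma> t \<in> Vec N \<and> (\<forall>k<m + r. F k (\<gamma> t) = 0)) \<and>
     (\<forall>j. (\<lambda>t. \<gamma> t j) holomorphic_on ball 0 e \<and> ((\<lambda>t. \<gamma> t j) has_field_derivative join n1 (col v) \<zeta> j) (at 0))"
  proof (rule polynomial_curve_exists)
    fix k assume k: "k < m + r"
    show "F k \<in> polyfun N" using k Gp[of "k - m"] up1[OF fp[of k]] by (auto simp: F_def)
    have "f k (a1 x) = 0" if "k < m"
    proof -
      have "a1 x \<in> a1 ` U1" using ch1(2) by blast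
      then show ?thesis unfolding im using that by simp
    qed
    moreover have "G j A = 0" if "j < r" for j
      using Ap[OF pq(1)[OF that]] Ap[OF pq(1)[OF i]] p0[OF that] p0[OF i] z0(2) by (simp add: G_def A_def)
    ultimately show "F k A = 0" using k Ap[OF fp[of k]] by (auto simp: F_def)
    have "dpoly N A (join n1 (col v) \<zeta>) (F k) = 0"
    proof (cases "k < m")
      case True
      then show ?thesis using dF1[OF v True] by (simp add: F_def)
    next
      case False
      then have j: "k - m < r" "F k = G (k - m)" using k by (auto simp: F_def)
      show ?thesis
      proof (cases "k - m = i")
        case True
        then show ?thesis unfolding j(2) using dGi \<zeta>(2) by simp
      next
        case False
        then show ?thesis unfolding j(2) dGj[OF v j(1) False] using vg[OF j(1)] vg[OF i] z0(2) by simp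
      qed
    qed
    then show "(\<Sum>j<N. partial_deriv j (F k) A * join n1 (col v) \<zeta> j) = 0" by (simp add: dpoly_def)
  next
    show "A \<in> Vec N" unfolding A_def N_def by (rule Vec_join[OF z0(1)])
    show "join n1 (col v) \<zeta> \<in> Vec N" unfolding N_def by (rule Vec_join[OF \<zeta>(1)])
  next
    fix c assume c: "\<And>j. j < N \<Longrightarrow> (\<Sum>k<m + r. c k * partial_deriv j (F k) A) = 0"
    \<comment> \<open>A relation between the rows, read as a relation between differentials that can
      be tested on any direction \<open>u\<close>.\<close>
    have tot: "(\<Sum>k<m. c k * dpoly N A u (f k)) + (\<Sum>j<r. c (m + j) * dpoly N A u (G j)) = 0" for u
    proof -
      have "(\<Sum>k<m + r. c k * dpoly N A u (F k)) = (\<Sum>j<N. (\<Sum>k<m + r. c k * partial_deriv j (F k) A) * u j)"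
        unfolding dpoly_def sum_distrib_left sum_distrib_right by (subst sum.swap) (simp add: algebra_simps)
      also have "\<dots> = 0" using c by simp
      finally show ?thesis unfolding sum_lessThan_add by (simp add: F_def)
    qed
    \<comment> \<open>Tested on the unit vector of the fibre coordinate \<open>i\<close> with the
      zero derivation, all other equations have differential zero.\<close>
    have "c (m + i) = 0"
    proof -
      define \<eta> where "\<eta> j = (if j = i then 1 else 0 :: complex)" for j
      note zt = X.tangent_zero[OF xp]
      have "(\<Sum>j<r. c (m + j) * dpoly N A (join n1 (col (\<lambda>f. 0)) \<eta>) (G j)) = (\<Sum>j<r. if j = i then c (m + j) else 0)"
      proof (intro sum.cong refl)
        fix j assume "j \<in> {..<r}"
        then show "c (m + j) * dpoly N A (join n1 (col (\<lambda>f. 0)) \<eta>) (G j) = (if j = i then c (m + j) else 0)"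
          using dGi[of "col (\<lambda>f. 0)" \<eta>] dGj[OF zt, of j \<eta>] by (simp add: \<eta>_def)
      qed
      then show ?thesis using tot[of "join n1 (col (\<lambda>f. 0)) \<eta>"] dF1[OF zt] i by simp
    qed
    note ci = this
    \<comment> \<open>Tested on a derivation without fibre component, the relation becomes one
      between the numbers \<open>u (g j)\<close>. Moving all multiples of \<open>u (g i)\<close>
      into the entry \<open>i\<close> gives the coefficients \<open>e'\<close>, to which
      independence along \<open>C\<close> applies.\<close>
    define e where "e j = c (m + j) * (q i (a1 x) * q j (a1 x))" for j
    define e' where "e' j = e j - (if j = i then (\<Sum>j<r. e j * z0 j) else 0)" for j
    have "\<forall>j<r. e' j = 0"
    proof (rule indep[OF xU xC])
      fix u assume u: "u \<in> tangent X x"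
      have "(\<Sum>j<r. c (m + j) * dpoly N A (join n1 (col u) (\<lambda>_. 0)) (G j)) = (\<Sum>j<r. e j * (u (g j) - z0 j * u (g i)))"
      proof (intro sum.cong refl)
        fix j assume "j \<in> {..<r}"
        then show "c (m + j) * dpoly N A (join n1 (col u) (\<lambda>_. 0)) (G j) = e j * (u (g j) - z0 j * u (g i))"
          using dGj[OF u, of j "\<lambda>_. 0"] ci by (cases "j = i") (simp_all add: e_def)
      qed
      then have "(\<Sum>j<r. e j * (u (g j) - z0 j * u (g i))) = 0"
        using tot[of "join n1 (col u) (\<lambda>_. 0)"] dF1[OF u] by simp
      then have "(\<Sum>j<r. e j * u (g j)) - (\<Sum>j<r. e j * z0 j) * u (g i) = 0"
        by (simp add: algebra_simps sum_subtractf sum_distrib_left)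
      moreover have "(\<Sum>j<r. (if j = i then (\<Sum>j<r. e j * z0 j) else 0) * u (g j)) = (\<Sum>j<r. e j * z0 j) * u (g i)"
      proof -
        have "(\<Sum>j<r. (if j = i then (\<Sum>j<r. e j * z0 j) else 0) * u (g j)) =
          (\<Sum>j<r. if j = i then (\<Sum>j<r. e j * z0 j) * u (g j) else 0)" by (intro sum.cong) auto
        then show ?thesis using i by simp
      qed
      ultimately show "(\<Sum>j<r. e' j * u (g j)) = 0"
        unfolding e'_def left_diff_distrib sum_subtractf by simp
    qed
    then have cj: "c (m + j) = 0" if "j < r" for j
      using that ci pq(3)[OF that] pq(3)[OF i] by (cases "j = i") (auto simp: e'_def e_def)
    have "\<forall>k<m. c k = 0"
    proof (rule jac, intro allI impI)
      fix j assume j: "j < n1"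
      have "(\<Sum>k<m + r. c k * partial_deriv j (F k) A) = (\<Sum>k<m. c k * partial_deriv j (f k) A)"
        unfolding sum_lessThan_add using cj by (simp add: F_def)
      also have "\<dots> = (\<Sum>k<m. c k * partial_deriv j (f k) (a1 x))"
      proof (intro sum.cong refl)
        fix k assume "k \<in> {..<m}"
        then have "partial_deriv j (f k) A = partial_deriv j (f k) (a1 x)"
          by (intro partial_deriv_cong[OF fp _ j]) (simp_all add: A_def)
        then show "c k * partial_deriv j (f k) A = c k * partial_deriv j (f k) (a1 x)" by simp
      qed
      finally show "(\<Sum>k<m. c k * partial_deriv j (f k) (a1 x)) = 0" using c[of j] j by (simp add: N_def)
    qed
    then show "\<forall>k<m + r. c k = 0"
      using cj by (metis add_diff_inverse_nat nat_add_left_cancel_less)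
  qed
  then obtain e \<Gamma> where e: "e > 0" and \<Gamma>0: "\<Gamma> 0 = A"
    and \<Gamma>1: "\<forall>t\<in>ball 0 e. \<Gamma> t \<in> Vec N \<and> (\<forall>k<m + r. F k (\<Gamma> t) = 0)"
    and \<Gamma>2: "\<forall>j. (\<lambda>t. \<Gamma> t j) holomorphic_on ball 0 e \<and>
       ((\<lambda>t. \<Gamma> t j) has_field_derivative join n1 (col v) \<zeta> j) (at 0)"
    by (elim exE conjE) (rule that, assumption+)
  have \<Gamma>: "\<Gamma> t \<in> Vec N" "k < m + r \<Longrightarrow> F k (\<Gamma> t) = 0" if "t \<in> ball 0 e" for t k
    using bspec[OF \<Gamma>1 that] by simp_all
  have hol: "(\<lambda>t. \<Gamma> t j) holomorphic_on ball 0 e"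
    and der: "((\<lambda>t. \<Gamma> t j) has_field_derivative join n1 (col v) \<zeta> j) (at 0)" for j
    using spec[OF \<Gamma>2, of j] by simp_all
  have "trunc n1 (\<Gamma> t) \<in> a1 ` U1" if t: "t \<in> ball 0 e" for t
  proof -
    have "f k (trunc n1 (\<Gamma> t)) = 0" if "k < m" for k
      using \<Gamma>(2)[OF t, of k] that polyfun_trunc[OF fp[OF that]] by (simp add: F_def)
    then show ?thesis unfolding im using trunc_Vec by simp
  qed
  then have "\<forall>t\<in>ball 0 e. \<exists>y. y \<in> U1 \<and> a1 y = trunc n1 (\<Gamma> t)" by (metis imageE)
  from bchoice[OF this] obtain \<xi> where \<xi>: "\<And>t. t \<in> ball 0 e \<Longrightarrow> \<xi> t \<in> U1" "\<And>t. t \<in> ball 0 e \<Longrightarrow> a1 (\<xi> t) = trunc n1 (\<Gamma> t)"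
    by blast
  have arc: "complex_arc X \<xi>"
  proof (rule X.complex_arc_chart[OF ch1(1) e \<xi>(1)])
    fix j assume j: "j < n1"
    show "(\<lambda>t. a1 (\<xi> t) j) holomorphic_on ball 0 e"
      by (rule holomorphic_transform[OF hol[of j]]) (simp add: \<xi>(2) trunc_def j)
  qed
  have z0e: "0 \<in> ball (0::complex) e" using e by simp
  have \<xi>0: "\<xi> 0 = x"
  proof -
    have "a1 (\<xi> 0) = a1 x" unfolding \<xi>(2)[OF z0e] \<Gamma>0 A_def
      by (rule Vec_eqI[OF trunc_Vec affine_chart_Vec[OF ch1]]) (simp add: trunc_def)
    then show ?thesis using inj_onD[OF affine_chart_inj[OF ch1(1)]] \<xi>(1)[OF z0e] ch1(2) by simp
  qed
  have vel: "velocity X \<xi> = v"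
  proof (rule X.tangent_eqI[OF X.velocity_tangent[OF arc, unfolded \<xi>0] v ch1])
    fix j assume j: "j < n1"
    have "eventually (\<lambda>t. t \<in> ball 0 e) (nhds (0::complex))" using e by (intro eventually_nhds_in_open) auto
    then have ev: "eventually (\<lambda>t. a1 (\<xi> t) j = \<Gamma> t j) (nhds 0)"
      by eventually_elim (simp add: \<xi>(2) trunc_def j)
    have "velocity X \<xi> (\<lambda>y. a1 y j) = deriv (\<lambda>t. a1 (\<xi> t) j) 0"
      by (rule X.velocity_eq) (simp add: \<xi>0 X.stalk_coord[OF ch1 j])
    also have "\<dots> = deriv (\<lambda>t. \<Gamma> t j) 0" by (rule deriv_cong_ev[OF ev refl])
    also have "\<dots> = col v j" using DERIV_imp_deriv[OF der[of j]] j by simp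
    finally show "velocity X \<xi> (\<lambda>y. a1 y j) = v (\<lambda>y. a1 y j)" by (simp add: col_def)
  qed
  define Z where "Z t = (\<lambda>j. if j < r then \<Gamma> t (n1 + j) else 0)" for t
  have Zhol: "(\<lambda>t. Z t j) holomorphic_on ball 0 e" for j
    using hol[of "n1 + j"] by (cases "j < r") (simp_all add: Z_def)
  have Zder: "((\<lambda>t. Z t j) has_field_derivative \<zeta> j) (at 0)" for j
    using der[of "n1 + j"] \<zeta>(1) by (cases "j < r") (simp_all add: Z_def Vec_def)
  have ZV: "Z t \<in> Vec r" for t by (simp add: Z_def Vec_def)
  have Z0: "Z 0 = z0" using z0(1) by (intro Vec_eqI[OF ZV]) (simp_all add: Z_def \<Gamma>0 A_def)
  \<comment> \<open>The fractions represent the \<open>g j\<close> only near \<open>x\<close>; this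
    is the reason for passing to the smaller radius \<open>e2\<close>.\<close>
  have "eventually (\<lambda>y. y \<in> U \<and> (\<forall>j\<in>{..<r}. g j y = p j (a1 y) / q j (a1 y) \<and> q j (a1 y) \<noteq> 0)) (znhds X x)"
    using pq(4) qnz
    by (intro eventually_conj eventually_ball_finite ballI eventually_znhds_open[OF affine_chart_open[OF chart] xU]) simp_all
  then have "eventually (\<lambda>t. \<xi> t \<in> U \<and> (\<forall>j\<in>{..<r}. g j (\<xi> t) = p j (a1 (\<xi> t)) / q j (a1 (\<xi> t)) \<and> q j (a1 (\<xi> t)) \<noteq> 0)) (nhds 0)"
    by (intro X.arc_eventually[OF arc]) (simp add: \<xi>0)
  then obtain e1 where e1: "e1 > 0" "\<And>t. dist t 0 < e1 \<Longrightarrow> \<xi> t \<in> U \<and> (\<forall>j\<in>{..<r}. g j (\<xi> t) = p j (a1 (\<xi> t)) / q j (a1 (\<xi> t)) \<and> q j (a1 (\<xi> t)) \<noteq> 0)"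
    unfolding eventually_nhds_metric by blast
  define e2 where "e2 = min e e1"
  have e2: "e2 > 0" "ball 0 e2 \<subseteq> ball (0::complex) e" using e e1(1) by (auto simp: e2_def)
  have "\<xi> t \<in> U \<and> Z t \<in> Vec r \<and> Z t i = 1 \<and> (\<forall>j<r. g j (\<xi> t) = Z t j * g i (\<xi> t))" if t: "t \<in> ball 0 e2" for t
  proof -
    have te: "t \<in> ball 0 e" and t1: "dist t 0 < e1" using t by (auto simp: e2_def dist_commute)
    note E = e1(2)[OF t1]
    have Gt: "G j (\<Gamma> t) = 0" if "j < r" for j using \<Gamma>(2)[OF te, of "m + j"] that by (simp add: F_def)
    have Zi: "Z t i = 1" using Gt[OF i] i by (simp add: G_def Z_def)
    have "g j (\<xi> t) = Z t j * g i (\<xi> t)" if j: "j < r" for j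
    proof (cases "j = i")
      case True
      then show ?thesis using Zi by simp
    next
      case False
      have ev: "h (a1 (\<xi> t)) = h (\<Gamma> t)" if "h \<in> polyfun n1" for h unfolding \<xi>(2)[OF te] by (rule polyfun_trunc[OF that])
      have "g k (\<xi> t) = p k (\<Gamma> t) / q k (\<Gamma> t)" "q k (\<Gamma> t) \<noteq> 0" if "k < r" for k
        using E that ev[OF pq(1)[OF that]] ev[OF pq(2)[OF that]] by auto
      note gk = this[OF j] this[OF i]
      have "p j (\<Gamma> t) * q i (\<Gamma> t) = Z t j * (p i (\<Gamma> t) * q j (\<Gamma> t))"
        using Gt[OF j] False j by (simp add: G_def Z_def)
      moreover have "p j (\<Gamma> t) = g j (\<xi> t) * q j (\<Gamma> t)" "p i (\<Gamma> t) = g i (\<xi> t) * q i (\<Gamma> t)"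
        using gk by simp_all
      ultimately have "(q j (\<Gamma> t) * q i (\<Gamma> t)) * g j (\<xi> t) = (q j (\<Gamma> t) * q i (\<Gamma> t)) * (Z t j * g i (\<xi> t))"
        by (simp add: algebra_simps)
      then show ?thesis using gk(2,4) by simp
    qed
    then show ?thesis using E ZV Zi by blast
  qed
  moreover have "(\<lambda>t. Z t j) holomorphic_on ball 0 e2" for j using Zhol e2(2) by (rule holomorphic_on_subset)
  ultimately show ?thesis
    using arc \<xi>0 vel e2(1) Z0 Zder by (intro exI[of _ \<xi>] exI[of _ Z] exI[of _ e2]) simp
qed

lemma chart_coordinates_holomorphic:
  assumes "complex_arc X \<xi>" "\<xi> 0 \<in> U"
  shows "\<exists>e>0. \<forall>l<n. (\<lambda>t. a (\<xi> t) l) holomorphic_on ball 0 e"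
proof -
  have "\<exists>e>0. (\<lambda>t. a (\<xi> t) l) holomorphic_on ball 0 e" if l: "l < n" for l
  proof -
    obtain e where "e > 0" "((\<lambda>y. a y l) \<circ> \<xi>) holomorphic_on ball 0 e"
      by (rule X.arc_holomorphic[OF assms(1) X.stalk_coord[OF chart assms(2) l]])
    then show ?thesis by (intro exI[of _ e]) (simp add: comp_def)
  qed
  then have "\<forall>l\<in>{..<n}. \<exists>e>0. (\<lambda>t. a (\<xi> t) l) holomorphic_on ball 0 e" by simp
  from bchoice[OF this] obtain e where e: "\<And>l. l < n \<Longrightarrow> e l > 0" "\<And>l. l < n \<Longrightarrow> (\<lambda>t. a (\<xi> t) l) holomorphic_on ball 0 (e l)"
    by auto
  define e0 where "e0 = Min (insert 1 (e ` {..<n}))"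
  have "e0 > 0" unfolding e0_def using e(1) by (subst Min_gr_iff) auto
  moreover have "(\<lambda>t. a (\<xi> t) l) holomorphic_on ball 0 e0" if "l < n" for l
  proof (rule holomorphic_on_subset[OF e(2)[OF that]])
    have "e0 \<le> e l" unfolding e0_def using that by (intro Min_le) auto
    then show "ball 0 e0 \<subseteq> ball 0 (e l)" by (rule subset_ball)
  qed
  ultimately show ?thesis by blast
qed

text \<open>The hypotheses are the compatibility conditions for velocities upstairs: differentiating
  \<open>g j = z j * g i\<close> where \<open>g i\<close> vanishes forces the values on the
  \<open>g j\<close> to be proportional to \<open>z i y\<close>, and \<open>z i y i = 1\<close>
  forces \<open>\<zeta> i = 0\<close>. The curve in the product supplies the coordinates of the arc
  in the chart.\<close>

lemma arc_exists:
  assumes y: "y \<in> V i" and yC: "\<sigma> y \<in> C" and v: "v \<in> tangent X (\<sigma> y)"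
    and vg: "\<And>j. j < r \<Longrightarrow> v (g j) = l0 * z i y j" and \<zeta>: "\<zeta> i = 0"
  obtains \<gamma> where "complex_arc Y \<gamma>" "\<gamma> 0 = y" "complex_arc X (\<lambda>t. \<sigma> (\<gamma> t))" "velocity X (\<lambda>t. \<sigma> (\<gamma> t)) = v"
    "\<And>f. f \<in> stalk X (\<sigma> y) \<Longrightarrow> velocity Y \<gamma> (\<lambda>y'. f (\<sigma> y')) = v f"
    "\<And>j. j < r \<Longrightarrow> velocity Y \<gamma> (\<lambda>y'. z i y' j) = \<zeta> j"
proof -
  note i = z_outside[OF y]
  have xU: "\<sigma> y \<in> U" using V_D[OF y] by simp
  have "trunc r \<zeta> i = 0" by (simp add: trunc_def \<zeta>)
  from curve_in_product[OF xU yC i z_Vec[OF y] z_self[OF y] v _ trunc_Vec this, of l0] vg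
  obtain \<xi> Z e where \<xi>: "complex_arc X \<xi>" "\<xi> 0 = \<sigma> y" "velocity X \<xi> = v" and e: "e > 0" and Z0: "Z 0 = z i y"
    and Z1: "\<forall>j. (\<lambda>t. Z t j) holomorphic_on ball 0 e \<and> ((\<lambda>t. Z t j) has_field_derivative trunc r \<zeta> j) (at 0)"
    and Z2: "\<forall>t\<in>ball 0 e. \<xi> t \<in> U \<and> Z t \<in> Vec r \<and> Z t i = 1 \<and> (\<forall>j<r. g j (\<xi> t) = Z t j * g i (\<xi> t))"
    by (auto elim!: exE conjE)
  note on = bspec[OF Z2]
  have hol: "(\<lambda>t. Z t j) holomorphic_on ball 0 e"
    and der: "((\<lambda>t. Z t j) has_field_derivative trunc r \<zeta> j) (at 0)" for j
    using spec[OF Z1, of j] by simp_all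
  obtain e1 where e1: "e1 > 0" "\<And>l. l < n \<Longrightarrow> (\<lambda>t. a (\<xi> t) l) holomorphic_on ball 0 e1"
    using chart_coordinates_holomorphic[OF \<xi>(1)] \<xi>(2) xU by auto
  have "\<forall>t\<in>ball 0 e. \<exists>y'. y' \<in> V i \<and> \<sigma> y' = \<xi> t \<and> z i y' = Z t"
  proof
    fix t :: complex assume t: "t \<in> ball 0 e"
    have "\<exists>y'\<in>V i. \<sigma> y' = \<xi> t \<and> z i y' = Z t" using on[OF t] by (intro V_point[OF i]) simp_all
    then show "\<exists>y'. y' \<in> V i \<and> \<sigma> y' = \<xi> t \<and> z i y' = Z t" by blast
  qed
  from bchoice[OF this] obtain \<gamma>' where \<gamma>': "\<And>t. t \<in> ball 0 e \<Longrightarrow> \<gamma>' t \<in> V i \<and> \<sigma> (\<gamma>' t) = \<xi> t \<and> z i (\<gamma>' t) = Z t"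
    by blast
  define e2 where "e2 = min e e1"
  have e2: "e2 > 0" "ball (0::complex) e2 \<subseteq> ball 0 e" "ball (0::complex) e2 \<subseteq> ball 0 e1" using e e1(1) by (auto simp: e2_def)
  have \<gamma>: "\<gamma>' t \<in> V i" "\<sigma> (\<gamma>' t) = \<xi> t" "z i (\<gamma>' t) = Z t" if "t \<in> ball 0 e2" for t
    using \<gamma>'[of t] that e2(2) by auto
  have z0: "0 \<in> ball (0::complex) e2" using e2(1) by simp
  have arc: "complex_arc Y \<gamma>'"
  proof (rule Y.complex_arc_chart[OF charts[OF i] e2(1) \<gamma>(1)])
    fix l assume l: "l < n + r"
    show "(\<lambda>t. b i (\<gamma>' t) l) holomorphic_on ball 0 e2"
    proof (cases "l < n")
      case True
      show ?thesis
        by (rule holomorphic_transform[OF holomorphic_on_subset[OF e1(2)[OF True] e2(3)]]) (simp add: b_def True \<gamma>)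
    next
      case False
      show ?thesis
        by (rule holomorphic_transform[OF holomorphic_on_subset[OF hol[of "l - n"] e2(2)]]) (simp add: b_def join_def False \<gamma>)
    qed
  qed
  have \<gamma>0: "\<gamma>' 0 = y"
    by (rule V_eqI[OF \<gamma>(1)[OF z0] y]) (simp_all add: \<gamma>[OF z0] \<xi>(2) Z0)
  have "eventually (\<lambda>t. t \<in> ball 0 e2) (nhds (0::complex))" using e2(1) by (intro eventually_nhds_in_open) auto
  then have ev: "eventually (\<lambda>t. \<sigma> (\<gamma>' t) = \<xi> t) (nhds 0)" "eventually (\<lambda>t. z i (\<gamma>' t) = Z t) (nhds 0)"
    by (eventually_elim; simp add: \<gamma>)+
  have velf: "velocity Y \<gamma>' (\<lambda>y'. f (\<sigma> y')) = v f" if f: "f \<in> stalk X (\<sigma> y)" for f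
  proof -
    have "velocity Y \<gamma>' (\<lambda>y'. f (\<sigma> y')) = deriv (\<lambda>t. f (\<sigma> (\<gamma>' t))) 0"
      by (rule arc_sigma_velocity[OF arc \<gamma>0 f])
    also have "\<dots> = deriv (\<lambda>t. f (\<xi> t)) 0"
      by (rule deriv_cong_ev[OF _ refl]) (use ev(1) in eventually_elim, simp)
    also have "\<dots> = velocity X \<xi> f" using X.velocity_eq[of f \<xi>] f \<xi>(2) by simp
    finally show ?thesis by (simp add: \<xi>(3))
  qed
  have velz: "velocity Y \<gamma>' (\<lambda>y'. z i y' j) = \<zeta> j" if j: "j < r" for j
  proof -
    have "velocity Y \<gamma>' (\<lambda>y'. z i y' j) = deriv (\<lambda>t. z i (\<gamma>' t) j) 0"
      by (rule Y.velocity_eq) (simp add: \<gamma>0 z_stalk[OF y j])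
    also have "\<dots> = deriv (\<lambda>t. Z t j) 0"
      by (rule deriv_cong_ev[OF _ refl]) (use ev(2) in eventually_elim, simp)
    also have "\<dots> = \<zeta> j" using DERIV_imp_deriv[OF der[of j]] j by (simp add: trunc_def)
    finally show ?thesis .
  qed
  \<comment> \<open>The curve \<xi> and the projected arc are known to agree only near 0, so the
    projected arc and its velocity are treated separately.\<close>
  have arc2: "complex_arc X (\<lambda>t. \<sigma> (\<gamma>' t))"
  proof (rule X.complex_arc_chart[OF chart e2(1)])
    fix t :: complex assume t: "t \<in> ball 0 e2"
    show "\<sigma> (\<gamma>' t) \<in> U" using V_D[OF \<gamma>(1)[OF t]] by simp
  next
    fix l assume l: "l < n"
    show "(\<lambda>t. a (\<sigma> (\<gamma>' t)) l) holomorphic_on ball 0 e2"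
      by (rule holomorphic_transform[OF holomorphic_on_subset[OF e1(2)[OF l] e2(3)]]) (simp add: \<gamma>)
  qed
  have "velocity X (\<lambda>t. \<sigma> (\<gamma>' t)) = v"
  proof (rule X.tangent_eqI[OF _ v chart xU])
    show "velocity X (\<lambda>t. \<sigma> (\<gamma>' t)) \<in> tangent X (\<sigma> y)" using X.velocity_tangent[OF arc2] by (simp add: \<gamma>0)
    fix l assume l: "l < n"
    note st = X.stalk_coord[OF chart xU l]
    have "velocity X (\<lambda>t. \<sigma> (\<gamma>' t)) (\<lambda>y. a y l) = deriv (\<lambda>t. a (\<sigma> (\<gamma>' t)) l) 0"
      by (rule X.velocity_eq) (simp add: \<gamma>0 st)
    also have "\<dots> = velocity Y \<gamma>' (\<lambda>y'. a (\<sigma> y') l)" using arc_sigma_velocity[OF arc \<gamma>0 st] by simp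
    also have "\<dots> = v (\<lambda>y. a y l)" by (rule velf[OF st])
    finally show "velocity X (\<lambda>t. \<sigma> (\<gamma>' t)) (\<lambda>y. a y l) = v (\<lambda>y. a y l)" .
  qed
  then show thesis by (rule that[OF arc \<gamma>0 arc2 _ velf velz])
qed

end

section \<open>The exceptional divisor and the strict transforms\<close>

lemma sum_powers_zero:
  assumes "\<And>t :: complex. (\<Sum>k<d. c k * t ^ k) = 0"
  shows "\<forall>k<d. c k = 0"
proof (cases d)
  case (Suc d')
  have "\<forall>t. (\<Sum>k\<le>d'. c k * t ^ k) = 0" using assms unfolding Suc lessThan_Suc_atMost by blast
  then have "\<forall>k\<le>d'. c k = 0" unfolding polyfun_eq_0 .
  then show ?thesis using Suc by simp
qed simp

context blowup_chart
begin

lemma exc_iff: "y \<in> V i \<Longrightarrow> g i (\<sigma> y) = 0 \<longleftrightarrow> \<sigma> y \<in> C"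
proof -
  assume y: "y \<in> V i"
  have xU: "\<sigma> y \<in> U" using V_D[OF y] by simp
  show ?thesis unfolding g_zero_iff[OF xU]
  proof
    assume "g i (\<sigma> y) = 0"
    then show "\<forall>j<r. g j (\<sigma> y) = 0" by (simp add: V_relation[OF y])
  qed (simp add: z_outside[OF y])
qed

text \<open>Take velocity \<open>z i y\<close> on the generators, the case \<open>l0 = 1\<close>,
  and constant fibre coordinates to first order. The arc leaves the exceptional divisor with unit
  speed, which is used to cancel \<open>g i\<close> and to show that its differential is
  nonzero.\<close>

lemma transversal_arc:
  assumes "y \<in> V i" "\<sigma> y \<in> C"
  obtains \<gamma> where "complex_arc Y \<gamma>" "\<gamma> 0 = y" "velocity Y \<gamma> (\<lambda>y'. g i (\<sigma> y')) = 1"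
proof -
  have xU: "\<sigma> y \<in> U" using V_D[OF assms(1)] by simp
  note i = z_outside[OF assms(1)]
  obtain v where v: "v \<in> tangent X (\<sigma> y)" "\<forall>j<r. v (g j) = z i y j"
    using g_differentials_surj[OF xU assms(2)] by blast
  have "v (g j) = 1 * z i y j" if "j < r" for j using v(2) that by simp
  from arc_exists[OF assms v(1) this, of "\<lambda>_. 0"] obtain \<gamma> where \<gamma>: "complex_arc Y \<gamma>" "\<gamma> 0 = y"
     "\<And>f. f \<in> stalk X (\<sigma> y) \<Longrightarrow> velocity Y \<gamma> (\<lambda>y'. f (\<sigma> y')) = v f" by metis
  have "velocity Y \<gamma> (\<lambda>y'. g i (\<sigma> y')) = 1"
    using \<gamma>(3)[OF g_stalk[OF i xU]] v(2) i z_self[OF assms(1)] by simp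
  then show thesis by (rule that[OF \<gamma>(1,2)])
qed

text \<open>Off the exceptional divisor \<open>g i\<close> is nonzero. On it, a transversal arc
  leaves the divisor at once, so \<open>f\<close> vanishes along the punctured arc and by continuity
  at its start. The argument is applied at every point near \<open>y\<close>, since a germ has to be
  killed.\<close>

lemma exc_cancel:
  assumes y: "y \<in> V i" "\<sigma> y \<in> C" and f: "f \<in> stalk Y y"
    and ev: "eventually (\<lambda>y'. f y' * g i (\<sigma> y') = 0) (znhds Y y)"
  shows "eventually (\<lambda>y'. f y' = 0) (znhds Y y)"
proof -
  have yp: "y \<in> pts Y" using V_D[OF y(1)] by simp
  note i = z_outside[OF y(1)]
  show ?thesis
    using Y.stalk_eventually[OF f] eventually_znhds_znhds[OF yp ev] eventually_V[OF y(1)]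
  proof eventually_elim
    case (elim y')
    then have y'p: "y' \<in> pts Y" by simp
    have *: "f y' * g i (\<sigma> y') = 0" using eventually_znhds_self[OF y'p] elim(2) by blast
    show ?case
    proof (cases "\<sigma> y' \<in> C")
      case False
      then show ?thesis using * exc_iff[OF elim(3)] by simp
    next
      case True
      obtain \<gamma> where \<gamma>: "complex_arc Y \<gamma>" "\<gamma> 0 = y'" "velocity Y \<gamma> (\<lambda>y'. g i (\<sigma> y')) = 1"
        by (rule transversal_arc[OF elim(3) True])
      have nz: "eventually (\<lambda>t. g i (\<sigma> (\<gamma> t)) \<noteq> 0) (at 0)"
        using Y.arc_nonzero[OF \<gamma>(1), of "\<lambda>y'. g i (\<sigma> y')"] \<gamma>(2,3) g_sigma_stalk[OF elim(3) i] by simp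
      have "eventually (\<lambda>t. f (\<gamma> t) * g i (\<sigma> (\<gamma> t)) = 0) (nhds 0)"
        by (rule Y.arc_eventually[OF \<gamma>(1)]) (use elim(2) \<gamma>(2) in simp)
      then have "eventually (\<lambda>t. f (\<gamma> t) * g i (\<sigma> (\<gamma> t)) = 0) (at 0)"
        unfolding eventually_at_filter by (rule eventually_mono) simp
      with nz have "eventually (\<lambda>t. f (\<gamma> t) = 0) (at 0)" by eventually_elim simp
      then have "f (\<gamma> 0) = 0" by (rule Y.arc_vanish[OF \<gamma>(1), rotated]) (simp add: \<gamma>(2) elim(1))
      then show ?thesis by (simp add: \<gamma>(2))
    qed
  qed
qed

lemma chart_polyfun_stalk: "y \<in> V i \<Longrightarrow> p \<in> polyfun (n + r) \<Longrightarrow> (\<lambda>y'. p (b i y')) \<in> stalk Y y"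
  by (rule Y.stalk_polyfun[OF charts[OF z_outside]])

text \<open>Induction on the number \<open>s\<close> of fibre coordinates. If \<open>p\<close>
  vanishes over \<open>C\<close> for every value of the last one, so do all its coefficients in that
  variable. Without fibre coordinates, \<open>p\<close> lies in the ideal of \<open>C\<close>, and
  each generator is a multiple of \<open>g i\<close> on the chart.\<close>

lemma exc_multiple_polyfun:
  assumes y: "y \<in> V i" "\<sigma> y \<in> C"
    and p: "p \<in> polyfun (n + s)" "s \<le> r" "\<And>x \<zeta>. x \<in> U \<Longrightarrow> x \<in> C \<Longrightarrow> p (join n (a x) \<zeta>) = 0"
  shows "\<exists>t\<in>stalk Y y. eventually (\<lambda>y'. p (b i y') = t y' * g i (\<sigma> y')) (znhds Y y)"
  using p
proof (induction s arbitrary: p)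
  case 0
  have yp: "y \<in> pts Y" and xU: "\<sigma> y \<in> U" using V_D[OF y(1)] by simp_all
  have p: "p \<in> polyfun n" using 0 by simp
  have pa: "p (a x) = 0" if "x \<in> U" "x \<in> C" for x using 0(3)[OF that, of "\<lambda>_. 0"] by (simp add: polyfun_join[OF p])
  have "eventually (\<lambda>x. x \<in> C \<longrightarrow> p (a x) = 0) (znhds X (\<sigma> y))"
    using eventually_znhds_open[OF affine_chart_open[OF chart] xU] by eventually_elim (use pa in blast)
  from X.generates_idealD[OF gen[OF xU] X.stalk_polyfun[OF chart xU p] this]
  obtain h where h: "\<forall>j\<in>{..<r}. h j \<in> stalk X (\<sigma> y)"
    "eventually (\<lambda>x. p (a x) = (\<Sum>j\<in>{..<r}. h j x * g j x)) (znhds X (\<sigma> y))" .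
  define t where "t y' = (\<Sum>j\<in>{..<r}. h j (\<sigma> y') * z i y' j)" for y'
  have "t \<in> stalk Y y"
    unfolding t_def by (intro Y.stalk_sum[OF yp] Y.stalk_mult stalk_sigma[OF yp] z_stalk[OF y(1)]) (use h(1) in simp_all)
  moreover have "eventually (\<lambda>y'. p (b i y') = t y' * g i (\<sigma> y')) (znhds Y y)"
    using eventually_sigma[OF yp h(2)] eventually_V[OF y(1)]
  proof eventually_elim
    case (elim y')
    have "p (b i y') = p (a (\<sigma> y'))" unfolding b_def by (rule polyfun_join[OF p])
    also have "\<dots> = (\<Sum>j<r. h j (\<sigma> y') * (z i y' j * g i (\<sigma> y')))"
      unfolding elim(1) by (intro sum.cong refl) (simp add: V_relation[OF elim(2)])
    also have "\<dots> = t y' * g i (\<sigma> y')" unfolding t_def sum_distrib_right by (simp add: algebra_simps)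
    finally show ?case .
  qed
  ultimately show ?case by blast
next
  case (Suc s)
  have yp: "y \<in> pts Y" using V_D[OF y(1)] by simp
  have "p \<in> polyfun (Suc (n + s))" using Suc.prems(1) by simp
  then obtain d c where c: "\<forall>k. c k \<in> polyfun (n + s)" "p = (\<lambda>w. \<Sum>k<d. c k w * w (n + s) ^ k)"
    using polyfun_Suc_expand by blast
  have "\<exists>t\<in>stalk Y y. eventually (\<lambda>y'. c k (b i y') = t y' * g i (\<sigma> y')) (znhds Y y)" if k: "k < d" for k
  proof (rule Suc.IH)
    show "c k \<in> polyfun (n + s)" using c(1) by blast
    show "s \<le> r" using Suc.prems(2) by simp
    fix x \<zeta> assume x: "x \<in> U" "x \<in> C"
    have "(\<Sum>k<d. c k (join n (a x) \<zeta>) * t ^ k) = 0" for t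
    proof -
      have "p (join n (a x) (\<zeta>(s := t))) = (\<Sum>k<d. c k (join n (a x) (\<zeta>(s := t))) * t ^ k)" unfolding c(2) by simp
      moreover have "c k (join n (a x) (\<zeta>(s := t))) = c k (join n (a x) \<zeta>)" for k
        by (rule polyfun_cong[OF spec[OF c(1)]]) (auto simp: join_def)
      ultimately show ?thesis using Suc.prems(3)[OF x, of "\<zeta>(s := t)"] by simp
    qed
    from sum_powers_zero[OF this] show "c k (join n (a x) \<zeta>) = 0" using k by blast
  qed
  then have "\<forall>k\<in>{..<d}. \<exists>t. t \<in> stalk Y y \<and> eventually (\<lambda>y'. c k (b i y') = t y' * g i (\<sigma> y')) (znhds Y y)" by blast
  from bchoice[OF this] obtain t where t: "\<forall>k\<in>{..<d}. t k \<in> stalk Y y \<and> eventually (\<lambda>y'. c k (b i y') = t k y' * g i (\<sigma> y')) (znhds Y y)" ..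
  have "eventually (\<lambda>y'. \<forall>k\<in>{..<d}. c k (b i y') = t k y' * g i (\<sigma> y')) (znhds Y y)"
    by (rule eventually_ball_finite) (use t in simp_all)
  then have "eventually (\<lambda>y'. p (b i y') = (\<Sum>k\<in>{..<d}. t k y' * z i y' s ^ k) * g i (\<sigma> y')) (znhds Y y)"
  proof eventually_elim
    case (elim y')
    have "p (b i y') = (\<Sum>k<d. t k y' * g i (\<sigma> y') * z i y' s ^ k)"
      unfolding c(2) using elim by (intro sum.cong refl) (simp add: b_def)
    then show ?case unfolding sum_distrib_right by (simp add: algebra_simps)
  qed
  moreover have "(\<lambda>y'. \<Sum>k\<in>{..<d}. t k y' * z i y' s ^ k) \<in> stalk Y y"
    by (intro Y.stalk_sum[OF yp] Y.stalk_mult Y.stalk_power z_stalk[OF y(1)]) (use t Suc.prems(2) in simp_all)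
  ultimately show ?case by (rule bexI)
qed

text \<open>A further factor vanishing outside a small neighbourhood makes the local vanishing condition hold for
  the numerator on the whole chart.\<close>

lemma stalk_numerator:
  assumes y: "y \<in> V i" and f: "f \<in> stalk Y y" and ev: "eventually (\<lambda>y'. P y' \<longrightarrow> f y' = 0) (znhds Y y)"
  obtains p q where "p \<in> polyfun (n + r)" "q \<in> polyfun (n + r)" "q (b i y) \<noteq> 0"
    "eventually (\<lambda>y'. f y' = p (b i y') / q (b i y')) (znhds Y y)" "\<forall>y'\<in>V i. P y' \<longrightarrow> p (b i y') = 0"
proof -
  note ch = charts[OF z_outside[OF y]]
  obtain p q where pq: "p \<in> polyfun (n + r)" "q \<in> polyfun (n + r)" "q (b i y) \<noteq> 0"
    "eventually (\<lambda>y'. f y' = p (b i y') / q (b i y')) (znhds Y y)"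
    using iffD1[OF Y.stalk_iff[OF ch y] f] by blast
  have qn: "eventually (\<lambda>y'. q (b i y') \<noteq> 0) (znhds Y y)"
    by (rule Y.stalk_nonzero[OF chart_polyfun_stalk[OF y pq(2)] pq(3)])
  have "eventually (\<lambda>y'. P y' \<longrightarrow> p (b i y') = 0) (znhds Y y)"
    using ev pq(4) qn by eventually_elim simp
  from basic_neighbourhood[OF ch y this] obtain w where w: "w \<in> polyfun (n + r)" "w (b i y) \<noteq> 0"
    "\<And>y'. y' \<in> V i \<Longrightarrow> w (b i y') \<noteq> 0 \<Longrightarrow> P y' \<longrightarrow> p (b i y') = 0" by metis
  have wn: "eventually (\<lambda>y'. w (b i y') \<noteq> 0) (znhds Y y)"
    by (rule Y.stalk_nonzero[OF chart_polyfun_stalk[OF y w(1)] w(2)])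
  show thesis
  proof (rule that[of "\<lambda>u. w u * p u" "\<lambda>u. w u * q u"])
    show "(\<lambda>u. w u * p u) \<in> polyfun (n + r)" "(\<lambda>u. w u * q u) \<in> polyfun (n + r)"
      by (intro polyfun.mult w pq)+
    show "w (b i y) * q (b i y) \<noteq> 0" using w(2) pq(3) by simp
    show "eventually (\<lambda>y'. f y' = (w (b i y') * p (b i y')) / (w (b i y') * q (b i y'))) (znhds Y y)"
      using pq(4) wn by eventually_elim simp
    show "\<forall>y'\<in>V i. P y' \<longrightarrow> w (b i y') * p (b i y') = 0" using w(3) by auto
  qed
qed

lemma multiple_of_numerator:
  assumes y: "y \<in> V i" and q: "q \<in> polyfun (n + r)" "q (b i y) \<noteq> 0"
    and ev: "eventually (\<lambda>y'. f y' = p (b i y') / q (b i y')) (znhds Y y)"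
    and s: "s \<in> stalk Y y" "eventually (\<lambda>y'. p (b i y') = s y' * e y') (znhds Y y)"
  shows "\<exists>s\<in>stalk Y y. eventually (\<lambda>y'. f y' = s y' * e y') (znhds Y y)"
proof (rule bexI[of _ "\<lambda>y'. s y' / q (b i y')"])
  show "(\<lambda>y'. s y' / q (b i y')) \<in> stalk Y y"
    by (rule Y.stalk_divide[OF s(1) chart_polyfun_stalk[OF y q(1)] q(2)])
  show "eventually (\<lambda>y'. f y' = s y' / q (b i y') * e y') (znhds Y y)"
    using ev s(2) by eventually_elim simp
qed

lemma exc_multiple:
  assumes y: "y \<in> V i" "\<sigma> y \<in> C" and f: "f \<in> stalk Y y"
    and ev: "eventually (\<lambda>y'. \<sigma> y' \<in> C \<longrightarrow> f y' = 0) (znhds Y y)"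
  shows "\<exists>s\<in>stalk Y y. eventually (\<lambda>y'. f y' = s y' * g i (\<sigma> y')) (znhds Y y)"
proof -
  note i = z_outside[OF y(1)]
  obtain p q where p: "p \<in> polyfun (n + r)" and q: "q \<in> polyfun (n + r)" "q (b i y) \<noteq> 0"
    and fe: "eventually (\<lambda>y'. f y' = p (b i y') / q (b i y')) (znhds Y y)"
    and pz: "\<forall>y'\<in>V i. \<sigma> y' \<in> C \<longrightarrow> p (b i y') = 0"
    by (rule stalk_numerator[OF y(1) f ev])
  \<comment> \<open>Points of the chart have fibre coordinate \<open>i\<close> equal to 1, whereas
    \<open>exc_multiple_polyfun\<close> wants vanishing for all values. Substituting 1 removes that
    variable without changing the function on the chart.\<close>
  define P where "P w = p (w(n + i := 1))" for w
  have "P \<in> polyfun (n + r)" unfolding P_def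
  proof (rule polyfun_subst[OF p])
    fix l assume l: "l < n + r"
    show "(\<lambda>w. (w(n + i := 1)) l) \<in> polyfun (n + r)"
      by (cases "l = n + i") (simp_all add: polyfun.const polyfun.coord l)
  qed
  moreover have "P (join n (a x) \<zeta>) = 0" if x: "x \<in> U" "x \<in> C" for x \<zeta>
  proof -
    define \<zeta>' where "\<zeta>' = trunc r (\<zeta>(i := 1))"
    have "\<exists>y'\<in>V i. \<sigma> y' = x \<and> z i y' = \<zeta>'"
    proof (rule V_point[OF i x(1)])
      show "\<zeta>' \<in> Vec r" unfolding \<zeta>'_def by (rule trunc_Vec)
      show "\<zeta>' i = 1" by (simp add: \<zeta>'_def trunc_def i)
      show "g j x = \<zeta>' j * g i x" if "j < r" for j using g_zero_iff[OF x(1)] x(2) that i by simp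
    qed
    then obtain y' where y': "y' \<in> V i" "\<sigma> y' = x" "z i y' = \<zeta>'" by blast
    have "P (join n (a x) \<zeta>) = p (join n (a x) (\<zeta>(i := 1)))"
      unfolding P_def by (rule polyfun_cong[OF p]) (auto simp: join_def)
    also have "\<dots> = p (b i y')" unfolding b_def y'(2,3) \<zeta>'_def by (rule polyfun_join_trunc[OF p, symmetric])
    also have "\<dots> = 0" using bspec[OF pz y'(1)] y'(2) x(2) by simp
    finally show ?thesis .
  qed
  ultimately obtain t where t: "t \<in> stalk Y y" "eventually (\<lambda>y'. P (b i y') = t y' * g i (\<sigma> y')) (znhds Y y)"
    using exc_multiple_polyfun[OF y, of P r] by auto
  have "eventually (\<lambda>y'. p (b i y') = t y' * g i (\<sigma> y')) (znhds Y y)"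
    using t(2) eventually_V[OF y(1)]
  proof eventually_elim
    case (elim y')
    have "P (b i y') = p (b i y')" unfolding P_def
      by (rule polyfun_cong[OF p]) (use z_self[OF elim(2)] in \<open>auto simp: b_def\<close>)
    then show ?case using elim(1) by simp
  qed
  from multiple_of_numerator[OF y(1) q fe t(1) this] show ?thesis .
qed

lemma smooth_eq_exc:
  assumes y: "y \<in> V i" "\<sigma> y \<in> C"
  shows "smooth_eq Y (exc_divisor Y C \<sigma>) y (\<lambda>y'. g i (\<sigma> y'))"
proof -
  note i = z_outside[OF y(1)] and st = g_sigma_stalk[OF y(1) z_outside[OF y(1)]]
  have yp: "y \<in> pts Y" using V_D[OF y(1)] by simp
  have "local_eq Y (exc_divisor Y C \<sigma>) y (\<lambda>y'. g i (\<sigma> y'))"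
  proof (rule Y.local_eqI[OF st])
    show "eventually (\<lambda>y'. y' \<in> exc_divisor Y C \<sigma> \<longrightarrow> g i (\<sigma> y') = 0) (znhds Y y)"
      using eventually_V[OF y(1)] by eventually_elim (simp add: exc_iff exc_divisor_def)
    fix f assume f: "f \<in> stalk Y y" and ev: "eventually (\<lambda>y'. y' \<in> exc_divisor Y C \<sigma> \<longrightarrow> f y' = 0) (znhds Y y)"
    have "eventually (\<lambda>y'. \<sigma> y' \<in> C \<longrightarrow> f y' = 0) (znhds Y y)"
      using ev eventually_znhds_pts by eventually_elim (simp add: exc_divisor_def)
    then show "\<exists>h\<in>stalk Y y. eventually (\<lambda>y'. f y' = h y' * g i (\<sigma> y')) (znhds Y y)" by (rule exc_multiple[OF y f])
  qed
  moreover have "\<exists>t\<in>tangent Y y. t (\<lambda>y'. g i (\<sigma> y')) \<noteq> 0"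
  proof -
    obtain \<gamma> where \<gamma>: "complex_arc Y \<gamma>" "\<gamma> 0 = y" "velocity Y \<gamma> (\<lambda>y'. g i (\<sigma> y')) = 1"
      by (rule transversal_arc[OF y])
    then show ?thesis using Y.velocity_tangent[OF \<gamma>(1)] by (intro bexI[of _ "velocity Y \<gamma>"]) simp_all
  qed
  ultimately show ?thesis using y(2) yp by (simp add: smooth_eq_def exc_divisor_def)
qed

text \<open>On the chart the fibre coordinates are the fractions \<open>g j / g i\<close>, and each
  occurrence costs one power of \<open>g i\<close> in the denominator. A sum is brought to the
  exponent \<open>N1 + N2\<close> by cross-multiplication.\<close>

lemma homogenize:
  assumes i: "i < r" and p: "p \<in> polyfun (n + r)"
  shows "\<exists>N q. (\<forall>x\<in>U. q \<in> stalk X x) \<and>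
     (\<forall>x\<in>U. g i x \<noteq> 0 \<longrightarrow> q x = g i x ^ N * p (join n (a x) (\<lambda>j. g j x / g i x)))"
  using p
proof (induction rule: polyfun.induct)
  case (const c)
  show ?case
    by (rule exI[of _ 0], rule exI[of _ "\<lambda>_. c"]) (simp add: X.stalk_const U_pts)
next
  case (coord l)
  show ?case
  proof (cases "l < n")
    case True
    then show ?thesis
      by (intro exI[of _ 0] exI[of _ "\<lambda>x. a x l"]) (simp add: X.stalk_coord[OF chart])
  next
    case False
    then show ?thesis using coord
      by (intro exI[of _ 1] exI[of _ "g (l - n)"]) (simp add: g_stalk join_def)
  qed
next
  case (add p1 p2)
  obtain N1 q1 where 1: "\<forall>x\<in>U. q1 \<in> stalk X x" "\<forall>x\<in>U. g i x \<noteq> 0 \<longrightarrow> q1 x = g i x ^ N1 * p1 (join n (a x) (\<lambda>j. g j x / g i x))"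
    using add.IH(1) by blast
  obtain N2 q2 where 2: "\<forall>x\<in>U. q2 \<in> stalk X x" "\<forall>x\<in>U. g i x \<noteq> 0 \<longrightarrow> q2 x = g i x ^ N2 * p2 (join n (a x) (\<lambda>j. g j x / g i x))"
    using add.IH(2) by blast
  show ?case
  proof (rule exI[of _ "N1 + N2"], rule exI[of _ "\<lambda>x. g i x ^ N2 * q1 x + g i x ^ N1 * q2 x"], intro conjI ballI impI)
    fix x assume x: "x \<in> U"
    show "(\<lambda>x. g i x ^ N2 * q1 x + g i x ^ N1 * q2 x) \<in> stalk X x"
      by (intro X.stalk_add X.stalk_mult X.stalk_power g_stalk[OF i x] bspec[OF 1(1) x] bspec[OF 2(1) x])
    assume "g i x \<noteq> 0"
    then have "q1 x = g i x ^ N1 * p1 (join n (a x) (\<lambda>j. g j x / g i x))" "q2 x = g i x ^ N2 * p2 (join n (a x) (\<lambda>j. g j x / g i x))"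
      using 1(2) 2(2) x by blast+
    then show "g i x ^ N2 * q1 x + g i x ^ N1 * q2 x = g i x ^ (N1 + N2) *
       (p1 (join n (a x) (\<lambda>j. g j x / g i x)) + p2 (join n (a x) (\<lambda>j. g j x / g i x)))"
      by (simp add: algebra_simps power_add)
  qed
next
  case (mult p1 p2)
  obtain N1 q1 where 1: "\<forall>x\<in>U. q1 \<in> stalk X x" "\<forall>x\<in>U. g i x \<noteq> 0 \<longrightarrow> q1 x = g i x ^ N1 * p1 (join n (a x) (\<lambda>j. g j x / g i x))"
    using mult.IH(1) by blast
  obtain N2 q2 where 2: "\<forall>x\<in>U. q2 \<in> stalk X x" "\<forall>x\<in>U. g i x \<noteq> 0 \<longrightarrow> q2 x = g i x ^ N2 * p2 (join n (a x) (\<lambda>j. g j x / g i x))"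
    using mult.IH(2) by blast
  show ?case
  proof (rule exI[of _ "N1 + N2"], rule exI[of _ "\<lambda>x. q1 x * q2 x"], intro conjI ballI impI)
    fix x assume x: "x \<in> U"
    show "(\<lambda>x. q1 x * q2 x) \<in> stalk X x" by (intro X.stalk_mult bspec[OF 1(1) x] bspec[OF 2(1) x])
    assume "g i x \<noteq> 0"
    then have "q1 x = g i x ^ N1 * p1 (join n (a x) (\<lambda>j. g j x / g i x))" "q2 x = g i x ^ N2 * p2 (join n (a x) (\<lambda>j. g j x / g i x))"
      using 1(2) 2(2) x by blast+
    then show "q1 x * q2 x = g i x ^ (N1 + N2) *
       (p1 (join n (a x) (\<lambda>j. g j x / g i x)) * p2 (join n (a x) (\<lambda>j. g j x / g i x)))"
      by (simp add: algebra_simps power_add)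
  qed
qed

section \<open>Equations of strict transforms\<close>

context
  fixes D :: "'a set" and d and h :: "nat \<Rightarrow> 'a \<Rightarrow> complex" and x
  assumes xU: "x \<in> U" and xC: "x \<in> C" and CD: "C \<subseteq> D" and smooth: "smooth_eq X D x d"
    and h: "\<And>j. j < r \<Longrightarrow> h j \<in> stalk X x"
    and dh: "eventually (\<lambda>x'. d x' = (\<Sum>j<r. h j x' * g j x')) (znhds X x)"
begin

lemma local_D: "local_eq X D x d" "d \<in> stalk X x" "x \<in> pts X" "d x = 0" "eventually (\<lambda>x'. x' \<in> D \<longrightarrow> d x' = 0) (znhds X x)"
  using X.smooth_eqD[OF smooth] X.local_eqD(2)[OF X.smooth_eqD(2)[OF smooth]] by simp_all

lemma differential_d:
  assumes v: "v \<in> tangent X x"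
  shows "v d = (\<Sum>j<r. h j x * v (g j))"
  by (rule X.tangent_sum_zero[OF v local_D(3) _ _ _ local_D(2) dh])
    (use h g_stalk xU g_zero_iff[OF xU] xC in simp_all)

definition strict_eq :: "nat \<Rightarrow> 'b \<Rightarrow> complex" where
  "strict_eq i y = (\<Sum>j<r. h j (\<sigma> y) * z i y j)"

context
  fixes i y
  assumes y: "y \<in> V i" and yx: "\<sigma> y = x"
begin

lemma y_pts: "y \<in> pts Y" and i_less: "i < r" and y_C: "\<sigma> y \<in> C"
  using V_D[OF y] z_outside[OF y] xC yx by simp_all

lemma strict_eq_stalk: "strict_eq i \<in> stalk Y y"
  unfolding strict_eq_def[abs_def]
  by (intro Y.stalk_sum[OF y_pts] Y.stalk_mult stalk_sigma[OF y_pts] z_stalk[OF y]) (use h yx in simp_all)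

lemma strict_eq_factor: "eventually (\<lambda>y'. d (\<sigma> y') = g i (\<sigma> y') * strict_eq i y') (znhds Y y)"
  using eventually_sigma[OF y_pts dh[folded yx]] eventually_V[OF y]
proof eventually_elim
  case (elim y')
  have "d (\<sigma> y') = (\<Sum>j<r. h j (\<sigma> y') * (z i y' j * g i (\<sigma> y')))"
    unfolding elim(1) by (intro sum.cong refl) (simp add: V_relation[OF elim(2)])
  then show ?case unfolding strict_eq_def sum_distrib_left by (simp add: algebra_simps)
qed

text \<open>The differential of \<open>d\<close> is the combination of the differentials of the
  \<open>g j\<close> with these coefficients, and it is nonzero.\<close>

lemma coefficient_nonzero: "\<exists>j<r. h j x \<noteq> 0"
proof (rule ccontr)
  assume *: "\<not> ?thesis"
  obtain t where t: "t \<in> tangent X x" "t d \<noteq> 0" using smooth unfolding smooth_eq_def by blast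
  show False using differential_d[OF t(1)] * t(2) by simp
qed

text \<open>Along the fibres of the exceptional divisor the equation of the strict transform is a nonzero
  affine function.\<close>

lemma strict_eq_cancel_exc:
  assumes s: "s \<in> stalk Y y" and ev: "eventually (\<lambda>y'. \<sigma> y' \<in> C \<longrightarrow> strict_eq i y' * s y' = 0) (znhds Y y)"
  shows "eventually (\<lambda>y'. \<sigma> y' \<in> C \<longrightarrow> s y' = 0) (znhds Y y)"
proof -
  obtain j0 where j0: "j0 < r" "h j0 x \<noteq> 0" using coefficient_nonzero by blast
  have "eventually (\<lambda>y'. h j0 (\<sigma> y') \<noteq> 0) (znhds Y y)"
    using eventually_sigma[OF y_pts] X.stalk_nonzero[OF h[OF j0(1)] j0(2)] yx by blast
  then show ?thesis
    using Y.stalk_eventually[OF s] Y.stalk_eventually[OF strict_eq_stalk] eventually_znhds_znhds[OF y_pts ev] eventually_V[OF y]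
  proof eventually_elim
    case (elim y')
    show ?case
    proof
      assume y'C: "\<sigma> y' \<in> C"
      have y'p: "y' \<in> pts Y" and x'U: "\<sigma> y' \<in> U" using V_D[OF elim(5)] by simp_all
      have prod: "strict_eq i y' * s y' = 0" using eventually_znhds_self[OF y'p conjunct2[OF elim(4)]] y'C by simp
      show "s y' = 0"
      proof (cases "strict_eq i y' = 0")
        case False then show ?thesis using prod by simp
      next
        case True
        \<comment> \<open>If only the coefficient with index \<open>i\<close> were nonzero,
          \<open>strict_eq i y'\<close> would equal it, because \<open>z i y' i = 1\<close>; but
          \<open>strict_eq i y'\<close> is zero here.\<close>
        have "\<exists>l<r. l \<noteq> i \<and> h l (\<sigma> y') \<noteq> 0"
        proof (rule ccontr)
          assume "\<not> ?thesis"
          then have hz: "h l (\<sigma> y') = 0" if "l < r" "l \<noteq> i" for l using that by blast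
          have "strict_eq i y' = (\<Sum>j<r. if j = i then h j (\<sigma> y') else 0)"
            unfolding strict_eq_def using hz z_self[OF elim(5)] by (intro sum.cong refl) auto
          then have "h i (\<sigma> y') = 0" using True i_less by simp
          then show False using hz[OF j0(1)] elim(1) by (cases "j0 = i") auto
        qed
        then obtain l where l: "l < r" "l \<noteq> i" "h l (\<sigma> y') \<noteq> 0" by blast
        \<comment> \<open>A line in the fibre over \<open>\<sigma> y'\<close>. Only the coordinate
          \<open>l\<close> moves, so the line stays in the exceptional divisor and the equation of
          the strict transform has a simple zero along it.\<close>
        define Z where "Z t = (z i y')(l := z i y' l + t)" for t
        have "\<exists>y''\<in>V i. \<sigma> y'' = \<sigma> y' \<and> z i y'' = Z t" for t
        proof (rule V_point[OF i_less x'U])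
          show "Z t \<in> Vec r" using z_Vec[OF elim(5)] l(1) by (auto simp: Z_def Vec_def)
          show "Z t i = 1" using z_self[OF elim(5)] l(2) by (simp add: Z_def)
          fix j assume "j < r"
          then show "g j (\<sigma> y') = Z t j * g i (\<sigma> y')" using g_zero_iff[OF x'U] y'C i_less by simp
        qed
        then have "\<forall>t. \<exists>y''. y'' \<in> V i \<and> \<sigma> y'' = \<sigma> y' \<and> z i y'' = Z t" by blast
        from choice[OF this] obtain \<gamma> where \<gamma>: "\<And>t. \<gamma> t \<in> V i" "\<And>t. \<sigma> (\<gamma> t) = \<sigma> y'" "\<And>t. z i (\<gamma> t) = Z t" by blast
        have arc: "complex_arc Y \<gamma>"
        proof (rule Y.complex_arc_chart[OF charts[OF i_less], of 1])
          fix k assume "k < n + r"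
          show "(\<lambda>t. b i (\<gamma> t) k) holomorphic_on ball 0 1"
          proof (cases "k = n + l")
            case True
            then show ?thesis by (simp add: b_def \<gamma> Z_def) (intro holomorphic_intros)
          next
            case False
            have "b i (\<gamma> t) k = b i y' k" for t
              using False by (auto simp: b_def \<gamma> Z_def join_def)
            then show ?thesis by simp
          qed
        qed (use \<gamma>(1) in simp_all)
        have \<gamma>0: "\<gamma> 0 = y'"
          by (rule V_eqI[OF \<gamma>(1) elim(5)]) (simp_all add: \<gamma> Z_def)
        have st: "strict_eq i (\<gamma> t) = t * h l (\<sigma> y')" for t
        proof -
          have "strict_eq i (\<gamma> t) = (\<Sum>j<r. h j (\<sigma> y') * z i y' j + (if j = l then h j (\<sigma> y') * t else 0))"
            unfolding strict_eq_def \<gamma> by (intro sum.cong refl) (simp add: Z_def algebra_simps)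
          also have "\<dots> = strict_eq i y' + h l (\<sigma> y') * t" using l(1) by (simp add: sum.distrib strict_eq_def)
          finally show ?thesis using True by simp
        qed
        have "eventually (\<lambda>t. \<sigma> (\<gamma> t) \<in> C \<longrightarrow> strict_eq i (\<gamma> t) * s (\<gamma> t) = 0) (nhds 0)"
          by (rule Y.arc_eventually[OF arc]) (use elim(4) \<gamma>0 in simp)
        then have "eventually (\<lambda>t. s (\<gamma> t) = 0) (at 0)"
          unfolding eventually_at_filter by (rule eventually_mono) (use y'C l(3) in \<open>auto simp: \<gamma> st\<close>)
        then have "s (\<gamma> 0) = 0" by (rule Y.arc_vanish[OF arc, rotated]) (simp add: \<gamma>0 elim(2))
        then show ?thesis by (simp add: \<gamma>0)
      qed
    qed
  qed
qed

text \<open>Clearing denominators with a power of \<open>g i\<close> turns the numerator of \<open>f\<close> into a function on \<open>X\<close> that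
  vanishes on \<open>D\<close>, hence is a multiple of \<open>d\<close>; the powers of \<open>g i\<close> are then cancelled one by one.\<close>

lemma strict_multiple:
  assumes f: "f \<in> stalk Y y" and ev: "eventually (\<lambda>y'. \<sigma> y' \<in> D - C \<longrightarrow> f y' = 0) (znhds Y y)"
  shows "\<exists>s\<in>stalk Y y. eventually (\<lambda>y'. f y' = s y' * strict_eq i y') (znhds Y y)"
proof -
  obtain p q where p: "p \<in> polyfun (n + r)" and q: "q \<in> polyfun (n + r)" "q (b i y) \<noteq> 0"
    and fe: "eventually (\<lambda>y'. f y' = p (b i y') / q (b i y')) (znhds Y y)"
    and pz: "\<forall>y'\<in>V i. \<sigma> y' \<in> D - C \<longrightarrow> p (b i y') = 0"
    by (rule stalk_numerator[OF y f ev])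
  note pst = chart_polyfun_stalk[OF y p] and gst = g_sigma_stalk[OF y i_less]
  obtain N Q where Q: "\<forall>x\<in>U. Q \<in> stalk X x" "\<forall>x\<in>U. g i x \<noteq> 0 \<longrightarrow> Q x = g i x ^ N * p (join n (a x) (\<lambda>j. g j x / g i x))"
    using homogenize[OF i_less p] by blast
  have pb: "p (join n (a (\<sigma> y')) (\<lambda>j. g j (\<sigma> y') / g i (\<sigma> y'))) = p (b i y')" if "y' \<in> V i" "g i (\<sigma> y') \<noteq> 0" for y'
    unfolding b_def by (rule polyfun_cong[OF p]) (use V_relation[OF that(1)] that(2) in \<open>auto simp: join_def\<close>)
  \<comment> \<open>The extra factor \<open>g i\<close> disposes of the points where
    \<open>g i\<close> vanishes, among them those of \<open>C\<close>. Every other point of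
    \<open>D\<close> lifts to the chart, where \<open>pz\<close> applies.\<close>
  have gQ: "g i x' * Q x' = 0" if x': "x' \<in> U" "x' \<in> D" for x'
  proof (cases "g i x' = 0")
    case False
    then have nC: "x' \<notin> C" using g_zero_iff[OF x'(1)] i_less by blast
    define \<zeta> where "\<zeta> = trunc r (\<lambda>j. g j x' / g i x')"
    have "\<exists>y'\<in>V i. \<sigma> y' = x' \<and> z i y' = \<zeta>"
    proof (rule V_point[OF i_less x'(1)])
      show "\<zeta> \<in> Vec r" unfolding \<zeta>_def by (rule trunc_Vec)
      show "\<zeta> i = 1" using False by (simp add: \<zeta>_def trunc_def i_less)
      show "g j x' = \<zeta> j * g i x'" if "j < r" for j using False that by (simp add: \<zeta>_def trunc_def)
    qed
    then obtain y' where y': "y' \<in> V i" "\<sigma> y' = x'" by blast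
    then have "p (b i y') = 0" using bspec[OF pz y'(1)] x'(2) nC by simp
    then show ?thesis using pb[OF y'(1)] Q(2) False x'(1) y'(2) by simp
  qed simp
  have "eventually (\<lambda>x'. x' \<in> D \<longrightarrow> g i x' * Q x' = 0) (znhds X x)"
    using eventually_znhds_open[OF affine_chart_open[OF chart] xU] by eventually_elim (use gQ in blast)
  from X.local_eq_multiple[OF local_D(1) X.stalk_mult[OF g_stalk[OF i_less xU] bspec[OF Q(1) xU]] this]
  obtain k where k: "k \<in> stalk X x" "eventually (\<lambda>x'. g i x' * Q x' = k x' * d x') (znhds X x)" .
  have kst: "(\<lambda>y'. k (\<sigma> y')) \<in> stalk Y y" by (rule stalk_sigma[OF y_pts]) (simp add: yx k(1))
  have start: "eventually (\<lambda>y'. g i (\<sigma> y') ^ Suc N * p (b i y') = g i (\<sigma> y') * (strict_eq i y' * k (\<sigma> y'))) (znhds Y y)"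
    using eventually_sigma[OF y_pts k(2)[folded yx]] strict_eq_factor eventually_V[OF y]
  proof eventually_elim
    case (elim y')
    have "g i (\<sigma> y') * Q (\<sigma> y') = g i (\<sigma> y') ^ Suc N * p (b i y')"
      using Q(2) pb[OF elim(3)] V_D[OF elim(3)] by (cases "g i (\<sigma> y') = 0") auto
    then have "g i (\<sigma> y') ^ Suc N * p (b i y') = k (\<sigma> y') * d (\<sigma> y')" using elim(1) by simp
    then show ?case unfolding elim(2) by (simp only: mult.commute mult.left_commute)
  qed
  have cancel: "eventually (\<lambda>y'. u y' = w y') (znhds Y y)"
    if "u \<in> stalk Y y" "w \<in> stalk Y y" "eventually (\<lambda>y'. g i (\<sigma> y') * u y' = g i (\<sigma> y') * w y') (znhds Y y)" for u w
  proof -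
    have "eventually (\<lambda>y'. (u y' - w y') * g i (\<sigma> y') = 0) (znhds Y y)"
      using that(3) by eventually_elim (simp add: algebra_simps)
    from exc_cancel[OF y y_C Y.stalk_diff[OF that(1,2)] this]
    show ?thesis by eventually_elim simp
  qed
  have "\<exists>s\<in>stalk Y y. eventually (\<lambda>y'. p (b i y') = s y' * strict_eq i y') (znhds Y y)"
    if "k' \<in> stalk Y y" "eventually (\<lambda>y'. g i (\<sigma> y') ^ N * p (b i y') = strict_eq i y' * k' y') (znhds Y y)" for N k'
    using that
  proof (induction N arbitrary: k')
    case 0
    have "eventually (\<lambda>y'. p (b i y') = k' y' * strict_eq i y') (znhds Y y)"
      using 0(2) by eventually_elim simp
    then show ?case by (rule bexI[OF _ 0(1)])
  next
    case (Suc N)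
    \<comment> \<open>Over \<open>C\<close> the left side of the identity vanishes, its exponent
      being positive. Hence \<open>k'\<close> is divisible by \<open>g i\<close> and one power
      cancels.\<close>
    have "eventually (\<lambda>y'. \<sigma> y' \<in> C \<longrightarrow> strict_eq i y' * k' y' = 0) (znhds Y y)"
      using Suc.prems(2) eventually_V[OF y]
    proof eventually_elim
      case (elim y')
      show ?case using elim(1) exc_iff[OF elim(2)] by auto
    qed
    from exc_multiple[OF y y_C Suc.prems(1) strict_eq_cancel_exc[OF Suc.prems(1) this]]
    obtain k2 where k2: "k2 \<in> stalk Y y" "eventually (\<lambda>y'. k' y' = k2 y' * g i (\<sigma> y')) (znhds Y y)" by blast
    have "eventually (\<lambda>y'. g i (\<sigma> y') * (g i (\<sigma> y') ^ N * p (b i y')) = g i (\<sigma> y') * (strict_eq i y' * k2 y')) (znhds Y y)"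
      using Suc.prems(2) k2(2) by eventually_elim (simp add: algebra_simps)
    from cancel[OF Y.stalk_mult[OF Y.stalk_power[OF gst] pst] Y.stalk_mult[OF strict_eq_stalk k2(1)] this]
    show ?case by (rule Suc.IH[OF k2(1)])
  qed
  moreover have "eventually (\<lambda>y'. g i (\<sigma> y') ^ N * p (b i y') = strict_eq i y' * k (\<sigma> y')) (znhds Y y)"
    by (rule cancel[OF Y.stalk_mult[OF Y.stalk_power[OF gst] pst] Y.stalk_mult[OF strict_eq_stalk kst]])
      (use start in eventually_elim, simp add: algebra_simps)
  ultimately obtain s where s: "s \<in> stalk Y y" "eventually (\<lambda>y'. p (b i y') = s y' * strict_eq i y') (znhds Y y)"
    using kst by blast
  show ?thesis by (rule multiple_of_numerator[OF y q fe s])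
qed

text \<open>If \<open>strict_eq i\<close> were nonzero at a point of the closure, it would be
  nonzero on a neighbourhood, which meets the inverse image of \<open>D - C\<close>. There
  \<open>g i\<close> is nonzero and \<open>d\<close> vanishes, against the factorisation.\<close>

lemma strict_transform_vanish:
  "eventually (\<lambda>y'. y' \<in> strict_transform Y C \<sigma> D \<longrightarrow> strict_eq i y' = 0) (znhds Y y)"
proof -
  define P where "P y' \<longleftrightarrow> y' \<in> V i \<and> d (\<sigma> y') = g i (\<sigma> y') * strict_eq i y' \<and> (\<sigma> y' \<in> D \<longrightarrow> d (\<sigma> y') = 0) \<and>
    strict_eq i \<in> stalk Y y'" for y'
  have "eventually P (znhds Y y)"
    unfolding P_def using eventually_sigma[OF y_pts local_D(5)[folded yx]]
    by (intro eventually_conj eventually_V[OF y] strict_eq_factor Y.stalk_eventually[OF strict_eq_stalk])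
  from eventually_znhds_znhds[OF y_pts this] show ?thesis
  proof eventually_elim
    case (elim y')
    then have y'p: "y' \<in> pts Y" and evP: "eventually P (znhds Y y')" by simp_all
    have "P y'" by (rule eventually_znhds_self[OF y'p evP])
    then have st: "strict_eq i \<in> stalk Y y'" by (simp add: P_def)
    show ?case
    proof (intro impI, rule ccontr)
      assume *: "y' \<in> strict_transform Y C \<sigma> D" "strict_eq i y' \<noteq> 0"
      have "eventually (\<lambda>y''. P y'' \<and> strict_eq i y'' \<noteq> 0) (znhds Y y')"
        using evP Y.stalk_nonzero[OF st *(2)] by (rule eventually_conj)
      then obtain W where W: "openin (zar Y) W" "y' \<in> W" "\<forall>y''\<in>W. P y'' \<and> strict_eq i y'' \<noteq> 0"
        unfolding eventually_znhds[OF y'p] by blast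
      then obtain y'' where y'': "y'' \<in> W" "y'' \<in> pts Y \<inter> \<sigma> -` (D - C)"
        using *(1) unfolding strict_transform_def in_closure_of by blast
      then have "P y''" "strict_eq i y'' \<noteq> 0" using W(3) by simp_all
      moreover have "\<sigma> y'' \<in> D" "\<sigma> y'' \<notin> C" using y''(2) by simp_all
      ultimately show False using exc_iff[of y'' i] by (auto simp: P_def)
    qed
  qed
qed

lemma strict_transform_mem:
  "y' \<in> pts Y \<Longrightarrow> \<sigma> y' \<in> D - C \<Longrightarrow> y' \<in> strict_transform Y C \<sigma> D"
proof -
  have "pts Y \<inter> \<sigma> -` (D - C) \<subseteq> zar Y closure_of (pts Y \<inter> \<sigma> -` (D - C))" by (rule closure_of_subset) blast
  then show "y' \<in> pts Y \<Longrightarrow> \<sigma> y' \<in> D - C \<Longrightarrow> y' \<in> strict_transform Y C \<sigma> D"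
    unfolding strict_transform_def by blast
qed

lemma local_eq_strict: "local_eq Y (strict_transform Y C \<sigma> D) y (strict_eq i)"
proof (rule Y.local_eqI[OF strict_eq_stalk strict_transform_vanish])
  fix f assume f: "f \<in> stalk Y y" and ev: "eventually (\<lambda>y'. y' \<in> strict_transform Y C \<sigma> D \<longrightarrow> f y' = 0) (znhds Y y)"
  have "eventually (\<lambda>y'. \<sigma> y' \<in> D - C \<longrightarrow> f y' = 0) (znhds Y y)"
    using ev eventually_znhds_pts by eventually_elim (use strict_transform_mem in blast)
  from strict_multiple[OF f this]
  show "\<exists>h\<in>stalk Y y. eventually (\<lambda>y'. f y' = h y' * strict_eq i y') (znhds Y y)" .
qed

lemma strict_transform_iff: "y \<in> strict_transform Y C \<sigma> D \<longleftrightarrow> (\<Sum>j<r. h j x * z i y j) = 0"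
proof -
  have eq: "strict_eq i y = (\<Sum>j<r. h j x * z i y j)" by (simp add: strict_eq_def yx)
  show ?thesis
  proof
    assume "y \<in> strict_transform Y C \<sigma> D"
    then show "(\<Sum>j<r. h j x * z i y j) = 0"
      using eventually_znhds_self[OF y_pts strict_transform_vanish] eq by simp
  next
    assume z: "(\<Sum>j<r. h j x * z i y j) = 0"
    show "y \<in> strict_transform Y C \<sigma> D"
    proof (rule ccontr)
      assume n: "y \<notin> strict_transform Y C \<sigma> D"
      have "closedin (zar Y) (strict_transform Y C \<sigma> D)" unfolding strict_transform_def by (rule closedin_closure_of)
      then have "openin (zar Y) (pts Y - strict_transform Y C \<sigma> D)" by (rule openin_diff[OF openin_topspace])
      then have "eventually (\<lambda>y'. y' \<in> pts Y - strict_transform Y C \<sigma> D) (znhds Y y)"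
        by (rule eventually_znhds_open) (use n y_pts in simp)
      \<comment> \<open>Near a point off the strict transform the constant 1 satisfies the vanishing
        condition vacuously. It is then a multiple of \<open>strict_eq i\<close>, which therefore
        cannot vanish at \<open>y\<close>.\<close>
      then have "eventually (\<lambda>y'. \<sigma> y' \<in> D - C \<longrightarrow> (1::complex) = 0) (znhds Y y)"
        by eventually_elim (use strict_transform_mem in blast)
      from strict_multiple[OF Y.stalk_const[OF y_pts] this]
      obtain s where "eventually (\<lambda>y'. (1::complex) = s y' * strict_eq i y') (znhds Y y)" by blast
      from eventually_znhds_self[OF y_pts this] show False using z eq by simp
    qed
  qed
qed

lemma velocity_strict_eq:
  assumes \<gamma>: "complex_arc Y \<gamma>" "\<gamma> 0 = y"
    and vf: "\<And>f. f \<in> stalk X (\<sigma> y) \<Longrightarrow> velocity Y \<gamma> (\<lambda>y'. f (\<sigma> y')) = v f"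
    and vz: "\<And>j. j < r \<Longrightarrow> velocity Y \<gamma> (\<lambda>y'. z i y' j) = \<zeta> j"
  shows "velocity Y \<gamma> (strict_eq i) = (\<Sum>j<r. h j x * \<zeta> j) + (\<Sum>j<r. z i y j * v (h j))"
proof -
  have tg: "velocity Y \<gamma> \<in> tangent Y y" using Y.velocity_tangent[OF \<gamma>(1)] \<gamma>(2) by simp
  have hs: "(\<lambda>y'. h j (\<sigma> y')) \<in> stalk Y y" if "j < r" for j by (rule stalk_sigma[OF y_pts]) (use h that yx in simp)
  note zs = z_stalk[OF y]
  have "velocity Y \<gamma> (strict_eq i) = (\<Sum>j<r. velocity Y \<gamma> (\<lambda>y'. h j (\<sigma> y') * z i y' j))"
    unfolding strict_eq_def[abs_def] by (rule Y.tangent_sum[OF tg y_pts]) (simp add: Y.stalk_mult hs zs)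
  also have "\<dots> = (\<Sum>j<r. h j x * \<zeta> j + z i y j * v (h j))"
  proof (intro sum.cong refl)
    fix j assume "j \<in> {..<r}"
    then have j: "j < r" by simp
    show "velocity Y \<gamma> (\<lambda>y'. h j (\<sigma> y') * z i y' j) = h j x * \<zeta> j + z i y j * v (h j)"
      unfolding Y.tangent_mult[OF tg hs[OF j] zs[OF j]] using vz[OF j] vf[of "h j"] h[OF j] yx by simp
  qed
  finally show ?thesis by (simp add: sum.distrib)
qed

end

end

end

section \<open>Normal vectors of the centre and of the exceptional divisor\<close>

context blowup_chart
begin

lemma coset_C_nonempty: "x \<in> U \<Longrightarrow> x \<in> C \<Longrightarrow> coset X x {..<r} g w \<noteq> {}"
  using g_differentials_surj[of x w] by (auto simp: coset_def)

lemma normal_C: "x \<in> U \<Longrightarrow> x \<in> C \<Longrightarrow> normal X C x = range (coset X x {..<r} g)"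
  unfolding X.normal_eq[OF gen _ U_pts] using coset_C_nonempty by auto

lemma normal_nz_C: "x \<in> U \<Longrightarrow> x \<in> C \<Longrightarrow> normal_nz X C x = {coset X x {..<r} g w | w. \<exists>j<r. w j \<noteq> 0}"
  unfolding X.normal_nz_eq[OF gen _ U_pts] using coset_C_nonempty by auto

text \<open>Differentiating \<open>g j = z j * g i\<close> where \<open>g i\<close> vanishes shows
  that the start of any lift, in its chart, is determined by the velocity of the arc below. This is
  the uniqueness half of the normal lift.\<close>

lemma lifted_arc_direction:
  assumes arcs: "complex_arc X \<gamma>" "complex_arc Y \<gamma>'" and ev: "eventually (\<lambda>t. \<sigma> (\<gamma>' t) = \<gamma> t) (nhds 0)"
    and xU: "\<gamma> 0 \<in> U" and xC: "\<gamma> 0 \<in> C" and y: "\<gamma>' 0 \<in> V i" and j: "j < r"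
  shows "velocity Y \<gamma>' (\<lambda>y. g j (\<sigma> y)) = velocity X \<gamma> (g j)"
    and "velocity X \<gamma> (g j) = z i (\<gamma>' 0) j * velocity X \<gamma> (g i)"
proof -
  have x: "\<sigma> (\<gamma>' 0) = \<gamma> 0" using eventually_nhds_x_imp_x[OF ev] .
  note i = z_outside[OF y]
  have vel: "velocity Y \<gamma>' (\<lambda>y. g k (\<sigma> y)) = velocity X \<gamma> (g k)" if k: "k < r" for k
  proof -
    have "velocity Y \<gamma>' (\<lambda>y. g k (\<sigma> y)) = deriv (\<lambda>t. g k (\<sigma> (\<gamma>' t))) 0"
      by (rule arc_sigma_velocity[OF arcs(2) refl]) (simp add: x g_stalk[OF k xU])
    also have "\<dots> = deriv (\<lambda>t. g k (\<gamma> t)) 0"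
      by (rule deriv_cong_ev[OF _ refl]) (use ev in eventually_elim, simp)
    also have "\<dots> = velocity X \<gamma> (g k)" using X.velocity_eq[of "g k" \<gamma>] g_stalk[OF k xU] by simp
    finally show ?thesis .
  qed
  show "velocity Y \<gamma>' (\<lambda>y. g j (\<sigma> y)) = velocity X \<gamma> (g j)" by (rule vel[OF j])
  have rel: "eventually (\<lambda>y. g j (\<sigma> y) = z i y j * g i (\<sigma> y)) (znhds Y (\<gamma>' 0))"
    using eventually_V[OF y] by eventually_elim (rule V_relation[OF _ j])
  have "g i (\<sigma> (\<gamma>' 0)) = 0" using g_zero_iff[OF xU] xC i x by simp
  from Y.tangent_multiple[OF Y.velocity_tangent[OF arcs(2)] z_stalk[OF y j] g_sigma_stalk[OF y i] this g_sigma_stalk[OF y j] rel]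
  show "velocity X \<gamma> (g j) = z i (\<gamma>' 0) j * velocity X \<gamma> (g i)" unfolding vel[OF j] vel[OF i] .
qed

lemma normal_class_velocity:
  assumes "complex_arc X \<gamma>" "\<gamma> 0 \<in> U" "\<gamma> 0 \<in> C" "normal_class X C (\<gamma> 0) (velocity X \<gamma>) = coset X (\<gamma> 0) {..<r} g w" "j < r"
  shows "velocity X \<gamma> (g j) = w j"
proof -
  have "velocity X \<gamma> \<in> coset X (\<gamma> 0) {..<r} g (\<lambda>j. velocity X \<gamma> (g j))"
    using X.velocity_tangent[OF assms(1)] by (simp add: coset_def)
  also have "\<dots> = coset X (\<gamma> 0) {..<r} g w"
    using X.normal_class_eq[OF gen[OF assms(2)] assms(3) U_pts[OF assms(2)] X.velocity_tangent[OF assms(1)]] assms(4) by simp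
  finally show ?thesis using assms(5) by (simp add: coset_def)
qed

lemma normal_lift_eq:
  assumes y: "y \<in> V i" and xC: "\<sigma> y \<in> C" and w0: "w i \<noteq> 0" and w: "\<And>j. j < r \<Longrightarrow> w j = w i * z i y j"
  shows "normal_lift Y X C \<sigma> (\<sigma> y, coset X (\<sigma> y) {..<r} g w) = (y, hcoset Y y (\<lambda>y'. g i (\<sigma> y')) (w i))"
  unfolding normal_lift_def prod.case
proof (rule the_equality)
  have xU: "\<sigma> y \<in> U" using V_D[OF y] by simp
  note i = z_outside[OF y] and sm = smooth_eq_exc[OF y xC]
  obtain v where v: "v \<in> tangent X (\<sigma> y)" "\<forall>j<r. v (g j) = w j"
    using g_differentials_surj[OF xU xC] by blast
  have "v (g j) = w i * z i y j" if "j < r" for j using v(2) w[OF that] that by simp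
  from arc_exists[OF y xC v(1) this, of "\<lambda>_. 0"] obtain \<gamma> where \<gamma>: "complex_arc Y \<gamma>" "\<gamma> 0 = y"
     "complex_arc X (\<lambda>t. \<sigma> (\<gamma> t))" "velocity X (\<lambda>t. \<sigma> (\<gamma> t)) = v"
     "\<And>f. f \<in> stalk X (\<sigma> y) \<Longrightarrow> velocity Y \<gamma> (\<lambda>y'. f (\<sigma> y')) = v f" by metis
  have "normal_class X C (\<sigma> y) v = coset X (\<sigma> y) {..<r} g w"
    unfolding X.normal_class_eq[OF gen[OF xU] xC U_pts[OF xU] v(1)] by (rule coset_cong) (use v(2) in simp)
  moreover have "velocity Y \<gamma> \<in> tangent Y y" using Y.velocity_tangent[OF \<gamma>(1)] \<gamma>(2) by simp
  then have "normal_class Y (exc_divisor Y C \<sigma>) y (velocity Y \<gamma>) = hcoset Y y (\<lambda>y'. g i (\<sigma> y')) (w i)"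
    using Y.normal_class_hcoset[OF sm, of "velocity Y \<gamma>"] \<gamma>(5)[OF g_stalk[OF i xU]] v(2) i by simp
  ultimately show "\<exists>\<gamma> \<gamma>'. complex_arc X \<gamma> \<and> \<gamma> 0 = \<sigma> y \<and> normal_class X C (\<sigma> y) (velocity X \<gamma>) = coset X (\<sigma> y) {..<r} g w \<and>
     complex_arc Y \<gamma>' \<and> (\<forall>\<^sub>F t in nhds 0. \<sigma> (\<gamma>' t) = \<gamma> t) \<and>
     (y, hcoset Y y (\<lambda>y'. g i (\<sigma> y')) (w i)) = (\<gamma>' 0, normal_class Y (exc_divisor Y C \<sigma>) (\<gamma>' 0) (velocity Y \<gamma>'))"
    using \<gamma>(1-4) by (intro exI[of _ "\<lambda>t. \<sigma> (\<gamma> t)"] exI[of _ \<gamma>]) simp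
next
  have xU: "\<sigma> y \<in> U" using V_D[OF y] by simp
  note i = z_outside[OF y] and sm = smooth_eq_exc[OF y xC]
  fix p
  assume "\<exists>\<gamma> \<gamma>'. complex_arc X \<gamma> \<and> \<gamma> 0 = \<sigma> y \<and> normal_class X C (\<sigma> y) (velocity X \<gamma>) = coset X (\<sigma> y) {..<r} g w \<and>
     complex_arc Y \<gamma>' \<and> (\<forall>\<^sub>F t in nhds 0. \<sigma> (\<gamma>' t) = \<gamma> t) \<and>
     p = (\<gamma>' 0, normal_class Y (exc_divisor Y C \<sigma>) (\<gamma>' 0) (velocity Y \<gamma>'))"
  then obtain \<gamma> \<gamma>' where arc: "complex_arc X \<gamma>" and x: "\<gamma> 0 = \<sigma> y"
    and cl: "normal_class X C (\<sigma> y) (velocity X \<gamma>) = coset X (\<sigma> y) {..<r} g w"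
    and arc': "complex_arc Y \<gamma>'" and ev: "\<forall>\<^sub>F t in nhds 0. \<sigma> (\<gamma>' t) = \<gamma> t"
    and p: "p = (\<gamma>' 0, normal_class Y (exc_divisor Y C \<sigma>) (\<gamma>' 0) (velocity Y \<gamma>'))"
    by (elim exE conjE) (rule that)
  have xU': "\<gamma> 0 \<in> U" and xC': "\<gamma> 0 \<in> C" using xU xC x by simp_all
  have vw: "velocity X \<gamma> (g j) = w j" if "j < r" for j
    using normal_class_velocity[OF arc xU' xC' _ that] cl x by simp
  have sx: "\<sigma> (\<gamma>' 0) = \<sigma> y" using eventually_nhds_x_imp_x[OF ev] x by simp
  note y'p = Y.arc_pts[OF arc']
  obtain i' where i': "i' < r" "\<gamma>' 0 \<in> V i'" using V_cover[OF y'p] sx xU by auto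
  \<comment> \<open>The lift may start in another chart \<open>i'\<close>. As \<open>w i\<close> is
    nonzero, its homogeneous coordinate \<open>i\<close> is nonzero as well, so it starts in the
    chart of \<open>y\<close>.\<close>
  have "w i = z i' (\<gamma>' 0) i * w i'"
    using lifted_arc_direction(2)[OF arc arc' ev xU' xC' i'(2) i] vw[OF i] vw[OF i'(1)] by simp
  then have "z i' (\<gamma>' 0) i \<noteq> 0" using w0 by auto
  then have "\<omega> (\<gamma>' 0) i \<noteq> 0" by (auto simp: z_def)
  then have y': "\<gamma>' 0 \<in> V i" using y'p sx xU by (simp add: V_def)
  have "\<gamma>' 0 = y"
  proof (rule V_eqI[OF y' y sx])
    fix j assume j: "j < r"
    have "w j = z i (\<gamma>' 0) j * w i"
      using lifted_arc_direction(2)[OF arc arc' ev xU' xC' y' j] vw[OF i] vw[OF j] by simp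
    then show "z i (\<gamma>' 0) j = z i y j" using w[OF j] w0 by simp
  qed
  moreover have "velocity Y \<gamma>' (\<lambda>y'. g i (\<sigma> y')) = w i"
    using lifted_arc_direction(1)[OF arc arc' ev xU' xC' y' i] vw[OF i] by simp
  moreover have "velocity Y \<gamma>' \<in> tangent Y y" using Y.velocity_tangent[OF arc'] calculation(1) by simp
  ultimately show "p = (y, hcoset Y y (\<lambda>y'. g i (\<sigma> y')) (w i))"
    unfolding p using Y.normal_class_hcoset[OF sm, of "velocity Y \<gamma>'"] by simp
qed

lemma chart_point_of_direction:
  assumes xU: "x \<in> U" and xC: "x \<in> C" and i: "i < r" and w0: "w i \<noteq> 0"
  shows "\<exists>y\<in>V i. \<sigma> y = x \<and> (\<forall>j<r. w j = w i * z i y j)"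
proof -
  have "\<exists>y\<in>V i. \<sigma> y = x \<and> z i y = trunc r (\<lambda>j. w j / w i)"
  proof (rule V_point[OF i xU trunc_Vec])
    show "trunc r (\<lambda>j. w j / w i) i = 1" using w0 i by (simp add: trunc_def)
    show "g j x = trunc r (\<lambda>j. w j / w i) j * g i x" if "j < r" for j using g_zero_iff[OF xU] xC that i by simp
  qed
  then obtain y where "y \<in> V i" "\<sigma> y = x" "z i y = trunc r (\<lambda>j. w j / w i)" by blast
  then show ?thesis using w0 by (intro bexI[of _ y]) (simp_all add: trunc_def)
qed

text \<open>Recovers the base point from a lift. It is needed at every point of \<open>C\<close>,
  since the unique choice in \<open>theta_down\<close> ranges over all of them.\<close>

lemma normal_lift_over:
  assumes xU: "x \<in> U" and xC: "x \<in> C" and m: "m \<in> normal_nz X C x"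
  shows "\<sigma> (fst (normal_lift Y X C \<sigma> (x, m))) = x"
proof -
  obtain w i where w: "m = coset X x {..<r} g w" and i: "i < r" "w i \<noteq> 0"
    using m unfolding normal_nz_C[OF xU xC] by blast
  obtain y where y: "y \<in> V i" "\<sigma> y = x" "\<forall>j<r. w j = w i * z i y j"
    using chart_point_of_direction[of x i w, OF xU xC i] by blast
  have wj: "w j = w i * z i y j" if "j < r" for j using y(3) that by blast
  show ?thesis using normal_lift_eq[OF y(1) _ i(2) wj] xC y(2) by (simp add: w)
qed

text \<open>The hypothesis \<open>over\<close> brings every competing base point into the present
  chart. There a competing normal vector has the same lift, so its coordinates are a positive
  multiple of the given ones.\<close>

lemma theta_down_eq:
  assumes over: "\<And>x m. x \<in> C \<Longrightarrow> m \<in> normal_nz X C x \<Longrightarrow> \<sigma> (fst (normal_lift Y X C \<sigma> (x, m))) = x"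
    and y: "y \<in> V i" and xC: "\<sigma> y \<in> C" and c: "c \<noteq> 0"
  shows "theta_down Y X C \<sigma> (y, ray (hcoset Y y (\<lambda>y'. g i (\<sigma> y')) c)) =
    (\<sigma> y, ray (coset X (\<sigma> y) {..<r} g (\<lambda>j. c * z i y j)))"
  unfolding theta_down_def prod.case
proof (rule the_equality)
  have xU: "\<sigma> y \<in> U" using V_D[OF y] by simp
  note i = z_outside[OF y] and zi = z_self[OF y]
  have "normal_lift Y X C \<sigma> (\<sigma> y, coset X (\<sigma> y) {..<r} g (\<lambda>j. c * z i y j)) = (y, hcoset Y y (\<lambda>y'. g i (\<sigma> y')) (c * z i y i))"
    by (rule normal_lift_eq[OF y xC]) (simp_all add: zi c)
  moreover have "coset X (\<sigma> y) {..<r} g (\<lambda>j. c * z i y j) \<in> normal_nz X C (\<sigma> y)"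
    unfolding normal_nz_C[OF xU xC] using i zi c by (intro CollectI exI[of _ "\<lambda>j. c * z i y j"] conjI refl exI[of _ i]) simp_all
  ultimately show "\<exists>x\<in>C. \<exists>m\<in>normal_nz X C x.
      (\<sigma> y, ray (coset X (\<sigma> y) {..<r} g (\<lambda>j. c * z i y j))) = (x, ray m) \<and>
      (\<exists>m'. normal_lift Y X C \<sigma> (x, m) = (y, m') \<and> ray (hcoset Y y (\<lambda>y'. g i (\<sigma> y')) c) = ray m')"
    using xC zi by (intro bexI[of _ "\<sigma> y"] bexI[of _ "coset X (\<sigma> y) {..<r} g (\<lambda>j. c * z i y j)"]) simp_all
next
  have xU: "\<sigma> y \<in> U" using V_D[OF y] by simp
  note i = z_outside[OF y] and zi = z_self[OF y] and sm = smooth_eq_exc[OF y xC]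
  fix p
  assume "\<exists>x\<in>C. \<exists>m\<in>normal_nz X C x. p = (x, ray m) \<and>
      (\<exists>m'. normal_lift Y X C \<sigma> (x, m) = (y, m') \<and> ray (hcoset Y y (\<lambda>y'. g i (\<sigma> y')) c) = ray m')"
  then obtain x m m' where x: "x \<in> C" and m: "m \<in> normal_nz X C x" and p: "p = (x, ray m)"
    and lift: "normal_lift Y X C \<sigma> (x, m) = (y, m')" and rays: "ray (hcoset Y y (\<lambda>y'. g i (\<sigma> y')) c) = ray m'" by blast
  have xy: "x = \<sigma> y" using over[OF x m] lift by simp
  obtain w i1 where w: "m = coset X (\<sigma> y) {..<r} g w" and i1: "i1 < r" "w i1 \<noteq> 0"
    using m unfolding xy normal_nz_C[OF xU xC] by blast
  obtain y1 where y1: "y1 \<in> V i1" "\<sigma> y1 = \<sigma> y" "\<forall>j<r. w j = w i1 * z i1 y1 j"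
    using chart_point_of_direction[of "\<sigma> y" i1 w, OF xU xC i1] by blast
  have w1: "w j = w i1 * z i1 y1 j" if "j < r" for j using y1(3) that by blast
  have "y1 = y"
    using normal_lift_eq[OF y1(1) _ i1(2) w1] lift xC y1(2) by (simp add: w xy)
  then have yV: "y \<in> V i1" and wy: "\<And>j. j < r \<Longrightarrow> w j = w i1 * z i1 y j" using y1(1) w1 by simp_all
  \<comment> \<open>The vector \<open>m\<close> is described in the chart \<open>i1\<close>; both
    homogeneous coordinates of \<open>y\<close> are nonzero, so it can be renormalised at the index
    \<open>i\<close>.\<close>
  have nz: "\<omega> y i1 \<noteq> 0" "\<omega> y i \<noteq> 0" using V_D[OF yV] V_D[OF y] by simp_all
  have wi: "w i \<noteq> 0" unfolding wy[OF i] using i1(2) nz by (simp add: z_def)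
  have wz: "w j = w i * z i y j" if "j < r" for j
    unfolding wy[OF i] wy[OF that] using nz by (simp add: z_def)
  have "m' = hcoset Y y (\<lambda>y'. g i (\<sigma> y')) (w i)"
    using normal_lift_eq[OF y xC wi wz] lift by (simp add: w xy)
  then obtain s where s: "s > 0" "c = of_real s * w i"
    using rays Y.ray_hcoset_eq_iff[OF sm] by auto
  have "ray m = ray (coset X (\<sigma> y) {..<r} g (\<lambda>j. c * z i y j))"
    unfolding w
  proof (rule sym, rule iffD2[OF X.ray_coset_eq_iff[OF coset_C_nonempty[OF xU xC]]], intro exI conjI ballI)
    show "s > 0" by (rule s(1))
    fix j assume "j \<in> {..<r}"
    then show "c * z i y j = of_real s * w j" using wz[of j] s(2) by simp
  qed
  then show "p = (\<sigma> y, ray (coset X (\<sigma> y) {..<r} g (\<lambda>j. c * z i y j)))" unfolding p xy by simp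
qed

end

text \<open>Adds, at one point \<open>x\<close> of the centre, equations of all components. Normal
  crossings enter as \<open>d_surj\<close>, the joint surjectivity of their differentials;
  \<open>h\<close> expresses that every component contains \<open>C\<close>. The assumption
  \<open>over\<close> concerns all of \<open>C\<close> and is discharged before any point is
  fixed.\<close>

locale blowup_snc = blowup_chart +
  fixes K :: "'k set" and D :: "'k \<Rightarrow> 'a set" and x :: 'a and d :: "'k \<Rightarrow> 'a \<Rightarrow> complex"
    and h :: "'k \<Rightarrow> nat \<Rightarrow> 'a \<Rightarrow> complex"
  assumes K: "finite K" "K \<noteq> {}" and xU: "x \<in> U" and xC: "x \<in> C"
    and CD: "\<And>k. k \<in> K \<Longrightarrow> C \<subseteq> D k" and D_closed: "\<And>k. k \<in> K \<Longrightarrow> closedin (zar X) (D k)"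
    and D_smooth: "\<And>k. k \<in> K \<Longrightarrow> smooth_eq X (D k) x (d k)"
    and d_surj: "\<And>c. \<exists>v\<in>tangent X x. \<forall>k\<in>K. v (d k) = c k"
    and h_stalk: "\<And>k j. k \<in> K \<Longrightarrow> j < r \<Longrightarrow> h k j \<in> stalk X x"
    and d_eq: "\<And>k. k \<in> K \<Longrightarrow> eventually (\<lambda>x'. d k x' = (\<Sum>j<r. h k j x' * g j x')) (znhds X x)"
    and over: "\<And>x m. x \<in> C \<Longrightarrow> m \<in> normal_nz X C x \<Longrightarrow> \<sigma> (fst (normal_lift Y X C \<sigma> (x, m))) = x"
begin

text \<open>The projection \<pi> from the normal space of \<open>C\<close> to that of
  \<open>D k\<close>, in the coordinates given by the \<open>g j\<close> and by
  \<open>d k\<close>.\<close>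

definition lin :: "'k \<Rightarrow> (nat \<Rightarrow> complex) \<Rightarrow> complex" where
  "lin k w = (\<Sum>j<r. h k j x * w j)"

lemma lin_scale: "lin k (\<lambda>j. c * w j) = c * lin k w"
  by (simp add: lin_def sum_distrib_left algebra_simps)

lemma lin_cong: "(\<And>j. j < r \<Longrightarrow> w j = w' j) \<Longrightarrow> lin k w = lin k w'"
  by (simp add: lin_def)

abbreviation N :: "(nat \<Rightarrow> complex) \<Rightarrow> 'a tvec set" where
  "N w \<equiv> coset X x {..<r} g w"

lemma N_nonempty: "N w \<noteq> {}" by (rule coset_C_nonempty[OF xU xC])

lemma differential_D: "k \<in> K \<Longrightarrow> v \<in> tangent X x \<Longrightarrow> v (d k) = lin k (\<lambda>j. v (g j))"
  unfolding lin_def by (rule differential_d[OF xU xC CD D_smooth h_stalk d_eq])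

lemma normal_proj_N:
  assumes k: "k \<in> K"
  shows "normal_proj X (D k) x (N w) = hcoset X x (d k) (lin k w)"
proof -
  have "normal_class X (D k) x v = hcoset X x (d k) (lin k w)" if "v \<in> N w" for v
  proof -
    have v: "v \<in> tangent X x" "\<And>j. j < r \<Longrightarrow> v (g j) = w j" using that by (simp_all add: coset_def)
    show ?thesis unfolding X.normal_class_hcoset[OF D_smooth[OF k] v(1)] differential_D[OF k v(1)]
      using lin_cong[of "\<lambda>j. v (g j)" w k] v(2) by simp
  qed
  then show ?thesis using N_nonempty[of w] unfolding normal_proj_def by blast
qed

lemma normal_proj_N_zero_iff:
  "k \<in> K \<Longrightarrow> normal_proj X (D k) x (N w) = tangent_sub X (D k) x \<longleftrightarrow> lin k w = 0"
  unfolding normal_proj_N X.tangent_sub_hcoset[OF D_smooth] X.hcoset_eq_iff[OF D_smooth] ..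

lemma normal_proj_ray:
  assumes k: "k \<in> K"
  shows "normal_proj X (D k) x ` ray (N w) = ray (hcoset X x (d k) (lin k w))"
proof -
  have "normal_proj X (D k) x ` ray (N w) = {normal_proj X (D k) x (N (\<lambda>j. of_real s * w j)) | s :: real. s > 0}"
    unfolding X.ray_coset by blast
  also have "\<dots> = ray (hcoset X x (d k) (lin k w))"
    unfolding X.ray_hcoset normal_proj_N[OF k] lin_scale ..
  finally show ?thesis .
qed

abbreviation ee :: "nat \<Rightarrow> 'b \<Rightarrow> complex" where
  "ee i \<equiv> \<lambda>y'. g i (\<sigma> y')"

definition dt :: "'k \<Rightarrow> nat \<Rightarrow> 'b \<Rightarrow> complex" where
  "dt k i = strict_eq (h k) i"

abbreviation S :: "'k \<Rightarrow> 'b set" where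
  "S k \<equiv> strict_transform Y C \<sigma> (D k)"

context
  fixes y i
  assumes y: "y \<in> V i" and yx: "\<sigma> y = x"
begin

lemma yC: "\<sigma> y \<in> C" using yx xC by simp

lemma yp: "y \<in> pts Y" and ir: "i < r" using V_D[OF y] z_outside[OF y] by simp_all

lemma y_exc: "y \<in> exc_divisor Y C \<sigma>" using yp yC by (simp add: exc_divisor_def)

lemma smooth_E: "smooth_eq Y (exc_divisor Y C \<sigma>) y (ee i)"
  by (rule smooth_eq_exc[OF y yC])

context
  fixes k assumes k: "k \<in> K"
begin

lemma dt_value: "dt k i y = lin k (z i y)"
proof -
  have "strict_eq (h k) i y = (\<Sum>j<r. h k j (\<sigma> y) * z i y j)"
    by (rule strict_eq_def[OF xU xC CD[OF k] D_smooth[OF k] h_stalk[OF k] d_eq[OF k]])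
  then show ?thesis by (simp add: dt_def lin_def yx)
qed

lemma dt_stalk: "dt k i \<in> stalk Y y"
  unfolding dt_def by (rule strict_eq_stalk[OF xU xC CD[OF k] D_smooth[OF k] h_stalk[OF k] d_eq[OF k] y yx])

lemma dt_factor: "eventually (\<lambda>y'. d k (\<sigma> y') = ee i y' * dt k i y') (znhds Y y)"
  unfolding dt_def by (rule strict_eq_factor[OF xU xC CD[OF k] D_smooth[OF k] h_stalk[OF k] d_eq[OF k] y yx])

lemma local_eq_dt: "local_eq Y (S k) y (dt k i)"
  unfolding dt_def by (rule local_eq_strict[OF xU xC CD[OF k] D_smooth[OF k] h_stalk[OF k] d_eq[OF k] y yx])

lemma mem_S_iff: "y \<in> S k \<longleftrightarrow> lin k (z i y) = 0"
  unfolding lin_def by (rule strict_transform_iff[OF xU xC CD[OF k] D_smooth[OF k] h_stalk[OF k] d_eq[OF k] y yx])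

lemma velocity_dt:
  assumes "complex_arc Y \<gamma>" "\<gamma> 0 = y" "\<And>f. f \<in> stalk X (\<sigma> y) \<Longrightarrow> velocity Y \<gamma> (\<lambda>y'. f (\<sigma> y')) = v f"
    "\<And>j. j < r \<Longrightarrow> velocity Y \<gamma> (\<lambda>y'. z i y' j) = \<zeta> j"
  shows "velocity Y \<gamma> (dt k i) = lin k \<zeta> + (\<Sum>j<r. z i y j * v (h k j))"
  unfolding dt_def lin_def
  by (rule velocity_strict_eq[OF xU xC CD[OF k] D_smooth[OF k] h_stalk[OF k] d_eq[OF k] y yx assms])

end

text \<open>The strict transforms through \<open>y\<close> are transversal inside the fibre. A
  relation that holds on vectors with \<open>\<zeta> i = 0\<close> also holds on
  \<open>z i y\<close>, because \<open>y\<close> lies on these strict transforms. As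
  \<open>z i y i = 1\<close>, it holds on all vectors, and then \<open>d_surj\<close> makes it
  trivial.\<close>

lemma lin_surj:
  assumes Q: "Q \<subseteq> K" and yQ: "\<And>q. q \<in> Q \<Longrightarrow> y \<in> S q"
  shows "\<exists>\<zeta>. \<zeta> i = 0 \<and> (\<forall>q\<in>Q. lin q \<zeta> = \<mu> q)"
proof -
  define W where "W = {w. \<exists>\<zeta>. \<zeta> i = 0 \<and> w = (\<lambda>q. lin q \<zeta>)}"
  have W: "(\<lambda>q. lin q \<zeta>) \<in> W" if "\<zeta> i = 0" for \<zeta> unfolding W_def using that by blast
  have "\<exists>w\<in>W. \<forall>q\<in>Q. w q = \<mu> q"
  proof (rule independent_surj[OF finite_subset[OF Q K(1)] W[of "\<lambda>_. 0"]])
    fix c1 c2 :: complex and u1 u2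
    assume "u1 \<in> W" "u2 \<in> W"
    then obtain \<zeta>1 \<zeta>2 where \<zeta>: "\<zeta>1 i = 0" "u1 = (\<lambda>q. lin q \<zeta>1)" "\<zeta>2 i = 0" "u2 = (\<lambda>q. lin q \<zeta>2)" unfolding W_def by blast
    have "(\<lambda>q. c1 * u1 q + c2 * u2 q) = (\<lambda>q. lin q (\<lambda>j. c1 * \<zeta>1 j + c2 * \<zeta>2 j))"
      unfolding \<zeta> by (simp add: lin_def algebra_simps sum.distrib sum_distrib_left)
    then show "(\<lambda>q. c1 * u1 q + c2 * u2 q) \<in> W" using W[of "\<lambda>j. c1 * \<zeta>1 j + c2 * \<zeta>2 j"] \<zeta> by simp
  next
    fix c :: "'k \<Rightarrow> complex"
    assume c: "\<And>w. w \<in> W \<Longrightarrow> (\<Sum>q\<in>Q. c q * w q) = 0"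
    define R where "R j = (\<Sum>q\<in>Q. c q * h q j x)" for j
    have tot: "(\<Sum>q\<in>Q. c q * lin q w) = (\<Sum>j<r. R j * w j)" for w
      unfolding lin_def R_def sum_distrib_left sum_distrib_right by (subst sum.swap) (simp add: algebra_simps)
    have R0: "R j = 0" if "j < r" "j \<noteq> i" for j
    proof -
      define \<zeta> where "\<zeta> l = (if l = j then 1 else 0 :: complex)" for l
      have "(\<Sum>l<r. R l * \<zeta> l) = 0" using c[OF W[of \<zeta>]] that(2) tot by (simp add: \<zeta>_def)
      moreover have "(\<Sum>l<r. R l * \<zeta> l) = (\<Sum>l<r. if l = j then R l else 0)" by (intro sum.cong) (auto simp: \<zeta>_def)
      ultimately show ?thesis using that(1) by simp
    qed
    \<comment> \<open>Evaluate the relation at \<open>z i y\<close>: each \<open>lin q\<close>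
      vanishes there, and among the coefficients \<open>R\<close> only the one with index
      \<open>i\<close> can remain.\<close>
    have "R i = 0"
    proof -
      have "(\<Sum>j<r. R j * z i y j) = (\<Sum>j<r. if j = i then R j else 0)"
        by (intro sum.cong refl) (use R0 z_self[OF y] in auto)
      moreover have "(\<Sum>q\<in>Q. c q * lin q (z i y)) = 0"
        using yQ mem_S_iff Q by (intro sum.neutral) auto
      ultimately show ?thesis using tot[of "z i y"] ir by simp
    qed
    then have R: "R j = 0" if "j < r" for j using R0 that by (cases "j = i") auto
    show "\<forall>q\<in>Q. c q = 0"
    proof
      fix q0 assume q0: "q0 \<in> Q"
      obtain v where v: "v \<in> tangent X x" "\<forall>k\<in>K. v (d k) = (if k = q0 then 1 else 0)"
        using d_surj[of "\<lambda>k. if k = q0 then 1 else 0"] by blast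
      have "(\<Sum>q\<in>Q. c q * lin q (\<lambda>j. v (g j))) = (\<Sum>q\<in>Q. if q = q0 then c q else 0)"
      proof (intro sum.cong refl)
        fix q assume "q \<in> Q"
        then have "q \<in> K" using Q by blast
        then show "c q * lin q (\<lambda>j. v (g j)) = (if q = q0 then c q else 0)"
          using differential_D[OF \<open>q \<in> K\<close> v(1)] bspec[OF v(2) \<open>q \<in> K\<close>] by (cases "q = q0") simp_all
      qed
      then show "c q0 = 0" using tot[of "\<lambda>j. v (g j)"] R q0 finite_subset[OF Q K(1)] by simp
    qed
  qed simp
  then obtain w where "w \<in> W" "\<forall>q\<in>Q. w q = \<mu> q" by blast
  then show ?thesis unfolding W_def by auto
qed

text \<open>Normal crossings upstairs in the form needed later: the normal components along the
  exceptional divisor and along all strict transforms through \<open>y\<close> can be chosen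
  independently.\<close>

lemma arc_prescribed:
  assumes Q: "Q \<subseteq> K" and yQ: "\<And>q. q \<in> Q \<Longrightarrow> y \<in> S q"
  obtains \<gamma> where "complex_arc Y \<gamma>" "\<gamma> 0 = y" "velocity Y \<gamma> (ee i) = c" "\<forall>q\<in>Q. velocity Y \<gamma> (dt q i) = \<mu> q"
proof -
  obtain v where v: "v \<in> tangent X x" "\<forall>j<r. v (g j) = c * z i y j"
    using g_differentials_surj[OF xU xC, of "\<lambda>j. c * z i y j"] by blast
  \<comment> \<open>The velocity of \<open>dt q i\<close> also contains the derivatives of the
    coefficients \<open>h q j\<close> along \<open>v\<close>; the fibre velocity compensates for
    them.\<close>
  obtain \<zeta> where \<zeta>: "\<zeta> i = 0" "\<forall>q\<in>Q. lin q \<zeta> = \<mu> q - (\<Sum>j<r. z i y j * v (h q j))"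
    using lin_surj[OF assms, of "\<lambda>q. \<mu> q - (\<Sum>j<r. z i y j * v (h q j))"] by blast
  have v1: "v \<in> tangent X (\<sigma> y)" using v(1) yx by simp
  have v2: "v (g j) = c * z i y j" if "j < r" for j using v(2) that by simp
  show thesis
  proof (rule arc_exists[of y i v c \<zeta>, OF y yC v1 v2 \<zeta>(1)])
    fix \<gamma>
    assume \<gamma>: "complex_arc Y \<gamma>" "\<gamma> 0 = y" "\<And>f. f \<in> stalk X (\<sigma> y) \<Longrightarrow> velocity Y \<gamma> (\<lambda>y'. f (\<sigma> y')) = v f"
     "\<And>j. j < r \<Longrightarrow> velocity Y \<gamma> (\<lambda>y'. z i y' j) = \<zeta> j"
    show thesis
    proof (rule that[OF \<gamma>(1,2)])
      show "velocity Y \<gamma> (ee i) = c" using \<gamma>(3)[of "g i"] g_stalk[OF ir xU] v(2) ir z_self[OF y] yx by simp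
      show "\<forall>q\<in>Q. velocity Y \<gamma> (dt q i) = \<mu> q"
      proof
        fix q assume q: "q \<in> Q"
        then have "q \<in> K" using Q by blast
        from velocity_dt[OF this \<gamma>] show "velocity Y \<gamma> (dt q i) = \<mu> q" using \<zeta>(2) q by simp
      qed
    qed
  qed simp_all
qed

lemma smooth_S:
  assumes k: "k \<in> K" and yS: "y \<in> S k"
  shows "smooth_eq Y (S k) y (dt k i)"
proof -
  obtain \<gamma> where \<gamma>: "complex_arc Y \<gamma>" "\<gamma> 0 = y" "\<forall>q\<in>{k}. velocity Y \<gamma> (dt q i) = 1"
    using arc_prescribed[of "{k}" 0 "\<lambda>_. 1"] k yS by auto
  then have "velocity Y \<gamma> \<in> tangent Y y" "velocity Y \<gamma> (dt k i) \<noteq> 0" using Y.velocity_tangent[OF \<gamma>(1)] by simp_all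
  then show ?thesis using yS local_eq_dt[OF k] unfolding smooth_eq_def by blast
qed

text \<open>Independence of the chosen equations. They differ from \<open>d k\<close>,
  \<open>ee i\<close> and \<open>dt k i\<close> by units \<open>u\<close>, \<open>u1\<close>,
  \<open>u2\<close>, and the product formula requires \<open>u x = u1 y * u2 y\<close>. The
  factorisation gives this after \<open>ee i\<close> and then \<open>dt k i\<close> are
  removed.\<close>

lemma normal_mult_eq:
  assumes k: "k \<in> K" and yS: "y \<in> S k"
  shows "normal_mult Y X C \<sigma> (D k) y (hcoset Y y (ee i) c) (hcoset Y y (dt k i) c') = hcoset X x (d k) (c * c')"
  unfolding normal_mult_def yx
proof (rule the_equality)
  note smD = D_smooth[OF k] and smS = smooth_S[OF k yS] and smE = smooth_E
  note dst = dt_stalk[OF k] and est = g_sigma_stalk[OF y ir]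
  show "hcoset X x (d k) (c * c') \<in> normal X (D k) x \<and> (\<forall>gg ge ga. local_eq X (D k) x gg \<longrightarrow>
     local_eq Y (exc_divisor Y C \<sigma>) y ge \<longrightarrow> local_eq Y (S k) y ga \<longrightarrow> germ_eq Y y (gg \<circ> \<sigma>) (\<lambda>z. ge z * ga z) \<longrightarrow>
     nderiv (hcoset X x (d k) (c * c')) gg = nderiv (hcoset Y y (ee i) c) ge * nderiv (hcoset Y y (dt k i) c') ga)"
  proof (intro conjI allI impI)
    show "hcoset X x (d k) (c * c') \<in> normal X (D k) x" unfolding X.normal_hcoset[OF smD] by simp
    fix gg ge ga
    assume gg: "local_eq X (D k) x gg" and ge: "local_eq Y (exc_divisor Y C \<sigma>) y ge" and ga: "local_eq Y (S k) y ga"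
      and germ: "germ_eq Y y (gg \<circ> \<sigma>) (\<lambda>z. ge z * ga z)"
    obtain u where u: "u \<in> stalk X x" "u x \<noteq> 0" "eventually (\<lambda>x'. gg x' = u x' * d k x') (znhds X x)"
      by (rule X.local_eq_unit[OF smD gg])
    obtain u1 where u1: "u1 \<in> stalk Y y" "u1 y \<noteq> 0" "eventually (\<lambda>y'. ge y' = u1 y' * ee i y') (znhds Y y)"
      by (rule Y.local_eq_unit[OF smE ge])
    obtain u2 where u2: "u2 \<in> stalk Y y" "u2 y \<noteq> 0" "eventually (\<lambda>y'. ga y' = u2 y' * dt k i y') (znhds Y y)"
      by (rule Y.local_eq_unit[OF smS ga])
    have ust: "(\<lambda>y'. u (\<sigma> y')) \<in> stalk Y y" by (rule stalk_sigma[OF yp]) (simp add: yx u(1))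
    have germ': "eventually (\<lambda>y'. gg (\<sigma> y') = ge y' * ga y') (znhds Y y)"
      using germ by (simp add: germ_eq_iff[OF yp] comp_def)
    have "eventually (\<lambda>y'. ((u (\<sigma> y') - u1 y' * u2 y') * dt k i y') * ee i y' = 0) (znhds Y y)"
      using germ' u1(3) u2(3) eventually_sigma[OF yp u(3)[folded yx]] dt_factor[OF k]
      by eventually_elim (simp add: algebra_simps)
    note dst2 = Y.stalk_diff[OF ust Y.stalk_mult[OF u1(1) u2(1)]]
    have "eventually (\<lambda>y'. (u (\<sigma> y') - u1 y' * u2 y') * dt k i y' = 0) (znhds Y y)"
      by (rule exc_cancel[OF y yC Y.stalk_mult[OF dst2 dst]]) fact
    then have ev0: "eventually (\<lambda>y'. 0 = (u (\<sigma> y') - u1 y' * u2 y') * dt k i y') (znhds Y y)"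
      by eventually_elim simp
    \<comment> \<open>The factor \<open>dt k i\<close> is removed by a derivation: it vanishes at
      \<open>y\<close> and \<open>t\<close> does not kill it, so only the value of the other factor
      at \<open>y\<close> survives.\<close>
    obtain t where t: "t \<in> tangent Y y" "t (dt k i) \<noteq> 0" using smS unfolding smooth_eq_def by blast
    have "t (\<lambda>y'. 0) = (u (\<sigma> y) - u1 y * u2 y) * t (dt k i)"
      by (rule Y.tangent_multiple[OF t(1) dst2 dst Y.smooth_eqD(5)[OF smS] Y.stalk_const[OF yp] ev0])
    then have "u x = u1 y * u2 y" using t(2) Y.tangent_const[OF t(1) yp, of 0] yx by simp
    then show "nderiv (hcoset X x (d k) (c * c')) gg = nderiv (hcoset Y y (ee i) c) ge * nderiv (hcoset Y y (dt k i) c') ga"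
      unfolding X.nderiv_hcoset[OF smD u(1) X.local_eqD(1)[OF gg] u(3)]
        Y.nderiv_hcoset[OF smE u1(1) Y.local_eqD(1)[OF ge] u1(3)]
        Y.nderiv_hcoset[OF smS u2(1) Y.local_eqD(1)[OF ga] u2(3)] by simp
  qed
next
  note smD = D_smooth[OF k] and smS = smooth_S[OF k yS] and smE = smooth_E
  fix m
  assume m: "m \<in> normal X (D k) x \<and> (\<forall>gg ge ga. local_eq X (D k) x gg \<longrightarrow>
     local_eq Y (exc_divisor Y C \<sigma>) y ge \<longrightarrow> local_eq Y (S k) y ga \<longrightarrow> germ_eq Y y (gg \<circ> \<sigma>) (\<lambda>z. ge z * ga z) \<longrightarrow>
     nderiv m gg = nderiv (hcoset Y y (ee i) c) ge * nderiv (hcoset Y y (dt k i) c') ga)"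
  then obtain b' where b': "m = hcoset X x (d k) b'" unfolding X.normal_hcoset[OF smD] by blast
  have "germ_eq Y y (d k \<circ> \<sigma>) (\<lambda>z. ee i z * dt k i z)"
    using dt_factor[OF k] by (simp add: germ_eq_iff[OF yp] comp_def)
  then have "nderiv m (d k) = nderiv (hcoset Y y (ee i) c) (ee i) * nderiv (hcoset Y y (dt k i) c') (dt k i)"
    using m X.smooth_eqD(2)[OF smD] Y.smooth_eqD(2)[OF smE] Y.smooth_eqD(2)[OF smS] by blast
  then have "b' = c * c'"
    unfolding b' X.nderiv_hcoset_self[OF smD] Y.nderiv_hcoset_self[OF smE] Y.nderiv_hcoset_self[OF smS] .
  then show "m = hcoset X x (d k) (c * c')" by (simp add: b')
qed

lemma dir_mult_eq:
  assumes k: "k \<in> K" and yS: "y \<in> S k"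
  shows "dir_mult Y X C \<sigma> (D k) y (ray (hcoset Y y (ee i) c)) (ray (hcoset Y y (dt k i) c')) = ray (hcoset X x (d k) (c * c'))"
proof (intro equalityI subsetI)
  fix m assume "m \<in> dir_mult Y X C \<sigma> (D k) y (ray (hcoset Y y (ee i) c)) (ray (hcoset Y y (dt k i) c'))"
  then obtain s s' :: real where s: "s > 0" "s' > 0"
    "m = normal_mult Y X C \<sigma> (D k) y (hcoset Y y (ee i) (of_real s * c)) (hcoset Y y (dt k i) (of_real s' * c'))"
    unfolding dir_mult_def Y.ray_hcoset by blast
  then have "m = hcoset X x (d k) (of_real (s * s') * (c * c'))"
    unfolding normal_mult_eq[OF assms] by (simp add: algebra_simps)
  then show "m \<in> ray (hcoset X x (d k) (c * c'))" unfolding X.ray_hcoset using s(1,2)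
    by (intro CollectI exI[of _ "s * s'"]) simp
next
  fix m assume "m \<in> ray (hcoset X x (d k) (c * c'))"
  then obtain s :: real where s: "s > 0" "m = hcoset X x (d k) (of_real s * (c * c'))" unfolding X.ray_hcoset by blast
  have "m = normal_mult Y X C \<sigma> (D k) y (hcoset Y y (ee i) (of_real s * c)) (hcoset Y y (dt k i) (of_real 1 * c'))"
    unfolding normal_mult_eq[OF assms] s(2) by (simp add: algebra_simps)
  moreover have "hcoset Y y (ee i) (of_real s * c) \<in> ray (hcoset Y y (ee i) c)"
    unfolding Y.ray_hcoset using s(1) by blast
  moreover have "hcoset Y y (dt k i) (of_real 1 * c') \<in> ray (hcoset Y y (dt k i) c')"
    unfolding Y.ray_hcoset using zero_less_one by blast
  ultimately show "m \<in> dir_mult Y X C \<sigma> (D k) y (ray (hcoset Y y (ee i) c)) (ray (hcoset Y y (dt k i) c'))"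
    unfolding dir_mult_def by blast
qed

end

end

section \<open>Directions and log-spaces\<close>

lemma with_zero_cases:
  assumes "p \<in> with_zero Q"
  obtains "p = None" | q where "q \<in> Q" "p = Some q"
  using assms unfolding with_zero_def by blast

lemma sgn_mult_cmod: "c = of_real (cmod c) * sgn c" for c :: complex
  by (cases "c = 0") (simp_all add: sgn_eq)

context blowup_snc
begin

abbreviation B :: "'a set" where
  "B \<equiv> \<Union>k\<in>K. D k"

abbreviation B' :: "'b set" where
  "B' \<equiv> pts Y \<inter> \<sigma> -` B"

lemma B_closed: "closedin (zar X) B"
  by (intro closedin_Union finite_imageI K(1)) (use D_closed in auto)

lemma B'_closed: "closedin (zar Y) B'"
  by (rule closedin_sigma[OF B_closed])

text \<open>Membership requires that \<open>d k\<close> has no zeros near \<open>x\<close> outside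
  \<open>D k\<close>, which is more than vanishing on \<open>D k\<close> and is supplied by
  \<open>local_eq_zero_set\<close>.\<close>

lemma d_log: "k \<in> K \<Longrightarrow> d k \<in> log_monoid X B x"
proof -
  assume k: "k \<in> K"
  have "eventually (\<lambda>y. d k y = 0 \<longrightarrow> y \<in> D k) (znhds X x)"
    by (rule X.local_eq_zero_set[OF D_closed[OF k] X.smooth_eqD(2)[OF D_smooth[OF k]]])
  then have "eventually (\<lambda>y. y \<notin> B \<longrightarrow> d k y \<noteq> 0) (znhds X x)"
    by eventually_elim (use k in blast)
  then show ?thesis using X.smooth_eqD(3)[OF D_smooth[OF k]] by (simp add: X.log_monoid_iff[OF B_closed])
qed

lemma sigma_log_monoid:
  assumes "y \<in> pts Y" "f \<in> log_monoid X B (\<sigma> y)"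
  shows "(\<lambda>y'. f (\<sigma> y')) \<in> log_monoid Y B' y"
proof -
  have f: "f \<in> stalk X (\<sigma> y)" "eventually (\<lambda>x. x \<notin> B \<longrightarrow> f x \<noteq> 0) (znhds X (\<sigma> y))"
    using assms(2) by (simp_all add: X.log_monoid_iff[OF B_closed])
  have "eventually (\<lambda>y'. y' \<notin> B' \<longrightarrow> f (\<sigma> y') \<noteq> 0) (znhds Y y)"
    using eventually_sigma[OF assms(1) f(2)] eventually_znhds_pts by eventually_elim blast
  then show ?thesis using stalk_sigma[OF assms(1) f(1)] by (simp add: Y.log_monoid_iff[OF B'_closed])
qed

lemma dirs_D: "k \<in> K \<Longrightarrow> dirs X (D k) x = {ray (hcoset X x (d k) c) | c. c \<noteq> 0}"
  by (rule X.dirs_hcoset[OF D_smooth])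

context
  fixes Q assumes QK: "Q \<subset> K"
begin

lemma Q_K: "q \<in> Q \<Longrightarrow> q \<in> K" using QK by blast

context
  fixes y i
  assumes y: "y \<in> V i" and yx: "\<sigma> y = x"
begin

lemma d_sigma_log: "k \<in> K \<Longrightarrow> (\<lambda>y'. d k (\<sigma> y')) \<in> log_monoid Y B' y"
  by (rule sigma_log_monoid[OF yp[OF y yx]]) (simp add: yx d_log)

lemma dt_log: "k \<in> K \<Longrightarrow> dt k i \<in> log_monoid Y B' y"
  by (rule Y.log_monoid_factor(2)[OF B'_closed g_sigma_stalk[OF y ir[OF y yx]] dt_stalk[OF y yx] d_sigma_log dt_factor[OF y yx]])

lemma ee_log: "ee i \<in> log_monoid Y B' y"
proof -
  \<comment> \<open>Any component contains the centre, so \<open>ee i\<close> is a factor of its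
    pulled-back equation; here \<open>K\<close> is nonempty.\<close>
  obtain k where k: "k \<in> K" using K(2) by blast
  show ?thesis
    by (rule Y.log_monoid_factor(1)[OF B'_closed g_sigma_stalk[OF y ir[OF y yx]] dt_stalk[OF y yx k] d_sigma_log[OF k] dt_factor[OF y yx k]])
qed

lemma stratum_iff:
  "y \<in> stratum Y C \<sigma> D K Q \<longleftrightarrow> (\<forall>q\<in>Q. lin q (z i y) = 0) \<and> (\<forall>k\<in>K - Q. lin k (z i y) \<noteq> 0)"
proof -
  have "y \<in> S k \<longleftrightarrow> lin k (z i y) = 0" if "k \<in> K" for k by (rule mem_S_iff[OF y yx that])
  then show ?thesis using y_exc[OF y yx] Q_K unfolding stratum_def by auto
qed

context
  assumes st: "y \<in> stratum Y C \<sigma> D K Q"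
begin

lemma y_S: "q \<in> Q \<Longrightarrow> y \<in> S q" using st by (simp add: stratum_def)

lemma lin_Q: "q \<in> Q \<Longrightarrow> lin q (z i y) = 0" and lin_not_Q: "k \<in> K \<Longrightarrow> k \<notin> Q \<Longrightarrow> lin k (z i y) \<noteq> 0"
  using st unfolding stratum_iff by blast+

lemma smooth_S_Q: "q \<in> Q \<Longrightarrow> smooth_eq Y (S q) y (dt q i)"
  by (rule smooth_S[OF y yx Q_K y_S])

definition dir_data :: "complex \<Rightarrow> ('k \<Rightarrow> complex) \<Rightarrow> 'k option \<Rightarrow> 'b tvec set set" where
  "dir_data c0 cq = (\<lambda>p\<in>with_zero Q. case p of None \<Rightarrow> ray (hcoset Y y (ee i) c0)
     | Some q \<Rightarrow> ray (hcoset Y y (dt q i) (cq q)))"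

lemma dir_data_None: "dir_data c0 cq None = ray (hcoset Y y (ee i) c0)"
  by (simp add: dir_data_def with_zero_def)

lemma dir_data_Some: "q \<in> Q \<Longrightarrow> dir_data c0 cq (Some q) = ray (hcoset Y y (dt q i) (cq q))"
  by (simp add: dir_data_def with_zero_def)

lemma dir_data_ext: "dir_data c0 cq \<in> extensional (with_zero Q)"
  by (simp add: dir_data_def)

lemma dir_data_mem:
  assumes "c0 \<noteq> 0" "\<And>q. q \<in> Q \<Longrightarrow> cq q \<noteq> 0"
  shows "(y, dir_data c0 cq) \<in> dir_bundle Y (up_div Y C \<sigma> D) (with_zero Q) (stratum Y C \<sigma> D K Q)"
  unfolding dir_bundle_def mem_Collect_eq prod.case
proof (intro conjI st PiE_I)
  fix p assume "p \<in> with_zero Q"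
  then show "dir_data c0 cq p \<in> dirs Y (up_div Y C \<sigma> D p) y"
  proof (cases rule: with_zero_cases)
    case 1
    show ?thesis unfolding 1 dir_data_None using assms(1) by (auto simp: up_div_def Y.dirs_hcoset[OF smooth_E[OF y yx]])
  next
    case (2 q)
    show ?thesis unfolding 2(2) dir_data_Some[OF 2(1)] using assms(2)[OF 2(1)]
      by (auto simp: up_div_def Y.dirs_hcoset[OF smooth_S_Q[OF 2(1)]])
  qed
next
  fix p assume "p \<notin> with_zero Q"
  then show "dir_data c0 cq p = undefined" using dir_data_ext by (rule extensional_arb[rotated])
qed

lemma dir_bundle_rep:
  assumes "(y, \<rho>) \<in> dir_bundle Y (up_div Y C \<sigma> D) (with_zero Q) (stratum Y C \<sigma> D K Q)"
  shows "\<exists>c0 cq. c0 \<noteq> 0 \<and> (\<forall>q\<in>Q. cq q \<noteq> 0) \<and> \<rho> = dir_data c0 cq"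
proof -
  have \<rho>: "\<rho> \<in> (\<Pi>\<^sub>E p\<in>with_zero Q. dirs Y (up_div Y C \<sigma> D p) y)" using assms by (simp add: dir_bundle_def)
  have "\<rho> None \<in> dirs Y (up_div Y C \<sigma> D None) y" by (rule PiE_mem[OF \<rho>]) (simp add: with_zero_def)
  then obtain c0 where c0: "c0 \<noteq> 0" "\<rho> None = ray (hcoset Y y (ee i) c0)"
    by (auto simp: up_div_def Y.dirs_hcoset[OF smooth_E[OF y yx]])
  have "\<forall>q\<in>Q. \<exists>c. c \<noteq> 0 \<and> \<rho> (Some q) = ray (hcoset Y y (dt q i) c)"
  proof
    fix q assume q: "q \<in> Q"
    have "\<rho> (Some q) \<in> dirs Y (up_div Y C \<sigma> D (Some q)) y" by (rule PiE_mem[OF \<rho>]) (simp add: with_zero_def q)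
    then show "\<exists>c. c \<noteq> 0 \<and> \<rho> (Some q) = ray (hcoset Y y (dt q i) c)"
      by (auto simp: up_div_def Y.dirs_hcoset[OF smooth_S_Q[OF q]])
  qed
  from bchoice[OF this] obtain cq where cq: "\<forall>q\<in>Q. cq q \<noteq> 0 \<and> \<rho> (Some q) = ray (hcoset Y y (dt q i) (cq q))" ..
  have "\<rho> = dir_data c0 cq"
  proof (rule extensionalityI[OF _ dir_data_ext])
    show "\<rho> \<in> extensional (with_zero Q)" using \<rho> by (simp add: PiE_def)
    fix p assume "p \<in> with_zero Q"
    then show "\<rho> p = dir_data c0 cq p"
      by (cases rule: with_zero_cases) (simp_all add: c0 cq dir_data_None dir_data_Some)
  qed
  then show ?thesis using c0(1) cq by blast
qed

lemma dir_data_eqI: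
  assumes "s > 0" "c0 = of_real s * c0'" "\<And>q. q \<in> Q \<Longrightarrow> \<exists>t>0. cq q = of_real t * cq' q"
  shows "dir_data c0 cq = dir_data c0' cq'"
proof (rule extensionalityI[OF dir_data_ext dir_data_ext])
  fix p assume "p \<in> with_zero Q"
  then show "dir_data c0 cq p = dir_data c0' cq' p"
  proof (cases rule: with_zero_cases)
    case 1
    show ?thesis unfolding 1 dir_data_None Y.ray_hcoset_eq_iff[OF smooth_E[OF y yx]] using assms(1,2) by blast
  next
    case (2 q)
    show ?thesis unfolding 2(2) dir_data_Some[OF 2(1)] Y.ray_hcoset_eq_iff[OF smooth_S_Q[OF 2(1)]] by (rule assms(3)[OF 2(1)])
  qed
qed

lemma H_log_eq:
  assumes c0: "c0 \<noteq> 0"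
  shows "H_log Y X D C \<sigma> Q (y, dir_data c0 cq) =
    (x, ray (N (\<lambda>j. c0 * z i y j)), \<lambda>q\<in>Q. ray (hcoset X x (d q) (c0 * cq q)))"
proof -
  have th: "theta_down Y X C \<sigma> (y, ray (hcoset Y y (ee i) c0)) = (x, ray (N (\<lambda>j. c0 * z i y j)))"
    using theta_down_eq[OF over y yC[OF y yx] c0] by (simp add: yx)
  have "(\<lambda>q\<in>Q. dir_mult Y X C \<sigma> (D q) y (dir_data c0 cq None) (dir_data c0 cq (Some q))) =
     (\<lambda>q\<in>Q. ray (hcoset X x (d q) (c0 * cq q)))"
  proof (rule restrict_ext)
    fix q assume q: "q \<in> Q"
    show "dir_mult Y X C \<sigma> (D q) y (dir_data c0 cq None) (dir_data c0 cq (Some q)) = ray (hcoset X x (d q) (c0 * cq q))"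
      unfolding dir_data_None dir_data_Some[OF q] by (rule dir_mult_eq[OF y yx Q_K[OF q] y_S[OF q]])
  qed
  then show ?thesis unfolding H_log_def prod.case dir_data_None th Let_def by simp
qed

lemma log_component:
  assumes \<phi>: "(y, \<phi>) \<in> log_space Y B'" and sm: "smooth_eq Y A y e" and e: "e \<in> log_monoid Y B' y"
  shows "(THE \<rho>. \<exists>m\<in>normal_nz Y A y. \<rho> = ray m \<and>
     (\<forall>g. local_eq Y A y g \<longrightarrow> \<phi> g = nderiv m g / of_real (cmod (nderiv m g)))) = ray (hcoset Y y e (\<phi> e))"
proof (rule Y.log_ident_component[OF sm])
  show "cmod (\<phi> e) = 1" by (rule Y.log_spaceD(4)[OF \<phi> e])
  fix f u assume "u \<in> stalk Y y" "u y \<noteq> 0" "eventually (\<lambda>y'. f y' = u y' * e y') (znhds Y y)"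
  then show "\<phi> f = sgn (u y) * \<phi> e" by (rule Y.log_char_unit_mult[OF B'_closed \<phi> e])
qed

lemma log_ident_up:
  assumes \<phi>: "(y, \<phi>) \<in> log_space Y B'"
  shows "log_ident Y (up_div Y C \<sigma> D) (with_zero Q) (y, \<phi>) = (y, dir_data (\<phi> (ee i)) (\<lambda>q. \<phi> (dt q i)))"
proof -
  have "(\<lambda>q\<in>with_zero Q. THE \<rho>. \<exists>m\<in>normal_nz Y (up_div Y C \<sigma> D q) y. \<rho> = ray m \<and>
     (\<forall>g. local_eq Y (up_div Y C \<sigma> D q) y g \<longrightarrow> \<phi> g = nderiv m g / of_real (cmod (nderiv m g)))) =
     dir_data (\<phi> (ee i)) (\<lambda>q. \<phi> (dt q i))" (is "?l = _")
  proof (rule extensionalityI[OF restrict_extensional dir_data_ext])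
    fix p assume p: "p \<in> with_zero Q"
    then show "?l p = dir_data (\<phi> (ee i)) (\<lambda>q. \<phi> (dt q i)) p"
    proof (cases rule: with_zero_cases)
      case 1
      show ?thesis unfolding 1 dir_data_None
        using log_component[OF \<phi> smooth_E[OF y yx] ee_log] p unfolding 1 by (simp add: up_div_def)
    next
      case (2 q)
      show ?thesis unfolding 2(2) dir_data_Some[OF 2(1)]
        using log_component[OF \<phi> smooth_S_Q[OF 2(1)] dt_log[OF Q_K[OF 2(1)]]] p unfolding 2(2) by (simp add: up_div_def)
    qed
  qed
  then show ?thesis by (simp add: log_ident_def)
qed

text \<open>Surjectivity of the identification over \<open>y\<close>: an arc with velocities
  \<open>c0\<close> and \<open>cq\<close> on the equations defines a log point with these
  directions.\<close>

lemma log_point_exists: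
  assumes c0: "c0 \<noteq> 0" and cq: "\<And>q. q \<in> Q \<Longrightarrow> cq q \<noteq> 0"
  shows "\<exists>\<phi>. (y, \<phi>) \<in> log_space Y B' \<and> log_ident Y (up_div Y C \<sigma> D) (with_zero Q) (y, \<phi>) = (y, dir_data c0 cq)"
proof -
  have "Q \<subseteq> K" using QK by blast
  obtain \<gamma> where \<gamma>: "complex_arc Y \<gamma>" "\<gamma> 0 = y" "velocity Y \<gamma> (ee i) = c0" "\<forall>q\<in>Q. velocity Y \<gamma> (dt q i) = cq q"
    by (rule arc_prescribed[OF y yx \<open>Q \<subseteq> K\<close> y_S])
  note ypts = yp[OF y yx]
  have ee_nz: "eventually (\<lambda>t. ee i (\<gamma> t) \<noteq> 0) (at 0)"
    by (rule Y.arc_nonzero[OF \<gamma>(1)]) (simp_all add: \<gamma>(2,3) c0 g_sigma_stalk[OF y ir[OF y yx]])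
  have dt_nz: "eventually (\<lambda>t. dt k i (\<gamma> t) \<noteq> 0) (at 0)" if k: "k \<in> K" for k
  proof (cases "k \<in> Q")
    case True
    then show ?thesis using \<gamma>(4) cq[OF True]
      by (intro Y.arc_nonzero[OF \<gamma>(1)]) (simp_all add: \<gamma>(2) dt_stalk[OF y yx k])
  next
    case False
    then have "dt k i y \<noteq> 0" using lin_not_Q[OF k] dt_value[OF y yx k] by simp
    from Y.stalk_nonzero[OF dt_stalk[OF y yx k] this] have "eventually (\<lambda>t. dt k i (\<gamma> t) \<noteq> 0) (nhds 0)"
      by (intro Y.arc_eventually[OF \<gamma>(1)]) (simp add: \<gamma>(2))
    then show ?thesis unfolding eventually_at_filter by (rule eventually_mono) simp
  qed
  have off1: "eventually (\<lambda>t. \<sigma> (\<gamma> t) \<notin> D k) (at 0)" if k: "k \<in> K" for k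
  proof -
    have "eventually (\<lambda>x'. x' \<in> D k \<longrightarrow> d k x' = 0) (znhds X (\<sigma> y))"
      using X.local_eqD(2)[OF X.smooth_eqD(2)[OF D_smooth[OF k]]] by (simp add: yx)
    from eventually_conj[OF eventually_sigma[OF ypts this] dt_factor[OF y yx k]]
    have "eventually (\<lambda>t. (\<sigma> (\<gamma> t) \<in> D k \<longrightarrow> d k (\<sigma> (\<gamma> t)) = 0) \<and> d k (\<sigma> (\<gamma> t)) = ee i (\<gamma> t) * dt k i (\<gamma> t)) (nhds 0)"
      by (intro Y.arc_eventually[OF \<gamma>(1)]) (simp add: \<gamma>(2))
    then have "eventually (\<lambda>t. (\<sigma> (\<gamma> t) \<in> D k \<longrightarrow> d k (\<sigma> (\<gamma> t)) = 0) \<and> d k (\<sigma> (\<gamma> t)) = ee i (\<gamma> t) * dt k i (\<gamma> t)) (at 0)"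
      by (rule filter_leD[OF at_within_le_nhds])
    then show ?thesis using ee_nz dt_nz[OF k] by eventually_elim auto
  qed
  have "eventually (\<lambda>t. \<forall>k\<in>K. \<sigma> (\<gamma> t) \<notin> D k) (at 0)"
    by (rule eventually_ball_finite[OF K(1)]) (use off1 in blast)
  then have off: "eventually (\<lambda>t. \<gamma> t \<notin> B') (at 0)" by eventually_elim blast
  obtain \<phi> where \<phi>0: "(\<gamma> 0, \<phi>) \<in> log_space Y B'"
    and \<phi>v: "\<forall>g. g \<in> log_monoid Y B' (\<gamma> 0) \<longrightarrow> g (\<gamma> 0) = 0 \<longrightarrow> velocity Y \<gamma> g \<noteq> 0 \<longrightarrow> \<phi> g = sgn (velocity Y \<gamma> g)"
    using Y.arc_log_point[OF B'_closed \<gamma>(1) off] by metis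
  have \<phi>: "(y, \<phi>) \<in> log_space Y B'" using \<phi>0 \<gamma>(2) by simp
  have "\<phi> (ee i) = sgn c0"
    using \<phi>v[rule_format, of "ee i"] \<gamma>(2,3) c0 ee_log Y.smooth_eqD(5)[OF smooth_E[OF y yx]] by simp
  moreover have "\<phi> (dt q i) = sgn (cq q)" if q: "q \<in> Q" for q
    using \<phi>v[rule_format, of "dt q i"] \<gamma>(2,4) cq[OF q] q dt_log[OF Q_K[OF q]] Y.smooth_eqD(5)[OF smooth_S_Q[OF q]] by simp
  \<comment> \<open>Characters have modulus 1, so they return \<open>sgn c0\<close> and
    \<open>sgn (cq q)\<close>, which span the same rays as \<open>c0\<close> and
    \<open>cq q\<close>.\<close>
  ultimately have "dir_data c0 cq = dir_data (\<phi> (ee i)) (\<lambda>q. \<phi> (dt q i))"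
    using c0 cq sgn_mult_cmod by (intro dir_data_eqI[of "cmod c0"]) (auto intro!: exI[of _ "cmod (cq _)"])
  then show ?thesis using \<phi> log_ident_up[OF \<phi>] by (intro exI[of _ \<phi>]) simp
qed

lemma sigma_log_ident:
  assumes \<phi>: "(y, \<phi>) \<in> log_space Y B'"
  shows "log_ident X D K (sigma_log X B \<sigma> (y, \<phi>)) = (x, \<lambda>k\<in>K. ray (hcoset X x (d k) (\<phi> (ee i) * \<phi> (dt k i))))"
proof -
  note ypts = yp[OF y yx]
  define \<phi>' where "\<phi>' = (\<lambda>g\<in>log_monoid X B x. \<phi> (g \<circ> \<sigma>))"
  have \<phi>': "\<phi>' f = \<phi> (\<lambda>y'. f (\<sigma> y'))" if "f \<in> log_monoid X B x" for f using that by (simp add: \<phi>'_def comp_def)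
  have "(THE \<rho>. \<exists>m\<in>normal_nz X (D k) x. \<rho> = ray m \<and>
     (\<forall>g. local_eq X (D k) x g \<longrightarrow> \<phi>' g = nderiv m g / of_real (cmod (nderiv m g)))) =
     ray (hcoset X x (d k) (\<phi> (ee i) * \<phi> (dt k i)))" if k: "k \<in> K" for k
  proof -
    have val: "\<phi>' (d k) = \<phi> (ee i) * \<phi> (dt k i)"
      unfolding \<phi>'[OF d_log[OF k]] by (rule Y.log_char_mult[OF B'_closed \<phi> ee_log dt_log[OF k] dt_factor[OF y yx k]])
    have "(THE \<rho>. \<exists>m\<in>normal_nz X (D k) x. \<rho> = ray m \<and>
     (\<forall>g. local_eq X (D k) x g \<longrightarrow> \<phi>' g = nderiv m g / of_real (cmod (nderiv m g)))) = ray (hcoset X x (d k) (\<phi>' (d k)))"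
    proof (rule X.log_ident_component[OF D_smooth[OF k]])
      show "cmod (\<phi>' (d k)) = 1" unfolding \<phi>'[OF d_log[OF k]] by (rule Y.log_spaceD(4)[OF \<phi> d_sigma_log[OF k]])
      fix f u assume f: "f \<in> stalk X x" and u: "u \<in> stalk X x" "u x \<noteq> 0" and ev: "eventually (\<lambda>x'. f x' = u x' * d k x') (znhds X x)"
      have ev': "eventually (\<lambda>x'. u x' * d k x' = f x') (znhds X x)" using ev by eventually_elim simp
      have fl: "f \<in> log_monoid X B x"
        by (rule X.log_monoid_cong[OF B_closed X.log_monoid_mult[OF B_closed X.unit_log_monoid[OF B_closed u] d_log[OF k]] ev'])
      have "\<phi> (\<lambda>y'. f (\<sigma> y')) = sgn (u (\<sigma> y)) * \<phi> (\<lambda>y'. d k (\<sigma> y'))"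
        by (rule Y.log_char_unit_mult[OF B'_closed \<phi> d_sigma_log[OF k]])
          (use u eventually_sigma[OF ypts ev[folded yx]] in \<open>simp_all add: yx stalk_sigma[OF ypts]\<close>)
      then show "\<phi>' f = sgn (u x) * \<phi>' (d k)" unfolding \<phi>'[OF fl] \<phi>'[OF d_log[OF k]] by (simp add: yx)
    qed
    then show ?thesis unfolding val .
  qed
  then have "(\<lambda>k\<in>K. THE \<rho>. \<exists>m\<in>normal_nz X (D k) x. \<rho> = ray m \<and>
     (\<forall>g. local_eq X (D k) x g \<longrightarrow> \<phi>' g = nderiv m g / of_real (cmod (nderiv m g)))) =
     (\<lambda>k\<in>K. ray (hcoset X x (d k) (\<phi> (ee i) * \<phi> (dt k i))))" by (rule restrict_ext)
  then show ?thesis unfolding sigma_log_def log_ident_def prod.case yx \<phi>'_def by simp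
qed

lemma h_log_eq:
  "h_log X K D Q (x, ray (N w), r') = (x, \<lambda>k\<in>K. if k \<in> Q then r' k else ray (hcoset X x (d k) (lin k w)))"
  unfolding h_log_def prod.case by (intro arg_cong[of _ _ "Pair x"] restrict_ext) (simp add: normal_proj_ray)

text \<open>\<open>inv_into\<close> returns some preimage \<phi> of the given directions. These
  directions are then written through the values of \<phi>, and both composites become rays computed
  from the same values, whichever preimage was returned.\<close>

lemma sigma_N_log_eq:
  assumes p: "(y, \<rho>) \<in> dir_bundle Y (up_div Y C \<sigma> D) (with_zero Q) (stratum Y C \<sigma> D K Q)"
  shows "sigma_N_log Y X K D C \<sigma> Q (y, \<rho>) = h_log X K D Q (H_log Y X D C \<sigma> Q (y, \<rho>))"
proof -
  obtain c0 cq where c: "c0 \<noteq> 0" "\<forall>q\<in>Q. cq q \<noteq> 0" "\<rho> = dir_data c0 cq"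
    using dir_bundle_rep[OF p] by blast
  let ?L = "log_over Y B' (stratum Y C \<sigma> D K Q)" and ?f = "log_ident Y (up_div Y C \<sigma> D) (with_zero Q)"
  define P where "P = inv_into ?L ?f (y, \<rho>)"
  obtain \<phi>1 where \<phi>1: "(y, \<phi>1) \<in> log_space Y B'" "?f (y, \<phi>1) = (y, \<rho>)"
    using log_point_exists[OF c(1), of cq] c(2) unfolding c(3) by blast
  have "(y, \<phi>1) \<in> ?L" using \<phi>1(1) st by (simp add: log_over_def)
  then have im: "(y, \<rho>) \<in> ?f ` ?L" using \<phi>1(2) by (metis image_eqI)
  have PL: "P \<in> ?L" and fP: "?f P = (y, \<rho>)"
    unfolding P_def by (rule inv_into_into[OF im], rule f_inv_into_f[OF im])
  obtain y2 \<phi> where P: "P = (y2, \<phi>)" by (cases P)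
  have "y2 = y" using fP unfolding P log_ident_def by simp
  then have \<phi>: "(y, \<phi>) \<in> log_space Y B'" and f\<phi>: "?f (y, \<phi>) = (y, \<rho>)" using PL fP by (simp_all add: P log_over_def)
  have \<rho>: "\<rho> = dir_data (\<phi> (ee i)) (\<lambda>q. \<phi> (dt q i))" using f\<phi> unfolding log_ident_up[OF \<phi>] by simp
  have nz: "\<phi> (ee i) \<noteq> 0" using Y.log_spaceD(4)[OF \<phi> ee_log] by auto
  have "sigma_N_log Y X K D C \<sigma> Q (y, \<rho>) = log_ident X D K (sigma_log X B \<sigma> P)"
    unfolding sigma_N_log_def P_def ..
  also have "\<dots> = (x, \<lambda>k\<in>K. ray (hcoset X x (d k) (\<phi> (ee i) * \<phi> (dt k i))))"
    unfolding P \<open>y2 = y\<close> by (rule sigma_log_ident[OF \<phi>])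
  also have "\<dots> = h_log X K D Q (H_log Y X D C \<sigma> Q (y, \<rho>))"
    unfolding \<rho> H_log_eq[OF nz] h_log_eq
  proof (intro arg_cong[of _ _ "Pair x"] restrict_ext)
    fix k assume k: "k \<in> K"
    show "ray (hcoset X x (d k) (\<phi> (ee i) * \<phi> (dt k i))) =
      (if k \<in> Q then (\<lambda>q\<in>Q. ray (hcoset X x (d q) (\<phi> (ee i) * \<phi> (dt q i)))) k
       else ray (hcoset X x (d k) (lin k (\<lambda>j. \<phi> (ee i) * z i y j))))"
    proof (cases "k \<in> Q")
      case False
      have l: "lin k (z i y) \<noteq> 0" by (rule lin_not_Q[OF k False])
      have dv: "dt k i y = lin k (z i y)" by (rule dt_value[OF y yx k])
      have "\<phi> (dt k i) = sgn (lin k (z i y))"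
        using Y.log_spaceD(6)[OF \<phi> dt_stalk[OF y yx k]] dv l by simp
      then have "\<phi> (ee i) * \<phi> (dt k i) = of_real (1 / cmod (lin k (z i y))) * lin k (\<lambda>j. \<phi> (ee i) * z i y j)"
        unfolding lin_scale by (simp add: sgn_eq)
      then have "\<exists>s>0. \<phi> (ee i) * \<phi> (dt k i) = of_real s * lin k (\<lambda>j. \<phi> (ee i) * z i y j)"
        using l by (intro exI[of _ "1 / cmod (lin k (z i y))"]) simp
      then show ?thesis unfolding if_not_P[OF False] by (rule iffD2[OF X.ray_hcoset_eq_iff[OF D_smooth[OF k]]])
    qed simp
  qed
  finally show ?thesis .
qed

text \<open>The base point is recorded separately so that injectivity becomes a question over a
  single point of the centre.\<close>

lemma H_log_mem:
  assumes p: "(y, \<rho>) \<in> dir_bundle Y (up_div Y C \<sigma> D) (with_zero Q) (stratum Y C \<sigma> D K Q)"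
  shows "H_log Y X D C \<sigma> Q (y, \<rho>) \<in> middle_space X K D C Q" and "fst (H_log Y X D C \<sigma> Q (y, \<rho>)) = x"
proof -
  obtain c0 cq where c: "c0 \<noteq> 0" "\<forall>q\<in>Q. cq q \<noteq> 0" "\<rho> = dir_data c0 cq"
    using dir_bundle_rep[OF p] by blast
  show "fst (H_log Y X D C \<sigma> Q (y, \<rho>)) = x" unfolding c(3) H_log_eq[OF c(1)] by simp
  have "(\<lambda>q\<in>Q. ray (hcoset X x (d q) (c0 * cq q))) \<in> (\<Pi>\<^sub>E q\<in>Q. dirs X (D q) x)"
  proof (rule restrict_PiE_iff[THEN iffD2], intro ballI)
    fix q assume q: "q \<in> Q"
    show "ray (hcoset X x (d q) (c0 * cq q)) \<in> dirs X (D q) x"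
      unfolding dirs_D[OF Q_K[OF q]] using c(1,2) q by auto
  qed
  moreover have "N (\<lambda>j. c0 * z i y j) \<in> normal X C x" unfolding normal_C[OF xU xC] by simp
  moreover have "\<forall>k\<in>K - Q. normal_proj X (D k) x (N (\<lambda>j. c0 * z i y j)) \<noteq> tangent_sub X (D k) x"
    using lin_not_Q c(1) by (auto simp: normal_proj_N_zero_iff lin_scale)
  moreover have "\<forall>q\<in>Q. normal_proj X (D q) x (N (\<lambda>j. c0 * z i y j)) = tangent_sub X (D q) x"
    using lin_Q Q_K by (auto simp: normal_proj_N_zero_iff lin_scale)
  ultimately show "H_log Y X D C \<sigma> Q (y, \<rho>) \<in> middle_space X K D C Q"
    unfolding c(3) H_log_eq[OF c(1)] middle_space_def dir_bundle_def mem_Collect_eq prod.case using xC by blast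
qed

end

end

text \<open>Once both points lie in the same chart, equality of the first rays gives equal fibre
  coordinates and a positive ratio between \<open>c0\<close> and \<open>b0\<close>. The remaining
  rays then determine each \<open>cq q\<close> up to a positive factor.\<close>

lemma H_log_inj:
  assumes p: "(y, \<rho>) \<in> dir_bundle Y (up_div Y C \<sigma> D) (with_zero Q) (stratum Y C \<sigma> D K Q)" and yx: "\<sigma> y = x"
    and p': "(y', \<rho>') \<in> dir_bundle Y (up_div Y C \<sigma> D) (with_zero Q) (stratum Y C \<sigma> D K Q)" and yx': "\<sigma> y' = x"
    and eq: "H_log Y X D C \<sigma> Q (y, \<rho>) = H_log Y X D C \<sigma> Q (y', \<rho>')"
  shows "(y, \<rho>) = (y', \<rho>')"
proof -
  have st: "y \<in> stratum Y C \<sigma> D K Q" and st': "y' \<in> stratum Y C \<sigma> D K Q" using p p' by (simp_all add: dir_bundle_def)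
  have ypts: "y \<in> pts Y" "y' \<in> pts Y" using st st' by (simp_all add: stratum_def exc_divisor_def)
  obtain i where yV: "y \<in> V i" using V_cover[OF ypts(1)] yx xU by auto
  obtain i' where yV': "y' \<in> V i'" using V_cover[OF ypts(2)] yx' xU by auto
  note i = z_outside[OF yV] and zi = z_self[OF yV]
  obtain c0 cq where c: "c0 \<noteq> 0" "\<rho> = dir_data y i c0 cq" using dir_bundle_rep[OF yV yx st p] by blast
  obtain c0' cq' where c': "c0' \<noteq> 0" "\<rho>' = dir_data y' i' c0' cq'" using dir_bundle_rep[OF yV' yx' st' p'] by blast
  have "ray (N (\<lambda>j. c0 * z i y j)) = ray (N (\<lambda>j. c0' * z i' y' j))"
    using eq unfolding c(2) c'(2) H_log_eq[OF yV yx st c(1)] H_log_eq[OF yV' yx' st' c'(1)] by simp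
  then obtain s :: real where s: "s > 0" "\<forall>j\<in>{..<r}. c0 * z i y j = of_real s * (c0' * z i' y' j)"
    unfolding X.ray_coset_eq_iff[OF N_nonempty] by blast
  \<comment> \<open>The two points may come in different charts. Proportionality at the index
    \<open>i\<close>, where \<open>z i y i = 1\<close>, brings \<open>y'\<close> into the chart of
    \<open>y\<close>.\<close>
  have "z i' y' i \<noteq> 0" using bspec[OF s(2), of i] i zi c(1) by auto
  then have "\<omega> y' i \<noteq> 0" by (auto simp: z_def)
  then have y'V: "y' \<in> V i" using V_D[OF yV'] by (simp add: V_def)
  obtain b0 bq where b: "b0 \<noteq> 0" "\<rho>' = dir_data y' i b0 bq" using dir_bundle_rep[OF y'V yx' st' p'] by blast
  have "ray (N (\<lambda>j. c0 * z i y j)) = ray (N (\<lambda>j. b0 * z i y' j))"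
    using eq unfolding c(2) b(2) H_log_eq[OF yV yx st c(1)] H_log_eq[OF y'V yx' st' b(1)] by simp
  then obtain t :: real where t: "t > 0" "\<forall>j\<in>{..<r}. c0 * z i y j = of_real t * (b0 * z i y' j)"
    unfolding X.ray_coset_eq_iff[OF N_nonempty] by blast
  have ct: "c0 = of_real t * b0" using bspec[OF t(2), of i] i zi z_self[OF y'V] by simp
  have yy: "y = y'"
  proof (rule V_eqI[OF yV y'V])
    show "\<sigma> y = \<sigma> y'" using yx yx' by simp
    fix j assume "j < r"
    then show "z i y j = z i y' j" using bspec[OF t(2), of j] ct c(1) by simp
  qed
  have "\<rho> = \<rho>'"
    unfolding c(2) b(2) yy[symmetric]
  proof (rule dir_data_eqI[OF yV yx st t(1) ct])
    fix q assume q: "q \<in> Q"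
    have "(\<lambda>q\<in>Q. ray (hcoset X x (d q) (c0 * cq q))) = (\<lambda>q\<in>Q. ray (hcoset X x (d q) (b0 * bq q)))"
      using eq unfolding c(2) b(2) H_log_eq[OF yV yx st c(1)] H_log_eq[OF y'V yx' st' b(1)] by simp
    from fun_cong[OF this, of q] have "ray (hcoset X x (d q) (c0 * cq q)) = ray (hcoset X x (d q) (b0 * bq q))"
      using q by simp
    then obtain u :: real where u: "u > 0" "c0 * cq q = of_real u * (b0 * bq q)"
      unfolding X.ray_hcoset_eq_iff[OF D_smooth[OF Q_K[OF q]]] by blast
    have "b0 * (of_real t * cq q) = b0 * (of_real u * bq q)" using u(2) ct by (simp add: algebra_simps)
    then have "of_real t * cq q = of_real u * bq q" using b(1) by simp
    then have "cq q = of_real (u / t) * bq q" using t(1) by (simp add: field_simps)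
    then show "\<exists>s>0. cq q = of_real s * bq q" using u(1) t(1) by (intro exI[of _ "u / t"]) simp
  qed
  then show ?thesis using yy by simp
qed

lemma middle_space_rep:
  assumes "(x, \<rho>, r') \<in> middle_space X K D C Q"
  obtains w where "\<rho> = ray (N w)" "\<forall>k\<in>K - Q. lin k w \<noteq> 0" "\<forall>q\<in>Q. lin q w = 0" "r' \<in> (\<Pi>\<^sub>E q\<in>Q. dirs X (D q) x)"
proof -
  from assms obtain m where m: "m \<in> normal X C x" "\<rho> = ray m" "\<forall>k\<in>K - Q. normal_proj X (D k) x m \<noteq> tangent_sub X (D k) x"
    "\<forall>q\<in>Q. normal_proj X (D q) x m = tangent_sub X (D q) x" "r' \<in> (\<Pi>\<^sub>E q\<in>Q. dirs X (D q) x)"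
    unfolding middle_space_def dir_bundle_def mem_Collect_eq prod.case by blast
  obtain w where w: "m = N w" using m(1) unfolding normal_C[OF xU xC] by blast
  show thesis
  proof (rule that)
    show "\<rho> = ray (N w)" using m(2) w by simp
    show "\<forall>k\<in>K - Q. lin k w \<noteq> 0" using m(3) normal_proj_N_zero_iff[of _ w] unfolding w by blast
    show "\<forall>q\<in>Q. lin q w = 0" using m(4) normal_proj_N_zero_iff[of _ w] Q_K unfolding w by blast
  qed (rule m(5))
qed

lemma h_log_mem:
  assumes m: "(x, \<rho>, r') \<in> middle_space X K D C Q"
  shows "h_log X K D Q (x, \<rho>, r') \<in> dir_bundle X D K C"
proof -
  obtain w where w: "\<rho> = ray (N w)" "\<forall>k\<in>K - Q. lin k w \<noteq> 0" and r': "r' \<in> (\<Pi>\<^sub>E q\<in>Q. dirs X (D q) x)"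
    by (rule middle_space_rep[OF m])
  have "(\<lambda>k\<in>K. if k \<in> Q then r' k else normal_proj X (D k) x ` \<rho>) \<in> (\<Pi>\<^sub>E k\<in>K. dirs X (D k) x)"
  proof (rule restrict_PiE_iff[THEN iffD2], intro ballI)
    fix k assume k: "k \<in> K"
    show "(if k \<in> Q then r' k else normal_proj X (D k) x ` \<rho>) \<in> dirs X (D k) x"
    proof (cases "k \<in> Q")
      case True
      then show ?thesis using PiE_mem[OF r' True] by simp
    next
      case False
      then have "lin k w \<noteq> 0" using w(2) k by blast
      then show ?thesis using False unfolding w(1) normal_proj_ray[OF k] dirs_D[OF k] by auto
    qed
  qed
  then show ?thesis unfolding h_log_def prod.case dir_bundle_def mem_Collect_eq using xC by blast
qed

lemma H_log_surj:
  assumes m: "(x, \<rho>, r') \<in> middle_space X K D C Q"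
  shows "\<exists>p\<in>dir_bundle Y (up_div Y C \<sigma> D) (with_zero Q) (stratum Y C \<sigma> D K Q). H_log Y X D C \<sigma> Q p = (x, \<rho>, r')"
proof -
  obtain w where w: "\<rho> = ray (N w)" "\<forall>k\<in>K - Q. lin k w \<noteq> 0" "\<forall>q\<in>Q. lin q w = 0" and r': "r' \<in> (\<Pi>\<^sub>E q\<in>Q. dirs X (D q) x)"
    by (rule middle_space_rep[OF m])
  \<comment> \<open>\<open>Q\<close> is a proper subset of \<open>K\<close>: some \<open>k\<close>
    outside \<open>Q\<close> has nonzero \<open>lin k w\<close>, so \<open>w\<close> is a nonzero
    vector and defines a point of the exceptional divisor.\<close>
  have "\<exists>i<r. w i \<noteq> 0"
  proof (rule ccontr)
    assume "\<not> ?thesis"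
    then have "lin k w = 0" for k by (simp add: lin_def)
    then show False using w(2) QK by blast
  qed
  then obtain i where i: "i < r" "w i \<noteq> 0" by blast
  obtain y where yV: "y \<in> V i" and yx: "\<sigma> y = x" and wy: "\<forall>j<r. w j = w i * z i y j"
    using chart_point_of_direction[of x i w, OF xU xC i] by blast
  have lw: "lin k w = w i * lin k (z i y)" for k
  proof -
    have "lin k w = lin k (\<lambda>j. w i * z i y j)" by (rule lin_cong) (use wy in blast)
    then show ?thesis by (simp add: lin_scale)
  qed
  have st: "y \<in> stratum Y C \<sigma> D K Q" unfolding stratum_iff[OF yV yx] using w(2,3) lw i(2) by simp
  have "\<forall>q\<in>Q. \<exists>c. c \<noteq> 0 \<and> r' q = ray (hcoset X x (d q) c)"
  proof
    fix q assume q: "q \<in> Q"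
    show "\<exists>c. c \<noteq> 0 \<and> r' q = ray (hcoset X x (d q) c)"
      using PiE_mem[OF r' q] unfolding dirs_D[OF Q_K[OF q]] by blast
  qed
  from bchoice[OF this] obtain b where b: "\<forall>q\<in>Q. b q \<noteq> 0 \<and> r' q = ray (hcoset X x (d q) (b q))" ..
  \<comment> \<open>Undoes the product of directions with the exceptional coordinate
    \<open>w i\<close>.\<close>
  define cq where "cq q = b q / w i" for q
  have "(\<lambda>q\<in>Q. ray (hcoset X x (d q) (w i * cq q))) = r'"
  proof (rule extensionalityI[OF restrict_extensional])
    show "r' \<in> extensional Q" using r' by (simp add: PiE_def)
    fix q assume "q \<in> Q"
    then show "(\<lambda>q\<in>Q. ray (hcoset X x (d q) (w i * cq q))) q = r' q" using b i(2) by (simp add: cq_def)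
  qed
  moreover have "N (\<lambda>j. w i * z i y j) = N w" by (rule coset_cong) (use wy in simp)
  ultimately have "H_log Y X D C \<sigma> Q (y, dir_data y i (w i) cq) = (x, \<rho>, r')"
    unfolding H_log_eq[OF yV yx st i(2)] w(1) by simp
  moreover have "(y, dir_data y i (w i) cq) \<in> dir_bundle Y (up_div Y C \<sigma> D) (with_zero Q) (stratum Y C \<sigma> D K Q)"
    by (rule dir_data_mem[OF yV yx st i(2)]) (use b i(2) in \<open>simp add: cq_def\<close>)
  ultimately show ?thesis by (rule bexI)
qed

end

end

section \<open>Local data at each point of the centre, and assembly\<close>

lemma blowup_chart_exists:
  assumes "nonsingular_variety X" "blowing_up Y X C \<sigma>" "closedin (zar X) C" "x \<in> pts X"
  obtains U n a r g \<omega> where "blowup_chart X Y \<sigma> C U n a r g \<omega>" "x \<in> U"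
proof -
  have vX: "variety X" using assms(1) unfolding nonsingular_variety_def by blast
  note bl0 = assms(2)[unfolded blowing_up_def]
  note bl = bl0[THEN conjunct1] bl0[THEN conjunct2, THEN conjunct1]
  have "\<forall>x\<in>pts X. \<exists>U n a r g \<omega>.
        affine_chart X U n a \<and> x \<in> U \<and>
        (\<forall>i<r. g i \<in> reg X U) \<and>
        (\<forall>y\<in>U. generates_ideal X C y {..<r} g) \<and>
        (\<forall>y\<in>U \<inter> C. \<forall>c :: nat \<Rightarrow> complex.
           (\<forall>v\<in>tangent X y. (\<Sum>i<r. c i * v (g i)) = 0) \<longrightarrow> (\<forall>i<r. c i = 0)) \<and>
        (\<forall>y\<in>pts Y \<inter> \<sigma> -` U. \<omega> y \<in> Vec r \<and> (\<exists>i<r. \<omega> y i \<noteq> 0)) \<and>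
        (\<forall>i<r. let V = {y \<in> pts Y \<inter> \<sigma> -` U. \<omega> y i \<noteq> 0};
                   b = (\<lambda>y. join n (a (\<sigma> y)) (\<lambda>j. \<omega> y j / \<omega> y i))
               in affine_chart Y V (n + r) b \<and>
                  b ` V = {join n (a y) z | y z. y \<in> U \<and> z \<in> Vec r \<and> z i = 1 \<and>
                             (\<forall>j<r. \<forall>l<r. g j y * z l = g l y * z j)})"
    by (rule bl0[THEN conjunct2, THEN conjunct2])
  from bspec[OF this assms(4)] obtain U n a g \<omega> and r :: nat where ch: "affine_chart X U n a" "x \<in> U"
    and g: "\<forall>i<r. g i \<in> reg X U" and gen: "\<forall>y\<in>U. generates_ideal X C y {..<r} g"
    and ind: "\<forall>y\<in>U \<inter> C. \<forall>c :: nat \<Rightarrow> complex.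
           (\<forall>v\<in>tangent X y. (\<Sum>i<r. c i * v (g i)) = 0) \<longrightarrow> (\<forall>i<r. c i = 0)"
    and om: "\<forall>y\<in>pts Y \<inter> \<sigma> -` U. \<omega> y \<in> Vec r \<and> (\<exists>i<r. \<omega> y i \<noteq> 0)"
    and im: "\<forall>i<r. let V = {y \<in> pts Y \<inter> \<sigma> -` U. \<omega> y i \<noteq> 0};
                   b = (\<lambda>y. join n (a (\<sigma> y)) (\<lambda>j. \<omega> y j / \<omega> y i))
               in affine_chart Y V (n + r) b \<and>
                  b ` V = {join n (a y) z | y z. y \<in> U \<and> z \<in> Vec r \<and> z i = 1 \<and>
                             (\<forall>j<r. \<forall>l<r. g j y * z l = g l y * z j)}"
    by (elim exE conjE) (rule that, assumption+)
  have "blowup_chart X Y \<sigma> C U n a r g \<omega>"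
  proof (unfold_locales)
    show "variety X" "variety Y" "morphism Y X \<sigma>" "nonsingular_variety X" "closedin (zar X) C" "affine_chart X U n a"
      by (fact vX bl assms ch)+
  next
    fix i assume "i < r" then show "g i \<in> reg X U" using g by blast
  next
    fix x assume "x \<in> U" then show "generates_ideal X C x {..<r} g" using gen by blast
  next
    fix x and c :: "nat \<Rightarrow> complex" assume "x \<in> U" "x \<in> C" "\<And>v. v \<in> tangent X x \<Longrightarrow> (\<Sum>i<r. c i * v (g i)) = 0"
    then show "\<forall>i<r. c i = 0" using bspec[OF ind, of x] by simp
  next
    fix y assume "y \<in> pts Y" "\<sigma> y \<in> U" then show "\<omega> y \<in> Vec r \<and> (\<exists>i<r. \<omega> y i \<noteq> 0)" using bspec[OF om, of y] by simp
  next
    fix i assume "i < r"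
    then show "affine_chart Y {y \<in> pts Y \<inter> \<sigma> -` U. \<omega> y i \<noteq> 0} (n + r) (\<lambda>y. join n (a (\<sigma> y)) (\<lambda>j. \<omega> y j / \<omega> y i))"
      using im[rule_format, of i] by (simp add: Let_def)
  next
    fix i assume "i < r"
    then show "(\<lambda>y. join n (a (\<sigma> y)) (\<lambda>j. \<omega> y j / \<omega> y i)) ` {y \<in> pts Y \<inter> \<sigma> -` U. \<omega> y i \<noteq> 0} =
      {join n (a x) \<zeta> | x \<zeta>. x \<in> U \<and> \<zeta> \<in> Vec r \<and> \<zeta> i = 1 \<and> (\<forall>j<r. \<forall>l<r. g j x * \<zeta> l = g l x * \<zeta> j)}"
      using im[rule_format, of i] by (simp add: Let_def)
  qed
  then show thesis using ch(2) by (rule that)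
qed

lemma (in blowup_chart) blowup_snc_exists:
  assumes K: "finite K" "K \<noteq> {}" and snc: "snc_divisor X K D" and CD: "C \<subseteq> (\<Inter>k\<in>K. D k)" and xU: "x \<in> U" and xC: "x \<in> C"
    and over: "\<And>x m. x \<in> C \<Longrightarrow> m \<in> normal_nz X C x \<Longrightarrow> \<sigma> (fst (normal_lift Y X C \<sigma> (x, m))) = x"
  obtains d h where "blowup_snc X Y \<sigma> C U n a r g \<omega> K D x d h"
proof -
  note xp = U_pts[OF xU]
  have closed_D: "closedin (zar X) (D k)" if "k \<in> K" for k using snc that unfolding snc_divisor_def by blast
  have "\<exists>m u. adapted_coords X K D x m u" using snc xp unfolding snc_divisor_def by blast
  then obtain m u where ad: "adapted_coords X K D x m u" by blast
  have xD: "x \<in> D k" if "k \<in> K" for k using CD xC that by blast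
  then have KK: "{k \<in> K. x \<in> D k} = K" by blast
  have lc: "local_coords X x m u" using ad unfolding adapted_coords_def by (rule conjunct1)
  have bij: "bij_betw (\<lambda>v i. if i < m then v (u i) else 0) (tangent X x) (Vec m)"
    using lc unfolding local_coords_def by (rule conjunct2)
  obtain \<iota> where \<iota>: "inj_on \<iota> K" "\<forall>k\<in>K. \<iota> k < m \<and> local_eq X (D k) x (u (\<iota> k))"
    using ad xD unfolding adapted_coords_def KK by blast
  define d where "d k = u (\<iota> k)" for k
  have dsurj: "\<exists>v\<in>tangent X x. \<forall>k\<in>K. v (d k) = c k" for c
  proof -
    \<comment> \<open>Coordinate vector with the prescribed entries at the indices of the components
      and zero elsewhere; adapted coordinates realise it by a tangent vector.\<close>
    define w where "w l = (if l \<in> \<iota> ` K then c (inv_into K \<iota> l) else 0)" for l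
    have "w \<in> Vec m" using \<iota>(2) by (auto simp: Vec_def w_def)
    then obtain v where v: "v \<in> tangent X x" "w = (\<lambda>i. if i < m then v (u i) else 0)"
      using bij unfolding bij_betw_def by blast
    have "v (d k) = c k" if k: "k \<in> K" for k
    proof -
      have "w (\<iota> k) = c k" using k \<iota>(1) by (simp add: w_def)
      moreover have "w (\<iota> k) = v (u (\<iota> k))" using \<iota>(2) k by (simp add: v(2))
      ultimately show ?thesis by (simp add: d_def)
    qed
    then show ?thesis using v(1) by blast
  qed
  have smooth: "smooth_eq X (D k) x (d k)" if k: "k \<in> K" for k
  proof -
    obtain v where v: "v \<in> tangent X x" "\<forall>k\<in>K. v (d k) = 1" using dsurj[of "\<lambda>_. 1"] by blast
    have "\<exists>t\<in>tangent X x. t (d k) \<noteq> 0" using bspec[OF v(2) k] by (intro bexI[OF _ v(1)]) simp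
    moreover have "local_eq X (D k) x (d k)" using bspec[OF \<iota>(2) k] by (simp add: d_def)
    ultimately show ?thesis using xD[OF k] by (simp add: smooth_eq_def)
  qed
  have "\<forall>k\<in>K. \<exists>h. (\<forall>j\<in>{..<r}. h j \<in> stalk X x) \<and> eventually (\<lambda>x'. d k x' = (\<Sum>j\<in>{..<r}. h j x' * g j x')) (znhds X x)"
  proof
    fix k assume k: "k \<in> K"
    note l = X.smooth_eqD(2)[OF smooth[OF k]]
    have "eventually (\<lambda>x'. x' \<in> C \<longrightarrow> d k x' = 0) (znhds X x)"
      using X.local_eqD(2)[OF l] by eventually_elim (use CD k in blast)
    from X.generates_idealD[OF gen[OF xU] X.local_eqD(1)[OF l] this]
    show "\<exists>h. (\<forall>j\<in>{..<r}. h j \<in> stalk X x) \<and> eventually (\<lambda>x'. d k x' = (\<Sum>j\<in>{..<r}. h j x' * g j x')) (znhds X x)"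
      by blast
  qed
  from bchoice[OF this] obtain h where h: "\<forall>k\<in>K. (\<forall>j\<in>{..<r}. h k j \<in> stalk X x) \<and>
     eventually (\<lambda>x'. d k x' = (\<Sum>j\<in>{..<r}. h k j x' * g j x')) (znhds X x)" ..
  have "blowup_snc X Y \<sigma> C U n a r g \<omega> K D x d h"
  proof (intro blowup_snc.intro blowup_snc_axioms.intro)
    show "blowup_chart X Y \<sigma> C U n a r g \<omega>" by (rule blowup_chart_axioms)
  next
    fix k assume "k \<in> K" then show "C \<subseteq> D k" using CD by blast
  next
    fix k j assume "k \<in> K" "j < r" then show "h k j \<in> stalk X x" using h by blast
  next
    fix k assume "k \<in> K" then show "eventually (\<lambda>x'. d k x' = (\<Sum>j<r. h k j x' * g j x')) (znhds X x)" using h by blast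
  qed (fact K xU xC closed_D smooth dsurj over)+
  then show thesis by (rule that)
qed

theorem theorem6p12:
  fixes M :: "'a fspace" and M' :: "'b fspace" and \<sigma> :: "'b \<Rightarrow> 'a"
    and K Q :: "'k set" and D :: "'k \<Rightarrow> 'a set" and C :: "'a set"
  assumes "nonsingular_variety M"
    and "finite K" and "K \<noteq> {}"
    and "snc_divisor M K D"
    and "C \<subseteq> (\<Inter>k\<in>K. D k)"
    and "nonsingular_subvariety M C"
    and "normal_crossings_with M K D C"
    and "blowing_up M' M C \<sigma>"
    and "Q \<subset> K"
  shows "bij_betw (H_log M' M D C \<sigma> Q)
           (dir_bundle M' (up_div M' C \<sigma> D) (with_zero Q) (stratum M' C \<sigma> D K Q))
           (middle_space M K D C Q)
       \<and> h_log M K D Q \<in> middle_space M K D C Q \<rightarrow> dir_bundle M D K C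
       \<and> (\<forall>p \<in> dir_bundle M' (up_div M' C \<sigma> D) (with_zero Q) (stratum M' C \<sigma> D K Q).
            sigma_N_log M' M K D C \<sigma> Q p = h_log M K D Q (H_log M' M D C \<sigma> Q p))"
proof -
  let ?A = "dir_bundle M' (up_div M' C \<sigma> D) (with_zero Q) (stratum M' C \<sigma> D K Q)"
  have closed: "closedin (zar M) C" using assms(6) unfolding nonsingular_subvariety_def by (rule conjunct1)
  then have Cp: "x \<in> pts M" if "x \<in> C" for x using closedin_subset that by blast
  \<comment> \<open>Proved at every point of \<open>C\<close>, each with its own chart, before any
    local data are fixed: those data include it as an assumption.\<close>
  have over: "\<sigma> (fst (normal_lift M' M C \<sigma> (x, m))) = x" if x: "x \<in> C" "m \<in> normal_nz M C x" for x m
  proof -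
    obtain U n a r g \<omega> where ch: "blowup_chart M M' \<sigma> C U n a r g \<omega>" "x \<in> U"
      by (rule blowup_chart_exists[OF assms(1,8) closed Cp[OF x(1)]])
    show ?thesis by (rule blowup_chart.normal_lift_over[OF ch x])
  qed
  have snc: "\<exists>U n a r g \<omega> d h. blowup_snc M M' \<sigma> C U n a r g \<omega> K D x d h" if x: "x \<in> C" for x
  proof -
    obtain U n a r g \<omega> where ch: "blowup_chart M M' \<sigma> C U n a r g \<omega>" "x \<in> U"
      by (rule blowup_chart_exists[OF assms(1,8) closed Cp[OF x]])
    obtain d h where "blowup_snc M M' \<sigma> C U n a r g \<omega> K D x d h"
      by (rule blowup_chart.blowup_snc_exists[OF ch(1) assms(2-5) ch(2) x over])
    then show ?thesis by blast
  qed
  have at_point: "\<sigma> y \<in> C" "y \<in> stratum M' C \<sigma> D K Q" "y \<in> pts M'" if "(y, \<rho>) \<in> ?A" for y \<rho>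
    using that by (simp_all add: dir_bundle_def stratum_def exc_divisor_def)
  have local: "H_log M' M D C \<sigma> Q (y, \<rho>) \<in> middle_space M K D C Q \<and> fst (H_log M' M D C \<sigma> Q (y, \<rho>)) = \<sigma> y \<and>
     sigma_N_log M' M K D C \<sigma> Q (y, \<rho>) = h_log M K D Q (H_log M' M D C \<sigma> Q (y, \<rho>))" if p: "(y, \<rho>) \<in> ?A" for y \<rho>
  proof -
    obtain U n a r g \<omega> d h where s: "blowup_snc M M' \<sigma> C U n a r g \<omega> K D (\<sigma> y) d h"
      using snc[OF at_point(1)[OF p]] by blast
    interpret blowup_snc M M' \<sigma> C U n a r g \<omega> "\<lambda>i y j. \<omega> y j / \<omega> y i" "\<lambda>i. {y \<in> pts M' \<inter> \<sigma> -` U. \<omega> y i \<noteq> 0}"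
      "\<lambda>i y. join n (a (\<sigma> y)) (\<lambda>j. \<omega> y j / \<omega> y i)" K D "\<sigma> y" d h by (rule s) simp_all
    obtain i where "y \<in> {y \<in> pts M' \<inter> \<sigma> -` U. \<omega> y i \<noteq> 0}" using V_cover[OF at_point(3)[OF p] xU] by blast
    note i = this refl at_point(2)[OF p] p
    show ?thesis using H_log_mem[OF assms(9) i] sigma_N_log_eq[OF assms(9) i] by simp
  qed
  have "bij_betw (H_log M' M D C \<sigma> Q) ?A (middle_space M K D C Q)"
    unfolding bij_betw_def
  proof (intro conjI equalityI subsetI)
    show "inj_on (H_log M' M D C \<sigma> Q) ?A"
    proof (rule inj_onI)
      fix p p' assume p: "p \<in> ?A" "p' \<in> ?A" and eq: "H_log M' M D C \<sigma> Q p = H_log M' M D C \<sigma> Q p'"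
      obtain y \<rho> y' \<rho>' where pp: "p = (y, \<rho>)" "p' = (y', \<rho>')" by (cases p, cases p')
      note p1 = p[unfolded pp]
      \<comment> \<open>Equal images have equal base points, so one choice of local data serves both
        points.\<close>
      have yy: "\<sigma> y' = \<sigma> y" using local[OF p1(1)] local[OF p1(2)] eq unfolding pp by simp
      obtain U n a r g \<omega> d h where s: "blowup_snc M M' \<sigma> C U n a r g \<omega> K D (\<sigma> y) d h"
        using snc[OF at_point(1)[OF p1(1)]] by blast
      interpret blowup_snc M M' \<sigma> C U n a r g \<omega> "\<lambda>i y j. \<omega> y j / \<omega> y i" "\<lambda>i. {y \<in> pts M' \<inter> \<sigma> -` U. \<omega> y i \<noteq> 0}"
        "\<lambda>i y. join n (a (\<sigma> y)) (\<lambda>j. \<omega> y j / \<omega> y i)" K D "\<sigma> y" d h by (rule s) simp_all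
      show "p = p'" unfolding pp by (rule H_log_inj[OF assms(9) p1(1) refl p1(2) yy eq[unfolded pp]])
    qed
  next
    fix q assume "q \<in> H_log M' M D C \<sigma> Q ` ?A"
    then show "q \<in> middle_space M K D C Q" using local by auto
  next
    fix q assume q: "q \<in> middle_space M K D C Q"
    obtain x \<rho> r' where qq: "q = (x, \<rho>, r')" by (cases q)
    have "x \<in> C" using q unfolding qq middle_space_def dir_bundle_def by blast
    then obtain U n a r g \<omega> d h where s: "blowup_snc M M' \<sigma> C U n a r g \<omega> K D x d h" using snc by blast
    interpret blowup_snc M M' \<sigma> C U n a r g \<omega> "\<lambda>i y j. \<omega> y j / \<omega> y i" "\<lambda>i. {y \<in> pts M' \<inter> \<sigma> -` U. \<omega> y i \<noteq> 0}"
      "\<lambda>i y. join n (a (\<sigma> y)) (\<lambda>j. \<omega> y j / \<omega> y i)" K D x d h by (rule s) simp_all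
    obtain p where "p \<in> ?A" "H_log M' M D C \<sigma> Q p = (x, \<rho>, r')" using H_log_surj[OF assms(9) q[unfolded qq]] by blast
    then show "q \<in> H_log M' M D C \<sigma> Q ` ?A" unfolding qq by (intro image_eqI[of _ _ p]) simp_all
  qed
  moreover have "h_log M K D Q \<in> middle_space M K D C Q \<rightarrow> dir_bundle M D K C"
  proof
    fix q assume q: "q \<in> middle_space M K D C Q"
    obtain x \<rho> r' where qq: "q = (x, \<rho>, r')" by (cases q)
    have "x \<in> C" using q unfolding qq middle_space_def dir_bundle_def by blast
    then obtain U n a r g \<omega> d h where s: "blowup_snc M M' \<sigma> C U n a r g \<omega> K D x d h" using snc by blast
    interpret blowup_snc M M' \<sigma> C U n a r g \<omega> "\<lambda>i y j. \<omega> y j / \<omega> y i" "\<lambda>i. {y \<in> pts M' \<inter> \<sigma> -` U. \<omega> y i \<noteq> 0}"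
      "\<lambda>i y. join n (a (\<sigma> y)) (\<lambda>j. \<omega> y j / \<omega> y i)" K D x d h by (rule s) simp_all
    show "h_log M K D Q q \<in> dir_bundle M D K C" unfolding qq by (rule h_log_mem[OF assms(9) q[unfolded qq]])
  qed
  moreover have "\<forall>p\<in>?A. sigma_N_log M' M K D C \<sigma> Q p = h_log M K D Q (H_log M' M D C \<sigma> Q p)"
    using local by auto
  ultimately show ?thesis by blast
qed

end
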